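(* Let $\Omega\subset\mathbb R^2$ be a bounded domain, let $\omega\subset\Omega$ be a subdomain, let $\mu\in(0,2)$ and let $\lambda=\frac{4-\mu}4$. Suppose $V\in C^0(\overline\omega)$ and $(V_k)_{k=1}^\infty$ is a sequence of nonnegative functions on $\overline\omega$ for which $V_k\to V$ in $C^0(\overline\omega)$. Let $(u_k)_{k=1}^\infty$ be a sequence of solutions to $$-\Delta u_k=V_k\,I_\mu[e^{\lambda u_k}\chi_\Omega]\,e^{\lambda u_k}\qquad\text{in }\omega$$ for which there exists $c_0>0$ satisfying $\|e^{u_k}\|_{L^1(\Omega)}\le c_0$ for all $k$. Suppose that the following (blow-up) alternative holds: there are a subsequence $(u_{k_\ell})_{\ell=1}^\infty$, a finite nonempty set $S=\{a^1,\dots,a^m\}\subset\omega$ (with $a^1,\dots,a^m$ distinct) and numbers $\alpha_1,\dots,\alpha_m\ge4\pi$ such that (i) for all $i\in\{1,\dots,m\}$ there is a sequence $(x^i_\ell)_{\ell=1}^\infty\subset\omega$ with $x^i_\ell\to a^i$ and $u_{k_\ell}(x_\ell^i)\to\infty$; (ii) $u_{k_\ell}\to-\infty$ locally uniformly on $\omega\setminus S$; (iii) $V_{k_\ell}I_\mu[e^{\lambda u_{k_\ell}}\chi_\Omega]e^{\lambda u_{k_\ell}}\rightharpoonup\sum_{i=1}^m\alpha_i\delta_{a^i}$ weak-$*$ in the sense of measures on $\omega$. Then for each $i\in\{1,\dots,m\}$ there is $N_i\in\mathbb N=\{1,2,\dots\}$ for which $\alpha_i=8\pi N_i$.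
   Context: For $\mu\in(0,2)$, $I_\mu f(x)=\int_{\mathbb R^2}\frac{f(y)}{|x-y|^\mu}\,dy$. $\chi_A$ is the characteristic function of $A$ (a product $g\chi_A$ is extended by zero outside $A$). Each $u_k:\Omega\to\mathbb R$ satisfies $u_k\in L^1_{\mathrm{loc}}(\omega)$ and the equation is understood in the distributional sense: $-\Delta u=f$ in $\omega$ (with $f\in L^1(\omega)$) means $-\int_\omega u\,\Delta\varphi=\int_\omega f\varphi$ for all $\varphi\in C_c^\infty(\omega)$. Under the stated hypotheses the right-hand side lies in $L^1(\omega)$, and solutions are identified on $\omega$ with their continuous representatives. $\delta_a$ is the Dirac mass at $a$; weak-$*$ convergence of $f_\ell$ to $\eta$ on $\omega$ means $\int_\omega f_\ell\psi\,dx\to\int_\omega\psi\,d\eta$ for all $\psi\in C_c(\omega)$. *)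

theory Defs
  imports "HOL-Analysis.Analysis"
begin

definition riesz_potential :: "real \<Rightarrow> (real^2 \<Rightarrow> real) \<Rightarrow> real^2 \<Rightarrow> real" where
  "riesz_potential \<mu> f x = (LINT y|lebesgue. f y / norm (x - y) powr \<mu>)"

definition locally_integrable_on :: "('a::euclidean_space \<Rightarrow> real) \<Rightarrow> 'a set \<Rightarrow> bool"
    (infix \<open>locally'_integrable'_on\<close> 50) where
  "u locally_integrable_on \<omega> \<longleftrightarrow> (\<forall>K. compact K \<and> K \<subseteq> \<omega> \<longrightarrow> set_integrable lebesgue K u)"

definition partial_deriv :: "'a::euclidean_space \<Rightarrow> ('a \<Rightarrow> real) \<Rightarrow> 'a \<Rightarrow> real" where
  "partial_deriv b f x = frechet_derivative f (at x) b"

definition laplacian :: "('a::euclidean_space \<Rightarrow> real) \<Rightarrow> 'a \<Rightarrow> real" where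
  "laplacian f x = (\<Sum>b\<in>Basis. partial_deriv b (partial_deriv b f) x)"

text \<open>\<open>times_cont_diff n f\<close>: the function \<open>f\<close> is of class \<open>C\<^sup>n\<close> on the whole space.\<close>

primrec times_cont_diff :: "nat \<Rightarrow> ('a::euclidean_space \<Rightarrow> real) \<Rightarrow> bool" where
  "times_cont_diff 0 f \<longleftrightarrow> continuous_on UNIV f"
| "times_cont_diff (Suc n) f \<longleftrightarrow>
     (\<forall>x. f differentiable (at x)) \<and> (\<forall>b\<in>Basis. times_cont_diff n (partial_deriv b f))"

definition compact_support_in :: "('a::euclidean_space \<Rightarrow> real) \<Rightarrow> 'a set \<Rightarrow> bool" where
  "compact_support_in f \<omega> \<longleftrightarrow> compact (closure {x. f x \<noteq> 0}) \<and> closure {x. f x \<noteq> 0} \<subseteq> \<omega>"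

text \<open>Elements of \<open>C\<^sub>c(\<omega>)\<close> and of its smooth counterpart are represented by their extensions
  by zero to the whole space.\<close>

definition Cc :: "'a::euclidean_space set \<Rightarrow> ('a \<Rightarrow> real) set" where
  "Cc \<omega> = {\<psi>. continuous_on UNIV \<psi> \<and> compact_support_in \<psi> \<omega>}"

definition Cc_infinity :: "'a::euclidean_space set \<Rightarrow> ('a \<Rightarrow> real) set" where
  "Cc_infinity \<omega> = {\<phi>. (\<forall>n. times_cont_diff n \<phi>) \<and> compact_support_in \<phi> \<omega>}"

text \<open>\<open>neg_laplace_eq \<omega> u f\<close>: the equation \<open>- \<Delta>u = f\<close> holds in \<open>\<omega>\<close> in the sense of distributions.\<close>

definition neg_laplace_eq ::
    "'a::euclidean_space set \<Rightarrow> ('a \<Rightarrow> real) \<Rightarrow> ('a \<Rightarrow> real) \<Rightarrow> bool" where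
  "neg_laplace_eq \<omega> u f \<longleftrightarrow>
     u locally_integrable_on \<omega> \<and> set_integrable lebesgue \<omega> f \<and>
     (\<forall>\<phi>\<in>Cc_infinity \<omega>.
        - (LINT x:\<omega>|lebesgue. u x * laplacian \<phi> x) = (LINT x:\<omega>|lebesgue. f x * \<phi> x))"

definition locally_uniformly_to_minus_infinity ::
    "'a::euclidean_space set \<Rightarrow> (nat \<Rightarrow> 'a \<Rightarrow> real) \<Rightarrow> bool" where
  "locally_uniformly_to_minus_infinity A u \<longleftrightarrow>
     (\<forall>K. compact K \<and> K \<subseteq> A \<longrightarrow> (\<forall>M. \<forall>\<^sub>F l in sequentially. \<forall>x\<in>K. u l x \<le> M))"

definition weak_star_converges ::
    "'a::euclidean_space set \<Rightarrow> (nat \<Rightarrow> 'a \<Rightarrow> real) \<Rightarrow> 'a measure \<Rightarrow> bool" where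
  "weak_star_converges \<omega> f \<eta> \<longleftrightarrow>
     (\<forall>\<psi>\<in>Cc \<omega>. (\<lambda>l. LINT x:\<omega>|lebesgue. f l x * \<psi> x) \<longlonglongrightarrow> (LINT x:\<omega>|\<eta>. \<psi> x))"

text \<open>The Borel measure \<open>\<Sum>i\<in>I. \<alpha> i \<delta>\<^bsub>a i\<^esub>\<close> for finite \<open>I\<close> and nonnegative \<open>\<alpha>\<close>, as the push-forward
  under \<open>a\<close> of the measure on \<open>I\<close> with point masses \<open>\<alpha> i\<close>.\<close>

definition dirac_sum ::
    "nat set \<Rightarrow> (nat \<Rightarrow> real) \<Rightarrow> (nat \<Rightarrow> 'a::euclidean_space) \<Rightarrow> 'a measure" where
  "dirac_sum I \<alpha> a = distr (point_measure I (\<lambda>i. ennreal (\<alpha> i))) borel a"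

lemma emeasure_dirac_sum:
  fixes a :: "nat \<Rightarrow> 'a::euclidean_space"
  assumes "finite I" "A \<in> sets borel"
  shows "emeasure (dirac_sum I \<alpha> a) A = (\<Sum>i\<in>I. ennreal (\<alpha> i) * indicator A (a i))"
proof -
  have "emeasure (dirac_sum I \<alpha> a) A = emeasure (point_measure I (\<lambda>i. ennreal (\<alpha> i))) (a -` A \<inter> I)"
    unfolding dirac_sum_def using assms
    by (subst emeasure_distr) (auto simp: space_point_measure measurable_def sets_point_measure)
  also have "\<dots> = (\<Sum>i\<in>a -` A \<inter> I. ennreal (\<alpha> i))"
    using assms by (intro emeasure_point_measure_finite) auto
  also have "\<dots> = (\<Sum>i\<in>I. ennreal (\<alpha> i) * indicator A (a i))"
    using assms by (intro sum.mono_neutral_cong_left) (auto simp: indicator_def)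
  finally show ?thesis .
qed

lemma integral_dirac_sum:
  fixes a :: "nat \<Rightarrow> 'a::euclidean_space"
  assumes "finite I" "\<And>i. i \<in> I \<Longrightarrow> 0 \<le> \<alpha> i" "\<psi> \<in> borel_measurable borel"
  shows "(LINT x|dirac_sum I \<alpha> a. \<psi> x) = (\<Sum>i\<in>I. \<alpha> i * \<psi> (a i) :: real)"
proof -
  have "(LINT x|dirac_sum I \<alpha> a. \<psi> x) = (LINT i|point_measure I (\<lambda>i. ennreal (\<alpha> i)). \<psi> (a i))"
    unfolding dirac_sum_def using assms
    by (subst integral_distr) (auto simp: space_point_measure measurable_def sets_point_measure)
  also have "\<dots> = (\<Sum>i\<in>I. \<alpha> i * \<psi> (a i))"
    using assms by (subst lebesgue_integral_point_measure_finite) auto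
  finally show ?thesis .
qed

end

theory Submission
  imports Defs "HOL-Complex_Analysis.Great_Picard" "HOL-Real_Asymp.Real_Asymp"
begin

text \<open>Write \<open>g = exp u\<close> and \<open>f\<close> for the right-hand side. Testing the distributional equation with radial
  functions yields Green's formula on balls: \<open>u x\<close> is the mean of \<open>u\<close> over a ball around \<open>x\<close> plus a
  logarithmic potential of \<open>f\<close>. This form of the equation is invariant under
  \<open>g \<mapsto> s\<^sup>2 g (x\<^sub>0 + s y)\<close> and passes to locally uniform limits, so it replaces elliptic regularity.

  An entire solution with bounded \<open>g\<close>, constant \<open>V\<close> and finite mass \<open>\<integral>f\<close> is, up to a constant, the
  logarithmic potential of \<open>f\<close>; this makes \<open>g\<close> decay like \<open>\<bar>x\<bar>\<^sup>-\<^sup>2\<close> at least, and comparing \<open>g\<close> with its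
  dilations (a Pohozaev identity in integrated form) forces the mass to be \<open>8\<pi>\<close>.

  Near a blow-up point, rescaling at almost maximal points of \<open>d\<^sup>2 g\<close>, with \<open>d\<close> the distance to the centers
  already chosen, produces separated bubbles of mass \<open>8\<pi>\<close>. Their number is bounded by \<open>\<alpha> / 8\<pi>\<close>; once it
  is maximal, \<open>d\<^sup>2 g\<close> stays bounded. Then Green's formula at \<open>x\<close> and at the nearest center \<open>x'\<close> gives
  \<open>f x \<le> C d\<^sup>-\<^sup>2 (d \<surd>(g x'))\<^sup>-\<^sup>q + o(1)\<close> with some \<open>q > 0\<close>, hence no mass is lost between the bubbles and
  \<open>\<alpha>\<close> is \<open>8\<pi>\<close> times their number.\<close>

section \<open>Radial integrals\<close>

text \<open>What the overview leaves open. Nonlocality: outside \<open>\<omega>\<close> only an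
  integral bound on \<open>g\<close> is available, but \<open>4 * (1 - lam) = \<mu>\<close>, so
  Young's inequality turns the far part of the potential into \<open>g\<close> plus an integrable
  power of the distance; escaping mass cannot disturb local limits. The value \<open>8 * pi\<close>:
  for a dilation factor \<open>t\<close>, convexity of \<open>exp\<close> bounds the first variation
  of the double integral from one side, the logarithmic potential with the inequality of arithmetic
  and geometric means from the other, with an error of order \<open>|t - 1|\<close> to the power
  3/2; \<open>t\<close> above and below 1 gives the two inequalities for the mass. Between bubbles:
  the mean of \<open>u\<close> over a fixed ball tends to minus infinity at an unknown rate
  \<open>N\<close>, so values of \<open>u\<close> at two points at distance \<open>d\<close> cannot
  be compared in general. If \<open>d * N\<close> is at most 1, the two means differ by a bounded
  amount, and a bubble of mass at least \<open>7 * pi\<close>, where anything above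
  \<open>4 * pi\<close> would serve, forces power decay of \<open>d^2 * g\<close>. Otherwise
  \<open>N\<close> exceeds \<open>1 / d\<close>, and \<open>g\<close> is exponentially small in
  \<open>N\<close> up to powers of \<open>N\<close>; this is the \<open>o(1)\<close> term.\<close>

lemma borel_ball [measurable]: "ball x r \<in> sets borel" "cball x r \<in> sets borel"
  by auto

lemma lebesgue_ball_real2: "0 \<le> r \<Longrightarrow> measure lborel (ball (x::real^2) r) = pi * r\<^sup>2"
  using content_ball[of r x] by (simp add: unit_ball_vol_2)

lemma emeasure_ball_real2: "0 \<le> r \<Longrightarrow> emeasure lborel (ball (x::real^2) r) = ennreal (pi * r\<^sup>2)"
  using emeasure_ball[of r x] by (simp add: unit_ball_vol_2)

lemma integrable_lborel_affine:
  fixes f :: "'a::euclidean_space \<Rightarrow> real"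
  assumes [measurable]: "f \<in> borel_measurable borel" and "c \<noteq> 0"
  shows "integrable lborel (\<lambda>x. f (t + c *\<^sub>R x)) \<longleftrightarrow> integrable lborel f"
  using assms(2)
  by (subst (2) lborel_affine[OF \<open>c \<noteq> 0\<close>, of t])
     (simp add: integrable_density integrable_distr_eq integrable_mult_left_iff)

lemma integral_lborel_affine:
  fixes f :: "'a::euclidean_space \<Rightarrow> real"
  assumes [measurable]: "f \<in> borel_measurable borel" and "c \<noteq> 0"
  shows "(LINT x|lborel. f x) = \<bar>c\<bar> ^ DIM('a) * (LINT x|lborel. f (t + c *\<^sub>R x))"
  by (subst lborel_affine[OF \<open>c \<noteq> 0\<close>, of t])
     (simp add: integral_density integral_distr)

lemma integral_lborel_shift:
  fixes f :: "'a::euclidean_space \<Rightarrow> real"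
  assumes "f \<in> borel_measurable borel"
  shows "(LINT y|lborel. f (y - x)) = (LINT y|lborel. f y)"
    and "integrable lborel (\<lambda>y. f (y - x)) \<longleftrightarrow> integrable lborel f"
    and "(LINT y|lborel. f (x - y)) = (LINT y|lborel. f y)"
    and "integrable lborel (\<lambda>y. f (x - y)) \<longleftrightarrow> integrable lborel f"
  using integral_lborel_affine[OF assms, of 1 "- x"] integrable_lborel_affine[OF assms, of 1 "- x"]
    integral_lborel_affine[OF assms, of "- 1" x] integrable_lborel_affine[OF assms, of "- 1" x]
  by simp_all

text \<open>The disc where \<open>norm z ^ 2 < a\<close> has area \<open>pi * a\<close>, linear in
  \<open>a\<close>. So the square of the norm, unlike the norm, pushes planar measure to a constant
  density on the half-line. Radial integrals below use the variable \<open>s = norm z ^ 2\<close>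
  and need no polar coordinates.\<close>

lemma distr_norm_square:
  "distr lborel borel (\<lambda>z::real^2. (norm z)\<^sup>2) = density lborel (\<lambda>s. ennreal (pi * indicator {0..} s))"
    (is "?M = ?N")
proof (rule measure_eqI_generator_eq[where E = "range lessThan" and \<Omega> = UNIV and A = "\<lambda>i. {..<real i}"])
  show "Int_stable (range (lessThan :: real \<Rightarrow> real set))"
    by (auto simp: Int_stable_def intro: range_eqI[where x = "min _ _"])
  fix X :: "real set" assume "X \<in> range lessThan"
  then obtain a where X: "X = {..<a}" by auto
  have N: "emeasure ?N {..<a} = ennreal (pi * max 0 a)" for a
  proof -
    have "emeasure ?N {..<a} = (\<integral>\<^sup>+s. ennreal pi * indicator {0..<a} s \<partial>lborel)"
      by (subst emeasure_density) (auto intro!: nn_integral_cong simp: indicator_def)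
    also have "\<dots> = ennreal pi * emeasure lborel {0..<a}"
      by (rule nn_integral_cmult_indicator) auto
    also have "\<dots> = ennreal (pi * max 0 a)"
      by (cases "0 \<le> a") (auto simp: ennreal_mult max_def)
    finally show ?thesis .
  qed
  have M: "emeasure ?M {..<a} = ennreal (pi * max 0 a)" for a
  proof -
    have "(\<lambda>z::real^2. (norm z)\<^sup>2) -` {..<a} = ball 0 (sqrt (max 0 a))"
    proof (cases "0 \<le> a")
      case True
      then show ?thesis
        by (auto simp: max_def intro: real_less_rsqrt)
           (metis abs_norm_cancel real_sqrt_abs real_sqrt_less_iff real_sqrt_less_mono sqrt_le_D not_less real_sqrt_pow2 real_sqrt_ge_0_iff norm_ge_zero power2_le_imp_le)
    next
      case False
      then have "\<not> (norm z)\<^sup>2 < a" for z :: "real^2"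
        by (smt (verit) zero_le_power2)
      with False show ?thesis by (auto simp: max_def)
    qed
    moreover have "emeasure lborel (ball (0::real^2) (sqrt (max 0 a))) = ennreal (pi * max 0 a)"
      by (subst emeasure_ball_real2) auto
    ultimately show ?thesis by (simp add: emeasure_distr)
  qed
  show "emeasure ?M X = emeasure ?N X" unfolding X M N ..
next
  fix i :: nat
  show "emeasure ?M {..<real i} \<noteq> \<infinity>"
  proof -
    have "(\<lambda>z::real^2. (norm z)\<^sup>2) -` {..<real i} \<subseteq> ball 0 (real i + 1)"
    proof
      fix z :: "real^2" assume "z \<in> (\<lambda>z. (norm z)\<^sup>2) -` {..<real i}"
      then have "(norm z)\<^sup>2 < real i" by auto
      also have "real i \<le> (real i + 1)\<^sup>2" by (simp add: power2_eq_square algebra_simps)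
      finally have "norm z < real i + 1" by (rule power2_less_imp_less) auto
      then show "z \<in> ball 0 (real i + 1)" by auto
    qed
    then have "emeasure lborel ((\<lambda>z::real^2. (norm z)\<^sup>2) -` {..<real i}) \<le> emeasure lborel (ball (0::real^2) (real i + 1))"
      by (rule emeasure_mono) auto
    also have "\<dots> < \<infinity>" by (simp add: emeasure_ball_real2)
    finally show ?thesis by (simp add: emeasure_distr)
  qed
next
  show "(\<Union>i. {..<real i}) = (UNIV :: real set)"
    by (auto intro: reals_Archimedean2)
qed (auto simp: borel_Iio)

lemma nn_integral_radial:
  assumes "h \<in> borel_measurable borel"
  shows "(\<integral>\<^sup>+z. h ((norm (z::real^2))\<^sup>2) \<partial>lborel) = ennreal pi * (\<integral>\<^sup>+s\<in>{0..}. h s \<partial>lborel)"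
proof -
  have "(\<integral>\<^sup>+z. h ((norm (z::real^2))\<^sup>2) \<partial>lborel) = (\<integral>\<^sup>+s. h s \<partial>distr lborel borel (\<lambda>z::real^2. (norm z)\<^sup>2))"
    using assms by (subst nn_integral_distr) auto
  also have "\<dots> = (\<integral>\<^sup>+s. ennreal (pi * indicator {0..} s) * h s \<partial>lborel)"
    unfolding distr_norm_square using assms by (subst nn_integral_density) auto
  also have "\<dots> = (\<integral>\<^sup>+s. ennreal pi * (h s * indicator {0..} s) \<partial>lborel)"
    by (intro nn_integral_cong) (auto simp: indicator_def)
  also have "\<dots> = ennreal pi * (\<integral>\<^sup>+s\<in>{0..}. h s \<partial>lborel)"
    using assms by (subst nn_integral_cmult) auto
  finally show ?thesis .
qed

lemma integral_radial:
  fixes h :: "real \<Rightarrow> real"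
  assumes "h \<in> borel_measurable borel"
  shows "integrable lborel (\<lambda>z::real^2. h ((norm z)\<^sup>2)) \<longleftrightarrow> set_integrable lborel {0..} h"
    and "(LINT z|lborel. h ((norm (z::real^2))\<^sup>2)) = pi * (LINT s:{0..}|lborel. h s)"
proof -
  have *: "pi * indicator {0..} s * h s = pi * (indicator {0..} s * h s)" for s by simp
  have "integrable lborel (\<lambda>z::real^2. h ((norm z)\<^sup>2)) \<longleftrightarrow> integrable (distr lborel borel (\<lambda>z::real^2. (norm z)\<^sup>2)) h"
    using assms by (subst integrable_distr_eq) auto
  also have "\<dots> \<longleftrightarrow> set_integrable lborel {0..} h"
    unfolding distr_norm_square set_integrable_def using assms
    by (subst integrable_real_density) (auto simp: *)
  finally show "integrable lborel (\<lambda>z::real^2. h ((norm z)\<^sup>2)) \<longleftrightarrow> set_integrable lborel {0..} h" .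
  have "(LINT z|lborel. h ((norm (z::real^2))\<^sup>2)) = (LINT s|distr lborel borel (\<lambda>z::real^2. (norm z)\<^sup>2). h s)"
    using assms by (subst integral_distr) auto
  also have "\<dots> = pi * (LINT s:{0..}|lborel. h s)"
    unfolding distr_norm_square set_lebesgue_integral_def using assms
    by (subst integral_real_density) (auto simp: *)
  finally show "(LINT z|lborel. h ((norm (z::real^2))\<^sup>2)) = pi * (LINT s:{0..}|lborel. h s)" .
qed

text \<open>In the variable \<open>s\<close> the integrand is \<open>s powr (- p / 2)\<close>, which
  is integrable at 0 for \<open>p < 2\<close>.\<close>

lemma has_bochner_integral_norm_powr_ball:
  assumes "0 < r" "p < 2"
  shows "has_bochner_integral lborel (\<lambda>z::real^2. indicator (ball 0 r) z * norm z powr - p)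
           (2 * pi * r powr (2 - p) / (2 - p))"
proof (rule has_bochner_integral_nn_integral)
  have ev: "ennreal (indicator (ball 0 r) z * norm z powr - p) =
      ennreal (indicator {..<r\<^sup>2} ((norm z)\<^sup>2) * ((norm z)\<^sup>2) powr (- p / 2))" for z :: "real^2"
    using assms abs_le_square_iff[of r "norm z"]
    by (cases "z = 0") (auto simp: indicator_def powr_powr not_le simp flip: powr_numeral)
  have "((\<lambda>s. s powr (- p / 2)) has_integral (r\<^sup>2 powr (- p / 2 + 1) / (- p / 2 + 1))) {0..r\<^sup>2}"
    using assms by (intro has_integral_powr_from_0) auto
  then have "(\<integral>\<^sup>+s. ennreal (indicator {0..r\<^sup>2} s * s powr (- p / 2)) \<partial>lborel) =
      ennreal (r\<^sup>2 powr (- p / 2 + 1) / (- p / 2 + 1))"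
    by (intro nn_integral_has_integral_lebesgue) auto
  moreover have "(\<integral>\<^sup>+s\<in>{0..}. ennreal (indicator {..<r\<^sup>2} s * s powr (- p / 2)) \<partial>lborel) =
      (\<integral>\<^sup>+s. ennreal (indicator {0..r\<^sup>2} s * s powr (- p / 2)) \<partial>lborel)"
    by (rule nn_integral_cong_AE) (use AE_lborel_singleton[of "r\<^sup>2"] in \<open>eventually_elim, auto simp: indicator_def\<close>)
  ultimately have "(\<integral>\<^sup>+z. ennreal (indicator (ball 0 r) z * norm (z::real^2) powr - p) \<partial>lborel) =
      ennreal pi * ennreal (r\<^sup>2 powr (- p / 2 + 1) / (- p / 2 + 1))"
    unfolding ev by (subst nn_integral_radial) auto
  also have "\<dots> = ennreal (2 * pi * r powr (2 - p) / (2 - p))"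
  proof -
    have "r\<^sup>2 powr (- p / 2 + 1) = r powr (2 - p)"
      using assms by (simp add: powr_powr algebra_simps flip: powr_numeral)
    moreover have "- p / 2 + 1 = (2 - p) / 2" by simp
    ultimately show ?thesis using assms by (simp add: ennreal_mult'[symmetric] field_simps)
  qed
  finally show "(\<integral>\<^sup>+z. ennreal (indicator (ball 0 r) z * norm (z::real^2) powr - p) \<partial>lborel) =
      ennreal (2 * pi * r powr (2 - p) / (2 - p))" .
qed (use assms in \<open>auto intro!: borel_measurable_times borel_measurable_indicator\<close>)

lemma has_bochner_integral_norm_powr_outside_ball:
  assumes "0 < r" "2 < p"
  shows "has_bochner_integral lborel (\<lambda>z::real^2. indicator (- ball 0 r) z * norm z powr - p)
           (2 * pi * r powr (2 - p) / (p - 2))"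
proof (rule has_bochner_integral_nn_integral)
  have ev: "ennreal (indicator (- ball 0 r) z * norm z powr - p) =
      ennreal (indicator {r\<^sup>2..} ((norm z)\<^sup>2) * ((norm z)\<^sup>2) powr (- p / 2))" for z :: "real^2"
    using assms abs_le_square_iff[of r "norm z"]
    by (cases "z = 0") (auto simp: indicator_def powr_powr not_le simp flip: powr_numeral)
  have "((\<lambda>s. s powr (- p / 2)) has_integral (- (r\<^sup>2 powr (- p / 2 + 1)) / (- p / 2 + 1))) {r\<^sup>2..}"
    using assms by (intro has_integral_powr_to_inf) auto
  then have "(\<integral>\<^sup>+s. ennreal (indicator {r\<^sup>2..} s * s powr (- p / 2)) \<partial>lborel) =
      ennreal (- (r\<^sup>2 powr (- p / 2 + 1)) / (- p / 2 + 1))"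
    by (intro nn_integral_has_integral_lebesgue) auto
  moreover have "(\<integral>\<^sup>+s\<in>{0..}. ennreal (indicator {r\<^sup>2..} s * s powr (- p / 2)) \<partial>lborel) =
      (\<integral>\<^sup>+s. ennreal (indicator {r\<^sup>2..} s * s powr (- p / 2)) \<partial>lborel)"
  proof (rule nn_integral_cong)
    fix s :: real
    have "r\<^sup>2 \<le> s \<Longrightarrow> 0 \<le> s" using order_trans zero_le_power2 by blast
    then show "ennreal (indicator {r\<^sup>2..} s * s powr (- p / 2)) * indicator {0..} s =
      ennreal (indicator {r\<^sup>2..} s * s powr (- p / 2))" by (auto simp: indicator_def)
  qed
  ultimately have "(\<integral>\<^sup>+z. ennreal (indicator (- ball 0 r) z * norm (z::real^2) powr - p) \<partial>lborel) =
      ennreal pi * ennreal (- (r\<^sup>2 powr (- p / 2 + 1)) / (- p / 2 + 1))"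
    unfolding ev by (subst nn_integral_radial) auto
  also have "\<dots> = ennreal (2 * pi * r powr (2 - p) / (p - 2))"
  proof -
    have "r\<^sup>2 powr (- p / 2 + 1) = r powr (2 - p)"
      using assms by (simp add: powr_powr algebra_simps flip: powr_numeral)
    moreover have "- (x::real) / (- p / 2 + 1) = 2 * x / (p - 2)" for x
      using assms by (simp add: field_simps)
    ultimately show ?thesis using assms by (simp add: ennreal_mult'[symmetric] field_simps)
  qed
  finally show "(\<integral>\<^sup>+z. ennreal (indicator (- ball 0 r) z * norm (z::real^2) powr - p) \<partial>lborel) =
      ennreal (2 * pi * r powr (2 - p) / (p - 2))" .
qed (use assms in \<open>auto intro!: borel_measurable_times borel_measurable_indicator\<close>)

section \<open>Smooth functions\<close>

lemma partial_deriv_eq: "(f has_derivative f') (at x) \<Longrightarrow> partial_deriv b f x = f' b"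
  unfolding partial_deriv_def using frechet_derivative_at by metis

lemma differentiable_has_partial:
  "f differentiable (at x) \<Longrightarrow> (f has_derivative (\<lambda>b. partial_deriv b f x)) (at x)"
  unfolding partial_deriv_def by (simp add: frechet_derivative_works)

lemma partial_deriv_real: "(f has_real_derivative D) (at x) \<Longrightarrow> partial_deriv 1 f x = D"
  using partial_deriv_eq[of f "(*) D" x 1] by (simp add: has_field_derivative_def)

lemma times_cont_diff_Suc_imp: "times_cont_diff (Suc n) f \<Longrightarrow> times_cont_diff n f"
proof (induction n arbitrary: f)
  case 0
  then show ?case
    by (auto simp: continuous_on_eq_continuous_at differentiable_imp_continuous_within)
qed auto

lemma times_cont_diff_const: "times_cont_diff n (\<lambda>x. c)"
proof (induction n arbitrary: c)
  case (Suc n)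
  have "partial_deriv b (\<lambda>x. c) = (\<lambda>x. 0)" for b :: 'a
    by (rule ext, rule partial_deriv_eq) (rule derivative_eq_intros refl)+
  with Suc show ?case by auto
qed auto

lemma times_cont_diff_add:
  "times_cont_diff n f \<Longrightarrow> times_cont_diff n g \<Longrightarrow> times_cont_diff n (\<lambda>x. f x + g x)"
proof (induction n arbitrary: f g)
  case 0
  then show ?case by (auto intro: continuous_intros)
next
  case (Suc n)
  have "partial_deriv b (\<lambda>x. f x + g x) = (\<lambda>x. partial_deriv b f x + partial_deriv b g x)" for b
    by (rule ext, rule partial_deriv_eq, rule has_derivative_add)
       (use Suc.prems in \<open>auto intro: differentiable_has_partial\<close>)
  with Suc show ?case by auto
qed

lemma times_cont_diff_mult:
  "times_cont_diff n f \<Longrightarrow> times_cont_diff n g \<Longrightarrow> times_cont_diff n (\<lambda>x. f x * g x)"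
proof (induction n arbitrary: f g)
  case 0
  then show ?case by (auto intro: continuous_intros)
next
  case (Suc n)
  have "partial_deriv b (\<lambda>x. f x * g x) = (\<lambda>x. f x * partial_deriv b g x + partial_deriv b f x * g x)" for b
    by (rule ext, rule partial_deriv_eq, rule has_derivative_mult)
       (use Suc.prems in \<open>auto intro: differentiable_has_partial\<close>)
  moreover have "times_cont_diff n f" "times_cont_diff n g"
    using Suc.prems times_cont_diff_Suc_imp by blast+
  ultimately show ?case using Suc
    by (auto intro!: times_cont_diff_add Suc.IH)
qed

text \<open>Both functions are assumed smooth to every order: the induction on \<open>n\<close>
  replaces \<open>F\<close> by its derivative, and the hypothesis has to be available for that
  derivative again.\<close>

lemma times_cont_diff_compose:
  fixes F :: "real \<Rightarrow> real" and q :: "'a::euclidean_space \<Rightarrow> real"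
  assumes "\<And>m. times_cont_diff m F" "\<And>m. times_cont_diff m q"
  shows "times_cont_diff n (\<lambda>x. F (q x))"
  using assms(1)
proof (induction n arbitrary: F)
  case 0
  have "continuous_on UNIV F" "continuous_on UNIV q"
    using 0 assms(2)[of 0] by (auto simp flip: times_cont_diff.simps(1))
  then show ?case by (auto intro: continuous_on_compose2)
next
  case (Suc n)
  have F: "F differentiable (at t)" "times_cont_diff m (partial_deriv 1 F)" for t m
    using Suc.prems[of "Suc m"] Suc.prems[of 1] by auto
  have q: "q differentiable (at x)" "b \<in> Basis \<Longrightarrow> times_cont_diff m (partial_deriv b q)" for x m b
    using assms(2)[of "Suc m"] assms(2)[of 1] by auto
  have D: "((\<lambda>x. F (q x)) has_derivative (\<lambda>b. partial_deriv 1 F (q x) * partial_deriv b q x)) (at x)" for x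
  proof -
    have lin: "partial_deriv h F t = partial_deriv 1 F t * h" for h t
    proof -
      have "linear (\<lambda>b. partial_deriv b F t)"
        using differentiable_has_partial[OF F(1)] has_derivative_linear by blast
      from linear_cmul[OF this, of h 1] show ?thesis by simp
    qed
    show ?thesis
      using has_derivative_compose[OF differentiable_has_partial[OF q(1)] differentiable_has_partial[OF F(1)], of x]
      by (subst (asm) lin) simp
  qed
  have "partial_deriv b (\<lambda>x. F (q x)) = (\<lambda>x. partial_deriv 1 F (q x) * partial_deriv b q x)" for b
    by (rule ext, rule partial_deriv_eq, rule D)
  moreover have "(\<lambda>x. F (q x)) differentiable (at x)" for x
    using D by (auto simp: differentiable_def)
  ultimately show ?case
    using Suc.IH[OF F(2)] q(2) by (auto intro!: times_cont_diff_mult)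
qed

lemma times_cont_diff_affine: "times_cont_diff n (\<lambda>y. c + (y - x) \<bullet> b)"
proof (cases n)
  case (Suc m)
  have D: "((\<lambda>y. c + (y - x) \<bullet> b) has_derivative (\<lambda>h. h \<bullet> b)) (at y)" for y
    by (auto intro!: derivative_eq_intros)
  have "partial_deriv v (\<lambda>y. c + (y - x) \<bullet> b) = (\<lambda>y. v \<bullet> b)" for v
    by (rule ext, rule partial_deriv_eq, rule D)
  then show ?thesis
    using D unfolding Suc by (auto simp: times_cont_diff_const differentiable_def)
qed (auto intro!: continuous_intros)

lemma times_cont_diff_sum:
  "finite I \<Longrightarrow> (\<And>i. i \<in> I \<Longrightarrow> times_cont_diff n (f i)) \<Longrightarrow> times_cont_diff n (\<lambda>x. \<Sum>i\<in>I. f i x)"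
  by (induction I rule: finite_induct) (auto intro: times_cont_diff_const times_cont_diff_add)

lemma times_cont_diff_norm_square: "times_cont_diff n (\<lambda>y. (norm (y - x))\<^sup>2)"
proof -
  have "(\<lambda>y::'a. (norm (y - x))\<^sup>2) = (\<lambda>y. \<Sum>b\<in>Basis. (0 + (y - x) \<bullet> b) * (0 + (y - x) \<bullet> b))"
    by (simp add: power2_norm_eq_inner euclidean_inner[of "_ - x" "_ - x"])
  then show ?thesis
    by (simp only:) (intro times_cont_diff_sum times_cont_diff_mult times_cont_diff_affine finite_Basis)
qed

lemma times_cont_diff_real_Suc:
  fixes f f' :: "real \<Rightarrow> real"
  assumes "\<And>x. (f has_real_derivative f' x) (at x)"
  shows "times_cont_diff (Suc n) f \<longleftrightarrow> times_cont_diff n f'"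
proof -
  have "partial_deriv 1 f = f'"
    by (rule ext, rule partial_deriv_real, rule assms)
  moreover have "f differentiable (at x)" for x
    using assms by (auto simp: real_differentiable_def)
  ultimately show ?thesis by auto
qed

lemma has_real_derivative_locally_0:
  assumes "open S" "x \<in> S" "\<And>y. y \<in> S \<Longrightarrow> f y = (0::real)"
  shows "(f has_real_derivative 0) (at x)"
  by (rule has_field_derivative_transform_within_open[of "\<lambda>_. 0" 0 x S]) (use assms in auto)

text \<open>The family \<open>q m\<close> of flat functions is closed under differentiation up to
  linear combinations, the derivative of \<open>q m\<close> being
  \<open>q (m + 2) - m * q (m + 1)\<close>. The induction therefore has to treat all
  \<open>m\<close> at once.\<close>

lemma times_cont_diff_exp_inverse:
  fixes m :: nat
  defines "q \<equiv> \<lambda>(m::nat) t. if (t::real) \<le> 0 then 0 else exp (- 1 / t) / t ^ m"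
  shows "times_cont_diff n (q m)"
proof (induction n arbitrary: m)
  have D: "(q m has_real_derivative (q (m + 2) t + - real m * q (m + 1) t)) (at t)" for m t
  proof -
    consider "t < 0" | "t = 0" | "0 < t" by linarith
    then show ?thesis
    proof cases
      case 1
      have "(q m has_real_derivative 0) (at t)"
        by (rule has_real_derivative_locally_0[of "{..<0}"]) (use 1 in \<open>auto simp: q_def\<close>)
      with 1 show ?thesis by (simp add: q_def)
    next
      case 2
      have "((\<lambda>h. q m h / h) \<longlongrightarrow> 0) (at 0)"
      proof (rule filterlim_split_at)
        show "((\<lambda>h. q m h / h) \<longlongrightarrow> 0) (at_left 0)"
          by (rule Lim_transform_eventually[OF tendsto_const])
             (auto simp: q_def eventually_at_filter)
        have "((\<lambda>h::real. exp (- 1 / h) / h ^ m / h) \<longlongrightarrow> 0) (at_right 0)"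
          by real_asymp
        then show "((\<lambda>h. q m h / h) \<longlongrightarrow> 0) (at_right 0)"
          by (rule Lim_transform_eventually) (auto simp: q_def eventually_at_filter)
      qed
      then have "(q m has_real_derivative 0) (at 0)"
        by (simp add: has_field_derivative_iff q_def)
      with 2 show ?thesis by (simp add: q_def)
    next
      case 3
      have "((\<lambda>t. exp (- 1 / t) / t ^ m) has_real_derivative
          (exp (- 1 / t) * (1 / t\<^sup>2) * t ^ m - exp (- 1 / t) * (real m * t ^ (m - 1))) / (t ^ m * t ^ m)) (at t)"
        using 3 by (auto intro!: derivative_eq_intros simp: power2_eq_square)
      also have "(exp (- 1 / t) * (1 / t\<^sup>2) * t ^ m - exp (- 1 / t) * (real m * t ^ (m - 1))) / (t ^ m * t ^ m)
          = q (m + 2) t + - real m * q (m + 1) t"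
        using 3 by (cases m) (auto simp: q_def field_simps power2_eq_square)
      finally show ?thesis
        by (rule has_field_derivative_transform_within_open[where S = "{0<..}"])
           (use 3 in \<open>auto simp: q_def\<close>)
    qed
  qed
  {
    case 0
    have "isCont (q m) t" for t using D DERIV_isCont by blast
    then show ?case by (auto simp: continuous_on_eq_continuous_at)
  next
    case (Suc n)
    show ?case unfolding times_cont_diff_real_Suc[OF D]
      by (intro times_cont_diff_add times_cont_diff_mult times_cont_diff_const Suc)
  }
qed

lemma continuous_antiderivative:
  fixes f :: "real \<Rightarrow> real"
  assumes "continuous_on UNIV f"
  obtains F where "\<And>x. (F has_real_derivative f x) (at x)"
proof -
  have "\<exists>F. \<forall>x::real. (-\<infinity>::ereal) < x \<longrightarrow> x < (\<infinity>::ereal) \<longrightarrow> (F has_vector_derivative f x) (at x)"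
    by (rule einterval_antiderivative) (use assms in \<open>auto simp: continuous_on_eq_continuous_at\<close>)
  then show ?thesis
    using that by (auto simp: has_real_derivative_iff_has_vector_derivative)
qed

lemma times_cont_diff_scale:
  fixes F :: "real \<Rightarrow> real"
  assumes "\<And>m. times_cont_diff m F"
  shows "times_cont_diff n (\<lambda>s. F (c + d * s))"
proof (rule times_cont_diff_compose[OF assms])
  fix m
  show "times_cont_diff m (\<lambda>s. c + d * s)"
    using times_cont_diff_affine[of m c 0 d] by (simp add: mult.commute)
qed

text \<open>Normalized antiderivative of the bump \<open>e t * e (1 - t)\<close>. Sign and support
  of \<open>\<psi>'\<close> are recorded because its rescalings act later as approximate Dirac
  masses.\<close>

lemma smooth_step_exists:
  obtains \<psi> \<psi>' :: "real \<Rightarrow> real" where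
    "\<And>n. times_cont_diff n \<psi>" "\<And>t. (\<psi> has_real_derivative \<psi>' t) (at t)"
    "\<And>t. t \<le> 0 \<Longrightarrow> \<psi> t = 0" "\<And>t. 1 \<le> t \<Longrightarrow> \<psi> t = 1" "\<And>t. 0 \<le> \<psi> t" "\<And>t. \<psi> t \<le> 1"
    "\<And>t. 0 \<le> \<psi>' t" "\<And>t. t \<notin> {0<..<1} \<Longrightarrow> \<psi>' t = 0" "continuous_on UNIV \<psi>'"
proof -
  define e where "e = (\<lambda>t::real. if t \<le> 0 then 0 else exp (- 1 / t) / t ^ 0)"
  define b where "b = (\<lambda>t::real. e (0 + 1 * t) * e (1 + (-1) * t))"
  have e: "times_cont_diff n e" for n
    unfolding e_def by (rule times_cont_diff_exp_inverse)
  have b: "times_cont_diff n b" for n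
    unfolding b_def by (intro times_cont_diff_mult times_cont_diff_scale e)
  have b0: "0 \<le> b t" "t \<notin> {0<..<1} \<Longrightarrow> b t = 0" "t \<in> {0<..<1} \<Longrightarrow> 0 < b t" for t
    by (auto simp: b_def e_def)
  have bc: "continuous_on UNIV b" using b[of 0] by simp
  then obtain B where B: "\<And>x. (B has_real_derivative b x) (at x)"
    using continuous_antiderivative by blast
  have mono: "B x \<le> B y" if "x \<le> y" for x y
    by (rule DERIV_nonneg_imp_nondecreasing[OF that]) (use B b0 in blast)
  have "B 0 < B 1"
  proof -
    have "\<exists>z>0. z < 1 \<and> B 1 - B 0 = (1 - 0) * b z"
      by (rule MVT2[of 0 1 B b]) (use B in auto)
    then obtain z where "0 < z" "z < 1" "B 1 - B 0 = b z" by force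
    moreover have "0 < b z" using \<open>0 < z\<close> \<open>z < 1\<close> by (intro b0) auto
    ultimately show ?thesis by linarith
  qed
  have eq: "B x = B y" if "x \<le> y" "y \<le> 0 \<or> 1 \<le> x" for x y
  proof (cases "x = y")
    case False
    have "\<exists>z>x. z < y \<and> B y - B x = (y - x) * b z"
      by (rule MVT2) (use B that False in auto)
    then obtain z where "x < z" "z < y" "B y - B x = (y - x) * b z" by auto
    with b0(2)[of z] that show ?thesis by auto
  qed auto
  define \<psi> where "\<psi> = (\<lambda>t. (B t + - B 0) * (1 / (B 1 - B 0)))"
  define \<psi>' where "\<psi>' = (\<lambda>t. b t / (B 1 - B 0))"
  have D: "(\<psi> has_real_derivative \<psi>' t) (at t)" for t
    unfolding \<psi>_def \<psi>'_def using B \<open>B 0 < B 1\<close> by (auto intro!: derivative_eq_intros)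
  show ?thesis
  proof (rule that[of \<psi> \<psi>'])
    have "times_cont_diff n B" for n
    proof (cases n)
      case 0
      have "isCont B t" for t using B DERIV_isCont by blast
      with 0 show ?thesis by (auto simp: continuous_on_eq_continuous_at)
    next
      case (Suc m)
      then show ?thesis using b times_cont_diff_real_Suc[OF B] by simp
    qed
    then show "times_cont_diff n \<psi>" for n
      unfolding \<psi>_def by (intro times_cont_diff_add times_cont_diff_mult times_cont_diff_const)
    show "\<psi> t = 0" if "t \<le> 0" for t using eq[of t 0] that by (simp add: \<psi>_def)
    show "\<psi> t = 1" if "1 \<le> t" for t using eq[of 1 t] that \<open>B 0 < B 1\<close> by (simp add: \<psi>_def)
    show "0 \<le> \<psi> t" for t
      using mono[of 0 t] eq[of t 0] \<open>B 0 < B 1\<close> by (cases "0 \<le> t") (auto simp: \<psi>_def)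
    show "\<psi> t \<le> 1" for t
      using mono[of t 1] eq[of 1 t] \<open>B 0 < B 1\<close> by (cases "t \<le> 1") (auto simp: \<psi>_def)
    show "0 \<le> \<psi>' t" for t using b0 \<open>B 0 < B 1\<close> by (simp add: \<psi>'_def)
    show "\<psi>' t = 0" if "t \<notin> {0<..<1}" for t using b0(2) that by (simp add: \<psi>'_def)
    show "continuous_on UNIV \<psi>'" unfolding \<psi>'_def
      using bc \<open>B 0 < B 1\<close> by (auto intro!: continuous_intros)
  qed (fact D)
qed

text \<open>Since \<open>g\<close> vanishes up to \<open>a > 0\<close>, the quotient is zero around
  the origin and the convention for division by 0 does no harm. All \<open>k\<close> are treated
  together because the derivative of \<open>g / s ^ k\<close> involves
  \<open>g / s ^ (k + 1)\<close>.\<close>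

lemma times_cont_diff_divide:
  fixes g :: "real \<Rightarrow> real"
  assumes "\<And>m. times_cont_diff m g" "0 < a" "\<And>s. s \<le> a \<Longrightarrow> g s = 0"
  shows "times_cont_diff n (\<lambda>s. g s / s ^ k)"
  using assms(1,3)
proof (induction n arbitrary: g k)
  have D: "((\<lambda>s. g s / s ^ k) has_real_derivative
      (partial_deriv 1 g s / s ^ k + - real k * (g s / s ^ (k + 1)))) (at s)"
      "s < a \<Longrightarrow> partial_deriv 1 g s = 0"
    if g: "\<And>m. times_cont_diff m g" and g0: "\<And>s. s \<le> a \<Longrightarrow> g s = 0" for g :: "real \<Rightarrow> real" and k s
  proof -
    have gd: "(g has_real_derivative partial_deriv 1 g s) (at s)"
    proof -
      have "g differentiable (at s)" using g[of 1] by auto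
      then obtain D where "(g has_real_derivative D) (at s)" by (auto simp: real_differentiable_def)
      with partial_deriv_real[OF this] show ?thesis by simp
    qed
    show z: "partial_deriv 1 g s = 0" if "s < a"
      by (rule partial_deriv_real, rule has_real_derivative_locally_0[of "{..<a}"])
         (use that g0 in auto)
    show "((\<lambda>s. g s / s ^ k) has_real_derivative
      (partial_deriv 1 g s / s ^ k + - real k * (g s / s ^ (k + 1)))) (at s)"
    proof (cases "s < a")
      case True
      have "((\<lambda>s. g s / s ^ k) has_real_derivative 0) (at s)"
        by (rule has_real_derivative_locally_0[of "{..<a}"]) (use True g0 in auto)
      with True z g0 show ?thesis by simp
    next
      case False
      with \<open>0 < a\<close> have "0 < s" by simp
      have "((\<lambda>s. g s / s ^ k) has_real_derivative
        (partial_deriv 1 g s * s ^ k - g s * (real k * s ^ (k - 1))) / (s ^ k * s ^ k)) (at s)"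
        using gd \<open>0 < s\<close> by (auto intro!: derivative_eq_intros)
      also have "(partial_deriv 1 g s * s ^ k - g s * (real k * s ^ (k - 1))) / (s ^ k * s ^ k)
        = partial_deriv 1 g s / s ^ k + - real k * (g s / s ^ (k + 1))"
        using \<open>0 < s\<close> by (cases k) (auto simp: field_simps)
      finally show ?thesis .
    qed
  qed
  {
    case 0
    have "isCont (\<lambda>s. g s / s ^ k) s" for s
      using D(1)[OF 0] DERIV_isCont by blast
    then show ?case by (auto simp: continuous_on_eq_continuous_at)
  next
    case (Suc n)
    have g': "times_cont_diff m (partial_deriv 1 g)" for m
      using Suc.prems(1)[of "Suc m"] by auto
    \<comment> \<open>The induction hypothesis asks for vanishing on the closed half-line; the
      endpoint is reached by continuity from the left.\<close>
    have "partial_deriv 1 g a = 0"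
    proof -
      have "isCont (partial_deriv 1 g) a"
        using g'[of 0] by (simp add: continuous_on_eq_continuous_at)
      then have "(partial_deriv 1 g \<longlongrightarrow> partial_deriv 1 g a) (at_left a)"
        by (auto simp: isCont_def intro: filterlim_at_split[THEN iffD1, THEN conjunct1])
      moreover have "(partial_deriv 1 g \<longlongrightarrow> 0) (at_left a)"
        by (rule Lim_transform_eventually[OF tendsto_const])
           (auto simp: eventually_at_filter D(2)[OF Suc.prems])
      ultimately show ?thesis using tendsto_unique trivial_limit_at_left_real by blast
    qed
    with D(2)[OF Suc.prems] have "s \<le> a \<Longrightarrow> partial_deriv 1 g s = 0" for s
      by (cases "s = a") auto
    note g'0 = this
    have "times_cont_diff n (\<lambda>s. partial_deriv 1 g s / s ^ k + - real k * (g s / s ^ (k + 1)))"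
      by (intro times_cont_diff_add times_cont_diff_mult times_cont_diff_const Suc.IH g' g'0 Suc.prems)
    moreover have "times_cont_diff (Suc n) (\<lambda>s. g s / s ^ k) \<longleftrightarrow>
        times_cont_diff n (\<lambda>s. partial_deriv 1 g s / s ^ k + - real k * (g s / s ^ (k + 1)))"
      by (rule times_cont_diff_real_Suc) (rule D(1)[OF Suc.prems])
    ultimately show ?case by blast
  }
qed

section \<open>Green's formula on balls\<close>

text \<open>Green kernel for solid means: on the ball, minus its Laplacian is the Dirac mass at 0
  minus the uniform density \<open>1 / (pi * R\<^sup>2)\<close>. Value and normal derivative vanish
  at \<open>norm z = R\<close>, so the extension by zero creates no boundary term. The value at the
  singularity 0 is a dummy on a null set.\<close>

definition green_kernel :: "real \<Rightarrow> real^2 \<Rightarrow> real" where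
  "green_kernel R z = (if 0 < norm z \<and> norm z < R
     then (ln (R / norm z) - 1 / 2 + (norm z)\<^sup>2 / (2 * R\<^sup>2)) / (2 * pi) else 0)"

lemma ln_le_powr: "0 < p \<Longrightarrow> 0 < a \<Longrightarrow> ln a \<le> a powr p / (p::real)"
  using ln_le_minus_one[of "a powr p"] by (simp add: field_simps ln_powr)

lemma ln_one_plus_le_powr:
  assumes "0 < p" "p \<le> 1" "0 \<le> a"
  shows "ln (1 + a) \<le> 2 * a powr p / (p::real)"
proof (cases "a \<le> 1")
  case True
  have "ln (1 + a) \<le> a" using assms(3) by (rule ln_add_one_self_le_self)
  also have "a \<le> a powr p" using powr_mono'[of p 1 a] assms True by simp
  also have "\<dots> \<le> 2 * a powr p / p" using assms mult_right_mono[of p 2 "a powr p"] by (simp add: field_simps)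
  finally show ?thesis .
next
  case False
  have "ln (1 + a) \<le> (1 + a) powr p / p" using ln_le_powr[of p "1 + a"] assms by simp
  also have "(1 + a) powr p \<le> (2 * a) powr p" using False assms by (intro powr_mono2) auto
  also have "\<dots> \<le> 2 * a powr p" using assms False powr_mono[of p 1 2] by (simp add: powr_mult)
  finally show ?thesis using assms by (simp add: divide_right_mono)
qed

lemma green_kernel_measurable [measurable]: "green_kernel R \<in> borel_measurable borel"
  unfolding green_kernel_def by measurable

lemma green_kernel_nonneg: "0 \<le> green_kernel R z"
proof -
  have "0 \<le> ln (R / norm z) - 1 / 2 + (norm z)\<^sup>2 / (2 * R\<^sup>2)" if "0 < norm z" "norm z < R"
  proof -
    define t where "t = (norm z / R)\<^sup>2"
    have "0 < t" using that by (auto simp: t_def)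
    have "ln t = - 2 * ln (R / norm z)"
      unfolding t_def using that by (simp add: ln_realpow ln_div)
    with ln_le_minus_one[OF \<open>0 < t\<close>] show ?thesis
      by (simp add: t_def power_divide)
  qed
  then show ?thesis by (simp add: green_kernel_def)
qed

text \<open>The exponent 1/2 is a choice: the singularity stays integrable, and the growth in
  \<open>R\<close> is slower than linear, on which \<open>avg_diff_lim\<close> relies.\<close>

lemma green_kernel_le_powr:
  assumes "0 < R"
  shows "green_kernel R z \<le> indicator (ball 0 R) z * (R powr (1/2) * norm z powr - (1/2))"
proof (cases "0 < norm z \<and> norm z < R")
  case True
  have "(norm z)\<^sup>2 / (2 * R\<^sup>2) \<le> 1 / 2"
    using True assms power_mono[of "norm z" R 2] by (simp add: field_simps)
  moreover have "ln (R / norm z) \<le> 2 * (R / norm z) powr (1/2)"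
    using ln_le_powr[of "1/2" "R / norm z"] True assms by (simp add: mult.commute)
  ultimately have "ln (R / norm z) - 1 / 2 + (norm z)\<^sup>2 / (2 * R\<^sup>2) \<le> 2 * (R / norm z) powr (1/2)"
    by linarith
  then have "green_kernel R z \<le> 2 * (R / norm z) powr (1/2) / (2 * pi)"
    unfolding green_kernel_def using True
    by (simp only: if_True simp_thms) (intro divide_right_mono; simp)
  also have "\<dots> \<le> (R / norm z) powr (1/2)"
    using pi_ge_two mult_right_mono[of 1 pi "(R / norm z) powr (1/2)"] by (simp add: field_simps)
  also have "\<dots> = R powr (1/2) * norm z powr - (1/2)"
    using True by (simp add: powr_divide powr_minus_divide)
  finally show ?thesis using True by simp
qed (auto simp: green_kernel_def)

lemma green_kernel_integrable: "0 < R \<Longrightarrow> integrable lborel (green_kernel R)"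
proof (rule Bochner_Integration.integrable_bound)
  assume "0 < R"
  show "integrable lborel (\<lambda>z. R powr (1/2) * (indicator (ball 0 R) z * norm (z::real^2) powr - (1/2)))"
    using has_bochner_integral_norm_powr_ball[OF \<open>0 < R\<close>, of "1/2"]
    by (intro integrable_mult_right) (auto simp: has_bochner_integral_iff)
  show "AE z in lborel. norm (green_kernel R z) \<le>
      norm (R powr (1/2) * (indicator (ball 0 R) z * norm (z::real^2) powr - (1/2)))"
    using green_kernel_le_powr[OF \<open>0 < R\<close>] green_kernel_nonneg by (auto simp: mult_ac)
qed auto

text \<open>In the variable \<open>s = norm (y - x) ^ 2\<close> the planar Laplacian of
  \<open>\<Phi>\<close> is \<open>4 * (s * \<Phi>')'\<close>. Prescribing
  \<open>T = s * \<Phi>'\<close> thus makes the Laplacian a total derivative. \<open>T\<close>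
  vanishes near 0 to keep \<open>T / s\<close> smooth, and from \<open>R\<^sup>2\<close> on to make
  \<open>\<Phi>\<close> constant there.\<close>

lemma radial_test_function:
  fixes T T' :: "real \<Rightarrow> real" and x :: "real^2"
  assumes T: "\<And>n. times_cont_diff n T" "\<And>s. (T has_real_derivative T' s) (at s)"
    and T0: "0 < a" "\<And>s. s \<le> a \<Longrightarrow> T s = 0" "\<And>s. R\<^sup>2 \<le> s \<Longrightarrow> T s = 0" and R: "0 < R"
  obtains \<Phi> where "\<And>s. (\<Phi> has_real_derivative T s / s) (at s)" "\<And>s. R\<^sup>2 \<le> s \<Longrightarrow> \<Phi> s = 0"
    "\<And>\<omega>. cball x R \<subseteq> \<omega> \<Longrightarrow> (\<lambda>y. \<Phi> ((norm (y - x))\<^sup>2)) \<in> Cc_infinity \<omega>"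
    "\<And>y. laplacian (\<lambda>y. \<Phi> ((norm (y - x))\<^sup>2)) y = 4 * T' ((norm (y - x))\<^sup>2)"
proof -
  have g: "times_cont_diff n (\<lambda>s. T s / s)" for n
    using times_cont_diff_divide[OF T(1) T0(1,2), of n 1] by simp
  from g[of 0] obtain G where G: "\<And>s. (G has_real_derivative T s / s) (at s)"
    using continuous_antiderivative[of "\<lambda>s. T s / s"] by auto
  \<comment> \<open>The subtracted constant is the value that \<open>G\<close> keeps beyond
    \<open>R\<^sup>2\<close>; this gives compact support.\<close>
  define \<Phi> where "\<Phi> = (\<lambda>s. G s - G (R\<^sup>2))"
  have D: "(\<Phi> has_real_derivative T s / s) (at s)" for s
    unfolding \<Phi>_def using G by (auto intro!: derivative_eq_intros)
  have Z: "\<Phi> s = 0" if s: "R\<^sup>2 \<le> s" for s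
  proof (cases "s = R\<^sup>2")
    case False
    have "\<exists>z>R\<^sup>2. z < s \<and> \<Phi> s - \<Phi> (R\<^sup>2) = (s - R\<^sup>2) * (T z / z)"
      by (rule MVT2) (use D s False in auto)
    then show ?thesis using T0(3) by (auto simp: \<Phi>_def)
  qed (simp add: \<Phi>_def)
  have smooth: "times_cont_diff n \<Phi>" for n
  proof (cases n)
    case 0
    have "isCont \<Phi> s" for s using D DERIV_isCont by blast
    with 0 show ?thesis by (auto simp: continuous_on_eq_continuous_at)
  next
    case (Suc m)
    then show ?thesis using g times_cont_diff_real_Suc[OF D] by simp
  qed
  show ?thesis
  proof (rule that[OF D Z])
    fix \<omega> :: "(real^2) set" assume \<omega>: "cball x R \<subseteq> \<omega>"
    have "{y. \<Phi> ((norm (y - x))\<^sup>2) \<noteq> 0} \<subseteq> cball x R"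
    proof
      fix y assume "y \<in> {y. \<Phi> ((norm (y - x))\<^sup>2) \<noteq> 0}"
      with Z have "\<not> R\<^sup>2 \<le> (norm (y - x))\<^sup>2" by auto
      with R have "norm (y - x) < R" using power_mono by (fastforce simp: not_le)
      then show "y \<in> cball x R" by (simp add: dist_norm norm_minus_commute)
    qed
    then have sub: "closure {y. \<Phi> ((norm (y - x))\<^sup>2) \<noteq> 0} \<subseteq> cball x R"
      by (rule closure_minimal) auto
    then have "compact (closure {y. \<Phi> ((norm (y - x))\<^sup>2) \<noteq> 0})"
      by (metis bounded_cball bounded_subset closed_closure compact_eq_bounded_closed)
    with sub \<omega> show "(\<lambda>y. \<Phi> ((norm (y - x))\<^sup>2)) \<in> Cc_infinity \<omega>"
      unfolding Cc_infinity_def compact_support_in_def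
      by (auto intro!: times_cont_diff_compose[OF smooth] times_cont_diff_norm_square)
  next
    fix y :: "real^2"
    define q where "q = (\<lambda>y. (norm (y - x))\<^sup>2)"
    define h where "h = (\<lambda>s. T s / s)"
    have qd: "(q has_derivative (\<lambda>v. 2 * ((y - x) \<bullet> v))) (at y)" for y
      unfolding q_def power2_norm_eq_inner
      by (auto intro!: derivative_eq_intros simp: inner_commute)
    have p1: "partial_deriv b (\<lambda>y. \<Phi> (q y)) = (\<lambda>y. 2 * ((y - x) \<bullet> b) * h (q y))" for b
    proof (rule ext, rule partial_deriv_eq)
      fix y
      have "((\<lambda>y. \<Phi> (q y)) has_derivative (\<lambda>v. h (q y) * (2 * ((y - x) \<bullet> v)))) (at y)"
        using has_derivative_compose[OF qd D[of "q y", unfolded has_field_derivative_def]] by (simp add: h_def)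
      then show "((\<lambda>y. \<Phi> (q y)) has_derivative (\<lambda>b. 2 * ((y - x) \<bullet> b) * h (q y))) (at y)"
        by (simp add: mult_ac)
    qed
    obtain h' where hd: "\<And>s. (h has_real_derivative h' s) (at s)"
    proof -
      have "h differentiable (at s)" for s using g[of 1] by (auto simp: h_def)
      then show ?thesis using that by (metis real_differentiable_def)
    qed
    have hT: "s * h' s + h s = T' s" for s
    proof -
      have "((\<lambda>s. s * h s) has_real_derivative s * h' s + h s) (at s)"
        using hd by (auto intro!: derivative_eq_intros)
      moreover have "(\<lambda>s. s * h s) = T"
        using T0(1,2) by (auto simp: h_def fun_eq_iff)
      ultimately show ?thesis using T(2) DERIV_unique by metis
    qed
    have p2: "partial_deriv b (partial_deriv b (\<lambda>y. \<Phi> (q y))) y =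
        4 * ((y - x) \<bullet> b)\<^sup>2 * h' (q y) + 2 * h (q y)" if "b \<in> Basis" for b
      unfolding p1
    proof (rule trans[OF partial_deriv_eq])
      have "((\<lambda>y. h (q y)) has_derivative (\<lambda>v. h' (q y) * (2 * ((y - x) \<bullet> v)))) (at y)"
        using has_derivative_compose[OF qd hd[of "q y", unfolded has_field_derivative_def]] by simp
      then show "((\<lambda>y. 2 * ((y - x) \<bullet> b) * h (q y)) has_derivative
          (\<lambda>v. 2 * ((y - x) \<bullet> b) * (h' (q y) * (2 * ((y - x) \<bullet> v))) + 2 * (v \<bullet> b) * h (q y))) (at y)"
        by (auto intro!: derivative_eq_intros)
    qed (use that in \<open>auto simp: power2_eq_square inner_Basis\<close>)
    have "laplacian (\<lambda>y. \<Phi> (q y)) y = (\<Sum>b\<in>Basis. 4 * ((y - x) \<bullet> b)\<^sup>2 * h' (q y) + 2 * h (q y))"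
      unfolding laplacian_def by (intro sum.cong refl p2)
    also have "\<dots> = 4 * (\<Sum>b\<in>Basis. ((y - x) \<bullet> b)\<^sup>2) * h' (q y) + 4 * h (q y)"
      by (simp add: sum.distrib sum_distrib_left sum_distrib_right)
    also have "(\<Sum>b\<in>Basis. ((y - x) \<bullet> b)\<^sup>2) = q y"
      unfolding q_def power2_norm_eq_inner euclidean_inner[of "y - x" "y - x"] by (simp add: power2_eq_square)
    also have "4 * q y * h' (q y) + 4 * h (q y) = 4 * T' (q y)"
      using hT[of "q y"] by (simp add: algebra_simps)
    finally show "laplacian (\<lambda>y. \<Phi> ((norm (y - x))\<^sup>2)) y = 4 * T' ((norm (y - x))\<^sup>2)"
      by (simp add: q_def)
  qed
qed

lemma integral_radial_derivative:
  fixes P P' :: "real \<Rightarrow> real"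
  assumes "\<And>s. (P has_real_derivative P' s) (at s)" "continuous_on UNIV P'" "0 \<le> b"
    and "\<And>s. b < s \<Longrightarrow> P' s = 0"
  shows "integrable lborel (\<lambda>z::real^2. P' ((norm (z - x))\<^sup>2))"
    and "(LINT z|lborel. P' ((norm ((z::real^2) - x))\<^sup>2)) = pi * (P b - P 0)"
proof -
  have P'[measurable]: "P' \<in> borel_measurable borel"
    using assms(2) by (rule borel_measurable_continuous_onI)
  have c: "isCont P' s" for s
    using assms(2) by (simp add: continuous_on_eq_continuous_at)
  have eq: "indicator {0..} s * P' s = P' s * indicator {0..b} s" for s
    using assms(4)[of s] by (auto simp: indicator_def)
  have i: "has_bochner_integral lborel (\<lambda>s. P' s * indicator {0..b} s) (P b - P 0)"
    by (rule has_bochner_integral_FTC_Icc_real[OF assms(3)]) (use assms(1) c in auto)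
  have I: "integrable lborel (\<lambda>z::real^2. P' ((norm z)\<^sup>2))"
    using integral_radial(1)[OF P'] i by (simp add: set_integrable_def eq has_bochner_integral_iff)
  have [measurable]: "(\<lambda>z::real^2. P' ((norm z)\<^sup>2)) \<in> borel_measurable borel" by measurable
  show "integrable lborel (\<lambda>z::real^2. P' ((norm (z - x))\<^sup>2))"
    using I integral_lborel_shift(2)[of "\<lambda>z::real^2. P' ((norm z)\<^sup>2)" x] by simp
  show "(LINT z|lborel. P' ((norm ((z::real^2) - x))\<^sup>2)) = pi * (P b - P 0)"
    using integral_lborel_shift(1)[of "\<lambda>z::real^2. P' ((norm z)\<^sup>2)" x] integral_radial(2)[OF P'] i
    by (simp add: set_lebesgue_integral_def eq has_bochner_integral_iff)
qed

text \<open>\<open>T\<close> vanishes at both ends, so \<open>T'\<close> has integral zero over the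
  ball and the constant \<open>u x\<close> can be subtracted from \<open>u\<close> at no cost. This
  subtraction is what removes the singular term at the center in
  \<open>green_formula\<close>.\<close>

lemma green_formula_smooth:
  fixes T T' :: "real \<Rightarrow> real" and x :: "real^2" and u F :: "real^2 \<Rightarrow> real"
  assumes T: "\<And>n. times_cont_diff n T" "\<And>s. (T has_real_derivative T' s) (at s)"
    and T0: "0 < a" "\<And>s. s \<le> a \<Longrightarrow> T s = 0" "\<And>s. R\<^sup>2 \<le> s \<Longrightarrow> T s = 0" and R: "0 < R"
    and sub: "cball x R \<subseteq> \<omega>" and eq: "neg_laplace_eq \<omega> u F"
    and u: "continuous_on \<omega> u" and F: "F \<in> borel_measurable borel"
  obtains \<Phi> where "\<And>s. (\<Phi> has_real_derivative T s / s) (at s)" "\<And>s. R\<^sup>2 \<le> s \<Longrightarrow> \<Phi> s = 0"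
    "(LINT y|lborel. (indicator (ball x R) y * (u y - u x)) * (4 * T' ((norm (y - x))\<^sup>2))) =
      - (LINT y|lborel. indicator (ball x R) y * (F y * \<Phi> ((norm (y - x))\<^sup>2)))"
proof -
  obtain \<Phi> where \<Phi>: "\<And>s. (\<Phi> has_real_derivative T s / s) (at s)" "\<And>s. R\<^sup>2 \<le> s \<Longrightarrow> \<Phi> s = 0"
    and "\<And>\<omega>. cball x R \<subseteq> \<omega> \<Longrightarrow> (\<lambda>y. \<Phi> ((norm (y - x))\<^sup>2)) \<in> Cc_infinity \<omega>"
    and lap: "\<And>y. laplacian (\<lambda>y. \<Phi> ((norm (y - x))\<^sup>2)) y = 4 * T' ((norm (y - x))\<^sup>2)"
    by (rule radial_test_function[OF T T0 R, where x = x]) (rule that | assumption)+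
  with sub have test: "(\<lambda>y. \<Phi> ((norm (y - x))\<^sup>2)) \<in> Cc_infinity \<omega>" by blast
  \<comment> \<open>The endpoint \<open>s = R\<^sup>2\<close> has to be included and follows from
    continuity of \<open>T'\<close>.\<close>
  have T'0: "T' s = 0" if "R\<^sup>2 \<le> s" for s
  proof -
    have c: "times_cont_diff 0 T'" using T(1)[of "Suc 0"] times_cont_diff_real_Suc[OF T(2), of 0] by blast
    have z: "T' s = 0" if "R\<^sup>2 < s" for s
    proof -
      have "(T has_real_derivative 0) (at s)"
        by (rule has_real_derivative_locally_0[of "{R\<^sup>2<..}"]) (use that T0 in auto)
      then show ?thesis using T(2) DERIV_unique by blast
    qed
    have "isCont T' (R\<^sup>2)" using c by (simp add: continuous_on_eq_continuous_at)
    then have "(T' \<longlongrightarrow> T' (R\<^sup>2)) (at_right (R\<^sup>2))"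
      by (auto simp: isCont_def filterlim_at_split)
    moreover have "(T' \<longlongrightarrow> 0) (at_right (R\<^sup>2))"
      by (rule Lim_transform_eventually[OF tendsto_const]) (auto simp: eventually_at_filter z)
    ultimately have "T' (R\<^sup>2) = 0" using tendsto_unique trivial_limit_at_right_real by blast
    with z that show ?thesis by (cases "s = R\<^sup>2") auto
  qed
  have T'c: "continuous_on UNIV T'"
    using T(1)[of "Suc 0"] times_cont_diff_real_Suc[OF T(2), of 0] by simp
  then have [measurable]: "T' \<in> borel_measurable borel" by (rule borel_measurable_continuous_onI)
  have "isCont \<Phi> s" for s using \<Phi>(1) DERIV_isCont by blast
  then have [measurable]: "\<Phi> \<in> borel_measurable borel"
    by (intro borel_measurable_continuous_onI) (auto simp: continuous_on_eq_continuous_at)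
  have q: "y \<in> ball x R \<longleftrightarrow> (norm (y - x))\<^sup>2 < R\<^sup>2" for y
  proof -
    have "R\<^sup>2 \<le> (norm (y - x))\<^sup>2 \<longleftrightarrow> R \<le> norm (y - x)" using R by (intro power_mono_iff) auto
    then show ?thesis by (auto simp: dist_norm norm_minus_commute)
  qed
  have [measurable]: "(\<lambda>y. indicator (ball x R) y * u y) \<in> borel_measurable borel"
    using borel_measurable_continuous_on_indicator[of "ball x R" u]
      continuous_on_subset[OF u order_trans[OF ball_subset_cball sub]] by simp
  have 1: "(LINT y:\<omega>|lebesgue. u y * laplacian (\<lambda>y. \<Phi> ((norm (y - x))\<^sup>2)) y) =
      (LINT y|lborel. indicator (ball x R) y * u y * (4 * T' ((norm (y - x))\<^sup>2)))"
  proof -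
    have "(LINT y:\<omega>|lebesgue. u y * laplacian (\<lambda>y. \<Phi> ((norm (y - x))\<^sup>2)) y) =
      (LINT y|lebesgue. indicator (ball x R) y * u y * (4 * T' ((norm (y - x))\<^sup>2)))"
      unfolding set_lebesgue_integral_def lap
    proof (intro Bochner_Integration.integral_cong refl)
      fix y
      show "indicator \<omega> y *\<^sub>R (u y * (4 * T' ((norm (y - x))\<^sup>2))) =
          indicator (ball x R) y * u y * (4 * T' ((norm (y - x))\<^sup>2))"
        using T'0[of "(norm (y - x))\<^sup>2"] q[of y] subsetD[OF order_trans[OF ball_subset_cball sub], of y]
        by (cases "y \<in> ball x R") (simp_all add: not_less)
    qed
    then show ?thesis by (simp add: integral_completion)
  qed
  have 2: "(LINT y:\<omega>|lebesgue. F y * \<Phi> ((norm (y - x))\<^sup>2)) =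
      (LINT y|lborel. indicator (ball x R) y * (F y * \<Phi> ((norm (y - x))\<^sup>2)))"
  proof -
    have "(LINT y:\<omega>|lebesgue. F y * \<Phi> ((norm (y - x))\<^sup>2)) =
      (LINT y|lebesgue. indicator (ball x R) y * (F y * \<Phi> ((norm (y - x))\<^sup>2)))"
      unfolding set_lebesgue_integral_def
    proof (intro Bochner_Integration.integral_cong refl)
      fix y
      show "indicator \<omega> y *\<^sub>R (F y * \<Phi> ((norm (y - x))\<^sup>2)) =
          indicator (ball x R) y * (F y * \<Phi> ((norm (y - x))\<^sup>2))"
        using \<Phi>(2)[of "(norm (y - x))\<^sup>2"] q[of y] subsetD[OF order_trans[OF ball_subset_cball sub], of y]
        by (cases "y \<in> ball x R") (simp_all add: not_less)
    qed
    then show ?thesis using F by (simp add: integral_completion)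
  qed
  have 3: "(LINT y|lborel. indicator (ball x R) y * u y * (4 * T' ((norm (y - x))\<^sup>2))) =
      - (LINT y|lborel. indicator (ball x R) y * (F y * \<Phi> ((norm (y - x))\<^sup>2)))"
  proof -
    have "- (LINT y:\<omega>|lebesgue. u y * laplacian (\<lambda>y. \<Phi> ((norm (y - x))\<^sup>2)) y) =
        (LINT y:\<omega>|lebesgue. F y * \<Phi> ((norm (y - x))\<^sup>2))"
      using eq test unfolding neg_laplace_eq_def by blast
    then show ?thesis unfolding 1 2 by simp
  qed
  have I: "integrable lborel (\<lambda>y::real^2. T' ((norm (y - x))\<^sup>2))"
    and Z: "(LINT y|lborel. T' ((norm ((y::real^2) - x))\<^sup>2)) = 0"
    using integral_radial_derivative[OF T(2) T'c, where b = "R\<^sup>2" and x = x] T'0 T0(1) T0(2)[of 0] T0(3)[of "R\<^sup>2"] by auto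
  have J: "integrable lborel (\<lambda>y. indicator (ball x R) y * u y * (4 * T' ((norm (y - x))\<^sup>2)))"
  proof -
    have "compact (u ` cball x R)"
      using continuous_on_subset[OF u sub] by (rule compact_continuous_image) auto
    then obtain B where "\<forall>z\<in>u ` cball x R. norm z \<le> B"
      by (meson compact_imp_bounded bounded_iff)
    then have B: "\<And>y. y \<in> cball x R \<Longrightarrow> \<bar>u y\<bar> \<le> B" by simp
    show ?thesis
    proof (rule Bochner_Integration.integrable_bound)
      show "integrable lborel (\<lambda>y. (4 * B) * T' ((norm (y - x))\<^sup>2))" using I by simp
      have "B \<ge> 0" using B[of x] R by auto
      show "AE y in lborel. norm (indicator (ball x R) y * u y * (4 * T' ((norm (y - x))\<^sup>2)))
          \<le> norm ((4 * B) * T' ((norm (y - x))\<^sup>2))"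
      proof (intro AE_I2)
        fix y
        show "norm (indicator (ball x R) y * u y * (4 * T' ((norm (y - x))\<^sup>2)))
          \<le> norm ((4 * B) * T' ((norm (y - x))\<^sup>2))"
          using mult_right_mono[OF B[of y], of "\<bar>T' ((norm (y - x))\<^sup>2)\<bar>"] \<open>B \<ge> 0\<close>
          by (cases "y \<in> ball x R") (simp_all add: abs_mult)
      qed
    qed measurable
  qed
  have "(indicator (ball x R) y * (u y - u x)) * (4 * T' ((norm (y - x))\<^sup>2)) =
      indicator (ball x R) y * u y * (4 * T' ((norm (y - x))\<^sup>2)) - (4 * u x) * T' ((norm (y - x))\<^sup>2)" for y
    using T'0[of "(norm (y - x))\<^sup>2"] q[of y] by (auto simp: indicator_def algebra_simps)
  then have "(LINT y|lborel. (indicator (ball x R) y * (u y - u x)) * (4 * T' ((norm (y - x))\<^sup>2))) =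
      - (LINT y|lborel. indicator (ball x R) y * (F y * \<Phi> ((norm (y - x))\<^sup>2)))"
    using I J Z 3 by simp
  with \<Phi>(1,2) show ?thesis by (rule that)
qed

text \<open>Formally one tests with \<open>ln (r / s) - 1 + s / r\<close> for
  \<open>r = R\<^sup>2\<close>, that is with \<open>T s = - 1 + s / r\<close>, whose derivative is
  the constant \<open>1 / r\<close> and yields the mean. This \<open>T\<close> does not vanish near
  0 and has a corner at \<open>r\<close> when extended by zero, so it is cut off at both ends and
  the cutoffs are removed in the limit.\<close>

theorem green_formula:
  fixes x :: "real^2" and u F :: "real^2 \<Rightarrow> real"
  assumes R: "0 < R" and sub: "cball x R \<subseteq> \<omega>" and eq: "neg_laplace_eq \<omega> u F"
    and u: "continuous_on \<omega> u" and F[measurable]: "F \<in> borel_measurable borel"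
    and M: "\<And>y. y \<in> cball x R \<Longrightarrow> \<bar>F y\<bar> \<le> M"
  shows "u x = (LINT y:ball x R|lborel. u y) / (pi * R\<^sup>2) + (LINT y|lborel. green_kernel R (x - y) * F y)"
proof -
  obtain \<psi> \<psi>' :: "real \<Rightarrow> real" where \<psi>: "\<And>n. times_cont_diff n \<psi>" "\<And>t. (\<psi> has_real_derivative \<psi>' t) (at t)"
    "\<And>t. t \<le> 0 \<Longrightarrow> \<psi> t = 0" "\<And>t. 1 \<le> t \<Longrightarrow> \<psi> t = 1" "\<And>t. 0 \<le> \<psi> t" "\<And>t. \<psi> t \<le> 1"
    "\<And>t. 0 \<le> \<psi>' t" "\<And>t. t \<notin> {0<..<1} \<Longrightarrow> \<psi>' t = 0" "continuous_on UNIV \<psi>'"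
    by (rule smooth_step_exists, rule that)
  have [measurable]: "\<psi> \<in> borel_measurable borel" "\<psi>' \<in> borel_measurable borel"
    using \<psi>(1)[of 0] \<psi>(9) by (auto intro: borel_measurable_continuous_onI)
  obtain M' where M': "\<And>t. \<psi>' t \<le> M'"
  proof -
    have "compact (\<psi>' ` {0..1})"
      using continuous_on_subset[OF \<psi>(9)] by (rule compact_continuous_image) auto
    then obtain B where B: "\<forall>z\<in>\<psi>' ` {0..1}. norm z \<le> B" by (meson compact_imp_bounded bounded_iff)
    have "\<psi>' t \<le> max B 0" for t
      using B[rule_format, OF imageI, of t] \<psi>(8)[of t] by (cases "t \<in> {0<..<1}") auto
    then show ?thesis by (rule that)
  qed
  define r where "r = R\<^sup>2"
  have r: "0 < r" using R by (simp add: r_def)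
  define N where "N = (\<lambda>n. real n + 1)"
  have N: "0 < N n" for n by (simp add: N_def)
  have Nlim: "eventually (\<lambda>n. c \<le> N n) sequentially" for c
    unfolding N_def by real_asymp
  \<comment> \<open>The inner cutoff rises for \<open>s\<close> between \<open>1 / N n\<close> and
    \<open>2 / N n\<close>, the outer one falls between \<open>r - 1 / N n\<close> and
    \<open>r\<close>. \<open>A\<close>, \<open>B\<close> and \<open>C\<close> are the terms of the
    product rule: interior, inner cutoff, outer cutoff.\<close>
  define T where "T = (\<lambda>n s. (- 1 + (1 / r) * s) * (\<psi> (- 1 + N n * s) * \<psi> (N n * r + (- N n) * s)))"
  define A where "A = (\<lambda>n s. (1 / r) * (\<psi> (- 1 + N n * s) * \<psi> (N n * r + (- N n) * s)))"
  define B where "B = (\<lambda>n s. (- 1 + (1 / r) * s) * (N n * \<psi>' (- 1 + N n * s) * \<psi> (N n * r + (- N n) * s)))"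
  define C where "C = (\<lambda>n s. (- 1 + (1 / r) * s) * (\<psi> (- 1 + N n * s) * (- N n * \<psi>' (N n * r + (- N n) * s))))"
  have [measurable]: "A n \<in> borel_measurable borel" "B n \<in> borel_measurable borel" "C n \<in> borel_measurable borel" for n
    unfolding A_def B_def C_def by measurable
  have T_smooth: "times_cont_diff m (T n)" for m n
    unfolding T_def
    by (intro times_cont_diff_mult times_cont_diff_scale \<psi>(1)
        times_cont_diff_scale[of "\<lambda>x. x" m "- 1" "1 / r", simplified])
       (use times_cont_diff_affine[of _ 0 0 "1::real"] in simp)
  have T_deriv: "(T n has_real_derivative A n s + B n s + C n s) (at s)" for n s
    unfolding T_def A_def B_def C_def
    by (rule derivative_eq_intros DERIV_chain2[OF \<psi>(2)] refl | simp add: algebra_simps)+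
  have T0: "s \<le> 1 / N n \<Longrightarrow> T n s = 0" "r \<le> s \<Longrightarrow> T n s = 0" for n s
    using N[of n] \<psi>(3)[of "- 1 + N n * s"] \<psi>(3)[of "N n * r + (- N n) * s"]
    by (simp_all add: T_def field_simps)
  define q where "q = (\<lambda>y. (norm (y - x))\<^sup>2)"
  have [measurable]: "q \<in> borel_measurable borel" unfolding q_def by measurable
  define W where "W = (\<lambda>y. indicator (ball x R) y * (u y - u x))"
  have "\<exists>\<Phi>. (\<forall>s. (\<Phi> has_real_derivative T n s / s) (at s)) \<and> (\<forall>s\<ge>r. \<Phi> s = 0) \<and>
      (LINT y|lborel. W y * (4 * (A n (q y) + B n (q y) + C n (q y)))) =
      - (LINT y|lborel. indicator (ball x R) y * (F y * \<Phi> (q y)))" for n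
  proof -
    obtain \<Phi> where "\<And>s. (\<Phi> has_real_derivative T n s / s) (at s)" "\<And>s. R\<^sup>2 \<le> s \<Longrightarrow> \<Phi> s = 0"
      "(LINT y|lborel. (indicator (ball x R) y * (u y - u x)) *
          (4 * (A n ((norm (y - x))\<^sup>2) + B n ((norm (y - x))\<^sup>2) + C n ((norm (y - x))\<^sup>2)))) =
        - (LINT y|lborel. indicator (ball x R) y * (F y * \<Phi> ((norm (y - x))\<^sup>2)))"
      by (rule green_formula_smooth[OF T_smooth[of _ n] T_deriv[of n] _ T0(1) T0(2)[unfolded r_def] R sub eq u F])
         (use N[of n] in auto)
    then show ?thesis unfolding W_def q_def r_def by blast
  qed
  then obtain \<Phi> where \<Phi>: "\<And>n s. (\<Phi> n has_real_derivative T n s / s) (at s)" "\<And>n s. r \<le> s \<Longrightarrow> \<Phi> n s = 0"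
    and main: "\<And>n. (LINT y|lborel. W y * (4 * (A n (q y) + B n (q y) + C n (q y)))) =
      - (LINT y|lborel. indicator (ball x R) y * (F y * \<Phi> n (q y)))"
    by metis
  have qr: "y \<in> ball x R \<longleftrightarrow> q y < r" for y
  proof -
    have "R\<^sup>2 \<le> (norm (y - x))\<^sup>2 \<longleftrightarrow> R \<le> norm (y - x)" using R by (intro power_mono_iff) auto
    then show ?thesis by (auto simp: dist_norm norm_minus_commute q_def r_def)
  qed
  have q0: "0 \<le> q y" "q y = 0 \<longleftrightarrow> y = x" for y by (auto simp: q_def)

  have "compact (u ` cball x R)"
    using continuous_on_subset[OF u sub] by (rule compact_continuous_image) auto
  then obtain B0 where "\<forall>z\<in>u ` cball x R. norm z \<le> B0" by (meson compact_imp_bounded bounded_iff)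
  then have B0: "\<And>y. y \<in> cball x R \<Longrightarrow> \<bar>u y\<bar> \<le> B0" by simp
  have "0 \<le> B0" using B0[of x] R by simp
  have um[measurable]: "(\<lambda>y. indicator (ball x R) y * u y) \<in> borel_measurable borel"
    using borel_measurable_continuous_on_indicator[of "ball x R" u]
      continuous_on_subset[OF u order_trans[OF ball_subset_cball sub]] by simp
  have W_eq: "W y = indicator (ball x R) y * u y - indicator (ball x R) y * u x" for y
    by (simp add: W_def algebra_simps)
  have [measurable]: "W \<in> borel_measurable borel" unfolding W_eq[abs_def] by measurable
  have ind_int: "integrable lborel (indicator (ball x R) :: real^2 \<Rightarrow> real)"
    using emeasure_ball_real2[of R x] R by (intro integrable_real_indicator) auto
  have u_int: "integrable lborel (\<lambda>y. indicator (ball x R) y * u y)"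
    by (rule Bochner_Integration.integrable_bound[OF integrable_mult_right[OF ind_int, of B0]])
       (use B0 \<open>0 \<le> B0\<close> um in \<open>simp_all add: indicator_def\<close>)
  have W_int: "integrable lborel W"
    unfolding W_eq[abs_def] using u_int ind_int by auto
  have W_val: "(LINT y|lborel. W y) = (LINT y:ball x R|lborel. u y) - pi * r * u x"
    unfolding W_eq[abs_def] using u_int ind_int R
    by (simp add: set_lebesgue_integral_def lebesgue_ball_real2 r_def)

  have Ab: "norm (W y * A n (q y)) \<le> \<bar>W y\<bar> * (1 / r)" for n y
  proof -
      have "\<psi> (- 1 + N n * q y) * \<psi> (N n * r + - N n * q y) \<le> 1"
        using \<psi>(5,6) by (intro mult_le_one) auto
      then have "\<bar>A n (q y)\<bar> \<le> 1 / r"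
        using \<psi>(5) r by (simp add: A_def abs_mult divide_right_mono)
      then show "norm (W y * A n (q y)) \<le> \<bar>W y\<bar> * (1 / r)"
        by (simp add: abs_mult mult_left_mono del: times_divide_eq_right)
  qed
  have limA: "(\<lambda>n. LINT y|lborel. W y * A n (q y)) \<longlonglongrightarrow> (LINT y|lborel. W y * (1 / r))"
  proof (rule integral_dominated_convergence[where w = "\<lambda>y. \<bar>W y\<bar> * (1 / r)"])
    show "AE y in lborel. (\<lambda>n. W y * A n (q y)) \<longlonglongrightarrow> W y * (1 / r)"
      using AE_lborel_singleton[of x]
    proof eventually_elim
      case (elim y)
      show ?case
      proof (cases "y \<in> ball x R")
        case True
        have "0 < q y" "q y < r" using elim True qr q0[of y] by auto
        have "eventually (\<lambda>n. 2 / q y \<le> N n \<and> 1 / (r - q y) \<le> N n) sequentially"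
          using Nlim by (intro eventually_conj)
        then have "eventually (\<lambda>n. W y * A n (q y) = W y * (1 / r)) sequentially"
        proof eventually_elim
          case (elim n)
          then have "2 \<le> N n * q y" "1 \<le> N n * (r - q y)"
            using \<open>0 < q y\<close> \<open>q y < r\<close> by (auto simp: field_simps)
          then have "\<psi> (- 1 + N n * q y) = 1" "\<psi> (N n * r + - N n * q y) = 1"
            by (auto intro!: \<psi>(4) simp: algebra_simps)
          then show ?case by (simp add: A_def)
        qed
        then show ?thesis by (rule tendsto_eventually)
      qed (simp add: W_def)
    qed
    show "AE y in lborel. norm (W y * A n (q y)) \<le> \<bar>W y\<bar> * (1 / r)" for n
      using Ab by simp
  qed (use W_int in auto)

  \<comment> \<open>The derivative of the outer cutoff has size \<open>N n\<close>, but on its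
    support the linear factor is at most \<open>1 / (N n * r)\<close>, so the product stays
    bounded.\<close>
  have Cb: "norm (W y * C n (q y)) \<le> \<bar>W y\<bar> * (M' / r)" for n y
  proof -
      have "\<bar>C n (q y)\<bar> \<le> M' / r"
      proof (cases "N n * (r - q y) \<in> {0<..<1}")
        case True
        have "\<bar>- 1 + 1 / r * q y\<bar> = (r - q y) / r"
          using True N[of n] r by (auto simp: zero_less_mult_iff field_simps abs_if)
        then have "\<bar>C n (q y)\<bar> = ((r - q y) * N n / r) * (\<psi> (- 1 + N n * q y) * \<psi>' (N n * r + - N n * q y))"
          unfolding C_def abs_mult using N[of n] \<psi>(5,7) by simp
        also have "\<dots> \<le> (1 / r) * (1 * M')"
          using True N[of n] r \<psi>(5,6,7) M'
          by (intro mult_mono divide_right_mono) (auto simp: zero_less_mult_iff mult.commute)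
        finally show ?thesis by simp
      next
        case False
        then have "\<psi>' (N n * r + - N n * q y) = 0" by (intro \<psi>(8)) (auto simp: algebra_simps)
        moreover have "0 \<le> M'" using \<psi>(7) M' order_trans by blast
        ultimately show ?thesis using r by (simp add: C_def)
      qed
      then show "norm (W y * C n (q y)) \<le> \<bar>W y\<bar> * (M' / r)"
        by (simp add: abs_mult mult_left_mono del: times_divide_eq_right)
  qed
  have limC: "(\<lambda>n. LINT y|lborel. W y * C n (q y)) \<longlonglongrightarrow> (LINT y::real^2|lborel. 0)"
  proof (rule integral_dominated_convergence[where w = "\<lambda>y. \<bar>W y\<bar> * (M' / r)"])
    show "AE y in lborel. (\<lambda>n. W y * C n (q y)) \<longlonglongrightarrow> 0"
    proof (rule AE_I2)
      fix y
      show "(\<lambda>n. W y * C n (q y)) \<longlonglongrightarrow> 0"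
      proof (cases "y \<in> ball x R")
        case True
        then have "q y < r" using qr by auto
        have "eventually (\<lambda>n. W y * C n (q y) = 0) sequentially"
          using Nlim[of "1 / (r - q y)"]
        proof eventually_elim
          case (elim n)
          then have "1 \<le> N n * (r - q y)"
            using \<open>q y < r\<close> by (auto simp: field_simps)
          then have "\<psi>' (N n * r + - N n * q y) = 0"
            by (intro \<psi>(8)) (auto simp: algebra_simps)
          then show ?case by (simp add: C_def)
        qed
        then show ?thesis by (rule tendsto_eventually)
      qed (simp add: W_def)
    qed
    show "AE y in lborel. norm (W y * C n (q y)) \<le> \<bar>W y\<bar> * (M' / r)" for n
      using Cb by simp
  qed (use W_int in auto)

  \<comment> \<open>An approximate Dirac mass at \<open>x\<close>, of total mass \<open>pi\<close>
    in the plane for every \<open>n\<close>; it controls the term \<open>B n\<close>.\<close>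
  define D where "D = (\<lambda>n s. N n * \<psi>' (- 1 + N n * s))"
  have D_int: "integrable lborel (\<lambda>y. D n (q y))" and D_val: "(LINT y|lborel. D n (q y)) = pi" for n
  proof -
    have d: "((\<lambda>s. \<psi> (- 1 + N n * s)) has_real_derivative D n s) (at s)" for s
    proof -
      have "((\<lambda>s. - 1 + N n * s) has_real_derivative N n) (at s)"
        by (auto intro!: derivative_eq_intros)
      from DERIV_chain2[OF \<psi>(2) this] show ?thesis by (simp add: D_def mult.commute)
    qed
    have c: "continuous_on UNIV (D n)"
      unfolding D_def by (intro continuous_intros continuous_on_compose2[OF \<psi>(9)]) auto
    have z: "D n s = 0" if "2 / N n < s" for s
      using that N[of n] \<psi>(8)[of "- 1 + N n * s"] by (auto simp: D_def field_simps)
    have "0 \<le> 2 / N n" using N[of n] by simp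
    note I = integral_radial_derivative[OF d c this z, of x]
    show "integrable lborel (\<lambda>y. D n (q y))" using I(1) by (simp add: q_def)
    have "\<psi> (- 1 + N n * (2 / N n)) = 1" using N[of n] by (intro \<psi>(4)) simp
    then show "(LINT y|lborel. D n (q y)) = pi" using I(2) by (simp add: q_def \<psi>(3))
  qed
  have D0: "0 \<le> D n s" for n s using \<psi>(7) N[of n] by (simp add: D_def)
  have Bb: "\<bar>B n (q y)\<bar> \<le> D n (q y)" if "q y < r" for n y
  proof -
    have "\<bar>- 1 + (1 / r) * q y\<bar> \<le> 1" using that q0(1)[of y] r by (auto simp: abs_le_iff field_simps)
    then have "\<bar>- 1 + (1 / r) * q y\<bar> * (N n * \<psi>' (- 1 + N n * q y) * \<psi> (N n * r + - N n * q y))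
       \<le> 1 * (N n * \<psi>' (- 1 + N n * q y) * 1)"
      using \<psi>(5,6,7) N[of n] by (intro mult_mono mult_nonneg_nonneg) (auto intro: less_imp_le)
    then show ?thesis using \<psi>(5,7) N[of n] by (simp add: B_def D_def abs_mult)
  qed
  have WBb: "norm (W y * B n (q y)) \<le> 2 * B0 * D n (q y)" for n y
  proof (cases "y \<in> ball x R")
    case True
    have "\<bar>W y\<bar> \<le> 2 * B0" using B0[of y] B0[of x] True R by (auto simp: W_def)
    then show ?thesis unfolding real_norm_def abs_mult using Bb True qr D0 \<open>0 \<le> B0\<close> by (intro mult_mono) auto
  qed (use D0 \<open>0 \<le> B0\<close> in \<open>simp add: W_def\<close>)
  \<comment> \<open>Here continuity of \<open>u\<close> at \<open>x\<close> replaces domination: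
    \<open>W\<close> is small where \<open>D n\<close> concentrates. The fraction
    \<open>e / 4\<close> suffices because \<open>pi < 4\<close>.\<close>
  have limB: "(\<lambda>n. LINT y|lborel. W y * B n (q y)) \<longlonglongrightarrow> 0"
  proof (rule tendstoI)
    fix e :: real assume "0 < e"
    then have "0 < e / 4" by simp
    have "continuous_on (cball x R) u" using continuous_on_subset[OF u sub] .
    then obtain d where d: "0 < d" "\<And>y. y \<in> cball x R \<Longrightarrow> dist y x < d \<Longrightarrow> dist (u y) (u x) < e / 4"
      unfolding continuous_on_iff using \<open>0 < e / 4\<close> R by (metis centre_in_cball less_eq_real_def)
    have "eventually (\<lambda>n. 3 / d\<^sup>2 \<le> N n) sequentially" by (rule Nlim)
    then show "eventually (\<lambda>n. dist (LINT y|lborel. W y * B n (q y)) 0 < e) sequentially"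
    proof eventually_elim
      case (elim n)
      have b: "norm (W y * B n (q y)) \<le> (e / 4) * D n (q y)" for y
      proof (cases "y \<in> ball x R \<and> - 1 + N n * q y \<in> {0<..<1}")
        case True
        then have y: "q y < r" "N n * q y < 2" "y \<in> cball x R" using qr[of y] by auto
        have "3 \<le> N n * d\<^sup>2" using elim d(1) by (simp add: field_simps)
        with y(2) have "N n * q y < N n * d\<^sup>2" by linarith
        then have "(norm (y - x))\<^sup>2 < d\<^sup>2" using N[of n] by (simp add: q_def)
        then have "dist y x < d" using d(1) by (metis dist_norm less_imp_le power2_less_imp_less)
        then have "\<bar>W y\<bar> \<le> e / 4" using d(2)[OF y(3)] True by (simp add: W_def dist_real_def)
        moreover have "\<bar>B n (q y)\<bar> \<le> D n (q y)" using Bb y(1) by simp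
        ultimately show ?thesis unfolding real_norm_def abs_mult using \<open>0 < e\<close> by (intro mult_mono) auto
      next
        case False
        then have "W y * B n (q y) = 0" using \<psi>(8)[of "- 1 + N n * q y"] by (auto simp: W_def B_def)
        moreover have "0 \<le> D n (q y)" using \<psi>(7) N[of n] by (simp add: D_def)
        ultimately show ?thesis using \<open>0 < e\<close> by (simp only: norm_zero) simp
      qed
      have "norm (LINT y|lborel. W y * B n (q y)) \<le> (LINT y|lborel. (e / 4) * D n (q y))"
        by (rule Bochner_Integration.integral_norm_bound_integral)
           (use D_int b in \<open>auto intro!: Bochner_Integration.integrable_bound[OF integrable_mult_right[OF D_int, of "e / 4" n]] AE_I2 order_trans[OF b]\<close>)
      also have "\<dots> = (e / 4) * pi" using D_val by simp
      also have "\<dots> < e" using \<open>0 < e\<close> pi_less_4 by (simp add: field_simps)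
      finally show ?case by simp
    qed
  qed

  have WA: "integrable lborel (\<lambda>y. W y * A n (q y))" "integrable lborel (\<lambda>y. W y * B n (q y))"
    "integrable lborel (\<lambda>y. W y * C n (q y))" for n
  proof -
    show "integrable lborel (\<lambda>y. W y * A n (q y))"
      by (rule Bochner_Integration.integrable_bound[of lborel "\<lambda>y. \<bar>W y\<bar> * (1 / r)"])
         (use W_int in simp, measurable, intro AE_I2 order_trans[OF Ab], simp only: real_norm_def abs_ge_self)
    show "integrable lborel (\<lambda>y. W y * C n (q y))"
      by (rule Bochner_Integration.integrable_bound[of lborel "\<lambda>y. \<bar>W y\<bar> * (M' / r)"])
         (use W_int in simp, measurable, intro AE_I2 order_trans[OF Cb], simp only: real_norm_def abs_ge_self)
    show "integrable lborel (\<lambda>y. W y * B n (q y))"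
      by (rule Bochner_Integration.integrable_bound[of lborel "\<lambda>y. 2 * B0 * D n (q y)"])
         (use D_int in simp, measurable, intro AE_I2 order_trans[OF WBb], simp)
  qed
  have lim1: "(\<lambda>n. LINT y|lborel. W y * (4 * (A n (q y) + B n (q y) + C n (q y))))
      \<longlonglongrightarrow> 4 * (LINT y|lborel. W y * (1 / r))"
  proof -
    have "(LINT y|lborel. W y * (4 * (A n (q y) + B n (q y) + C n (q y)))) =
        4 * ((LINT y|lborel. W y * A n (q y)) + (LINT y|lborel. W y * B n (q y)) + (LINT y|lborel. W y * C n (q y)))" for n
    proof -
      have "W y * (4 * (A n (q y) + B n (q y) + C n (q y))) =
          4 * (W y * A n (q y) + W y * B n (q y) + W y * C n (q y))" for y
        by (simp add: algebra_simps)
      then show ?thesis using WA[of n] by simp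
    qed
    moreover have "(\<lambda>n. 4 * ((LINT y|lborel. W y * A n (q y)) + (LINT y|lborel. W y * B n (q y)) + (LINT y|lborel. W y * C n (q y))))
      \<longlonglongrightarrow> 4 * ((LINT y|lborel. W y * (1 / r)) + 0 + (LINT y::real^2|lborel. 0))"
      by (intro tendsto_intros limA limB limC)
    ultimately show ?thesis by simp
  qed

  \<comment> \<open>The limit of \<open>\<Phi> n\<close>: it has derivative
    \<open>(- 1 + s / r) / s\<close>, vanishes at \<open>r\<close>, and is \<open>4 * pi\<close>
    times the Green kernel.\<close>
  define L where "L = (\<lambda>s. ln (r / s) - 1 + s / r)"
  have L_deriv: "(L has_real_derivative (- 1 + (1 / r) * s) / s) (at s)" if "0 < s" for s
    unfolding L_def using that r
    by (auto intro!: derivative_eq_intros simp: field_simps)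
  have Lr: "L r = 0" using r by (simp add: L_def)
  define E where "E = (\<lambda>n s. L s - \<Phi> n s)"
  have E_deriv: "(E n has_real_derivative (- 1 + (1 / r) * s) / s * (1 - \<psi> (- 1 + N n * s) * \<psi> (N n * r + - N n * s))) (at s)"
    if "0 < s" for n s
    unfolding E_def
    by (rule DERIV_cong[OF DERIV_diff[OF L_deriv[OF that] \<Phi>(1)[of n s]]])
       (simp add: T_def diff_divide_distrib[symmetric] right_diff_distrib)
  have pp: "0 \<le> \<psi> a * \<psi> b" "\<psi> a * \<psi> b \<le> 1" for a b
    using \<psi>(5,6) by (auto intro: mult_le_one)
  \<comment> \<open>The error decreases and is zero at \<open>r\<close>, hence
    \<open>\<Phi> n\<close> lies below \<open>L\<close>. Together with its nonnegativity this makes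
    the Green kernel an integrable majorant.\<close>
  have E_mono: "E n t \<le> E n s" if "0 < s" "s \<le> t" "t \<le> r" for n s t
  proof (rule DERIV_nonpos_imp_nonincreasing[OF that(2)])
    fix v assume v: "s \<le> v" "v \<le> t"
    then have "(- 1 + (1 / r) * v) / v \<le> 0" using that r by (auto simp: field_simps)
    then have "(- 1 + (1 / r) * v) / v * (1 - \<psi> (- 1 + N n * v) * \<psi> (N n * r + - N n * v)) \<le> 0"
      using pp by (intro mult_nonpos_nonneg) auto
    then show "\<exists>y. (E n has_real_derivative y) (at v) \<and> y \<le> 0"
      using E_deriv[of v n] v that by auto
  qed
  have E0: "0 \<le> E n s" if "0 < s" "s \<le> r" for n s
    using E_mono[of s r n] that \<Phi>(2)[of r n] Lr by (simp add: E_def)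
  have \<Phi>0: "0 \<le> \<Phi> n s" if "0 < s" "s \<le> r" for n s
  proof -
    have "\<Phi> n r \<le> \<Phi> n s"
    proof (rule DERIV_nonpos_imp_nonincreasing[OF that(2)])
      fix v assume v: "s \<le> v" "v \<le> r"
      then have "(- 1 + (1 / r) * v) / v \<le> 0" using that r by (auto simp: field_simps)
      then have "T n v / v \<le> 0"
        using pp mult_nonpos_nonneg[of "(- 1 + (1 / r) * v) / v" "\<psi> (- 1 + N n * v) * \<psi> (N n * r + - N n * v)"]
        by (simp add: T_def)
      then show "\<exists>y. (\<Phi> n has_real_derivative y) (at v) \<and> y \<le> 0" using \<Phi>(1) by blast
    qed
    then show ?thesis using \<Phi>(2)[of r n] by simp
  qed
  have \<Phi>_lim: "(\<lambda>n. \<Phi> n s) \<longlonglongrightarrow> L s" if s: "0 < s" "s < r" for s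
  proof -
    have lim0: "(\<lambda>n. L (r - 1 / N n)) \<longlonglongrightarrow> 0"
    proof -
      have "isCont L r" using L_deriv[OF r] DERIV_isCont by blast
      moreover have "(\<lambda>n. r - 1 / N n) \<longlonglongrightarrow> r" unfolding N_def by real_asymp
      ultimately show ?thesis using isCont_tendsto_compose Lr by fastforce
    qed
    have "eventually (\<lambda>n. 2 / s \<le> N n \<and> 1 / (r - s) \<le> N n) sequentially"
      using Nlim by (intro eventually_conj)
    then have ev: "eventually (\<lambda>n. E n s \<le> L (r - 1 / N n)) sequentially"
    proof eventually_elim
      case (elim n)
      then have n: "2 \<le> N n * s" "1 \<le> N n * (r - s)"
        using s by (auto simp: field_simps)
      define t where "t = r - 1 / N n"
      have t: "s \<le> t" "t < r" using n N[of n] by (auto simp: t_def field_simps)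
      \<comment> \<open>Between \<open>s\<close> and \<open>t = r - 1 / N n\<close> both cutoffs are
        1, so \<open>E n\<close> does not change there, and only its value near \<open>r\<close>,
        where \<open>L\<close> is small, remains.\<close>
      have "E n s \<le> E n t"
      proof (rule DERIV_nonneg_imp_nondecreasing[OF t(1)])
        fix v assume v: "s \<le> v" "v \<le> t"
        have "N n * s \<le> N n * v" "N n * v \<le> N n * t"
          using v N[of n] by (auto intro!: mult_left_mono)
        moreover have "N n * t = N n * r - 1" using N[of n] by (simp add: t_def field_simps)
        ultimately have "\<psi> (- 1 + N n * v) = 1" "\<psi> (N n * r + - N n * v) = 1"
          using n by (auto intro!: \<psi>(4))
        then show "\<exists>y. (E n has_real_derivative y) (at v) \<and> 0 \<le> y"
          using E_deriv[of v n] v s by (auto intro!: exI[of _ 0])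
      qed
      also have "\<dots> \<le> L t" using \<Phi>0[of t n] t s by (simp add: E_def)
      finally show ?case by (simp add: t_def)
    qed
    have "(\<lambda>n. E n s) \<longlonglongrightarrow> 0"
      by (rule tendsto_sandwich[OF _ ev tendsto_const lim0]) (use E0 s in auto)
    then have "(\<lambda>n. L s - E n s) \<longlonglongrightarrow> L s - 0" by (intro tendsto_intros)
    then show ?thesis by (simp add: E_def)
  qed
  have K: "L (q y) = 4 * pi * green_kernel R (x - y)" if "y \<in> ball x R" "y \<noteq> x" for y
  proof -
    define n where "n = norm (x - y)"
    have n: "0 < n" "n < R" using that by (auto simp: dist_norm n_def)
    have "ln (r / n\<^sup>2) = 2 * ln (R / n)"
      using n R by (simp add: r_def ln_div ln_realpow)
    moreover have "q y = n\<^sup>2" by (simp add: q_def n_def norm_minus_commute)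
    ultimately show ?thesis unfolding green_kernel_def n_def[symmetric] using n
      by (simp add: L_def r_def field_simps)
  qed
  have gk0: "green_kernel R (x - y) = 0" if "y \<notin> ball x R" for y
    using that by (simp add: green_kernel_def dist_norm)
  have gki: "integrable lborel (\<lambda>y. green_kernel R (x - y))"
    using green_kernel_integrable[OF R] by (simp add: integral_lborel_shift(4))
  have "0 \<le> M" using M[of x] R by simp
  have \<Phi>m[measurable]: "\<Phi> n \<in> borel_measurable borel" for n
  proof -
    have "isCont (\<Phi> n) s" for s using \<Phi>(1) DERIV_isCont by blast
    then show ?thesis by (intro borel_measurable_continuous_onI) (auto simp: continuous_on_eq_continuous_at)
  qed
  have lim2: "(\<lambda>n. LINT y|lborel. indicator (ball x R) y * (F y * \<Phi> n (q y)))
      \<longlonglongrightarrow> (LINT y|lborel. 4 * pi * (green_kernel R (x - y) * F y))"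
  proof (rule integral_dominated_convergence[where w = "\<lambda>y. M * (4 * pi) * green_kernel R (x - y)"])
    show "AE y in lborel. (\<lambda>n. indicator (ball x R) y * (F y * \<Phi> n (q y)))
        \<longlonglongrightarrow> 4 * pi * (green_kernel R (x - y) * F y)"
      using AE_lborel_singleton[of x]
    proof eventually_elim
      case (elim y)
      show ?case
      proof (cases "y \<in> ball x R")
        case True
        have "(\<lambda>n. F y * \<Phi> n (q y)) \<longlonglongrightarrow> F y * L (q y)"
          using elim True qr[of y] q0[of y] by (intro tendsto_intros \<Phi>_lim) auto
        then show ?thesis using True elim K[of y] by (simp add: mult_ac)
      next
        case False
        then show ?thesis using gk0[of y] by simp
      qed
    qed
    show "AE y in lborel. norm (indicator (ball x R) y * (F y * \<Phi> n (q y)))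
        \<le> M * (4 * pi) * green_kernel R (x - y)" for n
      using AE_lborel_singleton[of x]
    proof eventually_elim
      case (elim y)
      show ?case
      proof (cases "y \<in> ball x R")
        case True
        then have qy: "0 < q y" "q y \<le> r" using elim qr[of y] q0[of y] by auto
        have "\<bar>F y\<bar> * \<bar>\<Phi> n (q y)\<bar> \<le> M * (4 * pi * green_kernel R (x - y))"
          using M[of y] True E0[OF qy, of n] \<Phi>0[OF qy, of n] K[of y] elim \<open>0 \<le> M\<close>
          by (intro mult_mono) (auto simp: E_def)
        then show ?thesis using True by (simp add: abs_mult mult_ac)
      next
        case False
        then show ?thesis using gk0[of y] by simp
      qed
    qed
  qed (use gki in auto)
  define k where "k = (LINT y|lborel. green_kernel R (x - y) * F y)"
  define U where "U = (LINT y:ball x R|lborel. u y)"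
  have "(\<lambda>n. LINT y|lborel. W y * (4 * (A n (q y) + B n (q y) + C n (q y)))) \<longlonglongrightarrow> - (4 * pi * k)"
    using tendsto_minus[OF lim2] unfolding main k_def integral_mult_right_zero .
  from LIMSEQ_unique[OF lim1 this] have "4 * ((U - pi * r * u x) * (1 / r)) = - (4 * pi * k)"
    unfolding integral_mult_left_zero W_val U_def .
  then have "u x = U / (pi * r) + k"
    using r by (simp add: field_simps)
  then show ?thesis unfolding r_def U_def k_def .
qed

section \<open>The nonlinearity\<close>

lemma norm_powr_ball_shift:
  assumes "0 < \<rho>" "p < 2"
  shows "integrable lborel (\<lambda>y. indicator (ball x \<rho>) y * norm (x - (y::real^2)) powr - p)"
    and "(LINT y|lborel. indicator (ball x \<rho>) y * norm (x - (y::real^2)) powr - p) = 2 * pi * \<rho> powr (2 - p) / (2 - p)"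
proof -
  have m: "(\<lambda>z::real^2. indicator (ball 0 \<rho>) z * norm z powr - p) \<in> borel_measurable borel"
    by (auto intro!: borel_measurable_times borel_measurable_indicator)
  have "indicator (ball x \<rho>) y = (indicator (ball 0 \<rho>) (x - y) :: real)" for y :: "real^2"
    by (simp add: indicator_def dist_norm norm_minus_commute)
  then show "integrable lborel (\<lambda>y. indicator (ball x \<rho>) y * norm (x - (y::real^2)) powr - p)"
    and "(LINT y|lborel. indicator (ball x \<rho>) y * norm (x - (y::real^2)) powr - p) = 2 * pi * \<rho> powr (2 - p) / (2 - p)"
    using has_bochner_integral_norm_powr_ball[OF assms] integral_lborel_shift(3,4)[OF m, of x]
    by (simp_all add: has_bochner_integral_iff)
qed

text \<open>\<open>lam\<close> is the exponent for which the equation is invariant under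
  \<open>g \<mapsto> s^2 g (x0 + s y)\<close>. \<open>Lam\<close> and \<open>c0\<close> are the
  uniform bounds for the weights and for the integral of \<open>g\<close>.\<close>

locale hartree =
  fixes \<mu> lam Lam c0 :: real
  assumes mu: "0 < \<mu>" "\<mu> < 2" and lam: "lam = (4 - \<mu>) / 4" and c0: "0 < c0" and Lam: "0 < Lam"
begin

lemma lam_bounds: "1 / 2 < lam" "lam < 1" "0 < lam" "2 - 2 * lam = \<mu> / 2" "1 - lam = \<mu> / 4"
  using mu by (auto simp: lam field_simps)

definition pot :: "(real^2 \<Rightarrow> real) \<Rightarrow> real^2 \<Rightarrow> real" where
  "pot g x = (LINT y|lborel. g y powr lam * norm (x - y) powr - \<mu>)"

definition rhs :: "(real^2 \<Rightarrow> real) \<Rightarrow> (real^2 \<Rightarrow> real) \<Rightarrow> real^2 \<Rightarrow> real" where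
  "rhs V g x = V x * (g x powr lam * pot g x)"

definition density :: "(real^2 \<Rightarrow> real) \<Rightarrow> bool" where
  "density g \<longleftrightarrow> g \<in> borel_measurable borel \<and> (\<forall>x. 0 \<le> g x) \<and> integrable lborel g \<and> (LINT x|lborel. g x) \<le> c0"

definition weight :: "(real^2 \<Rightarrow> real) \<Rightarrow> bool" where
  "weight V \<longleftrightarrow> V \<in> borel_measurable borel \<and> (\<forall>x. 0 \<le> V x \<and> V x \<le> Lam)"

text \<open>\<open>solution D V g\<close> states, in terms of \<open>g = exp u\<close>, that \<open>u\<close> solves the equation in \<open>D\<close>; the
  equation itself enters through its mean value form.\<close>

definition solution :: "(real^2) set \<Rightarrow> (real^2 \<Rightarrow> real) \<Rightarrow> (real^2 \<Rightarrow> real) \<Rightarrow> bool" where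
  "solution D V g \<longleftrightarrow> density g \<and> weight V \<and> continuous_on D g \<and> (\<forall>x\<in>D. 0 < g x) \<and>
     (\<forall>x R. 0 < R \<longrightarrow> cball x R \<subseteq> D \<longrightarrow>
        ln (g x) = (LINT y:ball x R|lborel. ln (g y)) / (pi * R\<^sup>2) + (LINT y|lborel. green_kernel R (x - y) * rhs V g y))"

lemma pot_measurable [measurable]:
  assumes [measurable]: "g \<in> borel_measurable borel"
  shows "pot g \<in> borel_measurable borel"
  unfolding pot_def[abs_def]
  by (rule lborel.borel_measurable_lebesgue_integral) measurable

lemma rhs_measurable [measurable]:
  assumes [measurable]: "g \<in> borel_measurable borel" "V \<in> borel_measurable borel"
  shows "rhs V g \<in> borel_measurable borel"
  unfolding rhs_def[abs_def] by measurable

lemma pot_nonneg: "0 \<le> pot g x"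
  unfolding pot_def by (intro Bochner_Integration.integral_nonneg) auto

lemma rhs_nonneg: "weight V \<Longrightarrow> 0 \<le> rhs V g x"
  unfolding rhs_def weight_def using pot_nonneg by auto

text \<open>Young's inequality with exponents \<open>lam\<close> and \<open>1 - lam\<close>: since
  \<open>4 * (1 - lam) = \<mu>\<close>, the kernel is \<open>norm (x - y) powr - 4\<close> to the
  power \<open>1 - lam\<close>, and the power \<open>- 4\<close> is integrable at infinity. The
  weights in \<open>\<rho>\<close> are those whose product is 1. The result uses nothing about
  \<open>g\<close> beyond its integral.\<close>

lemma pot_outside_ball:
  assumes g: "density g" and \<rho>: "0 < \<rho>"
  shows "integrable lborel (\<lambda>y. indicator (- ball x \<rho>) y * (g y powr lam * norm (x - y) powr - \<mu>))"
    and "(LINT y|lborel. indicator (- ball x \<rho>) y * (g y powr lam * norm (x - y) powr - \<mu>))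
      \<le> (c0 + pi) * \<rho> powr - (\<mu> / 2)"
proof -
  have [measurable]: "g \<in> borel_measurable borel" and g0: "\<And>y. 0 \<le> g y" and gi: "integrable lborel g"
    and gc: "(LINT y|lborel. g y) \<le> c0"
    using g by (auto simp: density_def)
  define k where "k = (\<lambda>z::real^2. indicator (- ball 0 \<rho>) z * norm z powr - 4)"
  define B where "B = (\<lambda>y. lam * \<rho> powr - (\<mu> / 2) * g y + (1 - lam) * \<rho> powr (2 * lam) * k (x - y))"
  have [measurable]: "k \<in> borel_measurable borel"
    unfolding k_def by (auto intro!: borel_measurable_times borel_measurable_indicator)
  have k: "integrable lborel k" "(LINT z|lborel. k z) = pi * \<rho> powr - 2"
    using has_bochner_integral_norm_powr_outside_ball[OF \<rho>, of 4]
    by (auto simp: k_def has_bochner_integral_iff)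
  have Bi: "integrable lborel B"
    unfolding B_def using gi k(1) by (simp add: integral_lborel_shift(4))
  have bound: "indicator (- ball x \<rho>) y * (g y powr lam * norm (x - y) powr - \<mu>) \<le> B y" for y
  proof (cases "y \<in> ball x \<rho>")
    case True
    then show ?thesis using g0 lam_bounds by (simp add: B_def k_def)
  next
    case False
    then have n: "0 < norm (x - y)" using \<rho> by (auto simp: dist_norm)
    show ?thesis
    proof (cases "g y = 0")
      case True
      then show ?thesis using lam_bounds by (simp add: B_def k_def)
    next
      case gy: False
    have "(\<rho> powr - (\<mu> / 2) * g y) powr lam * (\<rho> powr (2 * lam) * norm (x - y) powr - 4) powr (1 - lam)
      \<le> lam * (\<rho> powr - (\<mu> / 2) * g y) + (1 - lam) * (\<rho> powr (2 * lam) * norm (x - y) powr - 4)"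
      using lam_bounds g0[of y] gy n \<rho> by (intro Youngs_inequality_0) auto
    also have "(\<rho> powr - (\<mu> / 2) * g y) powr lam * (\<rho> powr (2 * lam) * norm (x - y) powr - 4) powr (1 - lam)
        = (\<rho> powr (- (\<mu> / 2) * lam) * \<rho> powr (2 * lam * (1 - lam))) * (g y powr lam * norm (x - y) powr (- 4 * (1 - lam)))"
      using g0 by (simp add: powr_mult powr_powr)
    also have "\<rho> powr (- (\<mu> / 2) * lam) * \<rho> powr (2 * lam * (1 - lam)) = 1"
    proof -
      have "- (\<mu> / 2) * lam + 2 * lam * (1 - lam) = 0" unfolding lam_bounds(5) by (simp add: field_simps)
      then show ?thesis using \<rho> by (simp only: powr_add[symmetric]) simp
    qed
    also have "- 4 * (1 - lam) = - \<mu>" using lam_bounds(5) by simp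
    finally show ?thesis using False by (simp add: B_def k_def mult_ac dist_norm indicator_def)
    qed
  qed
  show I: "integrable lborel (\<lambda>y. indicator (- ball x \<rho>) y * (g y powr lam * norm (x - y) powr - \<mu>))"
  proof (rule Bochner_Integration.integrable_bound[OF Bi])
    show "(\<lambda>y. indicator (- ball x \<rho>) y * (g y powr lam * norm (x - y) powr - \<mu>)) \<in> borel_measurable lborel"
      by (auto intro!: borel_measurable_times borel_measurable_indicator)
    show "AE y in lborel. norm (indicator (- ball x \<rho>) y * (g y powr lam * norm (x - y) powr - \<mu>)) \<le> norm (B y)"
    proof (rule AE_I2)
      fix y
      have "0 \<le> indicator (- ball x \<rho>) y * (g y powr lam * norm (x - y) powr - \<mu>)" by simp
      with bound[of y] show "norm (indicator (- ball x \<rho>) y * (g y powr lam * norm (x - y) powr - \<mu>)) \<le> norm (B y)"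
        by simp
    qed
  qed
  have "(LINT y|lborel. indicator (- ball x \<rho>) y * (g y powr lam * norm (x - y) powr - \<mu>)) \<le> (LINT y|lborel. B y)"
    by (rule integral_mono[OF I Bi bound])
  also have "\<dots> = lam * \<rho> powr - (\<mu> / 2) * (LINT y|lborel. g y) + (1 - lam) * \<rho> powr (2 * lam) * (pi * \<rho> powr - 2)"
    unfolding B_def using gi k by (simp add: integral_lborel_shift(3,4))
  also have "\<dots> \<le> 1 * \<rho> powr - (\<mu> / 2) * c0 + 1 * \<rho> powr (2 * lam) * (pi * \<rho> powr - 2)"
    using lam_bounds gc \<rho> g0 by (intro add_mono mult_mono) (auto intro!: Bochner_Integration.integral_nonneg)
  also have "\<dots> = (c0 + pi) * \<rho> powr - (\<mu> / 2)"
  proof -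
    have "\<rho> powr (2 * lam) * \<rho> powr - 2 = \<rho> powr - (\<mu> / 2)"
      using lam_bounds(4) by (simp add: powr_add[symmetric]) (simp add: lam field_simps)
    then show ?thesis by (simp add: algebra_simps)
  qed
  finally show "(LINT y|lborel. indicator (- ball x \<rho>) y * (g y powr lam * norm (x - y) powr - \<mu>))
      \<le> (c0 + pi) * \<rho> powr - (\<mu> / 2)" .
qed

lemma pot_bound:
  assumes g: "density g" and \<rho>: "0 < \<rho>" and M: "\<And>y. y \<in> ball x \<rho> \<Longrightarrow> g y \<le> M"
  shows "integrable lborel (\<lambda>y. g y powr lam * norm (x - y) powr - \<mu>)"
    and "pot g x \<le> 2 * pi / (2 - \<mu>) * M powr lam * \<rho> powr (2 - \<mu>) + (c0 + pi) * \<rho> powr - (\<mu> / 2)"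
proof -
  have [measurable]: "g \<in> borel_measurable borel" and g0: "\<And>y. 0 \<le> g y"
    using g by (auto simp: density_def)
  define h where "h = (\<lambda>y. g y powr lam * norm (x - y) powr - \<mu>)"
  have [measurable]: "h \<in> borel_measurable borel" unfolding h_def by measurable
  define k where "k = (\<lambda>y. M powr lam * (indicator (ball x \<rho>) y * norm (x - y) powr - \<mu>))"
  have k: "integrable lborel k" "(LINT y|lborel. k y) = M powr lam * (2 * pi * \<rho> powr (2 - \<mu>) / (2 - \<mu>))"
    unfolding k_def using norm_powr_ball_shift[OF \<rho> mu(2), of x] by simp_all
  have b: "indicator (ball x \<rho>) y * h y \<le> k y" for y
    using M[of y] g0[of y] lam_bounds
    by (cases "y \<in> ball x \<rho>") (auto simp: h_def k_def intro!: mult_right_mono powr_mono2)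
  have i1: "integrable lborel (\<lambda>y. indicator (ball x \<rho>) y * h y)"
  proof (rule Bochner_Integration.integrable_bound[OF k(1)])
    show "AE y in lborel. norm (indicator (ball x \<rho>) y * h y) \<le> norm (k y)"
    proof (rule AE_I2)
      fix y
      have "0 \<le> indicator (ball x \<rho>) y * h y" by (simp add: h_def)
      with b[of y] show "norm (indicator (ball x \<rho>) y * h y) \<le> norm (k y)" by simp
    qed
  qed (auto intro!: borel_measurable_times borel_measurable_indicator)
  note i2 = pot_outside_ball[OF g \<rho>, of x, folded h_def]
  have h: "h y = indicator (ball x \<rho>) y * h y + indicator (- ball x \<rho>) y * h y" for y
    by (simp add: indicator_def)
  have i2': "integrable lborel (\<lambda>y. indicator (- ball x \<rho>) y * h y)"
    using i2(1) by (simp add: h_def)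
  show "integrable lborel (\<lambda>y. g y powr lam * norm (x - y) powr - \<mu>)"
    using Bochner_Integration.integrable_add[OF i1 i2'] unfolding h[symmetric] by (simp add: h_def)
  have "pot g x = (LINT y|lborel. indicator (ball x \<rho>) y * h y) + (LINT y|lborel. indicator (- ball x \<rho>) y * h y)"
    unfolding pot_def Bochner_Integration.integral_add[OF i1 i2', symmetric] h[symmetric] by (simp add: h_def)
  also have "\<dots> \<le> (LINT y|lborel. k y) + (c0 + pi) * \<rho> powr - (\<mu> / 2)"
    using i2(2) by (intro add_mono integral_mono i1 k(1) b) (simp add: h_def)
  finally show "pot g x \<le> 2 * pi / (2 - \<mu>) * M powr lam * \<rho> powr (2 - \<mu>) + (c0 + pi) * \<rho> powr - (\<mu> / 2)"
    unfolding k(2) by (simp add: mult_ac)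
qed

definition rhs_const :: "real \<Rightarrow> real" where
  "rhs_const Q = Lam * (c0 + pi + 2 * pi / (2 - \<mu>) * Q powr lam)"

lemma rhs_const_pos: "0 < rhs_const Q"
  unfolding rhs_const_def using Lam c0 mu by (intro mult_pos_pos add_pos_nonneg) (auto simp: pi_gt_zero)

text \<open>A scale-invariant estimate: \<open>\<rho>\<^sup>2\<close> times the right-hand side is
  controlled by \<open>\<rho>\<^sup>2 * g\<close>. The factor with \<open>g x\<close> is kept
  instead of being absorbed into \<open>Q\<close>, because smallness of \<open>g x\<close> is what
  yields decay later.\<close>

lemma rhs_bound:
  assumes g: "density g" and V: "weight V" and \<rho>: "0 < \<rho>"
    and M: "\<And>y. y \<in> ball x \<rho> \<Longrightarrow> g y \<le> Q / \<rho>\<^sup>2"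
  shows "rhs V g x \<le> rhs_const Q * (g x * \<rho>\<^sup>2) powr lam / \<rho>\<^sup>2"
proof -
  have g0: "0 \<le> g x" using g by (simp add: density_def)
  have "0 \<le> Q" using order_trans[OF g0 M[of x]] \<rho> by (simp add: zero_le_divide_iff)
  have e: "\<rho>\<^sup>2 powr lam = \<rho> powr (2 * lam)" using \<rho> by (simp add: powr_powr flip: powr_numeral)
  have "2 - \<mu> = 2 * lam + - (\<mu> / 2)" by (simp add: lam field_simps)
  then have "(Q / \<rho>\<^sup>2) powr lam * \<rho> powr (2 - \<mu>) = Q powr lam * \<rho> powr - (\<mu> / 2)"
    using \<rho> \<open>0 \<le> Q\<close> by (simp add: powr_divide e powr_diff powr_minus_divide)
  then have "pot g x \<le> (c0 + pi + 2 * pi / (2 - \<mu>) * Q powr lam) * \<rho> powr - (\<mu> / 2)"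
    using pot_bound(2)[OF g \<rho> M] by (simp add: algebra_simps)
  then have "rhs V g x \<le> Lam * (g x powr lam * ((c0 + pi + 2 * pi / (2 - \<mu>) * Q powr lam) * \<rho> powr - (\<mu> / 2)))"
    unfolding rhs_def using V pot_nonneg Lam by (intro mult_mono mult_left_mono) (auto simp: weight_def)
  also have "\<dots> = rhs_const Q * (g x powr lam * \<rho> powr - (\<mu> / 2))"
    by (simp add: rhs_const_def mult_ac)
  also have "g x powr lam * \<rho> powr - (\<mu> / 2) = (g x * \<rho>\<^sup>2) powr lam / \<rho>\<^sup>2"
  proof -
    have "\<rho> powr (2 * lam) / \<rho>\<^sup>2 = \<rho> powr - (\<mu> / 2)"
      using \<rho> by (simp add: powr_diff[symmetric] lam flip: powr_numeral) (simp add: field_simps)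
    then show ?thesis using g0 \<rho> by (simp only: powr_mult e times_divide_eq_right[symmetric])
  qed
  finally show ?thesis by simp
qed

end

lemma green_kernel_mult_integrable:
  fixes f :: "real^2 \<Rightarrow> real"
  assumes R: "0 < R" and [measurable]: "f \<in> borel_measurable borel" and M: "\<And>y. y \<in> ball x R \<Longrightarrow> \<bar>f y\<bar> \<le> M"
  shows "integrable lborel (\<lambda>y. green_kernel R (x - y) * f y)"
    and "\<bar>LINT y|lborel. green_kernel R (x - y) * f y\<bar> \<le> M * (LINT z|lborel. green_kernel R z)"
proof -
  have i: "integrable lborel (\<lambda>y. M * green_kernel R (x - y))"
    using green_kernel_integrable[OF R] by (simp add: integral_lborel_shift(4))
  have b: "norm (green_kernel R (x - y) * f y) \<le> M * green_kernel R (x - y)" for y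
  proof (cases "y \<in> ball x R")
    case True
    then show ?thesis
      using M[OF True] green_kernel_nonneg[of R "x - y"]
      by (simp add: abs_mult mult.commute mult_right_mono)
  next
    case False
    then show ?thesis by (simp add: green_kernel_def dist_norm)
  qed
  show *: "integrable lborel (\<lambda>y. green_kernel R (x - y) * f y)"
    by (rule Bochner_Integration.integrable_bound[OF i])
       (measurable, intro AE_I2 order_trans[OF b], simp only: real_norm_def abs_ge_self)
  have "norm (LINT y|lborel. green_kernel R (x - y) * f y) \<le> (LINT y|lborel. M * green_kernel R (x - y))"
    by (rule Bochner_Integration.integral_norm_bound_integral[OF * i b])
  then show "\<bar>LINT y|lborel. green_kernel R (x - y) * f y\<bar> \<le> M * (LINT z|lborel. green_kernel R z)"
    by (simp add: integral_lborel_shift(3))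
qed

text \<open>The kernel is radially decreasing and its quadratic term only reduces the difference, so
  the logarithm alone is a bound. It does not involve \<open>R\<close> and survives \<open>R\<close>
  tending to infinity.\<close>

lemma green_kernel_diff:
  assumes "0 < norm z" "norm z \<le> norm w"
  shows "0 \<le> green_kernel R z - green_kernel R w" "green_kernel R z - green_kernel R w \<le> ln (norm w / norm z) / (2 * pi)"
proof -
  define s t where "s = norm z" and "t = norm w"
  have st: "0 < s" "s \<le> t" using assms by (auto simp: s_def t_def)
  define \<phi> where "\<phi> = (\<lambda>r::real. if r < R then ln (R / r) - 1 / 2 + r\<^sup>2 / (2 * R\<^sup>2) else 0)"
  have gk: "green_kernel R z = \<phi> s / (2 * pi)" "green_kernel R w = \<phi> t / (2 * pi)"
    using st by (auto simp: green_kernel_def \<phi>_def s_def t_def)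
  have "0 \<le> \<phi> s - \<phi> t \<and> \<phi> s - \<phi> t \<le> ln (t / s)"
  proof (cases "t < R")
    case True
    define q where "q = (s / t)\<^sup>2"
    define a where "a = (t\<^sup>2 - s\<^sup>2) / (2 * R\<^sup>2)"
    have "ln (t / s) = - ln q / 2" using st by (simp add: q_def ln_realpow ln_div)
    moreover have "ln q \<le> q - 1" using st by (intro ln_le_minus_one) (auto simp: q_def)
    moreover have "a \<le> (1 - q) / 2"
    proof -
      have "a \<le> (t\<^sup>2 - s\<^sup>2) / (2 * t\<^sup>2)"
        unfolding a_def using st True by (intro divide_left_mono) (auto intro!: power_mono)
      also have "\<dots> = (1 - q) / 2" using st by (simp add: q_def field_simps)
      finally show ?thesis .
    qed
    moreover have "\<phi> s - \<phi> t = ln (t / s) - a"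
      using st True by (simp add: \<phi>_def ln_div diff_divide_distrib a_def)
    moreover have "0 \<le> a" using st by (auto intro!: power_mono simp: a_def)
    ultimately show ?thesis by argo
  next
    case False
    have "\<phi> s = 2 * pi * green_kernel R z" using gk(1) by simp
    then have "0 \<le> \<phi> s" using green_kernel_nonneg[of R z] by simp
    moreover have "\<phi> s \<le> ln (t / s)"
    proof (cases "s < R")
      case True
      then have "s\<^sup>2 / (2 * R\<^sup>2) \<le> 1 / 2" using st by (simp add: power_mono)
      moreover have "ln (R / s) \<le> ln (t / s)" using st False True by (simp add: divide_right_mono)
      ultimately show ?thesis using True by (simp add: \<phi>_def)
    next
      case False
      then show ?thesis using st by (simp add: \<phi>_def)
    qed
    ultimately show ?thesis using False by (simp add: \<phi>_def)
  qed
  then have "0 \<le> \<phi> s - \<phi> t" "\<phi> s - \<phi> t \<le> ln (t / s)" by auto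
  then show "0 \<le> green_kernel R z - green_kernel R w" "green_kernel R z - green_kernel R w \<le> ln (norm w / norm z) / (2 * pi)"
    unfolding gk s_def[symmetric] t_def[symmetric]
    by (auto simp: diff_divide_distrib[symmetric] divide_right_mono)
qed

lemma green_kernel_abs_diff:
  assumes "z \<noteq> 0" "w \<noteq> 0"
  shows "\<bar>green_kernel R z - green_kernel R w\<bar> \<le> \<bar>ln (norm w / norm z)\<bar> / (2 * pi)"
proof (cases "norm z \<le> norm w")
  case True
  have "\<bar>ln (norm w / norm z)\<bar> = ln (norm w / norm z)" using assms True by simp
  then show ?thesis using green_kernel_diff[of z w R] assms True by simp
next
  case False
  then have "ln (norm w / norm z) = - ln (norm z / norm w)" "0 \<le> ln (norm z / norm w)" using assms by (auto simp: ln_div)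
  then show ?thesis using green_kernel_diff[of w z R] assms False by simp
qed

text \<open>Uniformity in \<open>z\<close> is the point: enlarging the radius changes a potential by
  at most the mass times a logarithm.\<close>

lemma green_kernel_radius_diff:
  assumes "0 < R" "R \<le> R'"
  shows "green_kernel R' z - green_kernel R z \<le> ln (R' / R) / (2 * pi)"
proof -
  consider "z = 0" | "0 < norm z" "norm z < R" | "0 < norm z" "R \<le> norm z" "norm z < R'" | "R' \<le> norm z" by force
  then show ?thesis
  proof cases
    case 2
    have "(norm z)\<^sup>2 / (2 * R'\<^sup>2) \<le> (norm z)\<^sup>2 / (2 * R\<^sup>2)"
      using assms by (intro divide_left_mono) (auto intro!: power_mono)
    then have "ln (R' / norm z) - 1 / 2 + (norm z)\<^sup>2 / (2 * R'\<^sup>2) - (ln (R / norm z) - 1 / 2 + (norm z)\<^sup>2 / (2 * R\<^sup>2)) \<le> ln (R' / R)"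
      using 2 assms by (simp add: ln_div)
    then show ?thesis using 2 assms
      by (simp add: green_kernel_def diff_divide_distrib[symmetric] divide_right_mono)
  next
    case 3
    have "(norm z)\<^sup>2 / (2 * R'\<^sup>2) \<le> 1 / 2" using 3 assms by (simp add: power_mono)
    moreover have "ln (R' / norm z) \<le> ln (R' / R)" using 3 assms by (simp add: divide_left_mono)
    ultimately have "ln (R' / norm z) - 1 / 2 + (norm z)\<^sup>2 / (2 * R'\<^sup>2) \<le> ln (R' / R)" by linarith
    then show ?thesis using 3 assms by (simp add: green_kernel_def divide_right_mono)
  qed (use assms in \<open>auto simp: green_kernel_def\<close>)
qed

context hartree
begin

lemma solutionD:
  assumes "solution D V g"
  shows "density g" "weight V" "continuous_on D g" "\<And>x. x \<in> D \<Longrightarrow> 0 < g x"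
    "\<And>x R. 0 < R \<Longrightarrow> cball x R \<subseteq> D \<Longrightarrow>
        ln (g x) = (LINT y:ball x R|lborel. ln (g y)) / (pi * R\<^sup>2) + (LINT y|lborel. green_kernel R (x - y) * rhs V g y)"
    "g \<in> borel_measurable borel" "V \<in> borel_measurable borel" "\<And>x. 0 \<le> g x" "integrable lborel g"
    "(LINT x|lborel. g x) \<le> c0" "\<And>x. 0 \<le> V x" "\<And>x. V x \<le> Lam"
  using assms unfolding solution_def density_def weight_def by auto

text \<open>Bounding \<open>rhs\<close> at a point takes a bound for \<open>g\<close> on a whole
  ball, so \<open>K\<close> is thickened to a compact set inside \<open>D\<close>. The mean value
  form of the equation is not assumed, so that the lemma can also be used to derive it.\<close>

lemma density_bounded_on_compact:
  assumes g: "density g" and V: "weight V" and c: "continuous_on D g" and g0: "\<And>x. x \<in> D \<Longrightarrow> 0 < g x" and K: "compact K" "K \<subseteq> D" and D: "open D"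
  obtains M where "0 \<le> M" "\<And>x. x \<in> K \<Longrightarrow> g x \<le> M" "\<And>x. x \<in> K \<Longrightarrow> \<bar>ln (g x)\<bar> \<le> M"
    "\<And>x. x \<in> K \<Longrightarrow> rhs V g x \<le> M"
proof -
  have bd: "\<exists>B. \<forall>x\<in>L. \<bar>h x\<bar> \<le> B" if "compact L" "continuous_on L h" for L and h :: "real^2 \<Rightarrow> real"
  proof -
    have "compact (h ` L)" using that by (intro compact_continuous_image)
    then obtain B where "\<forall>z\<in>h ` L. norm z \<le> B" by (meson compact_imp_bounded bounded_iff)
    then show ?thesis by auto
  qed
  obtain e where e: "0 < e" "(\<Union>x\<in>K. cball x e) \<subseteq> D"
  proof -
    obtain d where "0 < d" "(\<Union>x\<in>K. ball x d) \<subseteq> D"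
      using compact_subset_open_imp_ball_epsilon_subset[OF K(1) D K(2)] .
    moreover have "cball x (d / 2) \<subseteq> ball x d" for x :: "real^2" using \<open>0 < d\<close> by auto
    ultimately show ?thesis using that[of "d / 2"] by fastforce
  qed
  define L where "L = (\<Union>x\<in>K. cball x e)"
  have L: "compact L" unfolding L_def using K(1) by (intro compact_minkowski_sum_cball) auto
  obtain B where B: "\<forall>x\<in>L. \<bar>g x\<bar> \<le> B"
    using bd[OF L continuous_on_subset[OF c]] e(2) by (auto simp: L_def)
  obtain B' where B': "\<forall>x\<in>K. \<bar>ln (g x)\<bar> \<le> B'"
  proof -
    have "\<And>x. x \<in> K \<Longrightarrow> g x \<noteq> 0" using g0 K(2) by (metis less_irrefl subsetD)
    then have "continuous_on K (\<lambda>x. ln (g x))"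
      using continuous_on_subset[OF c K(2)] by (intro continuous_on_ln) auto
    then show ?thesis using bd[OF K(1)] that by blast
  qed
  define M where "M = max (max 0 B) (max B' (rhs_const (max 0 B * e\<^sup>2) * (max 0 B * e\<^sup>2) powr lam / e\<^sup>2))"
  have KL: "K \<subseteq> L" using e(1) by (auto simp: L_def)
  show ?thesis
  proof (rule that[of M])
    fix x assume x: "x \<in> K"
    show "g x \<le> M" using bspec[OF B, of x] KL x by (auto simp: M_def)
    show "\<bar>ln (g x)\<bar> \<le> M" using B' x by (auto simp: M_def)
    have gB: "g y \<le> max 0 B" if "y \<in> cball x e" for y
    proof -
      have "y \<in> L" using x that by (auto simp: L_def)
      with B show ?thesis by (simp add: abs_le_iff le_max_iff_disj)
    qed
    have "rhs V g x \<le> rhs_const (max 0 B * e\<^sup>2) * (g x * e\<^sup>2) powr lam / e\<^sup>2"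
      using gB e(1) by (intro rhs_bound g V) auto
    also have "\<dots> \<le> rhs_const (max 0 B * e\<^sup>2) * (max 0 B * e\<^sup>2) powr lam / e\<^sup>2"
      using gB[of x] e(1) g lam_bounds rhs_const_pos
      by (intro divide_right_mono mult_left_mono powr_mono2 mult_right_mono) (auto simp: density_def intro: less_imp_le)
    finally show "rhs V g x \<le> M" by (simp add: M_def)
  qed (simp add: M_def)
qed

lemma solution_bounded_on_compact:
  assumes s: "solution D V g" and K: "compact K" "K \<subseteq> D" and D: "open D"
  obtains M where "0 \<le> M" "\<And>x. x \<in> K \<Longrightarrow> g x \<le> M" "\<And>x. x \<in> K \<Longrightarrow> \<bar>ln (g x)\<bar> \<le> M"
    "\<And>x. x \<in> K \<Longrightarrow> rhs V g x \<le> M"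
  by (rule density_bounded_on_compact[OF solutionD(1-3)[OF s] solutionD(4)[OF s] K D]) (assumption, rule that)

text \<open>Kernel and right-hand side are nonnegative, so the last claim expresses that
  \<open>ln g\<close> is superharmonic.\<close>

lemma solution_mean_value:
  assumes s: "solution D V g" and D: "open D" "cball x R \<subseteq> D" and R: "0 < R"
  shows "set_integrable lborel (ball x R) (\<lambda>y. ln (g y))"
    and "integrable lborel (\<lambda>y. green_kernel R (x - y) * rhs V g y)"
    and "0 \<le> (LINT y|lborel. green_kernel R (x - y) * rhs V g y)"
    and "(LINT y:ball x R|lborel. ln (g y)) / (pi * R\<^sup>2) \<le> ln (g x)"
proof -
  note sol = solutionD[OF s]
  note [measurable] = sol(6,7)
  obtain M where M: "0 \<le> M" "\<And>y. y \<in> cball x R \<Longrightarrow> \<bar>ln (g y)\<bar> \<le> M" "\<And>y. y \<in> cball x R \<Longrightarrow> rhs V g y \<le> M"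
    using solution_bounded_on_compact[OF s compact_cball D(2) D(1)] by metis
  have ind: "integrable lborel (\<lambda>y. M * indicator (ball x R) y)"
    using emeasure_ball_real2[of R x] R by (intro integrable_mult_right integrable_real_indicator) auto
  show "set_integrable lborel (ball x R) (\<lambda>y. ln (g y))"
    unfolding set_integrable_def
    by (rule Bochner_Integration.integrable_bound[OF ind])
       (use M in \<open>auto simp: indicator_def intro!: AE_I2\<close>)
  show "integrable lborel (\<lambda>y. green_kernel R (x - y) * rhs V g y)"
    using M(3) rhs_nonneg[OF sol(2)] R
    by (intro green_kernel_mult_integrable(1)[where M = M]) auto
  show nn: "0 \<le> (LINT y|lborel. green_kernel R (x - y) * rhs V g y)"
    using rhs_nonneg[OF sol(2)] green_kernel_nonneg by (intro Bochner_Integration.integral_nonneg mult_nonneg_nonneg)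
  show "(LINT y:ball x R|lborel. ln (g y)) / (pi * R\<^sup>2) \<le> ln (g x)"
    using sol(5)[OF R D(2)] nn by simp
qed

end

section \<open>Entire solutions\<close>

text \<open>Split at distance 1 from \<open>x\<close>: inside, \<open>f\<close> is bounded and the
  power integrable; outside, the power is at most 1.\<close>

lemma integrable_norm_powr_mult:
  fixes f :: "real^2 \<Rightarrow> real"
  assumes f: "integrable lborel f" "\<And>y. 0 \<le> f y" "\<And>y. f y \<le> C" and p: "0 \<le> p" "p < 2"
  shows "integrable lborel (\<lambda>y. norm (x - y) powr - p * f y)"
    and "(LINT y|lborel. norm (x - y) powr - p * f y) \<le> (LINT y|lborel. f y) + C * (2 * pi / (2 - p))"
proof -
  have [measurable]: "f \<in> borel_measurable borel" using f(1) by auto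
  define B where "B = (\<lambda>y. f y + C * (indicator (ball x 1) y * norm (x - y) powr - p))"
  have Bi: "integrable lborel B" and Bv: "(LINT y|lborel. B y) = (LINT y|lborel. f y) + C * (2 * pi / (2 - p))"
    unfolding B_def using f(1) norm_powr_ball_shift[of 1 p x] p by simp_all
  have "0 \<le> C" using f(2,3) order_trans by blast
  have b: "norm (x - y) powr - p * f y \<le> B y" for y
  proof (cases "y \<in> ball x 1")
    case True
    have "norm (x - y) powr - p * f y \<le> norm (x - y) powr - p * C"
      using f(3) by (intro mult_left_mono) auto
    then show ?thesis using f(2)[of y] True by (simp add: B_def mult.commute)
  next
    case False
    then have "1 \<le> norm (x - y)" by (simp add: dist_norm)
    then have "norm (x - y) powr - p \<le> 1" using p by (simp add: powr_le_one_le powr_minus ge_one_powr_ge_zero inverse_le_1_iff)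
    then show ?thesis using f(2)[of y] False mult_right_mono[of "norm (x - y) powr - p" 1 "f y"] by (simp add: B_def)
  qed
  show i: "integrable lborel (\<lambda>y. norm (x - y) powr - p * f y)"
    by (rule Bochner_Integration.integrable_bound[OF Bi])
       (use b f(2) in \<open>auto intro!: AE_I2 intro: order_trans[OF _ abs_ge_self]\<close>)
  show "(LINT y|lborel. norm (x - y) powr - p * f y) \<le> (LINT y|lborel. f y) + C * (2 * pi / (2 - p))"
    unfolding Bv[symmetric] by (rule integral_mono[OF i Bi b])
qed

lemma abs_ln_ratio_le:
  assumes "0 < s" "0 < (t::real)"
  shows "\<bar>ln (s / t)\<bar> \<le> \<bar>s - t\<bar> / s + \<bar>s - t\<bar> / t"
proof -
  have "ln (s / t) \<le> s / t - 1" using assms by (intro ln_le_minus_one) auto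
  also have "\<dots> = (s - t) / t" using assms by (simp add: field_simps)
  also have "\<dots> \<le> \<bar>s - t\<bar> / t" using assms by (intro divide_right_mono) auto
  finally have 1: "ln (s / t) \<le> \<bar>s - t\<bar> / t" .
  have "ln (t / s) \<le> t / s - 1" using assms by (intro ln_le_minus_one) auto
  also have "\<dots> = (t - s) / s" using assms by (simp add: field_simps)
  also have "\<dots> \<le> \<bar>s - t\<bar> / s" using assms by (intro divide_right_mono) auto
  finally have 2: "ln (t / s) \<le> \<bar>s - t\<bar> / s" .
  have "ln (t / s) = - ln (s / t)" using assms by (simp add: ln_div)
  moreover have "0 \<le> \<bar>s - t\<bar> / s" "0 \<le> \<bar>s - t\<bar> / t" using assms by auto
  ultimately show ?thesis using 1 2 by argo
qed

text \<open>A Lipschitz bound for the logarithmic kernel with singularities of order one, which are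
  locally integrable in the plane.\<close>

lemma abs_ln_norm_ratio_le:
  assumes "y \<noteq> a" "y \<noteq> (b::real^2)"
  shows "\<bar>ln (norm (b - y) / norm (a - y))\<bar> \<le> norm (a - b) * (norm (b - y) powr - 1 + norm (a - y) powr - 1)"
proof -
  have "\<bar>norm (b - y) - norm (a - y)\<bar> \<le> norm (a - b)"
    using norm_triangle_ineq3[of "b - y" "a - y"] by (simp add: norm_minus_commute)
  then have "\<bar>norm (b - y) - norm (a - y)\<bar> / norm (b - y) + \<bar>norm (b - y) - norm (a - y)\<bar> / norm (a - y)
      \<le> norm (a - b) / norm (b - y) + norm (a - b) / norm (a - y)"
    by (intro add_mono divide_right_mono) auto
  with abs_ln_ratio_le[of "norm (b - y)" "norm (a - y)"] assms show ?thesis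
    by (simp add: powr_minus_divide algebra_simps)
qed

locale entire_solution = hartree +
  fixes v0 :: real and g :: "real^2 \<Rightarrow> real" and M0 :: real
  assumes sol: "solution UNIV (\<lambda>_. v0) g" and M0: "\<And>x. g x \<le> M0"
    and f_int: "integrable lborel (rhs (\<lambda>_. v0) g)"
begin

abbreviation "f \<equiv> rhs (\<lambda>_. v0) g"
definition "u x = ln (g x)"
definition "m = (LINT x|lborel. f x)"

lemmas sols = solutionD[OF sol]

lemma g_pos: "0 < g x" using sols(4) by simp

lemma M0_pos: "0 < M0" using g_pos M0 less_le_trans by blast

lemma g_meas [measurable]: "g \<in> borel_measurable borel" by (rule sols(6))

lemma u_meas [measurable]: "u \<in> borel_measurable borel" unfolding u_def by measurable

lemma f_meas [measurable]: "f \<in> borel_measurable borel" by measurable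

lemma f_nonneg: "0 \<le> f x" by (rule rhs_nonneg[OF sols(2)])

lemma m_nonneg: "0 \<le> m" unfolding m_def using f_nonneg by (rule Bochner_Integration.integral_nonneg)

definition "Cf = rhs_const M0 * M0 powr lam"

lemma f_le: "f x \<le> Cf"
proof -
  have "f x \<le> rhs_const M0 * (g x * 1\<^sup>2) powr lam / 1\<^sup>2"
    by (rule rhs_bound[OF sols(1,2)]) (use M0 in auto)
  also have "\<dots> \<le> Cf"
    unfolding Cf_def using rhs_const_pos M0 sols(8) lam_bounds
    by (auto intro!: mult_left_mono powr_mono2 intro: less_imp_le)
  finally show ?thesis .
qed

lemma Cf_nonneg: "0 \<le> Cf" using f_nonneg f_le order_trans by blast

lemmas powr_f = integrable_norm_powr_mult[OF f_int f_nonneg f_le]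

section \<open>Means over large balls and the logarithmic potential\<close>

definition "avg R x = (LINT y:ball x R|lborel. u y) / (pi * R\<^sup>2)"

lemma u_eq: "0 < R \<Longrightarrow> u x = avg R x + (LINT y|lborel. green_kernel R (x - y) * f y)"
  using sols(5)[of R x] unfolding avg_def u_def by simp

lemmas mv = solution_mean_value[OF sol open_UNIV subset_UNIV]

lemma u_set_int: "set_integrable lborel (ball x R) u"
proof (cases "0 < R")
  case True
  then show ?thesis using mv(1)[of R x] by (simp add: u_def[abs_def])
next
  case False
  then have e: "ball x R = {}" by auto
  show ?thesis unfolding set_integrable_def e by simp
qed

text \<open>Nonnegative because \<open>u \<le> ln M0\<close>; the sign is what allows integrals over
  nested balls to be compared.\<close>

definition "defect R x = ln M0 - avg R x"

lemma ln_M0_ge: "u x \<le> ln M0"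
  unfolding u_def using g_pos M0 M0_pos by simp

lemma defect_eq:
  assumes "0 < R"
  shows "defect R x = (LINT y:ball x R|lborel. ln M0 - u y) / (pi * R\<^sup>2)"
    and "set_integrable lborel (ball x R) (\<lambda>y. ln M0 - u y)" "0 \<le> defect R x"
proof -
  have c: "set_integrable lborel (ball x R) (\<lambda>y. ln M0)"
    unfolding set_integrable_def using emeasure_ball_real2[of R x] assms
    by (intro integrable_mult_left integrable_real_indicator | simp)+
  show i: "set_integrable lborel (ball x R) (\<lambda>y. ln M0 - u y)"
    using c u_set_int by (rule set_integral_diff)
  have "(LINT y:ball x R|lborel. ln M0 - u y) = (LINT y:ball x R|lborel. ln M0) - (LINT y:ball x R|lborel. u y)"
    using c u_set_int by (rule set_integral_diff)
  also have "(LINT y:ball x R|lborel. ln M0) = pi * R\<^sup>2 * ln M0"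
    using assms by (simp add: set_lebesgue_integral_def lebesgue_ball_real2)
  finally show e: "defect R x = (LINT y:ball x R|lborel. ln M0 - u y) / (pi * R\<^sup>2)"
    using assms by (simp add: defect_def avg_def field_simps)
  have "0 \<le> (LINT y:ball x R|lborel. ln M0 - u y)"
    unfolding set_lebesgue_integral_def using ln_M0_ge
    by (intro Bochner_Integration.integral_nonneg) (auto simp: indicator_def)
  with e show "0 \<le> defect R x" using assms by simp
qed

text \<open>\<open>ball a R\<close> lies in \<open>ball b (R + d)\<close> and the integrand is
  nonnegative; the factor is the ratio of the areas.\<close>

lemma defect_mono:
  assumes R: "0 < R" and d: "norm (a - b) \<le> d"
  shows "defect R a \<le> (1 + d / R)\<^sup>2 * defect (R + d) b"
proof -
  have d0: "0 \<le> d" using d norm_ge_zero order_trans by blast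
  have sub: "ball a R \<subseteq> ball b (R + d)"
  proof
    fix y assume "y \<in> ball a R"
    then show "y \<in> ball b (R + d)"
      using dist_triangle[of b y a] d by (simp add: dist_norm norm_minus_commute)
  qed
  have "(LINT y:ball a R|lborel. ln M0 - u y) \<le> (LINT y:ball b (R + d)|lborel. ln M0 - u y)"
    unfolding set_lebesgue_integral_def
    using defect_eq(2)[of R a] defect_eq(2)[of "R + d" b] R d0 sub ln_M0_ge
    by (intro integral_mono) (auto simp: set_integrable_def indicator_def)
  then have "defect R a \<le> (LINT y:ball b (R + d)|lborel. ln M0 - u y) / (pi * R\<^sup>2)"
    using defect_eq(1)[of R a] R by (simp add: divide_right_mono)
  also have "\<dots> = (1 + d / R)\<^sup>2 * defect (R + d) b"
  proof -
    have "1 + d / R = (R + d) / R" using R by (simp add: field_simps)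
    then show ?thesis
    using defect_eq(1)[of "R + d" b] R d0 by (simp add: power_divide)
  qed
  finally show ?thesis .
qed

text \<open>By Green's formula at a fixed point, a change of the mean with the radius is a change of
  the potential, which the mass controls.\<close>

lemma defect_radius:
  assumes R: "0 < R" and d: "0 \<le> d"
  shows "defect (R + d) x \<le> defect R x + m * (d / R)"
proof -
  have i: "integrable lborel (\<lambda>y. green_kernel R (x - y) * f y)" "integrable lborel (\<lambda>y. green_kernel (R + d) (x - y) * f y)"
    using mv(2)[of R x] mv(2)[of "R + d" x] R d by auto
  have "defect (R + d) x - defect R x = avg R x - avg (R + d) x" by (simp add: defect_def)
  also have "\<dots> = (LINT y|lborel. green_kernel (R + d) (x - y) * f y) - (LINT y|lborel. green_kernel R (x - y) * f y)"
    using u_eq[of R x] u_eq[of "R + d" x] R d by simp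
  also have "\<dots> = (LINT y|lborel. green_kernel (R + d) (x - y) * f y - green_kernel R (x - y) * f y)"
    using i by simp
  also have "\<dots> \<le> (LINT y|lborel. (d / R) * f y)"
  proof (rule integral_mono)
    fix y
    have "ln ((R + d) / R) / (2 * pi) \<le> ln (1 + d / R)"
    proof -
      have "(R + d) / R = 1 + d / R" using R by (simp add: field_simps)
      moreover have "0 \<le> ln (1 + d / R)" using R d by simp
      ultimately show ?thesis using pi_ge_two mult_left_mono[of 1 "2 * pi" "ln (1 + d / R)"]
        by (simp add: field_simps)
    qed
    also have "\<dots> \<le> d / R" using R d by (intro ln_add_one_self_le_self) auto
    finally have "green_kernel (R + d) (x - y) - green_kernel R (x - y) \<le> d / R"
      using green_kernel_radius_diff[of R "R + d" "x - y"] R d by linarith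
    then show "green_kernel (R + d) (x - y) * f y - green_kernel R (x - y) * f y \<le> (d / R) * f y"
      using mult_right_mono[OF _ f_nonneg[of y]] by (simp only: left_diff_distrib[symmetric])
  qed (use i f_int in auto)
  also have "\<dots> = m * (d / R)" by (simp add: m_def)
  finally show ?thesis by simp
qed

text \<open>What matters is a rate below linear; the square root comes from
  \<open>green_kernel_le_powr\<close>.\<close>

lemma defect_growth:
  obtains C where "0 \<le> C" "\<And>R. 1 \<le> R \<Longrightarrow> defect R x \<le> C * R powr (1/2)"
proof -
  define C where "C = (LINT y|lborel. norm (x - y) powr - (1/2) * f y)"
  have C0: "0 \<le> C" unfolding C_def using f_nonneg by (intro Bochner_Integration.integral_nonneg) auto
  have b: "defect R x \<le> (\<bar>ln M0 - u x\<bar> + C) * R powr (1/2)" if R: "1 \<le> R" for R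
  proof -
    have "(LINT y|lborel. green_kernel R (x - y) * f y) \<le> (LINT y|lborel. R powr (1/2) * (norm (x - y) powr - (1/2) * f y))"
    proof (rule integral_mono)
      fix y
      have "green_kernel R (x - y) \<le> R powr (1/2) * norm (x - y) powr - (1/2)"
        using green_kernel_le_powr[of R "x - y"] R by (auto simp: indicator_def intro: order_trans split: if_splits)
      from mult_right_mono[OF this f_nonneg]
      show "green_kernel R (x - y) * f y \<le> R powr (1/2) * (norm (x - y) powr - (1/2) * f y)" by (simp add: mult_ac)
    qed (use mv(2)[of R x] R powr_f(1)[of "1/2" x] in auto)
    also have "\<dots> = R powr (1/2) * C" by (simp add: C_def)
    finally have "defect R x \<le> ln M0 - u x + C * R powr (1/2)"
      using u_eq[of R x] R by (simp add: defect_def mult.commute)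
    also have "\<dots> \<le> \<bar>ln M0 - u x\<bar> * R powr (1/2) + C * R powr (1/2)"
      using ge_one_powr_ge_zero[OF R, of "1/2"] mult_left_mono[of 1 "R powr (1/2)" "\<bar>ln M0 - u x\<bar>"] by simp
    finally show ?thesis by (simp add: distrib_right)
  qed
  show ?thesis by (rule that[of "\<bar>ln M0 - u x\<bar> + C"]) (use C0 b in auto)
qed

text \<open>The Liouville step. Moving the center by \<open>d\<close> costs a fraction of order
  \<open>d / R\<close> of a quantity of size \<open>R powr (1/2)\<close>, and restoring the radius
  costs \<open>m * d / R\<close>. Both vanish as \<open>R\<close> grows, so no harmonic part can
  distinguish two points.\<close>

lemma avg_diff_lim: "(\<lambda>n. avg (real n + 1) a - avg (real n + 1) b) \<longlonglongrightarrow> 0"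
proof -
  define d where "d = norm (a - b)"
  have one: "\<exists>e. e \<longlonglongrightarrow> 0 \<and> (\<forall>n. defect (real n + 1) a - defect (real n + 1) b \<le> e n)" if ab: "norm (a - b) = d" for a b
  proof -
    obtain C where C: "0 \<le> C" "\<And>R. 1 \<le> R \<Longrightarrow> defect R b \<le> C * R powr (1/2)"
      by (rule defect_growth, rule that)
    define e where "e = (\<lambda>n. (((1 + d / (real n + 1))\<^sup>2 - 1) * (real n + 1) powr (1/2)) * C
      + (1 + d / (real n + 1))\<^sup>2 * (1 / (real n + 1)) * (m * d))"
    have "defect (real n + 1) a - defect (real n + 1) b \<le> e n" for n
    proof -
      define R where "R = real n + 1"
      have R: "1 \<le> R" by (simp add: R_def)
      have d0: "0 \<le> d" by (simp add: d_def)
      have "defect R a \<le> (1 + d / R)\<^sup>2 * defect (R + d) b"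
        using R ab by (intro defect_mono) auto
      also have "\<dots> \<le> (1 + d / R)\<^sup>2 * (defect R b + m * (d / R))"
        using R d0 by (intro mult_left_mono defect_radius) auto
      finally have "defect R a - defect R b \<le> ((1 + d / R)\<^sup>2 - 1) * defect R b + (1 + d / R)\<^sup>2 * (m * (d / R))"
        by (simp add: algebra_simps)
      also have "((1 + d / R)\<^sup>2 - 1) * defect R b \<le> ((1 + d / R)\<^sup>2 - 1) * (C * R powr (1/2))"
        using C(2)[OF R] R d0 one_le_power[of "1 + d / R" 2] by (intro mult_left_mono) auto
      finally show ?thesis by (simp add: e_def R_def mult_ac)
    qed
    moreover have "e \<longlonglongrightarrow> 0"
    proof -
      have "(\<lambda>n. ((1 + d / (real n + 1))\<^sup>2 - 1) * (real n + 1) powr (1/2)) \<longlonglongrightarrow> 0"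
        by real_asymp
      moreover have "(\<lambda>n. (1 + d / (real n + 1))\<^sup>2 * (1 / (real n + 1))) \<longlonglongrightarrow> 0"
        by real_asymp
      ultimately have "(\<lambda>n. (((1 + d / (real n + 1))\<^sup>2 - 1) * (real n + 1) powr (1/2)) * C
        + (1 + d / (real n + 1))\<^sup>2 * (1 / (real n + 1)) * (m * d)) \<longlonglongrightarrow> 0 * C + 0 * (m * d)"
        by (intro tendsto_intros)
      then show ?thesis by (simp add: e_def)
    qed
    ultimately show ?thesis by blast
  qed
  obtain e1 where e1: "e1 \<longlonglongrightarrow> 0" "\<And>n. defect (real n + 1) a - defect (real n + 1) b \<le> e1 n"
    using one[of a b] d_def by blast
  obtain e2 where e2: "e2 \<longlonglongrightarrow> 0" "\<And>n. defect (real n + 1) b - defect (real n + 1) a \<le> e2 n"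
    using one[of b a] d_def by (metis norm_minus_commute)
  show ?thesis
  proof (rule tendsto_sandwich[OF _ _ _ e2(1)])
    show "(\<lambda>n. - e1 n) \<longlonglongrightarrow> 0" using tendsto_minus[OF e1(1)] by simp
  qed (use e1(2) e2(2) in \<open>auto simp: defect_def algebra_simps\<close>)
qed

lemma log_ratio_integrable:
  "integrable lborel (\<lambda>y. ln (norm (b - y) / norm (a - y)) * f y)"
proof (rule Bochner_Integration.integrable_bound)
  show "integrable lborel (\<lambda>y. norm (a - b) * (norm (b - y) powr - 1 * f y + norm (a - y) powr - 1 * f y))"
    using powr_f(1)[of 1] by simp
  show "AE y in lborel. norm (ln (norm (b - y) / norm (a - y)) * f y)
      \<le> norm (norm (a - b) * (norm (b - y) powr - 1 * f y + norm (a - y) powr - 1 * f y))"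
    using AE_lborel_singleton[of a] AE_lborel_singleton[of b]
  proof eventually_elim
    case (elim y)
    show ?case
      using mult_right_mono[OF abs_ln_norm_ratio_le[OF elim] f_nonneg[of y]] f_nonneg[of y]
      by (simp add: abs_mult algebra_simps)
  qed
qed measurable

text \<open>Subtract Green's formula at the two points. The means cancel in the limit, and the
  kernel differences, dominated independently of the radius, converge to the logarithm of the ratio
  of distances.\<close>

theorem log_potential:
  "u a - u b = (LINT y|lborel. ln (norm (b - y) / norm (a - y)) * f y) / (2 * pi)"
proof -
  define h where "h = (\<lambda>n y. (green_kernel (real n + 1) (a - y) - green_kernel (real n + 1) (b - y)) * f y)"
  have hv: "u a - u b = (avg (real n + 1) a - avg (real n + 1) b) + (LINT y|lborel. h n y)" for n
  proof -
    have i: "integrable lborel (\<lambda>y. green_kernel (real n + 1) (x - y) * f y)" for x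
      using mv(2)[of "real n + 1" x] by simp
    show ?thesis
      using u_eq[of "real n + 1" a] u_eq[of "real n + 1" b] i
      by (simp add: h_def left_diff_distrib)
  qed
  have "(\<lambda>n. LINT y|lborel. h n y) \<longlonglongrightarrow> (LINT y|lborel. ln (norm (b - y) / norm (a - y)) * f y / (2 * pi))"
  proof (rule integral_dominated_convergence)
    show "integrable lborel (\<lambda>y. \<bar>ln (norm (b - y) / norm (a - y)) * f y\<bar> / (2 * pi))"
      using log_ratio_integrable by simp
    show "AE y in lborel. norm (h n y) \<le> \<bar>ln (norm (b - y) / norm (a - y)) * f y\<bar> / (2 * pi)" for n
      using AE_lborel_singleton[of a] AE_lborel_singleton[of b]
    proof eventually_elim
      case (elim y)
      have "\<bar>green_kernel (real n + 1) (a - y) - green_kernel (real n + 1) (b - y)\<bar> \<le> \<bar>ln (norm (b - y) / norm (a - y))\<bar> / (2 * pi)"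
        using elim by (intro green_kernel_abs_diff) auto
      from mult_right_mono[OF this abs_ge_zero[of "f y"]] show ?case by (simp add: h_def abs_mult)
    qed
    show "AE y in lborel. (\<lambda>n. h n y) \<longlonglongrightarrow> ln (norm (b - y) / norm (a - y)) * f y / (2 * pi)"
      using AE_lborel_singleton[of a] AE_lborel_singleton[of b]
    proof eventually_elim
      case (elim y)
      define s t where "s = norm (a - y)" and "t = norm (b - y)"
      have st: "0 < s" "0 < t" using elim by (auto simp: s_def t_def)
      have "(\<lambda>n. (ln (t / s) + (s\<^sup>2 - t\<^sup>2) / 2 * (1 / (real n + 1)\<^sup>2)) * (1 / (2 * pi) * f y)) \<longlonglongrightarrow>
          (ln (t / s) + (s\<^sup>2 - t\<^sup>2) / 2 * 0) * (1 / (2 * pi) * f y)"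
        by (intro tendsto_intros) real_asymp
      moreover have "eventually (\<lambda>n. s < real n + 1 \<and> t < real n + 1) sequentially"
        by (intro eventually_conj; real_asymp)
      then have "eventually (\<lambda>n. (ln (t / s) + (s\<^sup>2 - t\<^sup>2) / 2 * (1 / (real n + 1)\<^sup>2)) * (1 / (2 * pi) * f y) = h n y) sequentially"
      proof eventually_elim
        case (elim n)
        have "ln ((real n + 1) / s) - ln ((real n + 1) / t) = ln (t / s)" using st by (simp add: ln_div)
        moreover have "(real n + 1)\<^sup>2 \<noteq> 0" by simp
        moreover have "s \<noteq> 0" "t \<noteq> 0" using st by auto
        ultimately show ?case using elim st
          unfolding h_def green_kernel_def s_def[symmetric] t_def[symmetric]
          by (simp add: diff_divide_distrib[symmetric]) (simp add: diff_divide_distrib add_divide_distrib algebra_simps)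
      qed
      ultimately show ?case
        by (auto intro: Lim_transform_eventually simp: s_def t_def)
    qed
  qed (auto simp: h_def)
  from tendsto_add[OF avg_diff_lim[of a b] this]
  have "(\<lambda>n::nat. u a - u b) \<longlonglongrightarrow> 0 + (LINT y|lborel. ln (norm (b - y) / norm (a - y)) * f y / (2 * pi))"
    unfolding hv[symmetric] .
  then show ?thesis by (simp add: LIMSEQ_const_iff)
qed

section \<open>Behaviour at infinity: mass above \<open>4 * pi\<close> and quadratic decay\<close>

lemma lower_bound:
  obtains c where "0 < c" "\<And>x. c * (1 + norm x) powr - (m / (2 * pi)) \<le> g x"
proof -
  define C where "C = (LINT y|lborel. norm (0 - y) powr - 1 * f y)"
  have b: "u 0 - (m * ln (1 + norm x) + C) / (2 * pi) \<le> u x" for x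
  proof -
    have "(LINT y|lborel. - ln (1 + norm x) * f y - norm (0 - y) powr - 1 * f y) \<le> (LINT y|lborel. ln (norm (0 - y) / norm (x - y)) * f y)"
    proof (rule integral_mono_AE)
      show "AE y in lborel. - ln (1 + norm x) * f y - norm (0 - y) powr - 1 * f y \<le> ln (norm (0 - y) / norm (x - y)) * f y"
        using AE_lborel_singleton[of 0] AE_lborel_singleton[of x]
      proof eventually_elim
        case (elim y)
        \<comment> \<open>After taking logarithms, \<open>x\<close> contributes
          \<open>ln (1 + norm x)\<close> times the mass, and what remains,
          \<open>ln (1 + norm y) - ln (norm y)\<close>, is at most \<open>1 / norm y\<close>,
          integrable against \<open>f\<close>.\<close>
        have "norm (x - y) \<le> (1 + norm x) * (1 + norm y)"
          unfolding distrib_left distrib_right mult_1_right mult_1_left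
          using norm_triangle_ineq4[of x y] mult_nonneg_nonneg[OF norm_ge_zero[of x] norm_ge_zero[of y]] by linarith
        then have "ln (norm (x - y)) \<le> ln ((1 + norm x) * (1 + norm y))"
          using elim by (subst ln_le_cancel_iff) (auto intro!: mult_pos_pos add_pos_nonneg)
        also have "\<dots> = ln (1 + norm x) + ln (1 + norm y)"
          by (intro ln_mult_pos) (auto intro!: add_pos_nonneg)
        finally have 1: "ln (norm (x - y)) \<le> ln (1 + norm x) + ln (1 + norm y)" .
        have 2: "ln (1 + norm y) - ln (norm y) \<le> norm (0 - y) powr - 1"
        proof -
          have y: "0 < norm y" "0 < 1 + norm y" using elim by (auto intro: add_pos_nonneg)
          then have "1 + 1 / norm y = (1 + norm y) / norm y" by (simp add: field_simps)
          then have "ln (1 + norm y) - ln (norm y) = ln (1 + 1 / norm y)"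
            using y by (simp add: ln_div)
          also have "\<dots> \<le> 1 / norm y" by (intro ln_add_one_self_le_self) auto
          finally show ?thesis by (simp add: powr_minus_divide)
        qed
        have "ln (norm (0 - y) / norm (x - y)) = ln (norm y) - ln (norm (x - y))"
          using elim by (simp add: ln_div)
        with 1 2 have "- ln (1 + norm x) - norm (0 - y) powr - 1 \<le> ln (norm (0 - y) / norm (x - y))"
          by argo
        from mult_right_mono[OF this f_nonneg[of y]] show ?case by (simp only: left_diff_distrib)
      qed
    qed (use f_int powr_f(1)[of 1 0] log_ratio_integrable[of 0 x] in auto)
    also have "(LINT y|lborel. - ln (1 + norm x) * f y - norm (0 - y) powr - 1 * f y) = - (m * ln (1 + norm x)) - C"
      using f_int powr_f(1)[of 1 0] by (simp add: m_def C_def)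
    finally have "(- (m * ln (1 + norm x)) - C) / (2 * pi) \<le> u x - u 0"
      unfolding log_potential by (intro divide_right_mono) auto
    then show ?thesis by (simp add: field_simps)
  qed
  show ?thesis
  proof (rule that[of "exp (u 0 - C / (2 * pi))"])
    fix x :: "real^2"
    have "exp (u 0 - C / (2 * pi)) * (1 + norm x) powr - (m / (2 * pi)) = exp (u 0 - (m * ln (1 + norm x) + C) / (2 * pi))"
      by (simp add: powr_def exp_add[symmetric] add_divide_distrib add_nonneg_eq_0_iff)
    also have "\<dots> \<le> exp (u x)" using b[of x] by simp
    also have "exp (u x) = g x" using g_pos by (simp add: u_def)
    finally show "exp (u 0 - C / (2 * pi)) * (1 + norm x) powr - (m / (2 * pi)) \<le> g x" .
  qed simp
qed

text \<open>Otherwise the lower bound would keep \<open>g\<close> above a multiple of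
  \<open>(1 + norm x) powr - 2\<close>, which is not integrable in the plane.\<close>

lemma mass_gt: "4 * pi < m"
proof (rule ccontr)
  assume "\<not> 4 * pi < m"
  then have m2: "m / (2 * pi) \<le> 2" by (simp add: field_simps)
  obtain c where c: "0 < c" "\<And>x. c * (1 + norm x) powr - (m / (2 * pi)) \<le> g x" by (rule lower_bound, rule that)
  \<comment> \<open>Divergence is made quantitative: powers \<open>p > 2\<close> are integrable, but
    their integrals blow up as \<open>p\<close> approaches 2.\<close>
  have *: "c / 4 * (2 * pi / (p - 2)) \<le> c0" if "2 < p" for p
  proof -
    note h = has_bochner_integral_norm_powr_outside_ball[OF zero_less_one that, unfolded has_bochner_integral_iff]
    have "c / 4 * (LINT z|lborel. indicator (- ball 0 1) z * norm (z::real^2) powr - p) =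
        (LINT z|lborel. c / 4 * (indicator (- ball 0 1) z * norm (z::real^2) powr - p))" by simp
    also have "\<dots> \<le> (LINT z|lborel. g z)"
    proof (rule integral_mono)
      fix z :: "real^2"
      show "c / 4 * (indicator (- ball 0 1) z * norm z powr - p) \<le> g z"
      proof (cases "1 \<le> norm z")
        case True
        have "norm z powr - p \<le> norm z powr - 2" using True that by (intro powr_mono) auto
        also have "norm z powr - 2 / 4 = (2 * norm z) powr - 2"
          by (simp add: powr_mult powr_minus_divide powr_numeral)
        then have "norm z powr - 2 = 4 * (2 * norm z) powr - 2" by simp
        also have "(2 * norm z) powr - 2 \<le> (1 + norm z) powr - 2"
          using True by (intro powr_mono2') auto
        also have "(1 + norm z) powr - 2 \<le> (1 + norm z) powr - (m / (2 * pi))"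
          using m2 by (intro powr_mono) auto
        finally have "c * norm z powr - p \<le> c * (4 * (1 + norm z) powr - (m / (2 * pi)))"
          using c(1) by (intro mult_left_mono) auto
        then show ?thesis using c(2)[of z] True by simp
      next
        case False
        then show ?thesis using sols(8) by simp
      qed
    qed (use h sols(9) in auto)
    also have "\<dots> \<le> c0" by (rule sols(10))
    finally show ?thesis using h by simp
  qed
  \<comment> \<open>Chosen so that the left-hand side of the estimate becomes
    \<open>2 * c0\<close>.\<close>
  define p where "p = 2 + c * pi / (4 * c0)"
  have "2 < p" using c(1) c0 by (simp add: p_def)
  from *[OF this] have "2 * c0 \<le> c0" using c(1) c0 by (simp add: p_def field_simps)
  then show False using c0 by simp
qed

lemma v0_pos: "0 < v0"
proof (rule ccontr)
  assume "\<not> 0 < v0"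
  moreover have "0 \<le> v0" using sols(11) .
  ultimately have "f = (\<lambda>x. 0)" by (auto simp: rhs_def)
  then have "m = 0" by (simp add: m_def)
  then show False using mass_gt pi_gt_zero by simp
qed

lemma mass_ball:
  assumes "0 < e"
  obtains R where "1 \<le> R" "m - e \<le> (LINT y:ball 0 R|lborel. f y)"
proof -
  have "(\<lambda>n. LINT y|lborel. indicator (ball 0 (real n)) y * f y) \<longlonglongrightarrow> (LINT y|lborel. f y)"
  proof (rule integral_dominated_convergence[where w = f])
    show "AE y in lborel. (\<lambda>n. indicator (ball 0 (real n)) y * f y) \<longlonglongrightarrow> f y"
    proof (rule AE_I2)
      fix y :: "real^2"
      have "eventually (\<lambda>n. norm y < real n) sequentially" by real_asymp
      then have "eventually (\<lambda>n. indicator (ball 0 (real n)) y * f y = f y) sequentially"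
        by eventually_elim simp
      then show "(\<lambda>n. indicator (ball 0 (real n)) y * f y) \<longlonglongrightarrow> f y" by (rule tendsto_eventually)
    qed
  qed (use f_int f_nonneg in \<open>auto simp: indicator_def intro!: borel_measurable_times borel_measurable_indicator\<close>)
  then have "eventually (\<lambda>n. m - e < (LINT y|lborel. indicator (ball 0 (real n)) y * f y)) sequentially"
    using assms by (intro order_tendstoD) (auto simp: m_def)
  moreover have "eventually (\<lambda>n. 1 \<le> real n) sequentially" by real_asymp
  ultimately have "eventually (\<lambda>n. 1 \<le> real n \<and> m - e < (LINT y|lborel. indicator (ball 0 (real n)) y * f y)) sequentially"
    by eventually_elim simp
  then obtain n where "1 \<le> real n \<and> m - e < (LINT y|lborel. indicator (ball 0 (real n)) y * f y)"
    using eventually_happens trivial_limit_sequentially by blast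
  then show ?thesis using that[of "real n"] by (simp add: set_lebesgue_integral_def)
qed

text \<open>Mass \<open>mR\<close> inside a large ball lowers \<open>u x\<close> by
  \<open>mR * ln (norm x)\<close>; the mass outside can raise it by at most
  \<open>(m - mR) * ln (norm x)\<close>, up to bounded terms. As \<open>m > 4 * pi\<close>, the ball
  can be taken so that the net coefficient is at least \<open>4 * pi\<close>, and
  \<open>4 * pi / (2 * pi) = 2\<close>.\<close>

lemma decay:
  obtains C where "0 \<le> C" "\<And>x. g x * (norm x)\<^sup>2 \<le> C"
proof -
  obtain R where R: "1 \<le> R" "m - (m - 4 * pi) / 2 \<le> (LINT y:ball 0 R|lborel. f y)"
    using mass_ball[of "(m - 4 * pi) / 2"] mass_gt by auto
  define mR where "mR = (LINT y|lborel. indicator (ball 0 R) y * f y)"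
  have iR: "integrable lborel (\<lambda>y. indicator (ball 0 R) y * f y)" "integrable lborel (\<lambda>y. indicator (- ball 0 R) y * f y)"
    using f_int by (auto intro!: integrable_real_mult_indicator simp: mult.commute[of "indicator _ _"])
  have iC: "(LINT y|lborel. indicator (- ball 0 R) y * f y) = m - mR"
  proof -
    have "(LINT y|lborel. indicator (ball 0 R) y * f y) + (LINT y|lborel. indicator (- ball 0 R) y * f y) = (LINT y|lborel. f y)"
      unfolding Bochner_Integration.integral_add[OF iR, symmetric]
      by (intro Bochner_Integration.integral_cong refl) (simp add: indicator_def)
    then show ?thesis by (simp add: mR_def m_def)
  qed
  have mR: "4 * pi \<le> mR - (m - mR)" using R(2) by (simp add: mR_def set_lebesgue_integral_def field_simps)
  define C where "C = mR * ln (2 * R) + (m - mR) * ln 3 + Cf * (2 * pi)"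
  have bound: "u x - u 0 \<le> - 2 * ln (norm x) + C / (2 * pi)" if x: "2 * R \<le> norm x" for x
  proof -
    have x0: "2 \<le> norm x" "0 < norm x" using x R(1) by auto
    define k where "k = (\<lambda>y. indicator (ball x 1) y * norm (x - y) powr - 1)"
    have k: "integrable lborel k" "(LINT y|lborel. k y) = 2 * pi"
      unfolding k_def using norm_powr_ball_shift[of 1 1 x] by simp_all
    have k0: "0 \<le> k y" for y by (simp add: k_def)
    define B where "B = (\<lambda>y. (ln (2 * R) - ln (norm x)) * (indicator (ball 0 R) y * f y)
      + (ln 3 + ln (norm x)) * (indicator (- ball 0 R) y * f y) + Cf * k y)"
    have B: "integrable lborel B" "(LINT y|lborel. B y) = (ln (2 * R) - ln (norm x)) * mR + (ln 3 + ln (norm x)) * (m - mR) + Cf * (2 * pi)"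
      unfolding B_def using iR iC k by (simp_all add: mR_def)
    have "(LINT y|lborel. ln (norm (0 - y) / norm (x - y)) * f y) \<le> (LINT y|lborel. B y)"
    proof (rule integral_mono_AE[OF log_ratio_integrable B(1)])
      show "AE y in lborel. ln (norm (0 - y) / norm (x - y)) * f y \<le> B y"
        using AE_lborel_singleton[of 0] AE_lborel_singleton[of x]
      proof eventually_elim
        case (elim y)
        have n: "0 < norm y" "0 < norm (x - y)" using elim by auto
        show ?case
        proof (cases "y \<in> ball 0 R")
          case True
          then have y: "norm y \<le> R" by simp
          have "norm x / 2 \<le> norm (x - y)" using norm_triangle_ineq2[of x y] x y by simp
          then have "norm y / norm (x - y) \<le> R / (norm x / 2)"
            using y n x0 R(1) by (intro frac_le) auto
          then have "ln (norm y / norm (x - y)) \<le> ln (R / (norm x / 2))"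
            using n x0 R(1) by (subst ln_le_cancel_iff) auto
          also have "\<dots> = ln (2 * R) - ln (norm x)" using x0 R(1) by (simp add: ln_div ln_mult)
          finally have "ln (norm y / norm (x - y)) * f y \<le> (ln (2 * R) - ln (norm x)) * f y"
            using f_nonneg by (rule mult_right_mono)
          moreover have "0 \<le> Cf * k y" using Cf_nonneg k0 by simp
          ultimately show ?thesis using True by (simp add: B_def)
        next
          case False
          have tri: "norm y \<le> norm (x - y) + norm x"
            using norm_triangle_ineq2[of y x] by (simp add: norm_minus_commute)
          have "ln (norm y / norm (x - y)) \<le> ln 3 + ln (norm x) + k y"
          \<comment> \<open>Close to \<open>x\<close> the logarithm is singular; the excess goes
            into \<open>k\<close>, which is integrable and is paid for by the bound
            \<open>Cf\<close> on \<open>f\<close>.\<close>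
          proof (cases "norm (x - y) < 1")
            case True
            have "norm y / norm (x - y) \<le> 3 * norm x / norm (x - y)"
              using tri True x0 n by (intro divide_right_mono) auto
            then have "ln (norm y / norm (x - y)) \<le> ln (3 * norm x / norm (x - y))"
              using n x0 by (subst ln_le_cancel_iff) auto
            also have "\<dots> = ln 3 + ln (norm x) + ln (1 / norm (x - y))"
              using n x0 by (simp add: ln_div ln_mult)
            also have "ln (1 / norm (x - y)) \<le> 1 / norm (x - y)"
              using ln_le_minus_one[of "1 / norm (x - y)"] n by simp
            finally show ?thesis using True by (simp add: powr_minus_divide dist_norm k_def)
          next
            case False
            have "norm x \<le> norm x * norm (x - y)" using False mult_left_mono[of 1 "norm (x - y)" "norm x"] by simp
            moreover have "norm (x - y) \<le> norm x * norm (x - y)" using x0 mult_right_mono[of 1 "norm x" "norm (x - y)"] by simp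
            ultimately have "norm y \<le> 3 * norm x * norm (x - y)" using tri norm_ge_zero[of "x - y"] x0 by argo
            then have "norm y / norm (x - y) \<le> 3 * norm x" using n by (simp add: divide_le_eq)
            then have "ln (norm y / norm (x - y)) \<le> ln (3 * norm x)"
              using n x0 by (subst ln_le_cancel_iff) auto
            also have "\<dots> = ln 3 + ln (norm x)" using x0 by (simp add: ln_mult)
            finally show ?thesis using k0[of y] by simp
          qed
          from mult_right_mono[OF this f_nonneg[of y]]
          have "ln (norm y / norm (x - y)) * f y \<le> (ln 3 + ln (norm x)) * f y + k y * f y"
            by (simp add: distrib_right)
          moreover have "k y * f y \<le> k y * Cf"
            using f_le k0 by (intro mult_left_mono) auto
          ultimately show ?thesis using False by (simp add: B_def mult_ac)
        qed
      qed
    qed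
    also have "(LINT y|lborel. B y) = C - (mR - (m - mR)) * ln (norm x)"
      unfolding B(2) by (simp add: C_def algebra_simps)
    also have "\<dots> \<le> C - 4 * pi * ln (norm x)"
      using mR x0 by (intro diff_left_mono mult_right_mono) auto
    finally have "u x - u 0 \<le> (C - 4 * pi * ln (norm x)) / (2 * pi)"
      unfolding log_potential by (intro divide_right_mono) auto
    then show ?thesis by (simp add: diff_divide_distrib)
  qed
  define C' where "C' = max (M0 * (2 * R)\<^sup>2) (exp (u 0 + C / (2 * pi)))"
  have "g x * (norm x)\<^sup>2 \<le> C'" for x
  proof (cases "2 * R \<le> norm x")
    case True
    then have x0: "0 < norm x" using R(1) by linarith
    have "2 * ln (norm x) = ln ((norm x)\<^sup>2)" using x0 by (simp add: ln_realpow)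
    then have "g x * (norm x)\<^sup>2 = exp (u x + 2 * ln (norm x))"
      using g_pos[of x] x0 by (simp add: u_def exp_add)
    also have "\<dots> \<le> exp (u 0 + C / (2 * pi))" using bound[OF True] by simp
    finally show ?thesis by (simp add: C'_def)
  next
    case False
    have "g x * (norm x)\<^sup>2 \<le> M0 * (2 * R)\<^sup>2"
      using False M0 M0_pos by (intro mult_mono power_mono) auto
    then show ?thesis by (simp add: C'_def)
  qed
  moreover have "0 \<le> C'" by (simp add: C'_def le_max_iff_disj)
  ultimately show ?thesis using that by blast
qed

text \<open>\<open>rhs_bound\<close> at radius \<open>norm x / 2\<close>, on which quadratic decay
  of \<open>g\<close> is the required scale-invariant bound.\<close>

lemma f_decay:
  obtains C where "0 \<le> C" "\<And>x. x \<noteq> 0 \<Longrightarrow> f x \<le> C / (norm x)\<^sup>2"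
proof -
  obtain C where C: "0 \<le> C" "\<And>x. g x * (norm x)\<^sup>2 \<le> C" by (rule decay, rule that)
  have "f x \<le> (rhs_const C * C powr lam * 4) / (norm x)\<^sup>2" if x: "x \<noteq> 0" for x
  proof -
    define \<rho> where "\<rho> = norm x / 2"
    have \<rho>: "0 < \<rho>" using x by (simp add: \<rho>_def)
    have "f x \<le> rhs_const C * (g x * \<rho>\<^sup>2) powr lam / \<rho>\<^sup>2"
    proof (rule rhs_bound[OF sols(1,2) \<rho>])
      fix y assume "y \<in> ball x \<rho>"
      then have "\<rho> \<le> norm y"
        using norm_triangle_ineq2[of x y] by (simp add: \<rho>_def dist_norm)
      then have "g y * \<rho>\<^sup>2 \<le> g y * (norm y)\<^sup>2" using \<rho> sols(8) by (intro mult_left_mono power_mono) auto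
      then show "g y \<le> C / \<rho>\<^sup>2" using C(2)[of y] \<rho> by (simp add: field_simps)
    qed
    also have "g x * \<rho>\<^sup>2 \<le> C" using C(2)[of x] C(1) by (simp add: \<rho>_def power_divide)
    then have "rhs_const C * (g x * \<rho>\<^sup>2) powr lam / \<rho>\<^sup>2 \<le> rhs_const C * C powr lam / \<rho>\<^sup>2"
      using rhs_const_pos[of C] sols(8)[of x] lam_bounds
      by (intro divide_right_mono mult_left_mono powr_mono2) (auto intro: less_imp_le)
    also have "\<dots> = (rhs_const C * C powr lam * 4) / (norm x)\<^sup>2" by (simp add: \<rho>_def power_divide)
    finally show ?thesis .
  qed
  then show ?thesis using that[of "rhs_const C * C powr lam * 4"] rhs_const_pos[of C] by (auto intro: less_imp_le)
qed

text \<open>A scale-invariant quantity: on the ball of radius \<open>norm x / 2\<close> about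
  \<open>x\<close> the decay of \<open>f\<close> compensates both the singularity and the weight;
  elsewhere \<open>norm (x - y)\<close> is at least \<open>norm x / 2\<close> and the mass
  suffices.\<close>

lemma weighted_potential_bound:
  assumes p: "0 < p" "p < 2"
  obtains C where "0 \<le> C" "\<And>x. (LINT y|lborel. norm x powr p * (norm (x - y) powr - p * f y)) \<le> C"
proof -
  obtain D where D: "0 \<le> D" "\<And>x. x \<noteq> 0 \<Longrightarrow> f x \<le> D / (norm x)\<^sup>2" by (rule f_decay, rule that)
  define C where "C = 2 powr p * m + 4 * D * (2 * pi * (1/2) powr (2 - p) / (2 - p))"
  have "(LINT y|lborel. norm x powr p * (norm (x - y) powr - p * f y)) \<le> C" for x
  proof (cases "x = 0")
    case True
    then show ?thesis using D(1) m_nonneg p by (simp add: C_def)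
  next
    case False
    define \<rho> where "\<rho> = norm x / 2"
    have \<rho>: "0 < \<rho>" using False by (simp add: \<rho>_def)
    define k where "k = (\<lambda>y. indicator (ball x \<rho>) y * norm (x - y) powr - p)"
    have k: "integrable lborel k" "(LINT y|lborel. k y) = 2 * pi * \<rho> powr (2 - p) / (2 - p)"
      unfolding k_def using norm_powr_ball_shift[of \<rho> p x] \<rho> p by simp_all
    have "(LINT y|lborel. norm x powr p * (norm (x - y) powr - p * f y)) \<le>
        (LINT y|lborel. 2 powr p * f y + (norm x powr p * (4 * D / (norm x)\<^sup>2)) * k y)"
    proof (rule integral_mono)
      fix y
      show "norm x powr p * (norm (x - y) powr - p * f y) \<le> 2 powr p * f y + (norm x powr p * (4 * D / (norm x)\<^sup>2)) * k y"
      proof (cases "y \<in> ball x \<rho>")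
        case True
        have ny: "\<rho> \<le> norm y" using norm_triangle_ineq2[of x y] True by (simp add: \<rho>_def dist_norm)
        then have "f y \<le> D / (norm y)\<^sup>2" using D(2)[of y] \<rho> by force
        also have "\<dots> \<le> D / \<rho>\<^sup>2" using ny \<rho> D(1) by (intro divide_left_mono power_mono) (auto simp: zero_less_mult_iff)
        also have "\<dots> = 4 * D / (norm x)\<^sup>2" by (simp add: \<rho>_def power_divide)
        finally have "norm x powr p * (norm (x - y) powr - p * f y) \<le> norm x powr p * (norm (x - y) powr - p * (4 * D / (norm x)\<^sup>2))"
          by (intro mult_left_mono) auto
        then show ?thesis using True f_nonneg[of y] by (simp add: k_def mult_ac add_increasing)
      next
        case F: False
        then have d: "norm x / 2 \<le> norm (x - y)" by (simp add: \<rho>_def dist_norm)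
        have "norm x powr p * norm (x - y) powr - p \<le> norm x powr p * (norm x / 2) powr - p"
          using d p \<rho> by (intro mult_left_mono powr_mono2') (auto simp: \<rho>_def)
        also have "\<dots> = 2 powr p" using False by (simp add: powr_divide powr_minus_divide)
        finally show ?thesis using mult_right_mono[OF _ f_nonneg[of y]] F by (simp add: k_def mult.assoc[symmetric])
      qed
    qed (use powr_f(1)[of p x] p f_int k in auto)
    also have "\<dots> = 2 powr p * m + (norm x powr p * (4 * D / (norm x)\<^sup>2)) * (2 * pi * \<rho> powr (2 - p) / (2 - p))"
      using f_int k by (simp add: m_def)
    also have "\<dots> = C"
    proof -
      have "norm x powr p * \<rho> powr (2 - p) = (norm x)\<^sup>2 * (1/2) powr (2 - p)"
        using False by (simp add: \<rho>_def powr_divide powr_diff powr_numeral)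
      then have "norm x powr p * \<rho> powr (2 - p) / (norm x)\<^sup>2 = (1/2) powr (2 - p)"
        using False by simp
      then have "(norm x powr p * (4 * D / (norm x)\<^sup>2)) * (2 * pi * \<rho> powr (2 - p) / (2 - p)) = 4 * D * (2 * pi * (1/2) powr (2 - p) / (2 - p))"
      proof -
        show ?thesis unfolding \<open>norm x powr p * \<rho> powr (2 - p) / (norm x)\<^sup>2 = (1/2) powr (2 - p)\<close>[symmetric]
          by (simp add: divide_inverse mult_ac)
      qed
      then show ?thesis by (simp add: C_def)
    qed
    finally show ?thesis .
  qed
  moreover have "0 \<le> C" using D(1) m_nonneg p by (simp add: C_def)
  ultimately show ?thesis using that by blast
qed

section \<open>The Pohozaev identity by comparison with dilations\<close>

lemma pair_integrable:
  fixes h :: "(real^2) \<times> (real^2) \<Rightarrow> real"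
  assumes [measurable]: "h \<in> borel_measurable borel"
    and i: "\<And>x. integrable lborel (\<lambda>y. h (x, y))"
    and b: "\<And>x. (LINT y|lborel. \<bar>h (x, y)\<bar>) \<le> B * f x"
  shows "integrable (lborel \<Otimes>\<^sub>M lborel) h"
proof (rule lborel_pair.Fubini_integrable)
  have m[measurable]: "h \<in> borel_measurable (borel \<Otimes>\<^sub>M borel)" using assms(1) by (simp add: borel_prod)
  show "h \<in> borel_measurable (lborel \<Otimes>\<^sub>M lborel)" by measurable
  show "integrable lborel (\<lambda>x. LINT y|lborel. norm (h (x, y)))"
  proof (rule Bochner_Integration.integrable_bound)
    show "integrable lborel (\<lambda>x. B * f x)" using f_int by simp
    show "(\<lambda>x. LINT y|lborel. norm (h (x, y))) \<in> borel_measurable lborel"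
      by (rule lborel.borel_measurable_lebesgue_integral) measurable
    show "AE x in lborel. norm (LINT y|lborel. norm (h (x, y))) \<le> norm (B * f x)"
    proof (rule AE_I2)
      fix x
      have "0 \<le> (LINT y|lborel. \<bar>h (x, y)\<bar>)" by (intro Bochner_Integration.integral_nonneg) auto
      with b[of x] show "norm (LINT y|lborel. norm (h (x, y))) \<le> norm (B * f x)" by simp
    qed
  qed
qed (use i in auto)

text \<open>For these \<open>t\<close> the points \<open>x\<close> and \<open>t *\<^sub>R x\<close>
  are at distance at most \<open>norm x\<close>, so the Lipschitz bound of the logarithm reduces the
  claim to the weighted potential with exponent 1.\<close>

lemma dilation_log_bound:
  obtains C where "0 \<le> C" "\<And>t x. 1/2 \<le> t \<Longrightarrow> t \<le> 2 \<Longrightarrow>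
    (LINT y|lborel. \<bar>ln (norm (x - y) / norm (t *\<^sub>R x - y)) * f y\<bar>) \<le> C"
proof -
  obtain C where C: "0 \<le> C" "\<And>x. (LINT y|lborel. norm x powr 1 * (norm (x - y) powr - 1 * f y)) \<le> C"
    by (rule weighted_potential_bound[of 1], simp, simp, rule that)
  have "(LINT y|lborel. \<bar>ln (norm (x - y) / norm (t *\<^sub>R x - y)) * f y\<bar>) \<le> C + 2 * C" if t: "1/2 \<le> t" "t \<le> 2" for t x
  proof -
    have "(LINT y|lborel. \<bar>ln (norm (x - y) / norm (t *\<^sub>R x - y)) * f y\<bar>) \<le>
        (LINT y|lborel. norm x powr 1 * (norm (x - y) powr - 1 * f y)
           + 2 * (norm (t *\<^sub>R x) powr 1 * (norm (t *\<^sub>R x - y) powr - 1 * f y)))"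
    proof (rule integral_mono_AE)
      show "integrable lborel (\<lambda>y. \<bar>ln (norm (x - y) / norm (t *\<^sub>R x - y)) * f y\<bar>)"
        using log_ratio_integrable[of x "t *\<^sub>R x"] by (rule integrable_abs)
      show "AE y in lborel. \<bar>ln (norm (x - y) / norm (t *\<^sub>R x - y)) * f y\<bar> \<le> norm x powr 1 * (norm (x - y) powr - 1 * f y)
           + 2 * (norm (t *\<^sub>R x) powr 1 * (norm (t *\<^sub>R x - y) powr - 1 * f y))"
        using AE_lborel_singleton[of x] AE_lborel_singleton[of "t *\<^sub>R x"]
      proof eventually_elim
        case (elim y)
        have "norm (t *\<^sub>R x - x) = \<bar>t - 1\<bar> * norm x" by (simp add: scaleR_left_diff_distrib[of t 1 x, simplified, symmetric])
        also have "\<dots> \<le> 1 * norm x" using t by (intro mult_right_mono) auto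
        finally have "norm (t *\<^sub>R x - x) \<le> norm x" by simp
        then have "\<bar>ln (norm (x - y) / norm (t *\<^sub>R x - y))\<bar> \<le> norm x * (norm (x - y) powr - 1 + norm (t *\<^sub>R x - y) powr - 1)"
          using abs_ln_norm_ratio_le[OF elim(2,1)] by (meson add_nonneg_nonneg mult_right_mono order_trans powr_ge_zero)
        also have "\<dots> \<le> norm x * norm (x - y) powr - 1 + 2 * (norm (t *\<^sub>R x) * norm (t *\<^sub>R x - y) powr - 1)"
        proof -
          have "norm x \<le> 2 * norm (t *\<^sub>R x)" using t mult_right_mono[of 1 "2 * t" "norm x"] by simp
          from mult_right_mono[OF this, of "norm (t *\<^sub>R x - y) powr - 1"] show ?thesis
            by (simp add: distrib_left del: norm_scaleR)
        qed
        finally have "\<bar>ln (norm (x - y) / norm (t *\<^sub>R x - y))\<bar> * f y \<le>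
            (norm x * norm (x - y) powr - 1 + 2 * (norm (t *\<^sub>R x) * norm (t *\<^sub>R x - y) powr - 1)) * f y"
          using f_nonneg by (rule mult_right_mono)
        then show ?case using f_nonneg[of y]
          by (simp only: abs_mult abs_of_nonneg powr_one norm_ge_zero distrib_right mult.assoc)
      qed
    qed (intro Bochner_Integration.integrable_add integrable_mult_right powr_f(1); simp)
    also have "\<dots> = (LINT y|lborel. norm x powr 1 * (norm (x - y) powr - 1 * f y))
        + (LINT y|lborel. 2 * (norm (t *\<^sub>R x) powr 1 * (norm (t *\<^sub>R x - y) powr - 1 * f y)))"
      by (intro Bochner_Integration.integral_add integrable_mult_right powr_f(1); simp)
    also have "(LINT y|lborel. 2 * (norm (t *\<^sub>R x) powr 1 * (norm (t *\<^sub>R x - y) powr - 1 * f y))) =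
        2 * (LINT y|lborel. norm (t *\<^sub>R x) powr 1 * (norm (t *\<^sub>R x - y) powr - 1 * f y))"
      by (rule integral_mult_right_zero)
    also have "(LINT y|lborel. norm x powr 1 * (norm (x - y) powr - 1 * f y))
        + 2 * (LINT y|lborel. norm (t *\<^sub>R x) powr 1 * (norm (t *\<^sub>R x - y) powr - 1 * f y)) \<le> C + 2 * C"
      using C(2)[of x] C(2)[of "t *\<^sub>R x"] by argo
    finally show ?thesis .
  qed
  with C(1) show ?thesis using that[of "C + 2 * C"] by simp
qed

text \<open>Symmetrizing in \<open>x\<close> and \<open>y\<close> is essential: \<open>|t x - y|^2 +
  |t y - x|^2 = 2 t |x - y|^2 + (t - 1)^2 (|x|^2 + |y|^2)\<close>, so the product of the two
  distances is at most \<open>t |x - y|^2\<close> up to second order in \<open>t - 1\<close>. The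
  exponent 3/2 is above 1, to make the error negligible against \<open>|t - 1|\<close>, and below 2,
  to keep it integrable.\<close>

lemma dilation_product_bound:
  fixes x y :: "real^2"
  assumes t: "1/2 \<le> t" "t \<le> 2" and ne: "y \<noteq> x" "y \<noteq> t *\<^sub>R x" "x \<noteq> t *\<^sub>R y"
  shows "- ln t - 6 * \<bar>t - 1\<bar> powr (3/2) * ((norm x powr (3/2) + norm y powr (3/2)) * norm (x - y) powr - (3/2))
    \<le> ln (norm (x - y) / norm (t *\<^sub>R x - y)) + ln (norm (y - x) / norm (t *\<^sub>R y - x))"
proof -
  define d where "d = norm (x - y)"
  have d: "0 < d" using ne by (simp add: d_def)
  define P where "P = norm (t *\<^sub>R x - y) * norm (t *\<^sub>R y - x)"
  have P: "0 < P" using ne by (simp add: P_def)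
  have "2 * P \<le> (norm (t *\<^sub>R x - y))\<^sup>2 + (norm (t *\<^sub>R y - x))\<^sup>2"
    using sum_squares_bound[of "norm (t *\<^sub>R x - y)" "norm (t *\<^sub>R y - x)"] by (simp add: P_def mult.assoc)
  also have "\<dots> = 2 * t * d\<^sup>2 + (t - 1)\<^sup>2 * ((norm x)\<^sup>2 + (norm y)\<^sup>2)"
    unfolding d_def power2_norm_eq_inner
    by (simp add: inner_diff_left inner_diff_right inner_commute power2_eq_square algebra_simps)
  finally have P1: "P \<le> t * d\<^sup>2 + (t - 1)\<^sup>2 * ((norm x)\<^sup>2 + (norm y)\<^sup>2) / 2" by simp
  define M where "M = max (norm x) (norm y)"
  have M: "0 \<le> M" by (simp add: M_def le_max_iff_disj)
  have "(norm x)\<^sup>2 \<le> M\<^sup>2" "(norm y)\<^sup>2 \<le> M\<^sup>2" by (auto simp: M_def intro!: power_mono)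
  then have "(t - 1)\<^sup>2 * ((norm x)\<^sup>2 + (norm y)\<^sup>2) / 2 \<le> (t - 1)\<^sup>2 * M\<^sup>2"
    using mult_left_mono[of "(norm x)\<^sup>2 + (norm y)\<^sup>2" "2 * M\<^sup>2" "(t - 1)\<^sup>2"] by simp
  also have "\<dots> \<le> 2 * t * ((t - 1)\<^sup>2 * M\<^sup>2)" using t mult_right_mono[of 1 "2 * t" "(t - 1)\<^sup>2 * M\<^sup>2"] by simp
  finally have P1': "P \<le> t * d\<^sup>2 + 2 * t * ((t - 1)\<^sup>2 * M\<^sup>2)" using P1 by argo
  define z where "z = \<bar>t - 1\<bar> * M / d"
  have z: "0 \<le> z" using M d by (simp add: z_def)
  have "(t - 1)\<^sup>2 * M\<^sup>2 = d\<^sup>2 * z\<^sup>2" using d by (simp add: z_def power_divide power_mult_distrib)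
  with P1' have P2: "P \<le> d\<^sup>2 * (t * (1 + 2 * z\<^sup>2))" by (simp add: algebra_simps)
  have "ln (norm (x - y) / norm (t *\<^sub>R x - y)) + ln (norm (y - x) / norm (t *\<^sub>R y - x)) = - ln (P / d\<^sup>2)"
    using ne d by (simp add: P_def d_def norm_minus_commute[of y x] ln_div ln_mult ln_realpow)
  moreover have "ln (P / d\<^sup>2) \<le> ln (t * (1 + 2 * z\<^sup>2))"
  proof (subst ln_le_cancel_iff)
    show "P / d\<^sup>2 \<le> t * (1 + 2 * z\<^sup>2)" using P2 d by (simp add: divide_le_eq mult.commute)
    show "0 < t * (1 + 2 * z\<^sup>2)" using t by (intro mult_pos_pos add_pos_nonneg) auto
  qed (use P d in simp)
  moreover have "ln (t * (1 + 2 * z\<^sup>2)) = ln t + ln (1 + 2 * z\<^sup>2)"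
    using t by (intro ln_mult_pos) (auto intro!: add_pos_nonneg)
  moreover have "ln (1 + 2 * z\<^sup>2) \<le> 2 * (2 * z\<^sup>2) powr (3/4) / (3/4)"
    by (rule ln_one_plus_le_powr) auto
  \<comment> \<open>The crude bound 9/4 for \<open>2 powr (3/4)\<close> is what produces the
    constant 6.\<close>
  moreover have "2 * (2 * z\<^sup>2) powr (3/4) / (3/4) \<le> 6 * z powr (3/2)"
  proof -
    have "(2 * z\<^sup>2) powr (3/4) = 2 powr (3/4) * z powr (3/2)"
      using z by (cases "z = 0") (simp_all add: powr_mult powr_powr flip: powr_numeral)
    moreover have "2 powr (3/4) \<le> (9/4 :: real)"
      using powr_mono[of "3/4" 1 2] by simp
    ultimately show ?thesis using mult_right_mono[of "2 powr (3/4)" "9/4" "z powr (3/2)"]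
      by (simp add: mult.commute)
  qed
  moreover have "z powr (3/2) \<le> \<bar>t - 1\<bar> powr (3/2) * ((norm x powr (3/2) + norm y powr (3/2)) * d powr - (3/2))"
  proof -
    have "z powr (3/2) = \<bar>t - 1\<bar> powr (3/2) * (M powr (3/2) * d powr - (3/2))"
      using M d by (simp add: z_def powr_divide powr_mult powr_minus_divide)
    moreover have "M powr (3/2) \<le> norm x powr (3/2) + norm y powr (3/2)"
      by (auto simp: M_def max_def)
    ultimately show ?thesis by (auto intro!: mult_left_mono mult_right_mono)
  qed
  ultimately show ?thesis unfolding d_def[symmetric] by argo
qed

text \<open>A one-sided estimate is enough, because \<open>ln t\<close> changes sign at
  \<open>t = 1\<close> and both sides of 1 are used.\<close>

lemma dilation_difference_lower:
  obtains K where "0 \<le> K"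
    "\<And>t. 1/2 \<le> t \<Longrightarrow> t \<le> 2 \<Longrightarrow> integrable lborel (\<lambda>x. (u (t *\<^sub>R x) - u x) * f x)"
    "\<And>t. 1/2 \<le> t \<Longrightarrow> t \<le> 2 \<Longrightarrow>
      - (m\<^sup>2 * ln t + K * \<bar>t - 1\<bar> powr (3/2)) / (4 * pi) \<le> (LINT x|lborel. (u (t *\<^sub>R x) - u x) * f x)"
    "\<And>t x. 1/2 \<le> t \<Longrightarrow> t \<le> 2 \<Longrightarrow> \<bar>u (t *\<^sub>R x) - u x\<bar> \<le> K"
proof -
  obtain C where C: "0 \<le> C" "\<And>t x. 1/2 \<le> t \<Longrightarrow> t \<le> 2 \<Longrightarrow>
    (LINT y|lborel. \<bar>ln (norm (x - y) / norm (t *\<^sub>R x - y)) * f y\<bar>) \<le> C"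
    by (rule dilation_log_bound, rule that)
  obtain D where D: "0 \<le> D" "\<And>x. (LINT y|lborel. norm x powr (3/2) * (norm (x - y) powr - (3/2) * f y)) \<le> D"
    by (rule weighted_potential_bound[of "3/2"], simp, simp, rule that)
  define K where "K = 12 * D * m + C"
  have w_eq: "u (t *\<^sub>R x) - u x = (LINT y|lborel. ln (norm (x - y) / norm (t *\<^sub>R x - y)) * f y) / (2 * pi)" for t x
    by (rule log_potential)
  have w_bound: "\<bar>u (t *\<^sub>R x) - u x\<bar> \<le> C" if t: "1/2 \<le> t" "t \<le> 2" for t x
  proof -
    have "\<bar>LINT y|lborel. ln (norm (x - y) / norm (t *\<^sub>R x - y)) * f y\<bar> \<le> C"
      using integral_abs_bound[of lborel "\<lambda>y. ln (norm (x - y) / norm (t *\<^sub>R x - y)) * f y"] C(2)[OF t, of x] by linarith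
    then have "\<bar>u (t *\<^sub>R x) - u x\<bar> \<le> C / (2 * pi)"
      unfolding w_eq by (simp add: abs_divide divide_right_mono)
    also have "\<dots> \<le> C" using C(1) pi_ge_two mult_left_mono[of 1 "2 * pi" C] by (simp add: divide_le_eq)
    finally show ?thesis .
  qed
  have int: "integrable lborel (\<lambda>x. (u (t *\<^sub>R x) - u x) * f x)" if t: "1/2 \<le> t" "t \<le> 2" for t
  proof (rule Bochner_Integration.integrable_bound)
    show "integrable lborel (\<lambda>x. C * f x)" using f_int by simp
    show "AE x in lborel. norm ((u (t *\<^sub>R x) - u x) * f x) \<le> norm (C * f x)"
      using mult_right_mono[OF w_bound[OF t] f_nonneg] f_nonneg C(1) by (auto simp: abs_mult)
  qed measurable
  have low: "- (m\<^sup>2 * ln t + 12 * D * m * \<bar>t - 1\<bar> powr (3/2)) / (4 * pi) \<le> (LINT x|lborel. (u (t *\<^sub>R x) - u x) * f x)"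
    if t: "1/2 \<le> t" "t \<le> 2" for t
  proof -
    define G where "G = (\<lambda>(x, y). ln (norm (x - y) / norm (t *\<^sub>R x - y)) * f y * f x)"
    have [measurable]: "G \<in> borel_measurable borel" unfolding G_def borel_prod[symmetric] by measurable
    define Q where "Q = (\<lambda>(x, y). norm x powr (3/2) * (norm (x - y) powr - (3/2) * f y) * f x)"
    have [measurable]: "Q \<in> borel_measurable borel" unfolding Q_def borel_prod[symmetric] by measurable
    have Gi: "integrable (lborel \<Otimes>\<^sub>M lborel) G"
    proof (rule pair_integrable)
      show "integrable lborel (\<lambda>y. G (x, y))" for x
        using log_ratio_integrable[of x "t *\<^sub>R x"] by (simp add: G_def)
      show "(LINT y|lborel. \<bar>G (x, y)\<bar>) \<le> C * f x" for x
      proof -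
        have "(LINT y|lborel. \<bar>G (x, y)\<bar>) = (LINT y|lborel. \<bar>ln (norm (x - y) / norm (t *\<^sub>R x - y)) * f y\<bar>) * f x"
          using f_nonneg by (simp add: G_def abs_mult)
        with mult_right_mono[OF C(2)[OF t, of x] f_nonneg[of x]] show ?thesis by simp
      qed
    qed measurable
    have Qi: "integrable (lborel \<Otimes>\<^sub>M lborel) Q"
    proof (rule pair_integrable)
      show "integrable lborel (\<lambda>y. Q (x, y))" for x
        using powr_f(1)[of "3/2" x] by (simp add: Q_def)
      show "(LINT y|lborel. \<bar>Q (x, y)\<bar>) \<le> D * f x" for x
      proof -
        have "(LINT y|lborel. \<bar>Q (x, y)\<bar>) = (LINT y|lborel. norm x powr (3/2) * (norm (x - y) powr - (3/2) * f y)) * f x"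
          using f_nonneg by (simp add: Q_def abs_mult)
        with mult_right_mono[OF D(2)[of x] f_nonneg[of x]] show ?thesis by simp
      qed
    qed measurable
    \<comment> \<open>Adding the integrand with exchanged variables doubles the integral and brings
      in the sum of logarithms that \<open>dilation_product_bound\<close> controls.\<close>
    define swap where "swap = (\<lambda>h :: (real^2) \<times> (real^2) \<Rightarrow> real. \<lambda>(x, y). h (y, x))"
    have swap: "integrable (lborel \<Otimes>\<^sub>M lborel) (swap h)" "integral\<^sup>L (lborel \<Otimes>\<^sub>M lborel) (swap h) = integral\<^sup>L (lborel \<Otimes>\<^sub>M lborel) h"
      if "integrable (lborel \<Otimes>\<^sub>M lborel) h" for h
      using lborel_pair.integrable_product_swap[OF that] lborel_pair.integral_product_swap[of h] that
      by (auto simp: swap_def case_prod_unfold)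
    have J: "(LINT x|lborel. (u (t *\<^sub>R x) - u x) * f x) = integral\<^sup>L (lborel \<Otimes>\<^sub>M lborel) G / (2 * pi)"
    proof -
      have "(u (t *\<^sub>R x) - u x) * f x = (LINT y|lborel. G (x, y)) / (2 * pi)" for x
        unfolding w_eq G_def by simp
      then show ?thesis using lborel_pair.integral_fst'[OF Gi] by simp
    qed
    have Qv: "integral\<^sup>L (lborel \<Otimes>\<^sub>M lborel) Q \<le> D * m"
    proof -
      have "integral\<^sup>L (lborel \<Otimes>\<^sub>M lborel) Q = (LINT x|lborel. LINT y|lborel. Q (x, y))"
        by (rule lborel_pair.integral_fst'[OF Qi, symmetric])
      also have "\<dots> \<le> (LINT x|lborel. D * f x)"
        using lborel_pair.integrable_fst'[OF Qi] f_int mult_right_mono[OF D(2) f_nonneg]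
        by (intro integral_mono) (auto simp: Q_def)
      finally show ?thesis by (simp add: m_def)
    qed
    define L where "L = (\<lambda>(x, y). - ln t * (f x * f y) - 6 * \<bar>t - 1\<bar> powr (3/2) * (Q (x, y) + swap Q (x, y)))"
    have ff: "integrable (lborel \<Otimes>\<^sub>M lborel) (\<lambda>(x, y). f x * f y)"
      "integral\<^sup>L (lborel \<Otimes>\<^sub>M lborel) (\<lambda>(x, y). f x * f y) = m\<^sup>2"
    proof -
      show *: "integrable (lborel \<Otimes>\<^sub>M lborel) (\<lambda>(x, y). f x * f y)"
        by (rule pair_integrable[where B = m])
           (use f_int f_nonneg in \<open>auto simp: borel_prod[symmetric] abs_mult m_def\<close>)
      show "integral\<^sup>L (lborel \<Otimes>\<^sub>M lborel) (\<lambda>(x, y). f x * f y) = m\<^sup>2"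
        using lborel_pair.integral_fst'[OF *] by (simp add: m_def power2_eq_square)
    qed
    have Li: "integrable (lborel \<Otimes>\<^sub>M lborel) L"
      and Lv: "integral\<^sup>L (lborel \<Otimes>\<^sub>M lborel) L = - ln t * m\<^sup>2 - 6 * \<bar>t - 1\<bar> powr (3/2) * (2 * integral\<^sup>L (lborel \<Otimes>\<^sub>M lborel) Q)"
      unfolding L_def case_prod_unfold using ff Qi swap[OF Qi] by (simp_all add: case_prod_unfold)
    have "integral\<^sup>L (lborel \<Otimes>\<^sub>M lborel) L \<le> integral\<^sup>L (lborel \<Otimes>\<^sub>M lborel) (\<lambda>z. G z + swap G z)"
    proof (rule integral_mono_AE[OF Li])
      show "integrable (lborel \<Otimes>\<^sub>M lborel) (\<lambda>z. G z + swap G z)" using Gi swap(1)[OF Gi] by simp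
      have "AE z in lborel \<Otimes>\<^sub>M lborel. case z of (x::real^2, y::real^2) \<Rightarrow> y \<noteq> x \<and> y \<noteq> t *\<^sub>R x \<and> x \<noteq> t *\<^sub>R y"
      proof (rule lborel_pair.AE_pair_measure)
        show "{z \<in> space (lborel \<Otimes>\<^sub>M lborel). case z of (x::real^2, y::real^2) \<Rightarrow> y \<noteq> x \<and> y \<noteq> t *\<^sub>R x \<and> x \<noteq> t *\<^sub>R y} \<in> sets (lborel \<Otimes>\<^sub>M lborel)"
          by measurable
        show "AE x in lborel. AE y in lborel. case (x, y) of (x::real^2, y::real^2) \<Rightarrow> y \<noteq> x \<and> y \<noteq> t *\<^sub>R x \<and> x \<noteq> t *\<^sub>R y"
        proof (rule AE_I2)
          fix x :: "real^2"
          show "AE y in lborel. case (x, y) of (x::real^2, y::real^2) \<Rightarrow> y \<noteq> x \<and> y \<noteq> t *\<^sub>R x \<and> x \<noteq> t *\<^sub>R y"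
            using AE_lborel_singleton[of x] AE_lborel_singleton[of "t *\<^sub>R x"] AE_lborel_singleton[of "(1/t) *\<^sub>R x"]
            by eventually_elim (use t in auto)
        qed
      qed
      then show "AE z in lborel \<Otimes>\<^sub>M lborel. L z \<le> G z + swap G z"
      proof eventually_elim
        case (elim z)
        obtain x y where z: "z = (x, y)" by (cases z)
        have ne: "y \<noteq> x" "y \<noteq> t *\<^sub>R x" "x \<noteq> t *\<^sub>R y" using elim z by auto
        have "0 \<le> f x * f y" using f_nonneg by simp
        from mult_right_mono[OF dilation_product_bound[OF t ne] this]
        show ?case by (simp add: z L_def G_def Q_def swap_def norm_minus_commute[of y x] algebra_simps)
      qed
    qed
    also have "\<dots> = 2 * integral\<^sup>L (lborel \<Otimes>\<^sub>M lborel) G" using Gi swap[OF Gi] by simp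
    finally have 1: "- ln t * m\<^sup>2 - 6 * \<bar>t - 1\<bar> powr (3/2) * (2 * integral\<^sup>L (lborel \<Otimes>\<^sub>M lborel) Q) \<le> 2 * integral\<^sup>L (lborel \<Otimes>\<^sub>M lborel) G"
      unfolding Lv .
    have 2: "\<bar>t - 1\<bar> powr (3/2) * integral\<^sup>L (lborel \<Otimes>\<^sub>M lborel) Q \<le> \<bar>t - 1\<bar> powr (3/2) * (D * m)"
      using Qv by (intro mult_left_mono) auto
    have "- (m\<^sup>2 * ln t + 12 * D * m * \<bar>t - 1\<bar> powr (3/2)) \<le> 2 * integral\<^sup>L (lborel \<Otimes>\<^sub>M lborel) G"
      using 1 2 by (simp add: algebra_simps)
    from divide_right_mono[OF this, of "4 * pi"] show ?thesis unfolding J by simp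
  qed
  show ?thesis
  proof (rule that[of K, OF _ int])
    show "0 \<le> K" using C(1) D(1) m_nonneg by (simp add: K_def)
    fix t :: real assume t: "1/2 \<le> t" "t \<le> 2"
    have "12 * D * m * \<bar>t - 1\<bar> powr (3/2) \<le> K * \<bar>t - 1\<bar> powr (3/2)"
      using C(1) by (intro mult_right_mono) (auto simp: K_def)
    then show "- (m\<^sup>2 * ln t + K * \<bar>t - 1\<bar> powr (3/2)) / (4 * pi) \<le> (LINT x|lborel. (u (t *\<^sub>R x) - u x) * f x)"
      by (intro order_trans[OF divide_right_mono low[OF t]]) auto
    fix x :: "real^2"
    show "\<bar>u (t *\<^sub>R x) - u x\<bar> \<le> K"
      using w_bound[OF t, of x] D(1) m_nonneg by (simp add: K_def add_increasing)
  qed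
qed

text \<open>With \<open>w x = u (t x) - u x\<close>, the energy integrand of the dilated density is
  \<open>H * exp (lam * (w x + w y))\<close>. Replacing \<open>exp a\<close> by its minorant
  \<open>1 + a\<close> gives the left-hand side, using the symmetry of \<open>H\<close>; a change of
  variables evaluates the dilated energy exactly.\<close>

lemma dilation_energy:
  assumes t: "1/2 \<le> t" "t \<le> 2"
    and wi: "integrable lborel (\<lambda>x. (u (t *\<^sub>R x) - u x) * f x)" and wK: "\<And>x. \<bar>u (t *\<^sub>R x) - u x\<bar> \<le> K"
  shows "m + 2 * lam * (LINT x|lborel. (u (t *\<^sub>R x) - u x) * f x) \<le> t powr (\<mu> - 4) * m"
proof -
  define w where "w = (\<lambda>x. u (t *\<^sub>R x) - u x)"
  have [measurable]: "w \<in> borel_measurable borel" unfolding w_def by measurable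
  have K0: "0 \<le> K" using wK[of 0] by (rule order_trans[OF abs_ge_zero])
  have t0: "0 < t" "t \<noteq> 0" using t by auto
  define H where "H = (\<lambda>(x, y). v0 * (g x powr lam * (g y powr lam * norm (x - y) powr - \<mu>)))"
  define Ht where "Ht = (\<lambda>(x, y). v0 * (g (t *\<^sub>R x) powr lam * (g (t *\<^sub>R y) powr lam * norm (x - y) powr - \<mu>)))"
  have [measurable]: "H \<in> borel_measurable borel" "Ht \<in> borel_measurable borel"
    unfolding H_def Ht_def borel_prod[symmetric] by measurable
  have pi: "integrable lborel (\<lambda>y. g y powr lam * norm (x - y) powr - \<mu>)" for x
    by (rule pot_bound(1)[OF sols(1) zero_less_one]) (rule M0)
  have H0: "0 \<le> H z" "0 \<le> Ht z" for z using v0_pos by (auto simp: H_def Ht_def case_prod_unfold)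
  have Hf: "integrable lborel (\<lambda>y. H (x, y))" "(LINT y|lborel. H (x, y)) = f x" for x
    using pi[of x] by (auto simp: H_def rhs_def pot_def)
  have Htf: "integrable lborel (\<lambda>y. Ht (x, y))" "(LINT y|lborel. Ht (x, y)) = t powr (\<mu> - 2) * f (t *\<^sub>R x)" for x
  proof -
    define F where "F = (\<lambda>z. g z powr lam * norm (t *\<^sub>R x - z) powr - \<mu>)"
    have [measurable]: "F \<in> borel_measurable borel" unfolding F_def by measurable
    have F: "g (t *\<^sub>R y) powr lam * norm (x - y) powr - \<mu> = t powr \<mu> * F (0 + t *\<^sub>R y)" for y
    proof -
      have "norm (t *\<^sub>R x - t *\<^sub>R y) = t * norm (x - y)"
        using t0 by (simp flip: scaleR_diff_right)
      then show ?thesis using t0 by (simp add: F_def powr_mult powr_minus)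
    qed
    have i: "integrable lborel (\<lambda>y. F (0 + t *\<^sub>R y))"
      using integrable_lborel_affine[of F t 0] t0 pi[of "t *\<^sub>R x"] by (simp add: F_def)
    have "(LINT y|lborel. F y) = t\<^sup>2 * (LINT y|lborel. F (0 + t *\<^sub>R y))"
      using integral_lborel_affine[of F t 0] t0 by simp
    then have v: "(LINT y|lborel. F (0 + t *\<^sub>R y)) = pot g (t *\<^sub>R x) / t\<^sup>2"
      using t0 by (simp add: F_def pot_def)
    show "integrable lborel (\<lambda>y. Ht (x, y))"
      unfolding Ht_def prod.case F using i by simp
    have "t powr \<mu> / t\<^sup>2 = t powr (\<mu> - 2)" using t0 by (simp add: powr_diff powr_numeral)
    moreover have "(LINT y|lborel. Ht (x, y)) = v0 * (g (t *\<^sub>R x) powr lam * (t powr \<mu> * (pot g (t *\<^sub>R x) / t\<^sup>2)))"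
      unfolding Ht_def prod.case F using v by simp
    ultimately show "(LINT y|lborel. Ht (x, y)) = t powr (\<mu> - 2) * f (t *\<^sub>R x)"
      by (simp add: rhs_def \<open>t powr \<mu> / t\<^sup>2 = t powr (\<mu> - 2)\<close>[symmetric])
  qed
  have Hi: "integrable (lborel \<Otimes>\<^sub>M lborel) H"
    by (rule pair_integrable[where B = 1]) (use Hf H0 in auto)
  have bounded: "integrable (lborel \<Otimes>\<^sub>M lborel) (\<lambda>z. H z * h z)"
    if [measurable]: "h \<in> borel_measurable (borel \<Otimes>\<^sub>M borel)" and h: "\<And>z. \<bar>h z\<bar> \<le> K" for h
  proof (rule Bochner_Integration.integrable_bound[OF integrable_mult_right[OF Hi, of K]])
    have [measurable]: "H \<in> borel_measurable (borel \<Otimes>\<^sub>M borel)" by (simp add: borel_prod)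
    show "(\<lambda>z. H z * h z) \<in> borel_measurable (lborel \<Otimes>\<^sub>M lborel)" by measurable
    show "AE z in lborel \<Otimes>\<^sub>M lborel. norm (H z * h z) \<le> norm (K * H z)"
      using mult_left_mono[OF h H0(1)] H0 K0 by (auto simp: abs_mult mult.commute)
  qed
  have i1: "integrable (lborel \<Otimes>\<^sub>M lborel) (\<lambda>z. H z * w (fst z))"
    and i2: "integrable (lborel \<Otimes>\<^sub>M lborel) (\<lambda>z. H z * w (snd z))"
    using wK by (auto intro!: bounded simp: w_def)
  have v1: "integral\<^sup>L (lborel \<Otimes>\<^sub>M lborel) (\<lambda>z. H z * w (fst z)) = (LINT x|lborel. w x * f x)"
    using lborel_pair.integral_fst'[OF i1] Hf by (simp add: mult.commute)
  have v2: "integral\<^sup>L (lborel \<Otimes>\<^sub>M lborel) (\<lambda>z. H z * w (snd z)) = (LINT x|lborel. w x * f x)"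
  proof -
    have "H (y, x) = H (x, y)" for x y by (simp add: H_def norm_minus_commute mult_ac)
    then have "(\<lambda>(x, y). H (y, x) * w (snd (y, x))) = (\<lambda>z. H z * w (fst z))" by (auto simp: fun_eq_iff)
    then show ?thesis
      using lborel_pair.integral_product_swap[of "\<lambda>z. H z * w (snd z)"] i2 v1 by (simp add: borel_measurable_integrable)
  qed
  have Hv: "integral\<^sup>L (lborel \<Otimes>\<^sub>M lborel) H = m"
    using lborel_pair.integral_fst'[OF Hi] Hf by (simp add: m_def)
  have fti: "integrable lborel (\<lambda>x. f (0 + t *\<^sub>R x))" "(LINT x|lborel. f (0 + t *\<^sub>R x)) = m / t\<^sup>2"
    using integrable_lborel_affine[of f t 0] integral_lborel_affine[of f t 0] t0 f_int by (simp_all add: m_def)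
  have Hti: "integrable (lborel \<Otimes>\<^sub>M lborel) Ht"
  proof (rule lborel_pair.Fubini_integrable)
    show "Ht \<in> borel_measurable (lborel \<Otimes>\<^sub>M lborel)"
    proof -
      have "Ht \<in> borel_measurable (borel \<Otimes>\<^sub>M borel)" by (simp add: borel_prod)
      then show ?thesis by measurable
    qed
    show "integrable lborel (\<lambda>x. LINT y|lborel. norm (Ht (x, y)))"
      using H0 Htf fti(1) by simp
  qed (use Htf in auto)
  have Htv: "integral\<^sup>L (lborel \<Otimes>\<^sub>M lborel) Ht = t powr (\<mu> - 4) * m"
  proof -
    have "integral\<^sup>L (lborel \<Otimes>\<^sub>M lborel) Ht = t powr (\<mu> - 2) * (m / t\<^sup>2)"
      using lborel_pair.integral_fst'[OF Hti] Htf fti(2) by simp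
    also have "t powr (\<mu> - 2) / t\<^sup>2 = t powr (\<mu> - 4)"
      using t0 powr_diff[of t "\<mu> - 2" 2] by (simp add: powr_numeral)
    from this[symmetric] have "t powr (\<mu> - 2) * (m / t\<^sup>2) = t powr (\<mu> - 4) * m" by simp
    finally show ?thesis .
  qed
  have "m + 2 * lam * (LINT x|lborel. w x * f x) =
      integral\<^sup>L (lborel \<Otimes>\<^sub>M lborel) (\<lambda>z. H z + (lam * (H z * w (fst z)) + lam * (H z * w (snd z))))"
    using i1 i2 Hi v1 v2 Hv by simp
  also have "\<dots> \<le> integral\<^sup>L (lborel \<Otimes>\<^sub>M lborel) Ht"
  proof (rule integral_mono)
    fix z :: "(real^2) \<times> (real^2)"
    obtain x y where z: "z = (x, y)" by (cases z)
    have gt: "g (t *\<^sub>R x) powr lam = g x powr lam * exp (lam * w x)" for x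
      using g_pos by (simp add: powr_def w_def u_def exp_add[symmetric] algebra_simps less_imp_neq[OF g_pos, symmetric])
    have "Ht z = H z * exp (lam * w x + lam * w y)"
      unfolding Ht_def H_def z prod.case gt by (simp add: exp_add mult_ac)
    also have "\<dots> \<ge> H z * (1 + (lam * w x + lam * w y))"
      using H0 exp_ge_add_one_self by (intro mult_left_mono) auto
    finally show "H z + (lam * (H z * w (fst z)) + lam * (H z * w (snd z))) \<le> Ht z"
      by (simp add: z algebra_simps)
  qed (use Hi i1 i2 Hti in auto)
  finally show ?thesis unfolding Htv w_def .
qed

text \<open>The two dilation estimates combine to an inequality whose sides both vanish at
  \<open>t = 1\<close>. Divided by \<open>|t - 1|\<close> it gives
  \<open>lam * m^2 / (2 * pi) \<ge> 4 * lam * m\<close> as \<open>t\<close> decreases to 1, and the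
  reverse as \<open>t\<close> increases to 1.\<close>

theorem mass_eq: "m = 8 * pi"
proof -
  obtain K where K: "0 \<le> K"
    "\<And>t. 1/2 \<le> t \<Longrightarrow> t \<le> 2 \<Longrightarrow> integrable lborel (\<lambda>x. (u (t *\<^sub>R x) - u x) * f x)"
    "\<And>t. 1/2 \<le> t \<Longrightarrow> t \<le> 2 \<Longrightarrow>
      - (m\<^sup>2 * ln t + K * \<bar>t - 1\<bar> powr (3/2)) / (4 * pi) \<le> (LINT x|lborel. (u (t *\<^sub>R x) - u x) * f x)"
    "\<And>t x. 1/2 \<le> t \<Longrightarrow> t \<le> 2 \<Longrightarrow> \<bar>u (t *\<^sub>R x) - u x\<bar> \<le> K"
    by (rule dilation_difference_lower, rule that)
  define c where "c = lam / (2 * pi)"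
  have main: "- c * (m\<^sup>2 * ln t + K * \<bar>t - 1\<bar> powr (3/2)) \<le> (t powr (\<mu> - 4) - 1) * m"
    if t: "1/2 \<le> t" "t \<le> 2" for t
  proof -
    have "2 * lam * (- (m\<^sup>2 * ln t + K * \<bar>t - 1\<bar> powr (3/2)) / (4 * pi)) \<le> 2 * lam * (LINT x|lborel. (u (t *\<^sub>R x) - u x) * f x)"
      using K(3)[OF t] lam_bounds by (intro mult_left_mono) auto
    moreover have "2 * lam * (- A / (4 * pi)) = - c * A" for A
      by (simp add: c_def)
    note this[of "m\<^sup>2 * ln t + K * \<bar>t - 1\<bar> powr (3/2)"]
    ultimately show ?thesis
      using dilation_energy[OF t K(2)[OF t] K(4)[OF t]] unfolding left_diff_distrib by linarith
  qed
  have m: "0 < m" using mass_gt pi_gt_zero by linarith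
  have lam4: "\<mu> - 4 = - 4 * lam" by (simp add: lam)
  define a where "a = - 4 * lam"
  have scale: "N * (- c * (A * L + B * P)) = - c * (A * (N * L) + B * (N * P))" for N A L B P
    by (simp add: algebra_simps)
  have main': "- c * (m\<^sup>2 * ln t + K * \<bar>t - 1\<bar> powr (3/2)) \<le> (t powr a - 1) * m"
    if t: "1/2 \<le> t" "t \<le> 2" for t using main[OF t] unfolding lam4 a_def .
  \<comment> \<open>Here \<open>t = 1 + 1 / real (n + 1)\<close>; the shift keeps
    \<open>t \<le> 2\<close> from \<open>n = 0\<close> on.\<close>
  have "- c * (m\<^sup>2 * 1 + K * 0) \<le> a * m"
  proof (rule LIMSEQ_le)
    have "(\<lambda>n. real (n + 1) * ((1 + 1 / real (n + 1)) powr a - 1)) \<longlonglongrightarrow> a" by real_asymp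
    then show "(\<lambda>n. (real (n + 1) * ((1 + 1 / real (n + 1)) powr a - 1)) * m) \<longlonglongrightarrow> a * m"
      by (intro tendsto_intros)
    show "(\<lambda>n. - c * (m\<^sup>2 * (real (n + 1) * ln (1 + 1 / real (n + 1)))
        + K * (real (n + 1) * (1 / real (n + 1)) powr (3/2)))) \<longlonglongrightarrow> - c * (m\<^sup>2 * 1 + K * 0)"
      by (intro tendsto_intros) real_asymp+
    show "\<exists>N. \<forall>n\<ge>N. - c * (m\<^sup>2 * (real (n + 1) * ln (1 + 1 / real (n + 1)))
        + K * (real (n + 1) * (1 / real (n + 1)) powr (3/2))) \<le> (real (n + 1) * ((1 + 1 / real (n + 1)) powr a - 1)) * m"
    proof (intro exI[of _ 0] allI impI)
      fix n :: nat
      have "- c * (m\<^sup>2 * ln (1 + 1 / real (n + 1)) + K * (1 / real (n + 1)) powr (3/2))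
         \<le> ((1 + 1 / real (n + 1)) powr a - 1) * m"
        using main'[of "1 + 1 / real (n + 1)"] by simp
      from mult_left_mono[OF this, of "real (n + 1)", unfolded scale]
      show "- c * (m\<^sup>2 * (real (n + 1) * ln (1 + 1 / real (n + 1)))
        + K * (real (n + 1) * (1 / real (n + 1)) powr (3/2))) \<le> (real (n + 1) * ((1 + 1 / real (n + 1)) powr a - 1)) * m"
        by (simp add: mult.assoc)
    qed
  qed
  then have "lam * (m * (8 * pi)) \<le> lam * (m * m)" by (simp add: a_def c_def field_simps power2_eq_square)
  then have 1: "8 * pi \<le> m" using lam_bounds m by simp
  \<comment> \<open>Here \<open>t = 1 - 1 / real (n + 2)\<close>; the shift by two keeps
    \<open>t \<ge> 1/2\<close>.\<close>
  have "a * m \<le> - c * (m\<^sup>2 * 1 - K * 0)"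
  proof (rule LIMSEQ_le)
    have "(\<lambda>n. real (n + 2) * (1 - (1 - 1 / real (n + 2)) powr a)) \<longlonglongrightarrow> a" by real_asymp
    then show "(\<lambda>n. (real (n + 2) * (1 - (1 - 1 / real (n + 2)) powr a)) * m) \<longlonglongrightarrow> a * m"
      by (intro tendsto_intros)
    show "(\<lambda>n. - c * (m\<^sup>2 * (real (n + 2) * (- ln (1 - 1 / real (n + 2))))
        - K * (real (n + 2) * (1 / real (n + 2)) powr (3/2)))) \<longlonglongrightarrow> - c * (m\<^sup>2 * 1 - K * 0)"
      by (intro tendsto_intros) real_asymp+
    show "\<exists>N. \<forall>n\<ge>N. (real (n + 2) * (1 - (1 - 1 / real (n + 2)) powr a)) * m
       \<le> - c * (m\<^sup>2 * (real (n + 2) * (- ln (1 - 1 / real (n + 2))))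
        - K * (real (n + 2) * (1 / real (n + 2)) powr (3/2)))"
    proof (intro exI[of _ 0] allI impI)
      fix n :: nat
      have "1 / real (n + 2) \<le> 1 / 2" by (simp add: field_simps)
      moreover have "1 - 1 / real (n + 2) \<le> 2" using divide_nonneg_nonneg[of 1 "real (n + 2)"] by linarith
      moreover have "\<bar>1 - 1 / real (n + 2) - 1\<bar> = 1 / real (n + 2)" by simp
      ultimately have "- c * (m\<^sup>2 * ln (1 - 1 / real (n + 2)) + K * (1 / real (n + 2)) powr (3/2))
         \<le> ((1 - 1 / real (n + 2)) powr a - 1) * m"
        using main'[of "1 - 1 / real (n + 2)"] by (simp only:)
      from mult_left_mono[OF this, of "real (n + 2)", unfolded scale]
      show "(real (n + 2) * (1 - (1 - 1 / real (n + 2)) powr a)) * m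
       \<le> - c * (m\<^sup>2 * (real (n + 2) * (- ln (1 - 1 / real (n + 2))))
        - K * (real (n + 2) * (1 / real (n + 2)) powr (3/2)))"
        by (simp add: left_diff_distrib right_diff_distrib distrib_left mult.assoc)
    qed
  qed
  then have "lam * (m * m) \<le> lam * (m * (8 * pi))" by (simp add: a_def c_def field_simps power2_eq_square)
  then have 2: "m \<le> 8 * pi" using lam_bounds m by simp
  show ?thesis using 1 2 by simp
qed

end

section \<open>Compactness and blow-up\<close>

lemma dominated_convergence_eventually:
  fixes s :: "nat \<Rightarrow> 'a \<Rightarrow> real"
  assumes "f \<in> borel_measurable M" "\<And>n. s n \<in> borel_measurable M" "integrable M w"
    and "AE x in M. (\<lambda>n. s n x) \<longlonglongrightarrow> f x" "eventually (\<lambda>n. \<forall>x. \<bar>s n x\<bar> \<le> w x) sequentially"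
  shows "(\<lambda>n. integral\<^sup>L M (s n)) \<longlonglongrightarrow> integral\<^sup>L M f"
proof -
  obtain N where N: "\<And>n x. n \<ge> N \<Longrightarrow> \<bar>s n x\<bar> \<le> w x"
    using assms(5) by (auto simp: eventually_sequentially)
  have "(\<lambda>n. integral\<^sup>L M (s (n + N))) \<longlonglongrightarrow> integral\<^sup>L M f"
  proof (rule integral_dominated_convergence[where w = w])
    show "AE x in M. (\<lambda>n. s (n + N) x) \<longlonglongrightarrow> f x"
      using assms(4) by eventually_elim (rule LIMSEQ_ignore_initial_segment)
  qed (use assms N in auto)
  then show ?thesis by (rule LIMSEQ_offset)
qed

lemma fatou_real:
  fixes s :: "nat \<Rightarrow> 'a \<Rightarrow> real"
  assumes f: "f \<in> borel_measurable M" and s: "\<And>n. integrable M (s n)" "\<And>n x. 0 \<le> s n x"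
    and lim: "\<And>x. (\<lambda>n. s n x) \<longlonglongrightarrow> f x" and c: "\<And>n. integral\<^sup>L M (s n) \<le> c"
  shows "integrable M f" "integral\<^sup>L M f \<le> c"
proof -
  have f0: "0 \<le> f x" for x using s(2) by (intro LIMSEQ_le_const[OF lim]) auto
  have "(\<integral>\<^sup>+x. ennreal (f x) \<partial>M) = (\<integral>\<^sup>+x. liminf (\<lambda>n. ennreal (s n x)) \<partial>M)"
  proof (rule nn_integral_cong)
    fix x
    have "(\<lambda>n. ennreal (s n x)) \<longlonglongrightarrow> ennreal (f x)" using lim by (rule tendsto_ennrealI)
    then show "ennreal (f x) = liminf (\<lambda>n. ennreal (s n x))"
      using lim_imp_Liminf trivial_limit_sequentially by metis
  qed
  also have "\<dots> \<le> liminf (\<lambda>n. \<integral>\<^sup>+x. ennreal (s n x) \<partial>M)"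
    using s(1) by (intro nn_integral_liminf) auto
  also have "\<dots> \<le> liminf (\<lambda>n::nat. ennreal c)"
  proof (intro Liminf_mono always_eventually allI)
    fix n
    have "(\<integral>\<^sup>+x. ennreal (s n x) \<partial>M) = ennreal (integral\<^sup>L M (s n))"
      using s by (intro nn_integral_eq_integral) auto
    then show "(\<integral>\<^sup>+x. ennreal (s n x) \<partial>M) \<le> ennreal c" using c by (simp add: ennreal_leI)
  qed
  also have "\<dots> = ennreal c" by (simp add: Liminf_const)
  finally have b: "(\<integral>\<^sup>+x. ennreal (f x) \<partial>M) \<le> ennreal c" .
  show i: "integrable M f"
    using f f0 b by (intro integrableI_nonneg) (auto intro: le_less_trans)
  have "0 \<le> c" using order_trans[OF Bochner_Integration.integral_nonneg c] s(2) by blast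
  have "ennreal (integral\<^sup>L M f) \<le> ennreal c"
    using b nn_integral_eq_integral[OF i] f0 by simp
  then show "integral\<^sup>L M f \<le> c" using \<open>0 \<le> c\<close> by simp
qed

lemma integrable_indicator_ball: "integrable lborel (indicator (ball (x::'a::euclidean_space) r) :: 'a \<Rightarrow> real)"
  using emeasure_bounded_finite[of "ball x r"] by (intro integrable_real_indicator) auto

text \<open>The symmetric difference lies in the annulus about \<open>x\<close> between the radii
  \<open>r - d\<close> and \<open>r + d\<close>.\<close>

lemma ball_indicator_difference:
  fixes x x' :: "real^2"
  assumes d: "norm (x - x') \<le> d" "d \<le> r"
  shows "integrable lborel (\<lambda>y. \<bar>indicator (ball x r) y - indicator (ball x' r) y\<bar> :: real)"
    and "(LINT y|lborel. \<bar>indicator (ball x r) y - indicator (ball x' r) y\<bar> :: real) \<le> 4 * pi * r * d"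
proof -
  have d0: "0 \<le> d" using d(1) norm_ge_zero order_trans by blast
  have ind: "integrable lborel (indicator (ball x s) :: real^2 \<Rightarrow> real)" for x s
    by (rule integrable_indicator_ball)
  show i: "integrable lborel (\<lambda>y. \<bar>indicator (ball x r) y - indicator (ball x' r) y\<bar> :: real)"
    using ind by (intro integrable_abs Bochner_Integration.integrable_diff)
  have "(LINT y|lborel. \<bar>indicator (ball x r) y - indicator (ball x' r) y\<bar> :: real) \<le>
    (LINT y|lborel. indicator (ball x (r + d)) y - indicator (ball x (r - d)) y)"
  proof (rule integral_mono[OF i])
    fix y
    have "dist x y \<le> dist x' y + d" "dist x' y \<le> dist x y + d"
      using dist_triangle[of x y x'] dist_triangle[of x' y x] d(1) by (auto simp: dist_norm norm_minus_commute)
    then show "\<bar>indicator (ball x r) y - indicator (ball x' r) y\<bar> \<le> (indicator (ball x (r + d)) y - indicator (ball x (r - d)) y :: real)"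
      using d0 by (auto simp: indicator_def)
  qed (use ind in simp)
  also have "\<dots> = pi * (r + d)\<^sup>2 - pi * (r - d)\<^sup>2"
    using ind d0 d(2) by (simp add: lebesgue_ball_real2)
  also have "\<dots> = 4 * pi * r * d" by (simp add: power2_eq_square algebra_simps)
  finally show "(LINT y|lborel. \<bar>indicator (ball x r) y - indicator (ball x' r) y\<bar> :: real) \<le> 4 * pi * r * d" .
qed

section \<open>Bounds for normalized solutions\<close>

context hartree
begin

text \<open>The 4 is the constant of almost maximality that selected centers satisfy, after the
  value at the center is normalized to 1.\<close>

definition "rhs4 = rhs_const 4 * 4 powr lam"

lemma rhs4_bound:
  assumes "solution D V h" "\<And>y. y \<in> ball x 1 \<Longrightarrow> h y \<le> 4"
  shows "rhs V h x \<le> rhs4"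
proof -
  have "rhs V h x \<le> rhs_const 4 * (h x * 1\<^sup>2) powr lam / 1\<^sup>2"
    using solutionD(1,2)[OF assms(1)] by (rule rhs_bound) (use assms(2) in auto)
  also have "\<dots> \<le> rhs4"
    unfolding rhs4_def using rhs_const_pos[of 4] solutionD(8)[OF assms(1)] lam_bounds assms(2)[of x]
    by (auto intro!: mult_left_mono powr_mono2 intro: less_imp_le)
  finally show ?thesis .
qed

lemma rhs4_nonneg: "0 \<le> rhs4" using rhs_const_pos[of 4] by (simp add: rhs4_def)

lemma set_integrable_ball_const: "set_integrable lborel (ball (x::real^2) r) (\<lambda>y. c :: real)"
  unfolding set_integrable_def real_scaleR_def by (intro integrable_mult_left integrable_indicator_ball)

text \<open>Arithmetic of three mean value estimates: \<open>r\<close> stands for the area of a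
  ball, or for the area from which those of concentric balls are obtained, and the numerators stand
  for integrals over balls.\<close>

lemma mean_value_arithmetic:
  fixes a b c d e r s :: real
  shows "0 \<le> c / r + d \<Longrightarrow> 0 < r \<Longrightarrow> r * b - c \<le> r * (b + d)"
    and "a \<le> s \<Longrightarrow> a = r * b - c \<Longrightarrow> s \<le> 4 * r * d \<Longrightarrow> c / r \<le> e \<Longrightarrow> 0 < r \<Longrightarrow> b - 4 * d \<le> e"
    and "0 < r \<Longrightarrow> a / (r / 4) \<le> b / (4 * r) + d \<Longrightarrow> - s \<le> a \<Longrightarrow> b \<le> c - e \<Longrightarrow> - s \<le> r / 4 * ((c - e) / (4 * r) + d)"
proof -
  show "- s \<le> r / 4 * ((c - e) / (4 * r) + d)"
    if "0 < r" "a / (r / 4) \<le> b / (4 * r) + d" "- s \<le> a" "b \<le> c - e"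
  proof -
    have "a \<le> r / 4 * (b / (4 * r) + d)" using that(1,2) by (simp add: divide_le_eq mult.commute)
    also have "\<dots> \<le> r / 4 * ((c - e) / (4 * r) + d)"
      using that by (intro mult_left_mono add_mono divide_right_mono) auto
    finally show ?thesis using that(3) by linarith
  qed
  show "r * b - c \<le> r * (b + d)" if "0 \<le> c / r + d" "0 < r"
    using that by (simp add: field_simps)
  show "b - 4 * d \<le> e" if "a \<le> s" "a = r * b - c" "s \<le> 4 * r * d" "c / r \<le> e" "0 < r"
  proof -
    have "r * (b - 4 * d) \<le> c" using that by (simp add: algebra_simps)
    then have "b - 4 * d \<le> c / r" using that(5) by (simp add: pos_le_divide_eq mult.commute)
    with that(4) show ?thesis by linarith
  qed
qed

text \<open>A Harnack argument for the nonnegative function \<open>ln 4 - ln h\<close>. Green's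
  formula at 0, where \<open>ln h\<close> vanishes, bounds its integral over
  \<open>ball 0 (2 * L)\<close>. That ball contains \<open>ball x L\<close>, and superharmonicity
  passes from the mean over the latter to the point. The factor 4 is the ratio of the areas.\<close>

lemma normalized_solution_lower_bound:
  assumes L: "1 \<le> L" "2 * L + 1 < \<rho>" and s: "solution (ball 0 \<rho>) V h" and h: "h 0 = 1" "\<And>y. y \<in> ball 0 \<rho> \<Longrightarrow> h y \<le> 4"
    and x: "norm x \<le> L"
  shows "ln 4 - 4 * (ln 4 + rhs4 * (LINT z|lborel. green_kernel (2 * L) z)) \<le> ln (h x)"
proof -
  note sol = solutionD[OF s]
  define I where "I = (LINT z|lborel. green_kernel (2 * L) z)"
  define S where "S = (LINT y:ball 0 (2 * L)|lborel. ln 4 - ln (h y))"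
  have sub: "cball 0 (2 * L) \<subseteq> ball 0 \<rho>" using L by auto
  have subx: "ball x L \<subseteq> ball 0 (2 * L)" "cball x L \<subseteq> ball 0 \<rho>"
  proof -
    have tri: "norm y \<le> norm (x - y) + L" for y using norm_triangle_ineq2[of y x] x by (simp add: norm_minus_commute)
    show "ball x L \<subseteq> ball 0 (2 * L)"
    proof
      fix y assume "y \<in> ball x L"
      then show "y \<in> ball 0 (2 * L)" using tri[of y] by (simp add: dist_norm)
    qed
    show "cball x L \<subseteq> ball 0 \<rho>"
    proof
      fix y assume "y \<in> cball x L"
      then show "y \<in> ball 0 \<rho>" using tri[of y] L by (simp add: dist_norm)
    qed
  qed
  note mv0 = solution_mean_value[OF s open_ball sub]
  note mvx = solution_mean_value[OF s open_ball subx(2)]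
  have int: "set_integrable lborel (ball 0 (2 * L)) (\<lambda>y. ln 4 - ln (h y))"
    using mv0(1) L set_integrable_ball_const by (intro set_integral_diff) auto
  have "(LINT y|lborel. green_kernel (2 * L) (0 - y) * rhs V h y) \<le> \<bar>LINT y|lborel. green_kernel (2 * L) (0 - y) * rhs V h y\<bar>" by simp
  also have "\<dots> \<le> rhs4 * I"
    unfolding I_def
  proof (rule green_kernel_mult_integrable(2))
    fix y :: "real^2" assume "y \<in> ball 0 (2 * L)"
    then have y: "norm y < 2 * L" by simp
    have "rhs V h y \<le> rhs4"
    proof (rule rhs4_bound[OF s])
      fix z assume "z \<in> ball y 1"
      then have "norm z < \<rho>" using y L norm_triangle_ineq2[of z y] by (simp add: dist_norm norm_minus_commute)
      then show "h z \<le> 4" using h(2) by simp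
    qed
    then show "\<bar>rhs V h y\<bar> \<le> rhs4" using rhs_nonneg[OF sol(2)] by simp
  qed (use L sol(6,7) in auto)
  finally have "0 \<le> (LINT y:ball 0 (2 * L)|lborel. ln (h y)) / (pi * (2 * L)\<^sup>2) + rhs4 * I"
    using sol(5)[OF _ sub] h(1) L by simp
  moreover have "S = pi * (2 * L)\<^sup>2 * ln 4 - (LINT y:ball 0 (2 * L)|lborel. ln (h y))"
  proof -
    have "S = (LINT y:ball (0::real^2) (2 * L)|lborel. ln 4) - (LINT y:ball 0 (2 * L)|lborel. ln (h y))"
      unfolding S_def using mv0(1) L by (intro set_integral_diff set_integrable_ball_const) auto
    then show ?thesis using L by (simp add: set_lebesgue_integral_def lebesgue_ball_real2)
  qed
  ultimately have S: "S \<le> pi * (2 * L)\<^sup>2 * (ln 4 + rhs4 * I)"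
    using mean_value_arithmetic(1)[of "LINT y:ball 0 (2 * L)|lborel. ln (h y)" "pi * (2 * L)\<^sup>2" "rhs4 * I" "ln 4"] L
    by (simp only: mult_pos_pos pi_gt_zero) simp
  have ln4: "y \<in> ball 0 \<rho> \<Longrightarrow> ln (h y) \<le> ln 4" for y using h(2)[of y] sol(4)[of y] by simp
  have intx: "set_integrable lborel (ball x L) (\<lambda>y. ln 4 - ln (h y))"
    using mvx(1) L set_integrable_ball_const by (intro set_integral_diff) auto
  have "(LINT y:ball x L|lborel. ln 4 - ln (h y)) \<le> S"
    unfolding S_def set_lebesgue_integral_def
  proof (rule integral_mono)
    fix y
    show "indicator (ball x L) y *\<^sub>R (ln 4 - ln (h y)) \<le> indicator (ball 0 (2 * L)) y *\<^sub>R (ln 4 - ln (h y))"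
    proof (cases "y \<in> ball 0 (2 * L)")
      case True
      then have "ln (h y) \<le> ln 4" using subsetD[OF sub, of y] by (intro ln4) auto
      then show ?thesis using True by (cases "y \<in> ball x L") (simp_all del: mem_ball)
    next
      case False
      then have "y \<notin> ball x L" using subx(1) by blast
      with False show ?thesis by (simp del: mem_ball)
    qed
  qed (use int intx in \<open>auto simp: set_integrable_def\<close>)
  moreover have "(LINT y:ball x L|lborel. ln 4 - ln (h y)) = pi * L\<^sup>2 * ln 4 - (LINT y:ball x L|lborel. ln (h y))"
  proof -
    have "(LINT y:ball x L|lborel. ln 4 - ln (h y)) = (LINT y:ball x L|lborel. ln 4) - (LINT y:ball x L|lborel. ln (h y))"
      using mvx(1) L by (intro set_integral_diff set_integrable_ball_const) auto
    then show ?thesis using L by (simp add: set_lebesgue_integral_def lebesgue_ball_real2)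
  qed
  moreover have "S \<le> 4 * (pi * L\<^sup>2) * (ln 4 + rhs4 * I)" using S by (simp add: power_mult_distrib)
  ultimately show ?thesis
    unfolding I_def[symmetric] by (rule mean_value_arithmetic(2)[OF _ _ _ mvx(4)]) (use L in auto)
qed

text \<open>Green's formula on unit balls: the mean varies with the area of the symmetric difference
  of the balls, the potential with the logarithm of a ratio of distances.\<close>

lemma normalized_solution_lipschitz:
  assumes L: "0 \<le> L" "L + 4 < \<rho>" and s: "solution (ball 0 \<rho>) V h" and h: "\<And>y. y \<in> ball 0 \<rho> \<Longrightarrow> h y \<le> 4"
    and C: "\<And>y. norm y \<le> L + 1 \<Longrightarrow> \<bar>ln (h y)\<bar> \<le> C"
    and x: "norm x \<le> L" "norm x' \<le> L" "norm (x - x') \<le> 1"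
  shows "\<bar>ln (h x) - ln (h x')\<bar> \<le> (4 * C + 10 * pi * rhs4) * norm (x - x')"
proof -
  note sol = solutionD[OF s]
  define d where "d = norm (x - x')"
  have C0: "0 \<le> C" using C[of 0] L by (auto intro: order_trans[OF abs_ge_zero])
  have tri: "norm y \<le> norm (z - y) + norm z" for y z :: "real^2"
    using norm_triangle_ineq2[of y z] by (simp add: norm_minus_commute)
  have "cball z 1 \<subseteq> ball 0 \<rho>" if "norm z \<le> L" for z :: "real^2"
  proof
    fix y assume "y \<in> cball z 1"
    then show "y \<in> ball 0 \<rho>" using tri[of y z] that L by (simp add: dist_norm)
  qed
  then have sub: "cball x 1 \<subseteq> ball 0 \<rho>" "cball x' 1 \<subseteq> ball 0 \<rho>" using x by auto
  note mvx = solution_mean_value[OF s open_ball sub(1)] note mvx' = solution_mean_value[OF s open_ball sub(2)]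
  have A: "\<bar>(LINT y:ball x 1|lborel. ln (h y)) - (LINT y:ball x' 1|lborel. ln (h y))\<bar> \<le> C * (4 * pi * 1 * d)"
  proof -
    have i: "integrable lborel (\<lambda>y. indicator (ball x 1) y * ln (h y))" "integrable lborel (\<lambda>y. indicator (ball x' 1) y * ln (h y))"
      using mvx(1) mvx'(1) by (auto simp: set_integrable_def)
    have "\<bar>(LINT y:ball x 1|lborel. ln (h y)) - (LINT y:ball x' 1|lborel. ln (h y))\<bar>
        = norm (LINT y|lborel. indicator (ball x 1) y * ln (h y) - indicator (ball x' 1) y * ln (h y))"
      using i by (simp add: set_lebesgue_integral_def)
    also have "\<dots> \<le> (LINT y|lborel. C * \<bar>indicator (ball x 1) y - indicator (ball x' 1) y\<bar>)"
    proof (rule Bochner_Integration.integral_norm_bound_integral)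
      fix y
      have "\<bar>ln (h y)\<bar> \<le> C" if "y \<in> ball x 1 \<or> y \<in> ball x' 1"
        using that tri[of y x] tri[of y x'] x by (intro C) (auto simp: dist_norm)
      then show "norm (indicator (ball x 1) y * ln (h y) - indicator (ball x' 1) y * ln (h y)) \<le> C * \<bar>indicator (ball x 1) y - indicator (ball x' 1) y\<bar>"
        by (auto simp: indicator_def)
    qed (use i ball_indicator_difference(1)[of x x' d 1] x(3) in \<open>auto simp: d_def\<close>)
    also have "\<dots> \<le> C * (4 * pi * 1 * d)"
      using ball_indicator_difference(2)[of x x' d 1] x(3) C0 by (auto simp: d_def intro: mult_left_mono)
    finally show ?thesis .
  qed
  have B: "\<bar>(LINT y|lborel. green_kernel 1 (x - y) * rhs V h y) - (LINT y|lborel. green_kernel 1 (x' - y) * rhs V h y)\<bar>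
     \<le> rhs4 * d * (10 * pi)"
  proof -
    define k where "k = (\<lambda>r (x::real^2) y. indicator (ball x r) y * norm (x - y) powr - 1 :: real)"
    have k: "integrable lborel (k r x)" "(LINT y|lborel. k r x y) = 2 * pi * r" if "0 < r" for r and x :: "real^2"
      unfolding k_def using norm_powr_ball_shift[of r 1 x] that by simp_all
    have k0: "0 \<le> k r x y" for r y and x :: "real^2" by (simp add: k_def)
    have "\<bar>(LINT y|lborel. green_kernel 1 (x - y) * rhs V h y) - (LINT y|lborel. green_kernel 1 (x' - y) * rhs V h y)\<bar>
      = \<bar>LINT y|lborel. green_kernel 1 (x - y) * rhs V h y - green_kernel 1 (x' - y) * rhs V h y\<bar>"
      using mvx(2) mvx'(2) by simp
    also have "\<dots> \<le> (LINT y|lborel. \<bar>green_kernel 1 (x - y) * rhs V h y - green_kernel 1 (x' - y) * rhs V h y\<bar>)"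
      by (rule integral_abs_bound)
    \<comment> \<open>At distance 2 or more from \<open>x\<close> both kernels vanish, since
      \<open>norm (x - x') \<le> 1\<close>; the remaining points are within 3 of \<open>x'\<close>.
      The two integrals are \<open>4 * pi\<close> and \<open>6 * pi\<close>, whence
      \<open>10 * pi\<close>.\<close>
    also have "\<dots> \<le> (LINT y|lborel. rhs4 * d * (k 2 x y + k 3 x' y))"
    proof (rule integral_mono_AE)
      show "AE y in lborel. \<bar>green_kernel 1 (x - y) * rhs V h y - green_kernel 1 (x' - y) * rhs V h y\<bar> \<le> rhs4 * d * (k 2 x y + k 3 x' y)"
        using AE_lborel_singleton[of x] AE_lborel_singleton[of x']
      proof eventually_elim
        case (elim y)
        have d1: "d \<le> 1" "0 \<le> d" using x(3) by (auto simp: d_def)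
        have xy: "norm (x' - y) \<le> norm (x - y) + d" "norm (x - y) \<le> norm (x' - y) + d"
          using norm_triangle_ineq[of "x - y" "x' - x"] norm_triangle_ineq[of "x' - y" "x - x'"]
          by (auto simp: d_def norm_minus_commute algebra_simps)
        show ?case
        proof (cases "norm (x - y) < 2")
          case True
          have "\<bar>green_kernel 1 (x - y) - green_kernel 1 (x' - y)\<bar> \<le> \<bar>ln (norm (x' - y) / norm (x - y))\<bar> / (2 * pi)"
            using elim by (intro green_kernel_abs_diff) auto
          also have "\<dots> \<le> \<bar>ln (norm (x' - y) / norm (x - y))\<bar>"
            using pi_ge_two mult_left_mono[of 1 "2 * pi" "\<bar>ln (norm (x' - y) / norm (x - y))\<bar>"] by (simp add: divide_le_eq)
          also have "\<dots> \<le> d * (norm (x' - y) powr - 1 + norm (x - y) powr - 1)"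
            unfolding d_def using elim by (intro abs_ln_norm_ratio_le)
          also have "\<dots> = d * (k 2 x y + k 3 x' y)"
            using True xy d1 by (simp add: k_def dist_norm add.commute)
          finally have g: "\<bar>green_kernel 1 (x - y) - green_kernel 1 (x' - y)\<bar> \<le> d * (k 2 x y + k 3 x' y)" .
          have "rhs V h y \<le> rhs4"
          proof (rule rhs4_bound[OF s])
            fix z assume "z \<in> ball y 1"
            then have "norm z < \<rho>" using True L x(1) tri[of z y] tri[of y x] by (simp add: dist_norm norm_minus_commute)
            then show "h z \<le> 4" using h by simp
          qed
          then have "\<bar>green_kernel 1 (x - y) - green_kernel 1 (x' - y)\<bar> * rhs V h y \<le> (d * (k 2 x y + k 3 x' y)) * rhs4"
            using g rhs_nonneg[OF sol(2)] by (intro mult_mono order_trans[OF abs_ge_zero g]) auto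
          then show ?thesis using rhs_nonneg[OF sol(2), of h y]
            by (simp add: left_diff_distrib[symmetric] abs_mult mult_ac)
        next
          case False
          then have "green_kernel 1 (x - y) = 0" "green_kernel 1 (x' - y) = 0" using xy d1 by (auto simp: green_kernel_def)
          then show ?thesis using rhs4_nonneg d1 k0 by simp
        qed
      qed
    qed (use mvx(2) mvx'(2) k in auto)
    also have "\<dots> = rhs4 * d * (10 * pi)" using k by simp
    finally show ?thesis .
  qed
  define a b a' b' where "a = (LINT y:ball x 1|lborel. ln (h y))" and "b = (LINT y|lborel. green_kernel 1 (x - y) * rhs V h y)"
    and "a' = (LINT y:ball x' 1|lborel. ln (h y))" and "b' = (LINT y|lborel. green_kernel 1 (x' - y) * rhs V h y)"
  have e: "ln (h x) = a / pi + b" "ln (h x') = a' / pi + b'"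
    using sol(5)[OF zero_less_one sub(1)] sol(5)[OF zero_less_one sub(2)] by (auto simp: a_def b_def a'_def b'_def)
  have "\<bar>a - a'\<bar> / pi \<le> 4 * C * d" using A by (simp add: a_def a'_def field_simps)
  moreover have "\<bar>a - a'\<bar> / pi = \<bar>a / pi - a' / pi\<bar>" by (simp add: abs_divide diff_divide_distrib[symmetric])
  moreover have "\<bar>b - b'\<bar> \<le> 10 * pi * rhs4 * d" using B by (simp add: b_def b'_def mult_ac)
  ultimately have "\<bar>ln (h x) - ln (h x')\<bar> \<le> 4 * C * d + 10 * pi * rhs4 * d" unfolding e by linarith
  then show ?thesis by (simp add: d_def distrib_right)
qed

end

lemma integral_indicator_split:
  fixes f :: "'a::euclidean_space \<Rightarrow> real"
  assumes "integrable lborel f" and A: "A \<in> sets borel"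
  shows "integrable lborel (\<lambda>y. indicator A y * f y)" "integrable lborel (\<lambda>y. indicator (- A) y * f y)"
    "(LINT y|lborel. f y) = (LINT y|lborel. indicator A y * f y) + (LINT y|lborel. indicator (- A) y * f y)"
proof -
  have A': "- A \<in> sets borel" using A by auto
  show i: "integrable lborel (\<lambda>y. indicator A y * f y)" "integrable lborel (\<lambda>y. indicator (- A) y * f y)"
    using assms A' by (auto intro!: integrable_real_mult_indicator simp: mult.commute[of "indicator _ _"])
  show "(LINT y|lborel. f y) = (LINT y|lborel. indicator A y * f y) + (LINT y|lborel. indicator (- A) y * f y)"
    unfolding Bochner_Integration.integral_add[OF i, symmetric]
    by (intro Bochner_Integration.integral_cong refl) (simp add: indicator_def)
qed

section \<open>Compactness and the mass of the limit\<close>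

context hartree
begin

text \<open>Mass may escape to infinity along the sequence, but \<open>pot_outside_ball\<close>
  makes its contribution small uniformly in \<open>n\<close>. The near part converges by
  domination.\<close>

lemma pot_tendsto:
  assumes h: "\<And>n. density (h n)" and g: "density g" and lim: "\<And>y. (\<lambda>n. h n y) \<longlonglongrightarrow> g y"
    and b: "\<And>L. eventually (\<lambda>n. \<forall>y\<in>ball x L. h n y \<le> M) sequentially"
  shows "(\<lambda>n. pot (h n) x) \<longlonglongrightarrow> pot g x"
proof (rule tendstoI)
  fix e :: real assume e: "0 < e"
  have gM: "g y \<le> M" for y
  proof (rule LIMSEQ_le_const2[OF lim])
    obtain N where "\<And>n. n \<ge> N \<Longrightarrow> \<forall>z\<in>ball x (dist x y + 1). h n z \<le> M"
      using b[of "dist x y + 1"] by (auto simp: eventually_sequentially)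
    then show "\<exists>N. \<forall>n\<ge>N. h n y \<le> M" by (intro exI[of _ N]) auto
  qed
  have M: "0 \<le> M" using gM[of x] g by (auto simp: density_def intro: order_trans)
  have gm[measurable]: "g \<in> borel_measurable borel" and hm[measurable]: "\<And>n. h n \<in> borel_measurable borel"
    and h0: "\<And>n y. 0 \<le> h n y" and g0: "\<And>y. 0 \<le> g y"
    using g h by (auto simp: density_def)
  have "((\<lambda>L. (c0 + pi) * L powr - (\<mu> / 2)) \<longlongrightarrow> (c0 + pi) * 0) at_top"
    using mu by (intro tendsto_intros tendsto_neg_powr filterlim_ident) auto
  then have "eventually (\<lambda>L. (c0 + pi) * L powr - (\<mu> / 2) < e / 4) at_top"
    by (rule order_tendstoD) (use e in simp)
  then obtain L where L: "0 < L" "(c0 + pi) * L powr - (\<mu> / 2) < e / 4"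
    using eventually_conj[OF eventually_gt_at_top[of "0::real"]] eventually_happens trivial_limit_at_top_linorder
    by (metis (mono_tags, lifting))
  define near where "near = (\<lambda>h. LINT y|lborel. indicator (ball x L) y * (h y powr lam * norm (x - y) powr - \<mu>))"
  define far where "far = (\<lambda>h. LINT y|lborel. indicator (- ball x L) y * (h y powr lam * norm (x - y) powr - \<mu>))"
  have far: "0 \<le> far h" "far h < e / 4" if "density h" for h
    using pot_outside_ball(2)[OF that L(1), of x] L(2)
    by (auto simp: far_def intro!: Bochner_Integration.integral_nonneg)
  have split: "pot h x = near h + far h" if d: "density h" and bd: "\<And>y. y \<in> ball x L \<Longrightarrow> h y \<le> M" for h
  proof -
    have i: "integrable lborel (\<lambda>y. h y powr lam * norm (x - y) powr - \<mu>)"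
      by (rule pot_bound(1)[OF d L(1) bd])
    show ?thesis unfolding near_def far_def pot_def by (rule integral_indicator_split(3)[OF i]) simp
  qed
  have "(\<lambda>n. near (h n)) \<longlonglongrightarrow> near g"
    unfolding near_def
  proof (rule dominated_convergence_eventually)
    show "integrable lborel (\<lambda>y. M powr lam * (indicator (ball x L) y * norm (x - y) powr - \<mu>))"
      using norm_powr_ball_shift(1)[OF L(1) mu(2), of x] by simp
    show "AE y in lborel. (\<lambda>n. indicator (ball x L) y * (h n y powr lam * norm (x - y) powr - \<mu>)) \<longlonglongrightarrow> indicator (ball x L) y * (g y powr lam * norm (x - y) powr - \<mu>)"
      using lim h0 lam_bounds by (intro AE_I2 tendsto_intros tendsto_powr2) auto
    show "eventually (\<lambda>n. \<forall>y. \<bar>indicator (ball x L) y * (h n y powr lam * norm (x - y) powr - \<mu>)\<bar> \<le> M powr lam * (indicator (ball x L) y * norm (x - y) powr - \<mu>)) sequentially"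
      using b[of L]
    proof eventually_elim
      case (elim n)
      show ?case
      proof
        fix y
        show "\<bar>indicator (ball x L) y * (h n y powr lam * norm (x - y) powr - \<mu>)\<bar> \<le> M powr lam * (indicator (ball x L) y * norm (x - y) powr - \<mu>)"
          using elim h0[of n y] lam_bounds
          by (cases "y \<in> ball x L") (auto simp: abs_mult intro!: mult_right_mono powr_mono2)
      qed
    qed
  qed (auto intro!: borel_measurable_times borel_measurable_indicator)
  then have "eventually (\<lambda>n. dist (near (h n)) (near g) < e / 4) sequentially" by (rule tendstoD) (use e in simp)
  then show "eventually (\<lambda>n. dist (pot (h n) x) (pot g x) < e) sequentially"
    using b[of L]
  proof eventually_elim
    case (elim n)
    have 1: "pot (h n) x = near (h n) + far (h n)" using elim by (intro split h) auto
    have 2: "pot g x = near g + far g" using gM by (intro split g)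
    have "\<bar>far (h n) - far g\<bar> < e / 2" using far[OF h[of n]] far[OF g] by linarith
    moreover have "\<bar>near (h n) - near g\<bar> < e / 4" using elim(1) by (simp add: dist_real_def)
    ultimately have "\<bar>(near (h n) + far (h n)) - (near g + far g)\<bar> < e" using e by linarith
    then show ?case unfolding 1 2 by (simp add: dist_real_def)
  qed
qed

text \<open>The theorem of Arzela and Ascoli on each ball of integer radius, followed by a diagonal
  choice.\<close>

lemma locally_uniform_subsequence:
  fixes F :: "nat \<Rightarrow> real^2 \<Rightarrow> real"
  assumes "\<And>i::nat. \<exists>C D N. \<forall>k\<ge>N. (\<forall>x. norm x \<le> real i \<longrightarrow> \<bar>F k x\<bar> \<le> C) \<and>
      (\<forall>x y. norm x \<le> real i \<longrightarrow> norm y \<le> real i \<longrightarrow> norm (x - y) \<le> 1 \<longrightarrow> \<bar>F k x - F k y\<bar> \<le> D * norm (x - y))"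
  obtains G \<sigma> where "strict_mono (\<sigma> :: nat \<Rightarrow> nat)" "continuous_on UNIV G" "\<And>i::nat. uniform_limit (cball 0 (real i)) (\<lambda>k. F (\<sigma> k)) G sequentially"
proof -
  have "\<forall>i. \<exists>C D N. \<forall>k\<ge>N. (\<forall>x. norm x \<le> real i \<longrightarrow> \<bar>F k x\<bar> \<le> C) \<and>
      (\<forall>x y. norm x \<le> real i \<longrightarrow> norm y \<le> real i \<longrightarrow> norm (x - y) \<le> 1 \<longrightarrow> \<bar>F k x - F k y\<bar> \<le> D * norm (x - y))"
    using assms by blast
  then obtain C D N where CDN: "\<And>i k x. N i \<le> k \<Longrightarrow> norm x \<le> real i \<Longrightarrow> \<bar>F k x\<bar> \<le> C i"
    "\<And>i k x y. N i \<le> k \<Longrightarrow> norm x \<le> real i \<Longrightarrow> norm y \<le> real i \<Longrightarrow> norm (x - y) \<le> 1 \<Longrightarrow> \<bar>F k x - F k y\<bar> \<le> D i * norm (x - y)"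
    by metis
  \<comment> \<open>The bounds on a ball hold only from an index depending on that ball; earlier
    members are replaced by 0, which leaves the limit unchanged.\<close>
  define F' where "F' = (\<lambda>i k x. if N i \<le> k then F k x else 0)"
  define conv where "conv = (\<lambda>i r. \<exists>l. continuous_on (cball 0 (real i)) l \<and> uniform_limit (cball 0 (real i)) (\<lambda>n. F' i (r n)) l sequentially)"
  obtain \<sigma> where \<sigma>: "strict_mono (\<sigma> :: nat \<Rightarrow> nat)" "\<And>i. conv i (id \<circ> \<sigma>)"
  proof (rule subsequence_diagonalization_lemma[where P = conv and r = "id :: nat \<Rightarrow> nat"])
    fix i :: nat and r :: "nat \<Rightarrow> nat"
    obtain l k where "continuous_on (cball 0 (real i)) l" "strict_mono (k :: nat \<Rightarrow> nat)"
      "\<And>e. 0 < e \<Longrightarrow> \<exists>N. \<forall>n x. n \<ge> N \<and> x \<in> cball 0 (real i) \<longrightarrow> norm (F' i (r (k n)) x - l x) < e"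
    proof (rule Arzela_Ascoli[of "cball 0 (real i)" "\<lambda>n. F' i (r n)" "max 0 (C i)"])
      show "norm (F' i (r n) x) \<le> max 0 (C i)" if "x \<in> cball 0 (real i)" for n x
        using CDN(1)[of i "r n" x] that by (auto simp: F'_def)
      fix x :: "real^2" and e :: real assume x: "x \<in> cball 0 (real i)" and e: "0 < e"
      define d where "d = min 1 (e / (\<bar>D i\<bar> + 1))"
      have d: "0 < d" "d \<le> 1" "d \<le> e / (\<bar>D i\<bar> + 1)" using e by (auto simp: d_def)
      show "\<exists>d>0. \<forall>n y. y \<in> cball 0 (real i) \<and> norm (x - y) < d \<longrightarrow> norm (F' i (r n) x - F' i (r n) y) < e"
      proof (intro exI[of _ d] conjI allI impI)
        fix n y assume y: "y \<in> cball 0 (real i) \<and> norm (x - y) < d"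
        show "norm (F' i (r n) x - F' i (r n) y) < e"
        proof (cases "N i \<le> r n")
          case True
          have "\<bar>F (r n) x - F (r n) y\<bar> \<le> D i * norm (x - y)"
            using x y d by (intro CDN(2)[OF True]) auto
          also have "\<dots> \<le> (\<bar>D i\<bar> + 1) * norm (x - y)" by (intro mult_right_mono) auto
          also have "\<dots> < (\<bar>D i\<bar> + 1) * d" using y by (intro mult_strict_left_mono) auto
          also have "\<dots> \<le> e" using d(3) by (simp add: pos_le_divide_eq mult.commute)
          finally show ?thesis using True by (simp add: F'_def)
        qed (use e in \<open>simp add: F'_def\<close>)
      qed (fact d(1))
    qed auto
    then show "\<exists>k::nat \<Rightarrow> nat. strict_mono k \<and> conv i (r \<circ> k)"
      unfolding conv_def uniform_limit_sequentially_iff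
      by (intro exI[of _ k] conjI exI[of _ l]) (simp_all only: dist_norm o_def, blast)
  next
    fix i :: nat and r k1 k2 :: "nat \<Rightarrow> nat" and M
    assume "conv i (r \<circ> k1)" and k: "\<And>j. M \<le> j \<Longrightarrow> \<exists>j'. j \<le> j' \<and> k2 j = k1 j'"
    then obtain l where l: "continuous_on (cball 0 (real i)) l" "uniform_limit (cball 0 (real i)) (\<lambda>n. F' i (r (k1 n))) l sequentially"
      by (auto simp: conv_def)
    have "uniform_limit (cball 0 (real i)) (\<lambda>n. F' i (r (k2 n))) l sequentially"
      unfolding uniform_limit_sequentially_iff
    proof (intro allI impI)
      fix e :: real assume "0 < e"
      with l(2) obtain K where K: "\<forall>n\<ge>K. \<forall>x\<in>cball 0 (real i). dist (F' i (r (k1 n)) x) (l x) < e"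
        unfolding uniform_limit_sequentially_iff by blast
      show "\<exists>K. \<forall>n\<ge>K. \<forall>x\<in>cball 0 (real i). dist (F' i (r (k2 n)) x) (l x) < e"
      proof (intro exI[of _ "max M K"] allI impI)
        fix n assume "max M K \<le> n"
        then obtain j' where "n \<le> j'" "k2 n = k1 j'" using k[of n] by auto
        with K \<open>max M K \<le> n\<close> show "\<forall>x\<in>cball 0 (real i). dist (F' i (r (k2 n)) x) (l x) < e" by auto
      qed
    qed
    with l(1) show "conv i (r \<circ> k2)" by (auto simp: conv_def)
  qed auto
  from \<sigma>(2) have "\<forall>i. \<exists>l. continuous_on (cball 0 (real i)) l \<and> uniform_limit (cball 0 (real i)) (\<lambda>n. F' i (\<sigma> n)) l sequentially"
    by (simp add: conv_def)
  then obtain l where l: "\<And>i. continuous_on (cball 0 (real i)) (l i)" "\<And>i. uniform_limit (cball 0 (real i)) (\<lambda>n. F' i (\<sigma> n)) (l i) sequentially"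
    by metis
  have ul: "uniform_limit (cball 0 (real i)) (\<lambda>n. F (\<sigma> n)) (l i) sequentially" for i
  proof (rule uniform_limit_cong[THEN iffD1, OF _ _ l(2)])
    have "eventually (\<lambda>n. N i \<le> n) sequentially" by (rule eventually_ge_at_top)
    then show "eventually (\<lambda>n. \<forall>x\<in>cball 0 (real i). F' i (\<sigma> n) x = F (\<sigma> n) x) sequentially"
    proof eventually_elim
      case (elim n)
      then have "N i \<le> \<sigma> n" using seq_suble[OF \<sigma>(1), of n] by simp
      then show ?case by (simp add: F'_def)
    qed
  qed simp
  define G where "G = (\<lambda>x. lim (\<lambda>n. F (\<sigma> n) x))"
  have G: "G x = l i x" if "x \<in> cball 0 (real i)" for i x
    unfolding G_def using tendsto_uniform_limitI[OF ul that] by (rule limI)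
  have u: "uniform_limit (cball 0 (real i)) (\<lambda>k. F (\<sigma> k)) G sequentially" for i
    using ul by (rule uniform_limit_cong'[THEN iffD1, rotated 2]) (auto simp: G)
  have "continuous_on UNIV G"
  proof (rule continuous_on_subset[of "\<Union>i. ball 0 (real i)"])
    show "continuous_on (\<Union>i. ball (0::real^2) (real i)) G"
    proof (rule continuous_on_open_UN)
      fix i
      have "continuous_on (cball 0 (real i)) G" using l(1) by (rule continuous_on_eq) (simp add: G)
      then show "continuous_on (ball 0 (real i)) G" by (rule continuous_on_subset) auto
    qed auto
    show "UNIV \<subseteq> (\<Union>i. ball (0::real^2) (real i))" by (auto intro: reals_Archimedean2)
  qed
  with \<sigma>(1) u show ?thesis using that by blast
qed

text \<open>The limit is an entire solution, so its mass is \<open>8 * pi\<close>. Only masses on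
  balls are handed on: \<open>mm L\<close> is the mass of the limit in \<open>ball 0 L\<close>,
  which explains its monotonicity and both bounds.\<close>

lemma normalized_limit:
  assumes R: "filterlim R at_top sequentially" and sol: "\<And>k. solution (ball 0 (R k)) (W k) (h k)"
    and h1: "\<And>k. h k 0 = 1" and h4: "\<And>k y. y \<in> ball 0 (R k) \<Longrightarrow> h k y \<le> 4"
    and W: "\<And>L e. 0 < e \<Longrightarrow> eventually (\<lambda>k. \<forall>y\<in>ball 0 L. \<bar>W k y - v0\<bar> < e) sequentially"
    and A: "\<And>k. set_integrable lborel (ball 0 (R k)) (rhs (W k) (h k))"
      "\<And>k. (LINT y:ball 0 (R k)|lborel. rhs (W k) (h k) y) \<le> A"
  obtains \<sigma> mm where "strict_mono (\<sigma> :: nat \<Rightarrow> nat)"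
    "\<And>L. (\<lambda>k. LINT y:ball 0 L|lborel. rhs (W (\<sigma> k)) (h (\<sigma> k)) y) \<longlonglongrightarrow> mm L"
    "\<And>L. mm L \<le> 8 * pi" "\<And>e. 0 < e \<Longrightarrow> \<exists>L\<ge>1. 8 * pi - e \<le> mm L"
    "\<And>L L'. L \<le> L' \<Longrightarrow> mm L \<le> mm L'"
proof -
  note sols = solutionD[OF sol]
  note [measurable] = sols(6,7)
  have Rev: "eventually (\<lambda>k. L < R k) sequentially" for L
    using R by (simp add: filterlim_at_top_dense)
  have "\<exists>C D N. \<forall>k\<ge>N. (\<forall>x. norm x \<le> real i \<longrightarrow> \<bar>ln (h k x)\<bar> \<le> C) \<and>
      (\<forall>x y. norm x \<le> real i \<longrightarrow> norm y \<le> real i \<longrightarrow> norm (x - y) \<le> 1 \<longrightarrow> \<bar>ln (h k x) - ln (h k y)\<bar> \<le> D * norm (x - y))" for i :: nat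
  proof -
    define L where "L = real i + 1"
    have L: "1 \<le> L" by (simp add: L_def)
    define C where "C = ln 4 + \<bar>ln 4 - 4 * (ln 4 + rhs4 * (LINT z|lborel. green_kernel (2 * L) z))\<bar>"
    obtain N where N: "\<And>k. k \<ge> N \<Longrightarrow> 2 * L + 4 < R k"
      using Rev[of "2 * L + 4"] by (auto simp: eventually_sequentially)
    have C: "\<bar>ln (h k x)\<bar> \<le> C" if k: "k \<ge> N" and x: "norm x \<le> L" for k x
    proof -
      have "ln 4 - 4 * (ln 4 + rhs4 * (LINT z|lborel. green_kernel (2 * L) z)) \<le> ln (h k x)"
        using N[OF k] by (intro normalized_solution_lower_bound[OF L _ sol h1 h4 x]) auto
      moreover have "x \<in> ball 0 (R k)" using N[OF k] x L by simp
      then have "ln (h k x) \<le> ln 4" using h4 sols(4) by (intro ln_mono) auto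
      moreover have "0 \<le> ln (4::real)" by simp
      ultimately show ?thesis unfolding C_def by linarith
    qed
    have "\<bar>ln (h k x) - ln (h k y)\<bar> \<le> (4 * C + 10 * pi * rhs4) * norm (x - y)"
      if k: "k \<ge> N" and "norm x \<le> real i" "norm y \<le> real i" "norm (x - y) \<le> 1" for k x y
      by (rule normalized_solution_lipschitz[of "real i" "R k", OF _ _ sol h4])
         (use N[OF k] C[OF k] that L in \<open>auto simp: L_def\<close>)
    with C show ?thesis
      by (intro exI[of _ C] exI[of _ "4 * C + 10 * pi * rhs4"] exI[of _ N]) (auto simp: L_def)
  qed
  note bounds = this
  obtain G \<sigma> where \<sigma>: "strict_mono (\<sigma> :: nat \<Rightarrow> nat)" and Gc: "continuous_on UNIV G"
    and ul: "\<And>i::nat. uniform_limit (cball 0 (real i)) (\<lambda>k x. ln (h (\<sigma> k) x)) G sequentially"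
    using locally_uniform_subsequence[of "\<lambda>k x. ln (h k x)", OF bounds] by metis
  have \<sigma>ev: "eventually (\<lambda>k. P (\<sigma> k)) sequentially" if "eventually P sequentially" for P
    using that filterlim_subseq[OF \<sigma>] by (rule eventually_compose_filterlim)
  have lnb: "\<exists>C. eventually (\<lambda>k. \<forall>y\<in>ball 0 L. \<bar>ln (h (\<sigma> k) y)\<bar> \<le> C) sequentially" for L
  proof -
    obtain i :: nat where i: "L \<le> real i" using real_arch_simple by blast
    obtain C D N where CDN: "\<forall>k\<ge>N. (\<forall>x. norm x \<le> real i \<longrightarrow> \<bar>ln (h k x)\<bar> \<le> C) \<and>
      (\<forall>x y. norm x \<le> real i \<longrightarrow> norm y \<le> real i \<longrightarrow> norm (x - y) \<le> 1 \<longrightarrow> \<bar>ln (h k x) - ln (h k y)\<bar> \<le> D * norm (x - y))"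
      using bounds[of i] by blast
    have "eventually (\<lambda>k. N \<le> \<sigma> k) sequentially" by (rule \<sigma>ev) (rule eventually_ge_at_top)
    then show ?thesis
      using CDN i by (intro exI[of _ C]) (auto elim!: eventually_mono)
  qed
  define g where "g = (\<lambda>x. exp (G x))"
  have gpos: "0 < g x" for x by (simp add: g_def)
  have Gm[measurable]: "G \<in> borel_measurable borel" using Gc by (rule borel_measurable_continuous_onI)
  have gm[measurable]: "g \<in> borel_measurable borel" unfolding g_def by measurable
  have Gl: "(\<lambda>k. ln (h (\<sigma> k) x)) \<longlonglongrightarrow> G x" for x
  proof -
    obtain i :: nat where "norm x \<le> real i" using real_arch_simple by blast
    then show ?thesis using tendsto_uniform_limitI[OF ul[of i], of x] by simp
  qed
  have inball: "eventually (\<lambda>k. x \<in> ball 0 (R (\<sigma> k))) sequentially" for x :: "real^2"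
    using \<sigma>ev[OF Rev[of "norm x"]] by simp
  have hl: "(\<lambda>k. h (\<sigma> k) x) \<longlonglongrightarrow> g x" for x
  proof (rule Lim_transform_eventually)
    show "(\<lambda>k. exp (ln (h (\<sigma> k) x))) \<longlonglongrightarrow> g x" unfolding g_def by (intro tendsto_intros Gl)
    show "eventually (\<lambda>k. exp (ln (h (\<sigma> k) x)) = h (\<sigma> k) x) sequentially"
      using inball[of x] by eventually_elim (use sols(4) in simp)
  qed
  have g4: "g x \<le> 4" for x
  proof -
    have "eventually (\<lambda>k. h (\<sigma> k) x \<le> 4) sequentially"
      using inball[of x] by eventually_elim (rule h4)
    with hl show ?thesis by (rule tendsto_upperbound) simp
  qed
  \<comment> \<open>Fatou's lemma gives the inequality for the integral, and \<open>density\<close>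
    asks for no more; some of the integral may be lost at infinity.\<close>
  have dg: "density g"
    using fatou_real[OF _ sols(9) sols(8) hl sols(10)] gpos
    unfolding density_def by (auto intro: less_imp_le)
  have ev4: "eventually (\<lambda>k. \<forall>y\<in>ball x L. h (\<sigma> k) y \<le> 4) sequentially" for x L
    using \<sigma>ev[OF Rev[of "norm x + L"]]
  proof eventually_elim
    case (elim k)
    show ?case
    proof
      fix y assume "y \<in> ball x L"
      then have "norm y < R (\<sigma> k)" using elim norm_triangle_ineq2[of y x] by (simp add: dist_norm norm_minus_commute)
      then show "h (\<sigma> k) y \<le> 4" using h4 by simp
    qed
  qed
  have potl: "(\<lambda>k. pot (h (\<sigma> k)) x) \<longlonglongrightarrow> pot g x" for x
    by (rule pot_tendsto[OF sols(1) dg hl ev4])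
  have Wl: "(\<lambda>k. W (\<sigma> k) x) \<longlonglongrightarrow> v0" for x
  proof (rule tendstoI)
    fix e :: real assume "0 < e"
    from \<sigma>ev[OF W[OF this, of "norm x + 1"]]
    show "eventually (\<lambda>k. dist (W (\<sigma> k) x) v0 < e) sequentially"
      by eventually_elim (simp add: dist_real_def)
  qed
  have v0: "0 \<le> v0" "v0 \<le> Lam"
  proof -
    show "0 \<le> v0" by (rule LIMSEQ_le_const[OF Wl[of 0]]) (use sols(11) in auto)
    show "v0 \<le> Lam" by (rule LIMSEQ_le_const2[OF Wl[of 0]]) (use sols(12) in auto)
  qed
  have wt: "weight (\<lambda>_. v0)" using v0 by (simp add: weight_def)
  have rl: "(\<lambda>k. rhs (W (\<sigma> k)) (h (\<sigma> k)) x) \<longlonglongrightarrow> rhs (\<lambda>_. v0) g x" for x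
    unfolding rhs_def using sols(8) gpos lam_bounds
    by (intro tendsto_intros Wl potl hl) (use gpos[of x] in auto)
  have r0: "0 \<le> rhs (W k) (h k) x" for k x using rhs_nonneg[OF sols(2)] .
  have rb: "eventually (\<lambda>k. \<forall>y\<in>ball x L. rhs (W (\<sigma> k)) (h (\<sigma> k)) y \<le> rhs4) sequentially" for x L
    using ev4[of x "L + 1"]
  proof eventually_elim
    case (elim k)
    show ?case
    proof
      fix y assume y: "y \<in> ball x L"
      show "rhs (W (\<sigma> k)) (h (\<sigma> k)) y \<le> rhs4"
      proof (rule rhs4_bound[OF sol])
        fix z assume "z \<in> ball y 1"
        then have "z \<in> ball x (L + 1)" using y dist_triangle[of x z y] by simp
        then show "h (\<sigma> k) z \<le> 4" using elim by blast
      qed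
    qed
  qed
  have rm[measurable]: "rhs (\<lambda>_. v0) g \<in> borel_measurable borel" by measurable
  have "solution UNIV (\<lambda>_. v0) g"
    unfolding solution_def
  proof (intro conjI ballI allI impI dg wt gpos)
    show "continuous_on UNIV g" unfolding g_def using Gc by (intro continuous_intros)
    fix x :: "real^2" and s :: real assume s: "0 < s"
    obtain C where C: "eventually (\<lambda>k. \<forall>y\<in>ball 0 (norm x + s). \<bar>ln (h (\<sigma> k) y)\<bar> \<le> C) sequentially"
      using lnb by blast
    have bx: "y \<in> ball 0 (norm x + s)" if "y \<in> ball x s" for y
      using that norm_triangle_ineq2[of y x] by (simp add: dist_norm norm_minus_commute)
    have l1: "(\<lambda>k. LINT y|lborel. indicator (ball x s) y * ln (h (\<sigma> k) y)) \<longlonglongrightarrow> (LINT y|lborel. indicator (ball x s) y * G y)"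
    proof (rule dominated_convergence_eventually)
      show "integrable lborel (\<lambda>y. C * indicator (ball x s) y)" by (intro integrable_mult_right integrable_indicator_ball)
      show "AE y in lborel. (\<lambda>k. indicator (ball x s) y * ln (h (\<sigma> k) y)) \<longlonglongrightarrow> indicator (ball x s) y * G y"
        by (intro AE_I2 tendsto_intros Gl)
      show "eventually (\<lambda>k. \<forall>y. \<bar>indicator (ball x s) y * ln (h (\<sigma> k) y)\<bar> \<le> C * indicator (ball x s) y) sequentially"
        using C by eventually_elim (use bx in \<open>auto simp: indicator_def\<close>)
    qed (auto intro!: borel_measurable_times borel_measurable_indicator)
    have l2: "(\<lambda>k. LINT y|lborel. green_kernel s (x - y) * rhs (W (\<sigma> k)) (h (\<sigma> k)) y) \<longlonglongrightarrow> (LINT y|lborel. green_kernel s (x - y) * rhs (\<lambda>_. v0) g y)"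
    proof (rule dominated_convergence_eventually)
      show "integrable lborel (\<lambda>y. rhs4 * green_kernel s (x - y))"
        using green_kernel_integrable[OF s] by (simp add: integral_lborel_shift(4))
      show "AE y in lborel. (\<lambda>k. green_kernel s (x - y) * rhs (W (\<sigma> k)) (h (\<sigma> k)) y) \<longlonglongrightarrow> green_kernel s (x - y) * rhs (\<lambda>_. v0) g y"
        by (intro AE_I2 tendsto_intros rl)
      show "eventually (\<lambda>k. \<forall>y. \<bar>green_kernel s (x - y) * rhs (W (\<sigma> k)) (h (\<sigma> k)) y\<bar> \<le> rhs4 * green_kernel s (x - y)) sequentially"
        using rb[of x s]
      proof eventually_elim
        case (elim k)
        show ?case
        proof
          fix y
          show "\<bar>green_kernel s (x - y) * rhs (W (\<sigma> k)) (h (\<sigma> k)) y\<bar> \<le> rhs4 * green_kernel s (x - y)"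
          proof (cases "y \<in> ball x s")
            case True
            then show ?thesis using elim r0[of "\<sigma> k" y] green_kernel_nonneg[of s "x - y"]
              by (simp add: abs_mult mult.commute[of rhs4] mult_left_mono)
          next
            case False
            then show ?thesis by (simp add: green_kernel_def dist_norm)
          qed
        qed
      qed
    qed measurable
    have "(\<lambda>k. ln (h (\<sigma> k) x)) \<longlonglongrightarrow> (LINT y|lborel. indicator (ball x s) y * G y) / (pi * s\<^sup>2) + (LINT y|lborel. green_kernel s (x - y) * rhs (\<lambda>_. v0) g y)"
    proof (rule Lim_transform_eventually)
      show "(\<lambda>k. (LINT y|lborel. indicator (ball x s) y * ln (h (\<sigma> k) y)) / (pi * s\<^sup>2) + (LINT y|lborel. green_kernel s (x - y) * rhs (W (\<sigma> k)) (h (\<sigma> k)) y))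
        \<longlonglongrightarrow> (LINT y|lborel. indicator (ball x s) y * G y) / (pi * s\<^sup>2) + (LINT y|lborel. green_kernel s (x - y) * rhs (\<lambda>_. v0) g y)"
        using s by (intro tendsto_intros l1 l2) auto
      show "eventually (\<lambda>k. (LINT y|lborel. indicator (ball x s) y * ln (h (\<sigma> k) y)) / (pi * s\<^sup>2) + (LINT y|lborel. green_kernel s (x - y) * rhs (W (\<sigma> k)) (h (\<sigma> k)) y)
          = ln (h (\<sigma> k) x)) sequentially"
        using \<sigma>ev[OF Rev[of "norm x + s"]]
      proof eventually_elim
        case (elim k)
        have "cball x s \<subseteq> ball 0 (R (\<sigma> k))"
        proof
          fix y assume "y \<in> cball x s"
          then show "y \<in> ball 0 (R (\<sigma> k))" using elim norm_triangle_ineq2[of y x] by (simp add: dist_norm norm_minus_commute)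
        qed
        from sols(5)[OF s this] show ?case by (simp add: set_lebesgue_integral_def)
      qed
    qed
    from LIMSEQ_unique[OF Gl this]
    show "ln (g x) = (LINT y:ball x s|lborel. ln (g y)) / (pi * s\<^sup>2) + (LINT y|lborel. green_kernel s (x - y) * rhs (\<lambda>_. v0) g y)"
      by (simp add: g_def set_lebesgue_integral_def)
  qed
  \<comment> \<open>The uniform mass bound \<open>A\<close> is what makes the mass of the limit
    finite.\<close>
  moreover have "integrable lborel (rhs (\<lambda>_. v0) g)"
  proof (rule fatou_real(1))
    show "integrable lborel (\<lambda>y. indicator (ball 0 (R (\<sigma> n))) y * rhs (W (\<sigma> n)) (h (\<sigma> n)) y)" for n
      using A(1)[of "\<sigma> n"] by (simp add: set_integrable_def)
    show "(LINT y|lborel. indicator (ball 0 (R (\<sigma> n))) y * rhs (W (\<sigma> n)) (h (\<sigma> n)) y) \<le> A" for n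
      using A(2)[of "\<sigma> n"] by (simp add: set_lebesgue_integral_def)
    show "(\<lambda>n. indicator (ball 0 (R (\<sigma> n))) x * rhs (W (\<sigma> n)) (h (\<sigma> n)) x) \<longlonglongrightarrow> rhs (\<lambda>_. v0) g x" for x
    proof (rule Lim_transform_eventually[OF rl])
      show "eventually (\<lambda>n. rhs (W (\<sigma> n)) (h (\<sigma> n)) x = indicator (ball 0 (R (\<sigma> n))) x * rhs (W (\<sigma> n)) (h (\<sigma> n)) x) sequentially"
        using inball[of x] by eventually_elim simp
    qed
  qed (use r0 in auto)
  ultimately interpret E: entire_solution \<mu> lam Lam c0 v0 g 4
    by unfold_locales (use g4 in auto)
  define mm where "mm = (\<lambda>L. LINT y|lborel. indicator (ball 0 L) y * E.f y)"
  have mono: "mm L \<le> mm L'" if "L \<le> L'" for L L'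
    unfolding mm_def
    using integral_indicator_split(1)[OF E.f_int, of "ball 0 _"] that E.f_nonneg
    by (intro integral_mono) (auto simp: indicator_def)
  show ?thesis
  proof (rule that[OF \<sigma> _ _ _ mono])
    fix L
    show "mm L \<le> 8 * pi"
    proof -
      have "mm L \<le> (LINT y|lborel. E.f y)"
        unfolding mm_def using integral_indicator_split(1)[OF E.f_int, of "ball 0 L"] E.f_nonneg E.f_int
        by (intro integral_mono) (auto simp: indicator_def)
      then show ?thesis using E.mass_eq by (simp add: E.m_def)
    qed
    have "(\<lambda>k. LINT y|lborel. indicator (ball 0 L) y * rhs (W (\<sigma> k)) (h (\<sigma> k)) y) \<longlonglongrightarrow> mm L"
      unfolding mm_def
    proof (rule dominated_convergence_eventually)
      show "integrable lborel (\<lambda>y. rhs4 * indicator (ball 0 L) y)" by (intro integrable_mult_right integrable_indicator_ball)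
      show "AE y in lborel. (\<lambda>k. indicator (ball 0 L) y * rhs (W (\<sigma> k)) (h (\<sigma> k)) y) \<longlonglongrightarrow> indicator (ball 0 L) y * E.f y"
        by (intro AE_I2 tendsto_intros rl)
      show "eventually (\<lambda>k. \<forall>y. \<bar>indicator (ball 0 L) y * rhs (W (\<sigma> k)) (h (\<sigma> k)) y\<bar> \<le> rhs4 * indicator (ball 0 L) y) sequentially"
        using rb[of 0 L] by eventually_elim (use r0 in \<open>auto simp: indicator_def\<close>)
    qed (auto intro!: borel_measurable_times borel_measurable_indicator)
    then show "(\<lambda>k. LINT y:ball 0 L|lborel. rhs (W (\<sigma> k)) (h (\<sigma> k)) y) \<longlonglongrightarrow> mm L"
      by (simp add: set_lebesgue_integral_def)
  next
    fix e :: real assume "0 < e"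
    from E.mass_ball[OF this] obtain L where "1 \<le> L" "E.m - e \<le> (LINT y:ball 0 L|lborel. E.f y)" .
    then show "\<exists>L\<ge>1. 8 * pi - e \<le> mm L"
      unfolding E.mass_eq mm_def by (auto simp: set_lebesgue_integral_def)
  qed
qed

section \<open>Scale invariance and rescaling at a center\<close>

lemma solution_mono: "solution D V g \<Longrightarrow> D' \<subseteq> D \<Longrightarrow> solution D' V g"
  unfolding solution_def by (auto intro: continuous_on_subset)

definition "rescale x0 s g = (\<lambda>y::real^2. s\<^sup>2 * g (x0 + s *\<^sub>R y))"

text \<open>Exponent count: \<open>2 * lam\<close> from the density,
  \<open>2 * lam + \<mu> - 2\<close> from the potential, in total 2. This is where the value of
  \<open>lam\<close> enters.\<close>

lemma rhs_rescale:
  assumes s: "0 < s" and [measurable]: "g \<in> borel_measurable borel" and g0: "\<And>y. 0 \<le> g y"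
  shows "rhs (\<lambda>y. V (x0 + s *\<^sub>R y)) (rescale x0 s g) y = s\<^sup>2 * rhs V g (x0 + s *\<^sub>R y)"
proof -
  define F where "F = (\<lambda>z. g z powr lam * norm ((x0 + s *\<^sub>R y) - z) powr - \<mu>)"
  have [measurable]: "F \<in> borel_measurable borel" unfolding F_def by measurable
  have s2: "s\<^sup>2 powr lam = s powr (2 * lam)" using s by (simp add: powr_powr flip: powr_numeral)
  have "rescale x0 s g z powr lam * norm (y - z) powr - \<mu> = s powr (2 * lam) * (s powr \<mu> * F (x0 + s *\<^sub>R z))" for z
  proof -
    have "norm ((x0 + s *\<^sub>R y) - (x0 + s *\<^sub>R z)) = s * norm (y - z)"
      using s by (simp flip: scaleR_diff_right)
    then show ?thesis using s g0 by (simp add: F_def rescale_def powr_mult s2 powr_minus)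
  qed
  then have "pot (rescale x0 s g) y = s powr (2 * lam) * (s powr \<mu> * (LINT z|lborel. F (x0 + s *\<^sub>R z)))"
    unfolding pot_def by simp
  also have "(LINT z|lborel. F (x0 + s *\<^sub>R z)) = pot g (x0 + s *\<^sub>R y) / s\<^sup>2"
    using integral_lborel_affine[of F s x0] s by (simp add: F_def pot_def)
  finally have p: "pot (rescale x0 s g) y = s powr (2 * lam) * (s powr \<mu> * (pot g (x0 + s *\<^sub>R y) / s\<^sup>2))" .
  have "s powr (2 * lam) * (s powr (2 * lam) * (s powr \<mu> / s\<^sup>2)) = s\<^sup>2"
  proof -
    have "2 * lam + (2 * lam + \<mu>) = 4" by (simp add: lam field_simps)
    then have "s powr (2 * lam) * (s powr (2 * lam) * s powr \<mu>) = s ^ 4"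
      using s by (simp only: powr_add[symmetric]) simp
    then show ?thesis using s by (simp add: power2_eq_square power4_eq_xxxx)
  qed
  moreover have "rhs (\<lambda>y. V (x0 + s *\<^sub>R y)) (rescale x0 s g) y =
      (s powr (2 * lam) * (s powr (2 * lam) * (s powr \<mu> / s\<^sup>2))) * rhs V g (x0 + s *\<^sub>R y)"
    unfolding rhs_def p using s g0 by (simp add: rescale_def powr_mult s2)
  ultimately show ?thesis by simp
qed

lemma ball_rescale:
  fixes x0 y z :: "real^2"
  assumes "0 < s"
  shows "x0 + s *\<^sub>R z \<in> ball (x0 + s *\<^sub>R y) (s * R) \<longleftrightarrow> z \<in> ball y R"
proof -
  have "dist (x0 + s *\<^sub>R y) (x0 + s *\<^sub>R z) = s * dist y z"
    using assms by (simp add: dist_norm flip: scaleR_diff_right)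
  then show ?thesis using assms by simp
qed

lemma green_kernel_rescale:
  assumes "0 < s"
  shows "green_kernel (s * R) (s *\<^sub>R z) = green_kernel R z"
  using assms by (simp add: green_kernel_def power_mult_distrib mult_less_cancel_left_pos)

text \<open>The logarithm of the rescaled density gains the constant \<open>2 * ln s\<close>, which
  means preserve. The Green kernel is invariant when radius and argument are scaled together, and
  the factor \<open>s\<^sup>2\<close> of the right-hand side is the Jacobian.\<close>

lemma solution_rescale:
  assumes sol: "solution D V g" and D: "open D" and s: "0 < s"
  shows "solution {y. x0 + s *\<^sub>R y \<in> D} (\<lambda>y. V (x0 + s *\<^sub>R y)) (rescale x0 s g)"
proof -
  note sols = solutionD[OF sol]
  note [measurable] = sols(6,7)
  have gm[measurable]: "rescale x0 s g \<in> borel_measurable borel" unfolding rescale_def by measurable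
  have d: "density (rescale x0 s g)"
    using integrable_lborel_affine[OF sols(6), of s x0] integral_lborel_affine[OF sols(6), of s x0] s sols(8,9,10) gm
    unfolding density_def by (auto simp: rescale_def)
  have w: "weight (\<lambda>y. V (x0 + s *\<^sub>R y))"
    using sols(11,12) by (auto simp: weight_def)
  show ?thesis
    unfolding solution_def
  proof (intro conjI ballI allI impI d w)
    show "continuous_on {y. x0 + s *\<^sub>R y \<in> D} (rescale x0 s g)"
      unfolding rescale_def
      by (intro continuous_intros continuous_on_compose2[OF sols(3)]) auto
    show "0 < rescale x0 s g x" if "x \<in> {y. x0 + s *\<^sub>R y \<in> D}" for x
      using that sols(4) s by (simp add: rescale_def)
    fix x :: "real^2" and R :: real assume R: "0 < R" and sub: "cball x R \<subseteq> {y. x0 + s *\<^sub>R y \<in> D}"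
    define X where "X = x0 + s *\<^sub>R x"
    have sub': "cball X (s * R) \<subseteq> D"
    proof
      fix z assume z: "z \<in> cball X (s * R)"
      define y where "y = (1 / s) *\<^sub>R (z - x0)"
      have zy: "z = x0 + s *\<^sub>R y" using s by (simp add: y_def)
      have "dist X z = s * dist x y" unfolding X_def zy using s by (simp add: dist_norm flip: scaleR_diff_right)
      then have "y \<in> cball x R" using z s by simp
      then show "z \<in> D" using sub zy by auto
    qed
    have sR: "0 < s * R" using s R by simp
    note mv = solution_mean_value[OF sol D sub' sR]
    have Xpos: "0 < g X" using sR by (intro sols(4) subsetD[OF sub']) auto
    define A where "A = (\<lambda>z. indicator (ball X (s * R)) z * ln (g z))"
    have [measurable]: "A \<in> borel_measurable borel"
      unfolding A_def by (auto intro!: borel_measurable_times borel_measurable_indicator)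
    have Ai: "integrable lborel A" using mv(1) by (simp add: A_def set_integrable_def)
    have Ai': "integrable lborel (\<lambda>y. A (x0 + s *\<^sub>R y))" "(LINT y|lborel. A (x0 + s *\<^sub>R y)) = (LINT z|lborel. A z) / s\<^sup>2"
      using integrable_lborel_affine[of A s x0] integral_lborel_affine[of A s x0] Ai s by simp_all
    have "(LINT y:ball x R|lborel. ln (rescale x0 s g y)) = (LINT y|lborel. A (x0 + s *\<^sub>R y) + 2 * ln s * indicator (ball x R) y)"
      unfolding set_lebesgue_integral_def
    proof (intro Bochner_Integration.integral_cong refl)
      fix y
      have b: "x0 + s *\<^sub>R y \<in> ball X (s * R) \<longleftrightarrow> y \<in> ball x R" unfolding X_def by (rule ball_rescale[OF s])
      show "indicator (ball x R) y *\<^sub>R ln (rescale x0 s g y) = A (x0 + s *\<^sub>R y) + 2 * ln s * indicator (ball x R) y"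
      proof (cases "y \<in> ball x R")
        case True
        then have "0 < g (x0 + s *\<^sub>R y)" using subsetD[OF sub, of y] by (intro sols(4)) auto
        then have "ln (rescale x0 s g y) = ln (g (x0 + s *\<^sub>R y)) + 2 * ln s"
          using s by (simp add: rescale_def ln_mult ln_realpow)
        with True b show ?thesis by (simp add: A_def del: mem_ball)
      next
        case False
        then show ?thesis using b by (simp add: A_def del: mem_ball)
      qed
    qed
    also have "\<dots> = (LINT z|lborel. A z) / s\<^sup>2 + 2 * ln s * (pi * R\<^sup>2)"
      using Ai' R integrable_indicator_ball[of x R] by (simp add: lebesgue_ball_real2)
    finally have 1: "(LINT y:ball x R|lborel. ln (rescale x0 s g y)) / (pi * R\<^sup>2) = (LINT z|lborel. A z) / (pi * (s * R)\<^sup>2) + 2 * ln s"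
      using s R by (simp add: field_simps power_mult_distrib)
    have 2: "(LINT y|lborel. green_kernel R (x - y) * rhs (\<lambda>y. V (x0 + s *\<^sub>R y)) (rescale x0 s g) y)
        = (LINT z|lborel. green_kernel (s * R) (X - z) * rhs V g z)"
    proof -
      define H where "H = (\<lambda>z. green_kernel (s * R) (X - z) * rhs V g z)"
      have [measurable]: "H \<in> borel_measurable borel" unfolding H_def by measurable
      have "green_kernel R (x - y) * rhs (\<lambda>y. V (x0 + s *\<^sub>R y)) (rescale x0 s g) y = s\<^sup>2 * H (x0 + s *\<^sub>R y)" for y
      proof -
        have "X - (x0 + s *\<^sub>R y) = s *\<^sub>R (x - y)" by (simp add: X_def scaleR_diff_right)
        then show ?thesis
          unfolding H_def rhs_rescale[OF s sols(6) sols(8)] using green_kernel_rescale[OF s, of R "x - y"] by simp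
      qed
      then show ?thesis using integral_lborel_affine[of H s x0] s by (simp add: H_def)
    qed
    have "ln (rescale x0 s g x) = ln (g X) + 2 * ln s"
      using Xpos s by (simp add: rescale_def X_def ln_mult ln_realpow)
    with sols(5)[OF sR sub'] 1 2
    show "ln (rescale x0 s g x) = (LINT y:ball x R|lborel. ln (rescale x0 s g y)) / (pi * R\<^sup>2)
       + (LINT y|lborel. green_kernel R (x - y) * rhs (\<lambda>y. V (x0 + s *\<^sub>R y)) (rescale x0 s g) y)"
      by (simp add: A_def set_lebesgue_integral_def)
  qed
qed

lemma rhs_mass_rescale:
  assumes s: "0 < s" and [measurable]: "g \<in> borel_measurable borel" "V \<in> borel_measurable borel" and g0: "\<And>y. 0 \<le> g y"
  shows "(LINT y:ball 0 L|lborel. rhs (\<lambda>y. V (x0 + s *\<^sub>R y)) (rescale x0 s g) y) = (LINT z:ball x0 (s * L)|lborel. rhs V g z)"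
    and "set_integrable lborel (ball 0 L) (rhs (\<lambda>y. V (x0 + s *\<^sub>R y)) (rescale x0 s g)) \<longleftrightarrow> set_integrable lborel (ball x0 (s * L)) (rhs V g)"
proof -
  define H where "H = (\<lambda>z. indicator (ball x0 (s * L)) z * rhs V g z)"
  have [measurable]: "H \<in> borel_measurable borel"
    unfolding H_def by (intro borel_measurable_times borel_measurable_indicator rhs_measurable assms) auto
  have *: "indicator (ball 0 L) y *\<^sub>R rhs (\<lambda>y. V (x0 + s *\<^sub>R y)) (rescale x0 s g) y = s\<^sup>2 * H (x0 + s *\<^sub>R y)" for y
    unfolding H_def rhs_rescale[OF s assms(2) g0] using ball_rescale[OF s, of x0 y 0 L]
    by (cases "y \<in> ball 0 L") (simp_all del: mem_ball)
  show "(LINT y:ball 0 L|lborel. rhs (\<lambda>y. V (x0 + s *\<^sub>R y)) (rescale x0 s g) y) = (LINT z:ball x0 (s * L)|lborel. rhs V g z)"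
    unfolding set_lebesgue_integral_def * using integral_lborel_affine[of H s x0] s by (simp add: H_def)
  show "set_integrable lborel (ball 0 L) (rhs (\<lambda>y. V (x0 + s *\<^sub>R y)) (rescale x0 s g)) \<longleftrightarrow> set_integrable lborel (ball x0 (s * L)) (rhs V g)"
    unfolding set_integrable_def * using integrable_lborel_affine[of H s x0] s by (simp add: H_def)
qed

text \<open>The length \<open>1 / sqrt (g k (x k))\<close> normalizes the rescaled value at the
  center to 1. By \<open>big\<close> the rescaled balls exhaust the plane, and since this length
  tends to 0 the rescaled weights tend to the constant \<open>v0\<close> locally uniformly.\<close>

theorem blow_up:
  assumes D: "open D" and sol: "\<And>k. solution D (V k) (g k)"
    and sub: "\<And>k. ball (x k) (r k) \<subseteq> D" and r: "\<And>k. 0 < r k"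
    and g4: "\<And>k y. y \<in> ball (x k) (r k) \<Longrightarrow> g k y \<le> 4 * g k (x k)"
    and big: "filterlim (\<lambda>k. r k * sqrt (g k (x k))) at_top sequentially"
    and x: "x \<longlonglongrightarrow> p" and gx: "filterlim (\<lambda>k. g k (x k)) at_top sequentially"
    and V: "\<And>e. 0 < e \<Longrightarrow> \<exists>d>0. eventually (\<lambda>k. \<forall>y\<in>ball p d. \<bar>V k y - v0\<bar> < e) sequentially"
    and A: "\<And>k. set_integrable lborel D (rhs (V k) (g k))" "\<And>k. (LINT y:D|lborel. rhs (V k) (g k) y) \<le> A"
  obtains \<sigma> mm where "strict_mono (\<sigma> :: nat \<Rightarrow> nat)"
    "\<And>L. (\<lambda>k. LINT y:ball (x (\<sigma> k)) (L / sqrt (g (\<sigma> k) (x (\<sigma> k))))|lborel. rhs (V (\<sigma> k)) (g (\<sigma> k)) y) \<longlonglongrightarrow> mm L"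
    "\<And>L. mm L \<le> 8 * pi" "\<And>e. 0 < e \<Longrightarrow> \<exists>L\<ge>1. 8 * pi - e \<le> mm L"
    "\<And>L L'. L \<le> L' \<Longrightarrow> mm L \<le> mm L'"
proof -
  note sols = solutionD[OF sol]
  have gpos: "0 < g k (x k)" for k
  proof -
    have "x k \<in> D" using sub[of k] r[of k] by auto
    then show ?thesis by (rule sols(4))
  qed
  define s where "s = (\<lambda>k. 1 / sqrt (g k (x k)))"
  have s: "0 < s k" for k using gpos by (simp add: s_def)
  have s2: "(s k)\<^sup>2 * g k (x k) = 1" for k using gpos[of k] by (simp add: s_def power_divide)
  define R where "R = (\<lambda>k. r k * sqrt (g k (x k)))"
  have sR: "s k * R k = r k" for k using gpos[of k] by (simp add: s_def R_def)
  define h where "h = (\<lambda>k. rescale (x k) (s k) (g k))"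
  define W where "W = (\<lambda>k y. V k (x k + s k *\<^sub>R y))"
  have slim: "s \<longlonglongrightarrow> 0"
    unfolding s_def using filterlim_compose[OF sqrt_at_top gx]
    by (rule tendsto_divide_0[OF tendsto_const filterlim_at_top_imp_at_infinity])
  have inb: "x k + s k *\<^sub>R y \<in> ball (x k) (r k) \<longleftrightarrow> y \<in> ball 0 (R k)" for k y
    using ball_rescale[OF s[of k], of "x k" y 0 "R k"] sR by simp
  obtain \<sigma> mm where \<sigma>: "strict_mono (\<sigma> :: nat \<Rightarrow> nat)"
    and l: "\<And>L. (\<lambda>k. LINT y:ball 0 L|lborel. rhs (W (\<sigma> k)) (h (\<sigma> k)) y) \<longlonglongrightarrow> mm L"
    and mm: "\<And>L. mm L \<le> 8 * pi" "\<And>e. 0 < e \<Longrightarrow> \<exists>L\<ge>1. 8 * pi - e \<le> mm L"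
    "\<And>L L'. L \<le> L' \<Longrightarrow> mm L \<le> mm L'"
  proof (rule normalized_limit[of R W h v0 A])
    show "filterlim R at_top sequentially" using big by (simp add: R_def)
    show "solution (ball 0 (R k)) (W k) (h k)" for k
      unfolding W_def h_def using sub[of k] inb[of k]
      by (intro solution_mono[OF solution_rescale[OF sol D s]]) auto
    show "h k 0 = 1" for k using s2 by (simp add: h_def rescale_def)
    show "h k y \<le> 4" if "y \<in> ball 0 (R k)" for k y
    proof -
      have "h k y \<le> (s k)\<^sup>2 * (4 * g k (x k))"
        unfolding h_def rescale_def using that inb[of k y] g4[of "x k + s k *\<^sub>R y" k] by (intro mult_left_mono) auto
      then show ?thesis using s2[of k] by simp
    qed
    show "eventually (\<lambda>k. \<forall>y\<in>ball 0 L. \<bar>W k y - v0\<bar> < e) sequentially" if e: "0 < e" for L e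
    proof -
      obtain d where d: "0 < d" "eventually (\<lambda>k. \<forall>y\<in>ball p d. \<bar>V k y - v0\<bar> < e) sequentially"
        using V[OF e] by blast
      have "(\<lambda>k. dist (x k) p + s k * \<bar>L\<bar>) \<longlonglongrightarrow> dist p p + 0 * \<bar>L\<bar>"
        by (intro tendsto_intros x slim)
      then have "eventually (\<lambda>k. dist (x k) p + s k * \<bar>L\<bar> < d) sequentially"
        by (rule order_tendstoD) (use d in simp)
      with d(2) show ?thesis
      proof eventually_elim
        case (elim k)
        show ?case
        proof
          fix y :: "real^2" assume y: "y \<in> ball 0 L"
          have "dist p (x k + s k *\<^sub>R y) \<le> dist p (x k) + dist (x k) (x k + s k *\<^sub>R y)" by (rule dist_triangle)
          also have "dist (x k) (x k + s k *\<^sub>R y) \<le> s k * \<bar>L\<bar>"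
            using y s[of k] by (auto simp: dist_norm intro!: mult_left_mono)
          finally have "x k + s k *\<^sub>R y \<in> ball p d" using elim(2) by (simp add: dist_commute)
          then show "\<bar>W k y - v0\<bar> < e" using elim(1) by (simp add: W_def)
        qed
      qed
    qed
    have m: "g k \<in> borel_measurable borel" "V k \<in> borel_measurable borel" for k using sols(6,7) by auto
    have i: "set_integrable lborel (ball (x k) (r k)) (rhs (V k) (g k))" for k
      by (rule set_integrable_subset[OF A(1)]) (use sub in auto)
    show "set_integrable lborel (ball 0 (R k)) (rhs (W k) (h k))" for k
      unfolding W_def h_def rhs_mass_rescale(2)[OF s m sols(8)] sR by (rule i)
    show "(LINT y:ball 0 (R k)|lborel. rhs (W k) (h k) y) \<le> A" for k
    proof -
      have "(LINT y:ball 0 (R k)|lborel. rhs (W k) (h k) y) = (LINT y:ball (x k) (r k)|lborel. rhs (V k) (g k) y)"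
        unfolding W_def h_def rhs_mass_rescale(1)[OF s m sols(8)] sR ..
      also have "\<dots> \<le> (LINT y:D|lborel. rhs (V k) (g k) y)"
        unfolding set_lebesgue_integral_def using i[of k] A(1)[of k] sub[of k] rhs_nonneg[OF sols(2)]
        by (intro integral_mono) (auto simp: set_integrable_def indicator_def)
      also have "\<dots> \<le> A" by (rule A(2))
      finally show ?thesis .
    qed
  qed (rule that)
  show ?thesis
  proof (rule that[OF \<sigma> _ mm])
    fix L
    have m: "g k \<in> borel_measurable borel" "V k \<in> borel_measurable borel" for k using sols(6,7) by auto
    have "(LINT y:ball 0 L|lborel. rhs (W k) (h k) y) = (LINT y:ball (x k) (L / sqrt (g k (x k)))|lborel. rhs (V k) (g k) y)" for k
      unfolding W_def h_def rhs_mass_rescale(1)[OF s m sols(8)] by (simp add: s_def)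
    then show "(\<lambda>k. LINT y:ball (x (\<sigma> k)) (L / sqrt (g (\<sigma> k) (x (\<sigma> k))))|lborel. rhs (V (\<sigma> k)) (g (\<sigma> k)) y) \<longlonglongrightarrow> mm L"
      using l[of L] by simp
  qed
qed

end

section \<open>Decay away from the centers\<close>

lemma norm_square_ratio_le: "norm z < R \<Longrightarrow> (norm z)\<^sup>2 / (2 * R\<^sup>2) \<le> 1 / 2"
proof -
  assume z: "norm z < R"
  then have "0 < R" by (rule le_less_trans[OF norm_ge_zero])
  moreover have "(norm z)\<^sup>2 \<le> R\<^sup>2" using z by (intro power_mono) auto
  ultimately show ?thesis by (simp add: divide_le_eq)
qed

text \<open>The quadratic term of the kernel lies between 0 and 1/2 before the division by
  \<open>2 * pi\<close>; hence the loss of 1/2.\<close>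

lemma green_kernel_diff_lower:
  assumes "0 < norm w" "norm w \<le> norm z" "norm z < R"
  shows "(ln (norm z / norm w) - 1 / 2) / (2 * pi) \<le> green_kernel R w - green_kernel R z"
proof -
  have pos: "0 < R" "0 < norm z" "norm w < R" using assms by linarith+
  have "(norm z)\<^sup>2 / (2 * R\<^sup>2) \<le> 1 / 2" using assms(3) by (rule norm_square_ratio_le)
  moreover have "0 \<le> (norm w)\<^sup>2 / (2 * R\<^sup>2)" by simp
  moreover have "ln (R / norm w) - ln (R / norm z) = ln (norm z / norm w)"
    using assms(1) pos by (simp add: ln_div)
  ultimately have "ln (norm z / norm w) - 1 / 2 \<le> (ln (R / norm w) - 1 / 2 + (norm w)\<^sup>2 / (2 * R\<^sup>2)) - (ln (R / norm z) - 1 / 2 + (norm z)\<^sup>2 / (2 * R\<^sup>2))"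
    by argo
  then have "(ln (norm z / norm w) - 1 / 2) / (2 * pi) \<le> ((ln (R / norm w) - 1 / 2 + (norm w)\<^sup>2 / (2 * R\<^sup>2)) - (ln (R / norm z) - 1 / 2 + (norm z)\<^sup>2 / (2 * R\<^sup>2))) / (2 * pi)"
    by (intro divide_right_mono) auto
  also have "\<dots> = green_kernel R w - green_kernel R z"
    unfolding green_kernel_def using assms pos by (simp only: if_True simp_thms diff_divide_distrib)
  finally show ?thesis .
qed

lemma green_kernel_le_ln:
  assumes "0 < norm z" "norm z < R"
  shows "green_kernel R z \<le> ln (R / norm z) / (2 * pi)"
proof -
  have "ln (R / norm z) - 1 / 2 + (norm z)\<^sup>2 / (2 * R\<^sup>2) \<le> ln (R / norm z)"
    using norm_square_ratio_le[OF assms(2)] by argo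
  then have "(ln (R / norm z) - 1 / 2 + (norm z)\<^sup>2 / (2 * R\<^sup>2)) / (2 * pi) \<le> ln (R / norm z) / (2 * pi)"
    by (intro divide_right_mono) auto
  then show ?thesis unfolding green_kernel_def using assms by (simp only: if_True simp_thms)
qed

section \<open>Means and potentials near a blow-up point\<close>

locale local_solution = hartree +
  fixes D :: "(real^2) set" and V g :: "real^2 \<Rightarrow> real" and p :: "real^2" and \<rho> A :: real
  assumes sol: "solution D V g" and D: "open D" "cball p (2 * \<rho>) \<subseteq> D" and rho: "0 < \<rho>"
    and A: "set_integrable lborel D (rhs V g)" "(LINT y:D|lborel. rhs V g y) \<le> A"
begin

lemmas sols = solutionD[OF sol]

lemma meas [measurable]: "g \<in> borel_measurable borel" "V \<in> borel_measurable borel" "rhs V g \<in> borel_measurable borel"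
  using sols(6,7) by auto

text \<open>Measures how far \<open>ln g\<close> lies below zero on the scale of
  \<open>\<rho>\<close>. Along a concentrating sequence it tends to infinity, so the estimates below
  display their dependence on \<open>N\<close>.\<close>

definition "N = (LINT y:ball p (2 * \<rho>)|lborel. max 0 (- ln (g y)))"
definition "havg x = (LINT y:ball x \<rho>|lborel. ln (g y)) / (pi * \<rho>\<^sup>2)"
definition "W x = (LINT y|lborel. green_kernel \<rho> (x - y) * rhs V g y)"

lemma rhs0: "0 \<le> rhs V g y" by (rule rhs_nonneg[OF sols(2)])

lemma A_nonneg: "0 \<le> A"
proof -
  have "0 \<le> (LINT y:D|lborel. rhs V g y)"
    unfolding set_lebesgue_integral_def using rhs0 by (intro Bochner_Integration.integral_nonneg) simp
  then show ?thesis using A(2) by linarith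
qed

lemma sub_ball: "dist p x + r \<le> 2 * \<rho> \<Longrightarrow> cball x r \<subseteq> D"
  using cball_subset_cball_iff[of x r p "2 * \<rho>"] D(2) by (metis add.commute dist_commute order_trans)

lemma mass_sub:
  assumes "B \<in> sets borel" "B \<subseteq> D"
  shows "set_integrable lborel B (rhs V g)" "(LINT y:B|lborel. rhs V g y) \<le> A"
proof -
  show i: "set_integrable lborel B (rhs V g)" by (rule set_integrable_subset[OF A(1)]) (use assms in auto)
  have "(LINT y:B|lborel. rhs V g y) \<le> (LINT y:D|lborel. rhs V g y)"
    unfolding set_lebesgue_integral_def using i A(1) assms(2) rhs0
    by (intro integral_mono) (auto simp: set_integrable_def indicator_def)
  with A(2) show "(LINT y:B|lborel. rhs V g y) \<le> A" by linarith
qed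

definition "um y = max 0 (- ln (g y))"
definition "up y = max 0 (ln (g y))"

lemma [measurable]: "um \<in> borel_measurable borel" "up \<in> borel_measurable borel"
  unfolding um_def up_def by measurable

lemma um0: "0 \<le> um y" "0 \<le> up y" "ln (g y) = up y - um y" by (auto simp: um_def up_def)

lemma ints:
  assumes "dist p x + r \<le> 2 * \<rho>" "0 < r"
  shows "set_integrable lborel (ball x r) (\<lambda>y. ln (g y))" "set_integrable lborel (ball x r) um" "set_integrable lborel (ball x r) up"
    "(LINT y:ball x r|lborel. ln (g y)) = (LINT y:ball x r|lborel. up y) - (LINT y:ball x r|lborel. um y)"
    "(LINT y:ball x r|lborel. up y) \<le> c0" "(LINT y:ball x r|lborel. um y) \<le> N"
proof -
  have i: "set_integrable lborel (ball x r) (\<lambda>y. ln (g y))" if "dist p x + r \<le> 2 * \<rho>" "0 < r" for x r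
    by (rule solution_mean_value(1)[OF sol D(1) sub_ball[OF that(1)] that(2)])
  then show "set_integrable lborel (ball x r) (\<lambda>y. ln (g y))" using assms .
  have iu: "set_integrable lborel (ball x r) um" "set_integrable lborel (ball x r) up" if "dist p x + r \<le> 2 * \<rho>" "0 < r" for x r
  proof -
    note i = i[OF that]
    show "set_integrable lborel (ball x r) um" "set_integrable lborel (ball x r) up"
      unfolding set_integrable_def
      by (rule Bochner_Integration.integrable_bound[OF integrable_abs[OF i[unfolded set_integrable_def]]];
          auto simp: um_def up_def indicator_def intro!: borel_measurable_times borel_measurable_indicator AE_I2)+
  qed
  show i2: "set_integrable lborel (ball x r) um" "set_integrable lborel (ball x r) up" using iu[OF assms] by auto
  show "(LINT y:ball x r|lborel. ln (g y)) = (LINT y:ball x r|lborel. up y) - (LINT y:ball x r|lborel. um y)"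
    unfolding um0(3) by (rule set_integral_diff(2)[OF i2(2,1)])
  have "(LINT y:ball x r|lborel. up y) \<le> (LINT y|lborel. g y)"
    unfolding set_lebesgue_integral_def
  proof (rule integral_mono)
    fix y
    show "indicator (ball x r) y *\<^sub>R up y \<le> g y"
    proof (cases "y \<in> ball x r")
      case True
      have "ball x r \<subseteq> D" using sub_ball[OF assms(1)] ball_subset_cball by blast
      then have "0 < g y" using True sols(4) by blast
      then have "up y \<le> g y" using ln_le_minus_one[of "g y"] by (simp add: up_def)
      then show ?thesis using True by (simp del: mem_ball)
    qed (use sols(8) in \<open>simp del: mem_ball\<close>)
  qed (use i2 sols(9) in \<open>auto simp: set_integrable_def\<close>)
  then show "(LINT y:ball x r|lborel. up y) \<le> c0" using sols(10) by linarith
  have sb: "ball x r \<subseteq> ball p (2 * \<rho>)"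
  proof
    fix y assume "y \<in> ball x r"
    then show "y \<in> ball p (2 * \<rho>)" using assms(1) dist_triangle[of p y x] by simp
  qed
  have "(LINT y:ball x r|lborel. um y) \<le> (LINT y:ball p (2 * \<rho>)|lborel. um y)"
    unfolding set_lebesgue_integral_def using i2(1) iu(1)[of p "2 * \<rho>"] rho sb um0
    by (intro integral_mono) (auto simp: set_integrable_def indicator_def)
  then show "(LINT y:ball x r|lborel. um y) \<le> N" by (simp add: N_def um_def[abs_def])
qed

lemma N_nonneg: "0 \<le> N"
  unfolding N_def set_lebesgue_integral_def by (intro Bochner_Integration.integral_nonneg) simp

lemma mean_value: "dist p x \<le> \<rho> \<Longrightarrow> ln (g x) = havg x + W x"
  unfolding havg_def W_def using sols(5)[OF rho sub_ball[of x \<rho>]] by simp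

text \<open>Green's formula at \<open>p\<close> with two radii shows that the mean over
  \<open>ball p (\<rho> / 2)\<close> exceeds that over \<open>ball p (2 * \<rho>)\<close> by at most
  \<open>A\<close>. The negative part is therefore felt in the small ball in the proportion 1/16 of
  the areas, and \<open>ball x \<rho>\<close> contains the small ball.\<close>

lemma havg_upper:
  assumes x: "x \<in> ball p (\<rho> / 4)"
  shows "havg x \<le> (17/16 * c0 + A * (pi * \<rho>\<^sup>2 / 4)) / (pi * \<rho>\<^sup>2) - N / (16 * (pi * \<rho>\<^sup>2))"
proof -
  define a where "a = pi * \<rho>\<^sup>2"
  have a: "0 < a" using rho by (simp add: a_def)
  have d: "dist p x + \<rho> \<le> 2 * \<rho>" "dist p p + \<rho> / 2 \<le> 2 * \<rho>" "dist p p + 2 * \<rho> \<le> 2 * \<rho>" using x rho by auto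
  have sb: "ball p (\<rho> / 2) \<subseteq> ball x \<rho>"
  proof
    fix y assume "y \<in> ball p (\<rho> / 2)"
    then show "y \<in> ball x \<rho>" using x rho dist_triangle[of x y p] by (simp add: dist_commute)
  qed
  have "(LINT y:ball p (\<rho> / 2)|lborel. um y) \<le> (LINT y:ball x \<rho>|lborel. um y)"
    unfolding set_lebesgue_integral_def using ints(2)[OF d(1) rho] ints(2)[OF d(2)] rho sb um0
    by (intro integral_mono) (auto simp: set_integrable_def indicator_def)
  then have 1: "(LINT y:ball x \<rho>|lborel. ln (g y)) \<le> c0 - (LINT y:ball p (\<rho> / 2)|lborel. um y)"
    using ints(4,5)[OF d(1) rho] by linarith
  define K where "K r = (LINT y|lborel. green_kernel r (p - y) * rhs V g y)" for r
  have K: "integrable lborel (\<lambda>y. green_kernel r (p - y) * rhs V g y)" if "0 < r" "r \<le> 2 * \<rho>" for r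
    using solution_mean_value(2)[OF sol D(1) sub_ball that(1)] that by simp
  have e: "ln (g p) = (LINT y:ball p r|lborel. ln (g y)) / (pi * r\<^sup>2) + K r" if "0 < r" "r \<le> 2 * \<rho>" for r
    unfolding K_def using sols(5)[OF that(1) sub_ball[of p r]] that by simp
  \<comment> \<open>The ratio of the radii is 4, and \<open>ln 4 / (2 * pi)\<close> is at most
    1.\<close>
  have "K (2 * \<rho>) - K (\<rho> / 2) \<le> A"
  proof -
    have "K (2 * \<rho>) - K (\<rho> / 2) = (LINT y|lborel. green_kernel (2 * \<rho>) (p - y) * rhs V g y - green_kernel (\<rho> / 2) (p - y) * rhs V g y)"
      unfolding K_def using K rho by simp
    also have "\<dots> \<le> (LINT y|lborel. indicator (ball p (2 * \<rho>)) y *\<^sub>R rhs V g y)"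
    proof (rule integral_mono)
      fix y
      show "green_kernel (2 * \<rho>) (p - y) * rhs V g y - green_kernel (\<rho> / 2) (p - y) * rhs V g y \<le> indicator (ball p (2 * \<rho>)) y *\<^sub>R rhs V g y"
      proof (cases "y \<in> ball p (2 * \<rho>)")
        case True
        have "green_kernel (2 * \<rho>) (p - y) - green_kernel (\<rho> / 2) (p - y) \<le> ln 4 / (2 * pi)"
          using green_kernel_radius_diff[of "\<rho> / 2" "2 * \<rho>" "p - y"] rho by simp
        also have "\<dots> \<le> 1"
          using ln_le_minus_one[of "4::real"] pi_ge_two by (simp add: divide_le_eq)
        finally show ?thesis using True mult_right_mono[OF _ rhs0, of _ 1 y]
          by (simp add: left_diff_distrib[symmetric])
      next
        case False
        then show ?thesis using rho by (simp add: green_kernel_def dist_norm)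
      qed
    qed (use K rho mass_sub(1)[of "ball p (2 * \<rho>)"] order_trans[OF ball_subset_cball D(2)] in \<open>simp_all add: set_integrable_def\<close>)
    also have "\<dots> \<le> A"
      using mass_sub(2)[of "ball p (2 * \<rho>)"] order_trans[OF ball_subset_cball D(2)]
      by (simp add: set_lebesgue_integral_def)
    finally show ?thesis .
  qed
  then have "(LINT y:ball p (\<rho> / 2)|lborel. ln (g y)) / (pi * (\<rho> / 2)\<^sup>2) \<le> (LINT y:ball p (2 * \<rho>)|lborel. ln (g y)) / (pi * (2 * \<rho>)\<^sup>2) + A"
    using e[of "\<rho> / 2"] e[of "2 * \<rho>"] rho by linarith
  moreover have "- (LINT y:ball p (\<rho> / 2)|lborel. um y) \<le> (LINT y:ball p (\<rho> / 2)|lborel. ln (g y))"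
  proof -
    have "0 \<le> (LINT y:ball p (\<rho> / 2)|lborel. up y)"
      unfolding set_lebesgue_integral_def using um0 by (intro Bochner_Integration.integral_nonneg) simp
    then show ?thesis using ints(4)[OF d(2)] rho by simp
  qed
  moreover have "(LINT y:ball p (2 * \<rho>)|lborel. ln (g y)) \<le> c0 - N"
    using ints(4,5)[OF d(3)] rho by (simp add: N_def um_def[abs_def])
  moreover have "pi * (\<rho> / 2)\<^sup>2 = a / 4" "pi * (2 * \<rho>)\<^sup>2 = 4 * a" by (auto simp: a_def power_divide power_mult_distrib)
  ultimately have "- (LINT y:ball p (\<rho> / 2)|lborel. um y) \<le> a / 4 * ((c0 - N) / (4 * a) + A)"
    using mean_value_arithmetic(3)[OF a] by (simp only:)
  also have "\<dots> = c0 / 16 - N / 16 + A * (a / 4)" using a by (simp add: field_simps)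
  finally have "(LINT y:ball x \<rho>|lborel. ln (g y)) \<le> (17/16 * c0 + A * (a / 4)) - N / 16" using 1 by argo
  then have "havg x \<le> ((17/16 * c0 + A * (a / 4)) - N / 16) / a"
    unfolding havg_def a_def[symmetric] using a by (intro divide_right_mono) auto
  also have "\<dots> = (17/16 * c0 + A * (a / 4)) / a - N / (16 * a)" by (simp add: diff_divide_distrib)
  finally show ?thesis by (simp only: a_def)
qed

text \<open>The positive part of \<open>ln g\<close> costs at most \<open>c0\<close>. The negative
  part changes only on the symmetric difference of the balls, whose area is of order
  \<open>\<rho> * dist x x'\<close>, and is bounded pointwise in terms of \<open>N\<close>.\<close>

lemma havg_diff:
  assumes x: "x \<in> ball p (\<rho> / 4)" "x' \<in> ball p (\<rho> / 4)"
  shows "havg x - havg x' \<le> c0 / (pi * \<rho>\<^sup>2) + 16 / (pi * \<rho> ^ 3) * (dist x x' * N)"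
proof -
  define d where "d = dist x x'"
  have d: "norm (x - x') \<le> d" "d \<le> \<rho>" "0 \<le> d"
  proof -
    have "d \<le> dist p x + dist p x'" unfolding d_def by (rule dist_triangle3)
    then show "d \<le> \<rho>" using x rho by simp
  qed (simp_all add: d_def dist_norm)
  have dx: "dist p x + \<rho> \<le> 2 * \<rho>" "dist p x' + \<rho> \<le> 2 * \<rho>" using x rho by auto
  note I = ints[OF dx(1) rho] and I' = ints[OF dx(2) rho]
  \<comment> \<open>Superharmonicity on a ball of radius \<open>\<rho> / 2\<close>, which still fits
    into \<open>ball p (2 * \<rho>)\<close>.\<close>
  have um_le: "um y \<le> 4 * N / (pi * \<rho>\<^sup>2)" if y: "y \<in> ball x \<rho> \<or> y \<in> ball x' \<rho>" for y
  proof -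
    have "dist p y < 5 / 4 * \<rho>"
      using y
    proof
      assume "y \<in> ball x \<rho>"
      with x(1) dist_triangle[of p y x] show ?thesis by simp
    next
      assume "y \<in> ball x' \<rho>"
      with x(2) dist_triangle[of p y x'] show ?thesis by simp
    qed
    then have dy: "dist p y + \<rho> / 2 \<le> 2 * \<rho>" using rho by simp
    have r2: "0 < \<rho> / 2" using rho by simp
    have "- N \<le> (LINT y:ball y (\<rho> / 2)|lborel. ln (g y))"
    proof -
      have "0 \<le> (LINT y:ball y (\<rho> / 2)|lborel. up y)"
        unfolding set_lebesgue_integral_def using um0 by (intro Bochner_Integration.integral_nonneg) simp
      then show ?thesis using ints(4,6)[OF dy r2] by linarith
    qed
    then have "- N / (pi * (\<rho> / 2)\<^sup>2) \<le> (LINT y:ball y (\<rho> / 2)|lborel. ln (g y)) / (pi * (\<rho> / 2)\<^sup>2)"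
      by (rule divide_right_mono) simp
    also have "\<dots> \<le> ln (g y)" by (rule solution_mean_value(4)[OF sol D(1) sub_ball[OF dy] r2])
    also have "- N / (pi * (\<rho> / 2)\<^sup>2) = - (4 * N / (pi * \<rho>\<^sup>2))" by (simp add: power_divide)
    finally have "- ln (g y) \<le> 4 * N / (pi * \<rho>\<^sup>2)" by linarith
    moreover have "0 \<le> 4 * N / (pi * \<rho>\<^sup>2)" using N_nonneg by simp
    ultimately show ?thesis by (simp add: um_def)
  qed
  have "(LINT y:ball x' \<rho>|lborel. um y) - (LINT y:ball x \<rho>|lborel. um y) = (LINT y|lborel. indicator (ball x' \<rho>) y * um y - indicator (ball x \<rho>) y * um y)"
    using I(2) I'(2) by (simp add: set_lebesgue_integral_def set_integrable_def)
  also have "\<dots> \<le> (LINT y|lborel. 4 * N / (pi * \<rho>\<^sup>2) * \<bar>indicator (ball x \<rho>) y - indicator (ball x' \<rho>) y\<bar>)"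
  proof (rule integral_mono)
    fix y
    show "indicator (ball x' \<rho>) y * um y - indicator (ball x \<rho>) y * um y \<le> 4 * N / (pi * \<rho>\<^sup>2) * \<bar>indicator (ball x \<rho>) y - indicator (ball x' \<rho>) y\<bar>"
      using um_le[of y] um0(1)[of y] N_nonneg
      by (cases "y \<in> ball x \<rho>"; cases "y \<in> ball x' \<rho>") (simp_all del: mem_ball)
  qed (use I(2) I'(2) ball_indicator_difference(1)[OF d(1,2)] in \<open>auto simp: set_integrable_def\<close>)
  also have "\<dots> \<le> 4 * N / (pi * \<rho>\<^sup>2) * (4 * pi * \<rho> * d)"
    unfolding integral_mult_right_zero using ball_indicator_difference(2)[OF d(1,2)] N_nonneg by (intro mult_left_mono) auto
  also have "\<dots> = 16 * N * d / \<rho>" using rho by (simp add: power2_eq_square)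
  finally have 1: "(LINT y:ball x' \<rho>|lborel. um y) - (LINT y:ball x \<rho>|lborel. um y) \<le> 16 * N * d / \<rho>" .
  have "0 \<le> (LINT y:ball x' \<rho>|lborel. up y)"
    unfolding set_lebesgue_integral_def using um0 by (intro Bochner_Integration.integral_nonneg) simp
  then have "(LINT y:ball x \<rho>|lborel. ln (g y)) - (LINT y:ball x' \<rho>|lborel. ln (g y)) \<le> c0 + 16 * N * d / \<rho>"
    using I(4,5) I'(4) 1 by linarith
  then have "((LINT y:ball x \<rho>|lborel. ln (g y)) - (LINT y:ball x' \<rho>|lborel. ln (g y))) / (pi * \<rho>\<^sup>2) \<le> (c0 + 16 * N * d / \<rho>) / (pi * \<rho>\<^sup>2)"
    by (rule divide_right_mono) simp
  then have "havg x - havg x' \<le> (c0 + 16 * N * d / \<rho>) / (pi * \<rho>\<^sup>2)"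
    unfolding havg_def by (subst diff_divide_distrib[symmetric])
  also have "\<dots> = c0 / (pi * \<rho>\<^sup>2) + 16 * N * d / \<rho> / (pi * \<rho>\<^sup>2)" by (rule add_divide_distrib)
  also have "16 * N * d / \<rho> / (pi * \<rho>\<^sup>2) = 16 / (pi * \<rho> ^ 3) * (d * N)"
    using rho by (simp add: power2_eq_square power3_eq_cube mult_ac)
  finally show ?thesis by (simp only: d_def)
qed

end

context hartree
begin

text \<open>Comes from \<open>rhs_bound\<close> at radius \<open>d / 4\<close>, because
  \<open>4 * Q / d\<^sup>2 = (Q / 4) / (d / 4)\<^sup>2\<close>.\<close>

definition "near_const Q = rhs_const (Q / 4) * (Q / 4) powr lam * 16"

lemma near_const_nonneg: "0 \<le> near_const Q"
  unfolding near_const_def using rhs_const_pos[of "Q / 4"] by (intro mult_nonneg_nonneg) auto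

lemma near_rhs:
  assumes sol: "solution D V g" and d: "0 < d" and g: "\<And>z. z \<in> ball x (d / 2) \<Longrightarrow> g z \<le> 4 * Q / d\<^sup>2"
  shows "y \<in> ball x (d / 4) \<Longrightarrow> rhs V g y \<le> near_const Q / d\<^sup>2"
    and "rhs V g x \<le> rhs_const (Q / 4) * 16 * (g x * d\<^sup>2) powr lam / d\<^sup>2"
proof -
  note sols = solutionD[OF sol]
  have b: "rhs V g y \<le> rhs_const (Q / 4) * (g y * (d / 4)\<^sup>2) powr lam / (d / 4)\<^sup>2" if y: "y \<in> ball x (d / 4)" for y
  proof (rule rhs_bound[OF sols(1,2)])
    fix z assume "z \<in> ball y (d / 4)"
    then have "z \<in> ball x (d / 2)" using y dist_triangle[of x z y] by simp
    then have "g z \<le> 4 * Q / d\<^sup>2" by (rule g)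
    then show "g z \<le> (Q / 4) / (d / 4)\<^sup>2" by (simp add: power_divide)
  qed (use d in simp)
  show "rhs V g y \<le> near_const Q / d\<^sup>2" if y: "y \<in> ball x (d / 4)"
  proof -
    have "g y \<le> 4 * Q / d\<^sup>2" using y d by (intro g) auto
    then have "g y * (d / 4)\<^sup>2 \<le> Q / 4" using d by (simp add: power_divide field_simps)
    then have "rhs_const (Q / 4) * (g y * (d / 4)\<^sup>2) powr lam / (d / 4)\<^sup>2 \<le> rhs_const (Q / 4) * (Q / 4) powr lam / (d / 4)\<^sup>2"
      using rhs_const_pos[of "Q / 4"] sols(8)[of y] lam_bounds
      by (intro divide_right_mono mult_left_mono powr_mono2) auto
    also have "\<dots> = near_const Q / d\<^sup>2" by (simp add: near_const_def power_divide)
    finally show ?thesis using b[OF y] by simp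
  qed
  have "rhs V g x \<le> rhs_const (Q / 4) * (g x * (d / 4)\<^sup>2) powr lam / (d / 4)\<^sup>2" using d by (intro b) auto
  also have "\<dots> \<le> rhs_const (Q / 4) * (g x * d\<^sup>2) powr lam / (d / 4)\<^sup>2"
    using rhs_const_pos[of "Q / 4"] sols(8)[of x] lam_bounds
    by (intro divide_right_mono mult_left_mono powr_mono2) (auto simp: power_divide)
  finally show "rhs V g x \<le> rhs_const (Q / 4) * 16 * (g x * d\<^sup>2) powr lam / d\<^sup>2"
    by (simp add: power_divide mult_ac)
qed

end

context local_solution
begin

lemma ball_mass_le: "integrable lborel (\<lambda>y. indicator (ball p (2 * \<rho>)) y * rhs V g y)"
  "(LINT y|lborel. indicator (ball p (2 * \<rho>)) y * rhs V g y) \<le> A"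
  using mass_sub[of "ball p (2 * \<rho>)"] order_trans[OF ball_subset_cball D(2)]
  by (auto simp: set_integrable_def set_lebesgue_integral_def)

lemma W_integrable: "dist p x \<le> \<rho> \<Longrightarrow> integrable lborel (\<lambda>y. green_kernel \<rho> (x - y) * rhs V g y)"
  using solution_mean_value(2)[OF sol D(1) sub_ball[of x \<rho>] rho] by simp

text \<open>Outside \<open>ball x (d / 4)\<close> the kernel is at most
  \<open>ln (4 * \<rho> / d)\<close>, which multiplies the mass. Inside, the excess of the logarithm
  is integrated against the pointwise bound of order \<open>1 / d\<^sup>2\<close>.\<close>

lemma W_upper:
  assumes x: "x \<in> ball p (\<rho> / 4)" and d: "0 < d" "d \<le> \<rho>" and g: "\<And>z. z \<in> ball x (d / 2) \<Longrightarrow> g z \<le> 4 * Q / d\<^sup>2"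
  shows "W x \<le> A * ln (4 * \<rho> / d) + near_const Q * pi"
proof -
  define L where "L = ln (4 * \<rho> / d)"
  have L: "0 \<le> L" unfolding L_def using d rho by (simp add: le_divide_eq)
  define k where "k = (\<lambda>y. indicator (ball x (d / 4)) y * norm (x - y) powr - 1)"
  have k: "integrable lborel k" "(LINT y|lborel. k y) = 2 * pi * (d / 4)"
    unfolding k_def using norm_powr_ball_shift[of "d / 4" 1 x] d by simp_all
  have k0: "0 \<le> k y" for y by (simp add: k_def)
  have "W x \<le> (LINT y|lborel. L * (indicator (ball p (2 * \<rho>)) y * rhs V g y) + (near_const Q / d) * k y)"
    unfolding W_def
  proof (rule integral_mono_AE)
    show "AE y in lborel. green_kernel \<rho> (x - y) * rhs V g y \<le> L * (indicator (ball p (2 * \<rho>)) y * rhs V g y) + (near_const Q / d) * k y"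
      using AE_lborel_singleton[of x]
    proof eventually_elim
      case (elim y)
      have n: "0 < norm (x - y)" using elim by simp
      have nk: "0 \<le> (near_const Q / d) * k y" using near_const_nonneg k0 d by simp
      show ?case
      proof (cases "norm (x - y) < \<rho>")
        case False
        then have "green_kernel \<rho> (x - y) = 0" by (simp add: green_kernel_def)
        then show ?thesis using nk L rhs0[of y] by simp
      next
        case True
        have "dist p y < 2 * \<rho>" using True x dist_triangle[of p y x] rho by (simp add: dist_norm)
        then have E: "indicator (ball p (2 * \<rho>)) y = (1::real)" by simp
        have "green_kernel \<rho> (x - y) \<le> ln (\<rho> / norm (x - y)) / (2 * pi)" by (rule green_kernel_le_ln[OF n True])
        also have "\<dots> \<le> ln (\<rho> / norm (x - y))"
          using mult_left_mono[of 1 "2 * pi" "ln (\<rho> / norm (x - y))"] pi_ge_two n True by (simp add: divide_le_eq)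
        finally have gk: "green_kernel \<rho> (x - y) \<le> ln (\<rho> / norm (x - y))" .
        show ?thesis
        proof (cases "norm (x - y) < d / 4")
          case near: True
          have "ln (\<rho> / norm (x - y)) = L + ln ((d / 4) / norm (x - y))"
            using n d rho by (simp add: L_def ln_div ln_mult)
          also have "ln ((d / 4) / norm (x - y)) \<le> (d / 4) / norm (x - y)"
            using ln_le_minus_one[of "(d / 4) / norm (x - y)"] n d by simp
          also have "(d / 4) / norm (x - y) \<le> d / norm (x - y)" using d n by (intro divide_right_mono) auto
          finally have "green_kernel \<rho> (x - y) \<le> L + d / norm (x - y)" using gk by linarith
          then have "green_kernel \<rho> (x - y) \<le> L + d * norm (x - y) powr - 1"
            by (simp add: powr_minus_divide)
          then have "green_kernel \<rho> (x - y) * rhs V g y \<le> L * rhs V g y + d * norm (x - y) powr - 1 * rhs V g y"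
            using mult_right_mono[OF _ rhs0[of y]] by (simp only: distrib_right[symmetric])
          also have "rhs V g y \<le> near_const Q / d\<^sup>2" using near by (intro near_rhs(1)[OF sol d(1) g]) (auto simp: dist_norm)
          then have "d * norm (x - y) powr - 1 * rhs V g y \<le> d * norm (x - y) powr - 1 * (near_const Q / d\<^sup>2)"
            using d by (intro mult_left_mono) auto
          also have "d * norm (x - y) powr - 1 * (near_const Q / d\<^sup>2) = (near_const Q / d) * k y"
            using near d by (simp add: k_def dist_norm power2_eq_square)
          finally show ?thesis by (simp add: E)
        next
          case False
          have "ln (\<rho> / norm (x - y)) \<le> L"
            unfolding L_def using False n d rho by (subst ln_le_cancel_iff) (auto simp: field_simps)
          then show ?thesis using gk nk mult_right_mono[of "green_kernel \<rho> (x - y)" L "rhs V g y"] rhs0[of y] by (simp add: E)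
        qed
      qed
    qed
  qed (use W_integrable[of x] x rho ball_mass_le(1) k(1) in auto)
  also have "\<dots> = L * (LINT y|lborel. indicator (ball p (2 * \<rho>)) y * rhs V g y) + (near_const Q / d) * (2 * pi * (d / 4))"
    using ball_mass_le(1) k(1) by (simp add: k(2))
  also have "\<dots> \<le> L * A + near_const Q * pi"
  proof -
    have "(near_const Q / d) * (2 * pi * (d / 4)) = near_const Q * (pi / 2)" using d by simp
    also have "\<dots> \<le> near_const Q * pi" using near_const_nonneg by (intro mult_left_mono) auto
    finally show ?thesis using mult_left_mono[OF ball_mass_le(2) L] by linarith
  qed
  finally show ?thesis by (simp add: L_def mult.commute)
qed

text \<open>The mass of at least \<open>7 * pi\<close> within \<open>s\<close> of \<open>x'\<close>
  is at distance at least \<open>d / 2\<close> from \<open>x\<close>; it contributes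
  \<open>- 7 * pi / (2 * pi) = - 7 / 2\<close> times the logarithm. The rest contributes a bounded
  amount: the kernel difference is bounded away from \<open>x\<close>, and near \<open>x\<close> the
  pointwise bound on the right-hand side applies.\<close>

lemma W_diff:
  assumes x: "x \<in> ball p (\<rho> / 4)" "x' \<in> ball p (\<rho> / 4)" and d: "d = dist x x'" "0 < d"
    and g: "\<And>z. z \<in> ball x (d / 2) \<Longrightarrow> g z \<le> 4 * Q / d\<^sup>2"
    and s: "0 < s" "2 * s \<le> d" and m0: "7 * pi \<le> (LINT y:ball x' s|lborel. rhs V g y)"
  shows "W x - W x' \<le> 2 * A + near_const Q * pi - 7 / 2 * ln (d / (2 * s))"
proof -
  have d\<rho>: "d < \<rho> / 2"
  proof -
    have "d \<le> dist p x + dist p x'" unfolding d(1) by (rule dist_triangle3)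
    then show ?thesis using x by simp
  qed
  define k where "k = (\<lambda>y. indicator (ball x (d / 4)) y * norm (x - y) powr - 1)"
  have k: "integrable lborel k" "(LINT y|lborel. k y) = 2 * pi * (d / 4)"
    unfolding k_def using norm_powr_ball_shift[of "d / 4" 1 x] d by simp_all
  have k0: "0 \<le> k y" for y by (simp add: k_def)
  define L where "L = ln (d / (2 * s))"
  have L: "0 \<le> L" unfolding L_def using s by simp
  define f where "f = rhs V g"
  have f0: "0 \<le> f y" for y by (simp add: f_def rhs0)
  have bs: "ball x' s \<subseteq> D"
  proof -
    have "dist p x' + s \<le> 2 * \<rho>" using x s d\<rho> rho by simp
    from sub_ball[OF this] show ?thesis using ball_subset_cball by blast
  qed
  have fs: "integrable lborel (\<lambda>y. indicator (ball x' s) y * f y)" "7 * pi \<le> (LINT y|lborel. indicator (ball x' s) y * f y)"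
    using mass_sub(1)[OF _ bs] m0 by (auto simp: set_integrable_def set_lebesgue_integral_def f_def)
  define B where "B = (\<lambda>y. 2 * (indicator (ball p (2 * \<rho>)) y * f y) + (2 * near_const Q / d) * k y
      - (L / (2 * pi)) * (indicator (ball x' s) y * f y))"
  have Wi: "integrable lborel (\<lambda>y. green_kernel \<rho> (x - y) * f y)" "integrable lborel (\<lambda>y. green_kernel \<rho> (x' - y) * f y)"
    unfolding f_def using W_integrable[of x] W_integrable[of x'] x rho by auto
  have tri: "norm (x' - y) \<le> norm (x - y) + d" "d \<le> norm (x - y) + norm (x' - y)" "norm (x - y) \<le> norm (x' - y) + d" for y
    using dist_triangle[of x' y x] dist_triangle[of x x' y] dist_triangle[of x y x'] d by (auto simp: dist_norm norm_minus_commute)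
  have "W x - W x' = (LINT y|lborel. green_kernel \<rho> (x - y) * f y - green_kernel \<rho> (x' - y) * f y)"
    unfolding W_def f_def[symmetric] using Wi by simp
  also have "\<dots> \<le> (LINT y|lborel. B y)"
  proof (rule integral_mono_AE)
    show "AE y in lborel. green_kernel \<rho> (x - y) * f y - green_kernel \<rho> (x' - y) * f y \<le> B y"
      using AE_lborel_singleton[of x] AE_lborel_singleton[of x']
    proof eventually_elim
      case (elim y)
      have n: "0 < norm (x - y)" "0 < norm (x' - y)" using elim by auto
      have nk: "0 \<le> (2 * near_const Q / d) * k y" using near_const_nonneg k0 d by simp
      have Ef: "f y \<le> indicator (ball p (2 * \<rho>)) y * f y" if "norm (x - y) < \<rho> \<or> norm (x' - y) < \<rho>"
      proof -
        have "dist p y < 2 * \<rho>"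
          using that
        proof
          assume "norm (x - y) < \<rho>"
          then show ?thesis using x(1) dist_triangle[of p y x] rho by (simp add: dist_norm)
        next
          assume "norm (x' - y) < \<rho>"
          then show ?thesis using x(2) dist_triangle[of p y x'] rho by (simp add: dist_norm)
        qed
        then show ?thesis by simp
      qed
      have E0: "0 \<le> indicator (ball p (2 * \<rho>)) y * f y" using f0 by simp
      consider (far) "y \<notin> ball x' s" "d / 4 \<le> norm (x - y)" | (near) "y \<notin> ball x' s" "norm (x - y) < d / 4" | (center) "y \<in> ball x' s"
        by linarith
      then show ?case
      proof cases
        case far
        show ?thesis
        proof (cases "norm (x - y) \<le> norm (x' - y) \<and> norm (x - y) < \<rho>")
          case True
          have "green_kernel \<rho> (x - y) - green_kernel \<rho> (x' - y) \<le> ln (norm (x' - y) / norm (x - y)) / (2 * pi)"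
            using True n by (intro green_kernel_diff(2)) auto
          \<comment> \<open>From \<open>d / 4 \<le> norm (x - y)\<close> and the triangle
            inequality, \<open>norm (x' - y)\<close> is at most 5 times
            \<open>norm (x - y)\<close>.\<close>
          also have "\<dots> \<le> ln 5 / (2 * pi)"
          proof (intro divide_right_mono, subst ln_le_cancel_iff)
            show "norm (x' - y) / norm (x - y) \<le> 5" using tri(1)[of y] far n by (simp add: divide_le_eq)
          qed (use n in auto)
          also have "\<dots> \<le> 2" using ln_le_minus_one[of "5::real"] pi_ge_two by (simp add: divide_le_eq)
          finally have "(green_kernel \<rho> (x - y) - green_kernel \<rho> (x' - y)) * f y \<le> 2 * f y"
            using f0 by (intro mult_right_mono) auto
          also have "\<dots> \<le> 2 * (indicator (ball p (2 * \<rho>)) y * f y)" using Ef True by simp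
          finally show ?thesis using nk far by (simp add: B_def left_diff_distrib del: mem_ball)
        next
          case False
          have "green_kernel \<rho> (x - y) - green_kernel \<rho> (x' - y) \<le> 0"
          proof (cases "norm (x - y) \<le> norm (x' - y)")
            case True
            with False have "green_kernel \<rho> (x - y) = 0" by (simp add: green_kernel_def)
            then show ?thesis using green_kernel_nonneg by simp
          next
            case False
            then show ?thesis using green_kernel_diff(1)[of "x' - y" "x - y" \<rho>] n by simp
          qed
          then have "(green_kernel \<rho> (x - y) - green_kernel \<rho> (x' - y)) * f y \<le> 0"
            using f0 by (intro mult_nonpos_nonneg)
          then show ?thesis using nk far E0 by (simp add: B_def left_diff_distrib del: mem_ball)
        qed
      next
        case near
        have xy: "norm (x - y) \<le> norm (x' - y)" "norm (x - y) < \<rho>" using near(2) tri(2)[of y] d(2) d\<rho> rho by linarith+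
        have "green_kernel \<rho> (x - y) - green_kernel \<rho> (x' - y) \<le> ln (norm (x' - y) / norm (x - y)) / (2 * pi)"
          using xy n by (intro green_kernel_diff(2)) auto
        also have "\<dots> \<le> ln (norm (x' - y) / norm (x - y))"
          using mult_left_mono[of 1 "2 * pi" "ln (norm (x' - y) / norm (x - y))"] pi_ge_two xy n by (simp add: divide_le_eq)
        also have "\<dots> \<le> norm (x' - y) / norm (x - y)"
          using ln_le_minus_one[of "norm (x' - y) / norm (x - y)"] n by simp
        also have "\<dots> \<le> 2 * d / norm (x - y)"
        proof (rule divide_right_mono)
          show "norm (x' - y) \<le> 2 * d" using tri(1)[of y] near(2) d(2) by linarith
        qed simp
        also have "\<dots> = 2 * d * norm (x - y) powr - 1" by (simp add: powr_minus_divide)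
        finally have "(green_kernel \<rho> (x - y) - green_kernel \<rho> (x' - y)) * f y \<le> 2 * d * norm (x - y) powr - 1 * f y"
          using f0 by (intro mult_right_mono) auto
        also have "\<dots> \<le> 2 * d * norm (x - y) powr - 1 * (near_const Q / d\<^sup>2)"
          unfolding f_def using near d by (intro mult_left_mono near_rhs(1)[OF sol d(2) g]) (auto simp: dist_norm)
        also have "\<dots> = (2 * near_const Q / d) * k y"
          using near d by (simp add: k_def dist_norm power2_eq_square)
        finally show ?thesis using near E0 by (simp add: B_def left_diff_distrib del: mem_ball)
      next
        case center
        have xy: "norm (x' - y) < s" using center by (simp add: dist_norm)
        have yd: "d / 2 \<le> norm (x - y)" "norm (x - y) < \<rho>" "norm (x' - y) \<le> norm (x - y)"
          using xy tri(2,3)[of y] s d\<rho> by auto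
        have "d / (2 * s) \<le> norm (x - y) / norm (x' - y)"
          using frac_le[of "norm (x - y)" "d / 2" "norm (x' - y)" s] yd xy n by simp
        then have "L \<le> ln (norm (x - y) / norm (x' - y))"
          unfolding L_def using d s n by (subst ln_le_cancel_iff) auto
        then have "(L - 1 / 2) / (2 * pi) \<le> (ln (norm (x - y) / norm (x' - y)) - 1 / 2) / (2 * pi)"
          by (intro divide_right_mono) auto
        also have "\<dots> \<le> green_kernel \<rho> (x' - y) - green_kernel \<rho> (x - y)"
          using n yd by (intro green_kernel_diff_lower) auto
        finally have "green_kernel \<rho> (x - y) - green_kernel \<rho> (x' - y) \<le> - (L / (2 * pi)) + 1 / 2 / (2 * pi)"
          by (simp add: diff_divide_distrib)
        also have "\<dots> \<le> - (L / (2 * pi)) + 2" using pi_ge_two by (simp add: divide_le_eq)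
        finally have "(green_kernel \<rho> (x - y) - green_kernel \<rho> (x' - y)) * f y \<le> (- (L / (2 * pi)) + 2) * f y"
          using f0 by (intro mult_right_mono) auto
        also have "\<dots> = 2 * f y - (L / (2 * pi)) * f y" by (simp add: algebra_simps)
        also have "\<dots> \<le> 2 * (indicator (ball p (2 * \<rho>)) y * f y) - (L / (2 * pi)) * f y" using Ef yd by simp
        finally show ?thesis using nk center by (simp add: B_def left_diff_distrib del: mem_ball)
      qed
    qed
    show "integrable lborel B"
      unfolding B_def using ball_mass_le(1) k(1) fs(1)
      by (intro Bochner_Integration.integrable_add Bochner_Integration.integrable_diff integrable_mult_right) (auto simp: f_def)
  qed (use Wi in simp)
  also have "(LINT y|lborel. B y) = 2 * (LINT y|lborel. indicator (ball p (2 * \<rho>)) y * f y) + (2 * near_const Q / d) * (2 * pi * (d / 4))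
      - (L / (2 * pi)) * (LINT y|lborel. indicator (ball x' s) y * f y)"
    unfolding B_def using ball_mass_le(1) k(1) fs(1) by (simp add: f_def k(2))
  also have "\<dots> \<le> 2 * A + near_const Q * pi - 7 / 2 * L"
  proof -
    have "(2 * near_const Q / d) * (2 * pi * (d / 4)) = near_const Q * pi" using d by simp
    moreover have "(L / (2 * pi)) * (7 * pi) \<le> (L / (2 * pi)) * (LINT y|lborel. indicator (ball x' s) y * f y)"
      using fs(2) L by (intro mult_left_mono) auto
    moreover have "(L / (2 * pi)) * (7 * pi) = 7 / 2 * L" by simp
    moreover have "(LINT y|lborel. indicator (ball p (2 * \<rho>)) y * f y) \<le> A" using ball_mass_le(2) by (simp add: f_def)
    ultimately show ?thesis by linarith
  qed
  finally show ?thesis by (simp add: L_def)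
qed

end

context hartree
begin

text \<open>Mass \<open>7 * pi\<close> gives the slope 7/2, scaling takes back 2, and the remaining
  3/2 is multiplied by the exponent \<open>lam\<close> with which \<open>g\<close> enters the
  right-hand side.\<close>

definition "decay_exp = 3 / 2 * lam"
definition "decay_const \<rho> A Q b = rhs_const (Q / 4) * 16 *
  exp (lam * (c0 / (pi * \<rho>\<^sup>2) + 16 / (pi * \<rho> ^ 3) + 2 * A + near_const Q * pi + 7 / 2 * ln (2 * b)))"
text \<open>The bound in the regime \<open>1 / d < N\<close>: the factor
  \<open>1 / d\<^sup>2\<close> is replaced by \<open>N\<^sup>2\<close> and the logarithm of
  \<open>W_upper\<close> by \<open>ln (4 * \<rho> * N)\<close>, while \<open>havg_upper\<close>
  supplies the decisive negative multiple of \<open>N\<close> in the exponent.\<close>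

definition "tail_bound \<rho> A Q N = rhs_const (Q / 4) * 16 * (\<rho>\<^sup>2) powr lam * (N\<^sup>2 *
  exp (lam * (((17/16 * c0 + A * (pi * \<rho>\<^sup>2 / 4)) / (pi * \<rho>\<^sup>2) + near_const Q * pi) - N * (1 / (16 * (pi * \<rho>\<^sup>2))) + A * ln (4 * \<rho> * N))))"

lemma decay_const_nonneg: "0 \<le> decay_const \<rho> A Q b"
  unfolding decay_const_def using rhs_const_pos[of "Q / 4"] by (intro mult_nonneg_nonneg) auto

lemma tail_bound_nonneg: "0 \<le> tail_bound \<rho> A Q N"
  unfolding tail_bound_def using rhs_const_pos[of "Q / 4"] by (intro mult_nonneg_nonneg) auto

lemma tail_bound_tendsto:
  assumes "0 < \<rho>" "0 \<le> A"
  shows "(tail_bound \<rho> A Q \<longlongrightarrow> 0) at_top"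
proof -
  have "((\<lambda>N. N\<^sup>2 * exp (a * (C - N * c + A * ln (d * N)))) \<longlongrightarrow> 0) at_top" if "0 < a" "0 < c" "0 < d" for a C c d :: real
    using that assms(2) by real_asymp
  from tendsto_mult_left[OF this, of lam "1 / (16 * (pi * \<rho>\<^sup>2))" "4 * \<rho>"] show ?thesis
    unfolding tail_bound_def[abs_def] using assms(1) lam_bounds by (auto intro: tendsto_mult_right_zero)
qed

end

context local_solution
begin

text \<open>Dichotomy in \<open>d * N\<close>. If it is at most 1, \<open>havg_diff\<close> is a
  bounded quantity and \<open>x\<close> can be compared with \<open>x'\<close>. If not, no
  comparison is attempted: \<open>havg_upper\<close> and \<open>W_upper\<close> alone make
  \<open>g x\<close> exponentially small in \<open>N\<close>.\<close>

lemma decay_estimate: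
  assumes x: "x \<in> ball p (\<rho> / 4)" "x' \<in> ball p (\<rho> / 4)" and d: "d = dist x x'" "0 < d"
    and g: "\<And>z. z \<in> ball x (d / 2) \<Longrightarrow> g z \<le> 4 * Q / d\<^sup>2"
    and b: "1 \<le> b" "2 * (b / sqrt (g x')) \<le> d"
    and m0: "7 * pi \<le> (LINT y:ball x' (b / sqrt (g x'))|lborel. rhs V g y)"
  shows "rhs V g x \<le> decay_const \<rho> A Q b * (d * sqrt (g x')) powr - decay_exp / d\<^sup>2 + tail_bound \<rho> A Q N"
proof -
  have d\<rho>: "d < \<rho> / 2"
  proof -
    have "d \<le> dist p x + dist p x'" unfolding d(1) by (rule dist_triangle3)
    then show ?thesis using x by simp
  qed
  have dist: "dist p x \<le> \<rho>" "dist p x' \<le> \<rho>" using x rho by auto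
  have inD: "x \<in> D" "x' \<in> D" using sub_ball[of x 0] sub_ball[of x' 0] dist rho by auto
  note gpos = sols(4)[OF inD(1)] sols(4)[OF inD(2)]
  \<comment> \<open>The distance to the center in units of the length of the bubble there.\<close>
  define \<tau> where "\<tau> = d * sqrt (g x')"
  have \<tau>: "0 < \<tau>" using d gpos by (simp add: \<tau>_def)
  have r: "rhs V g x \<le> rhs_const (Q / 4) * 16 * (g x * d\<^sup>2) powr lam / d\<^sup>2" by (rule near_rhs(2)[OF sol d(2) g])
  have rc: "0 \<le> rhs_const (Q / 4) * 16" using rhs_const_pos[of "Q / 4"] by simp
  show ?thesis
  proof (cases "d * N \<le> 1")
    case True
    define K where "K = c0 / (pi * \<rho>\<^sup>2) + 16 / (pi * \<rho> ^ 3) + 2 * A + near_const Q * pi + 7 / 2 * ln (2 * b)"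
    have "havg x - havg x' \<le> c0 / (pi * \<rho>\<^sup>2) + 16 / (pi * \<rho> ^ 3) * (d * N)"
      unfolding d(1) by (rule havg_diff[OF x])
    also have "\<dots> \<le> c0 / (pi * \<rho>\<^sup>2) + 16 / (pi * \<rho> ^ 3) * 1"
      using True rho by (intro add_left_mono mult_left_mono) auto
    finally have 1: "havg x - havg x' \<le> c0 / (pi * \<rho>\<^sup>2) + 16 / (pi * \<rho> ^ 3)" by simp
    have 2: "W x - W x' \<le> 2 * A + near_const Q * pi - 7 / 2 * ln (d / (2 * (b / sqrt (g x'))))"
      by (rule W_diff[OF x d g _ b(2) m0]) (use b gpos in auto)
    have "d / (2 * (b / sqrt (g x'))) = \<tau> / (2 * b)" by (simp add: \<tau>_def)
    then have 3: "ln (d / (2 * (b / sqrt (g x')))) = ln \<tau> - ln (2 * b)" using \<tau> b by (simp add: ln_div)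
    have 4: "ln (g x' * d\<^sup>2) = 2 * ln \<tau>"
    proof -
      have "g x' * d\<^sup>2 = \<tau>\<^sup>2" using gpos by (simp add: \<tau>_def power_mult_distrib)
      then show ?thesis using \<tau> by (simp add: ln_realpow)
    qed
    have 5: "ln (g x * d\<^sup>2) = ln (g x) + 2 * ln d" "ln (g x' * d\<^sup>2) = ln (g x') + 2 * ln d"
      using gpos d by (simp_all add: ln_mult ln_realpow)
    have "ln (g x * d\<^sup>2) \<le> K - 3 / 2 * ln \<tau>"
      using 1 2 mean_value[OF dist(1)] mean_value[OF dist(2)] 4 5 unfolding 3 K_def by argo
    then have "exp (ln (g x * d\<^sup>2)) \<le> exp (K - 3 / 2 * ln \<tau>)" by simp
    moreover have "exp (ln (g x * d\<^sup>2)) = g x * d\<^sup>2" using gpos d by simp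
    moreover have "exp (K - 3 / 2 * ln \<tau>) = exp K * \<tau> powr - (3 / 2)"
      using \<tau> by (simp add: powr_def flip: exp_add)
    ultimately have "g x * d\<^sup>2 \<le> exp K * \<tau> powr - (3 / 2)" by (simp only:)
    then have "(g x * d\<^sup>2) powr lam \<le> (exp K * \<tau> powr - (3 / 2)) powr lam"
      using gpos lam_bounds by (intro powr_mono2) auto
    also have "\<dots> = exp (lam * K) * \<tau> powr - decay_exp"
      using \<tau> by (simp add: powr_mult powr_powr decay_exp_def exp_powr_real mult.commute)
    finally have "rhs_const (Q / 4) * 16 * (g x * d\<^sup>2) powr lam / d\<^sup>2 \<le> rhs_const (Q / 4) * 16 * (exp (lam * K) * \<tau> powr - decay_exp) / d\<^sup>2"
      using rc by (intro divide_right_mono mult_left_mono) auto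
    also have "\<dots> = decay_const \<rho> A Q b * (d * sqrt (g x')) powr - decay_exp / d\<^sup>2"
      by (simp add: decay_const_def K_def \<tau>_def mult.assoc)
    finally show ?thesis using r tail_bound_nonneg[of \<rho> A Q N] by linarith
  next
    case False
    then have N: "0 < N" "1 / d < N" using d N_nonneg by (auto simp: divide_less_eq mult.commute zero_less_mult_iff not_le intro: ccontr)
    define C where "C = (17/16 * c0 + A * (pi * \<rho>\<^sup>2 / 4)) / (pi * \<rho>\<^sup>2) + near_const Q * pi"
    have "W x \<le> A * ln (4 * \<rho> / d) + near_const Q * pi"
      using d d\<rho> rho by (intro W_upper[OF x(1) d(2) _ g]) auto
    moreover have "A * ln (4 * \<rho> / d) \<le> A * ln (4 * \<rho> * N)"
    proof (rule mult_left_mono[OF _ A_nonneg])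
      have "4 * \<rho> * (1 / d) \<le> 4 * \<rho> * N" using N rho by (intro mult_left_mono) auto
      then show "ln (4 * \<rho> / d) \<le> ln (4 * \<rho> * N)" using d rho N by (subst ln_le_cancel_iff) auto
    qed
    moreover note havg_upper[OF x(1)] mean_value[OF dist(1)]
    moreover have "N / (16 * (pi * \<rho>\<^sup>2)) = N * (1 / (16 * (pi * \<rho>\<^sup>2)))" by simp
    ultimately have "ln (g x) \<le> C - N * (1 / (16 * (pi * \<rho>\<^sup>2))) + A * ln (4 * \<rho> * N)"
      unfolding C_def by linarith
    then have "exp (ln (g x)) \<le> exp (C - N * (1 / (16 * (pi * \<rho>\<^sup>2))) + A * ln (4 * \<rho> * N))" by (simp only: exp_le_cancel_iff)
    then have gx: "g x \<le> exp (C - N * (1 / (16 * (pi * \<rho>\<^sup>2))) + A * ln (4 * \<rho> * N))" using gpos by simp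
    have "g x * d\<^sup>2 \<le> exp (C - N * (1 / (16 * (pi * \<rho>\<^sup>2))) + A * ln (4 * \<rho> * N)) * \<rho>\<^sup>2"
      using gx gpos d d\<rho> rho by (intro mult_mono power_mono) auto
    then have "(g x * d\<^sup>2) powr lam \<le> (exp (C - N * (1 / (16 * (pi * \<rho>\<^sup>2))) + A * ln (4 * \<rho> * N)) * \<rho>\<^sup>2) powr lam"
      using gpos lam_bounds by (intro powr_mono2) auto
    also have "\<dots> = exp (lam * (C - N * (1 / (16 * (pi * \<rho>\<^sup>2))) + A * ln (4 * \<rho> * N))) * (\<rho>\<^sup>2) powr lam"
      by (simp only: powr_mult exp_ge_zero zero_le_power2 exp_powr_real mult.commute)
    finally have p: "(g x * d\<^sup>2) powr lam \<le> exp (lam * (C - N * (1 / (16 * (pi * \<rho>\<^sup>2))) + A * ln (4 * \<rho> * N))) * (\<rho>\<^sup>2) powr lam" .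
    have "rhs V g x \<le> (rhs_const (Q / 4) * 16 * (g x * d\<^sup>2) powr lam) * (1 / d\<^sup>2)" using r by simp
    also have "\<dots> \<le> (rhs_const (Q / 4) * 16 * (exp (lam * (C - N * (1 / (16 * (pi * \<rho>\<^sup>2))) + A * ln (4 * \<rho> * N))) * (\<rho>\<^sup>2) powr lam)) * N\<^sup>2"
    proof (rule mult_mono[OF mult_left_mono[OF p rc]])
      have "(1 / d)\<^sup>2 \<le> N\<^sup>2" using N d by (intro power_mono) auto
      then show "1 / d\<^sup>2 \<le> N\<^sup>2" by (simp add: power_divide)
      show "0 \<le> rhs_const (Q / 4) * 16 * (exp (lam * (C - N * (1 / (16 * (pi * \<rho>\<^sup>2))) + A * ln (4 * \<rho> * N))) * (\<rho>\<^sup>2) powr lam)"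
        using rc by (intro mult_nonneg_nonneg) auto
    qed auto
    also have "\<dots> = tail_bound \<rho> A Q N"
    proof -
      have "a * (E * P) * n = a * P * (n * E)" for a E P n :: real by simp
      then show ?thesis unfolding tail_bound_def C_def .
    qed
    finally have t: "rhs V g x \<le> tail_bound \<rho> A Q N" .
    have "0 \<le> decay_const \<rho> A Q b * (d * sqrt (g x')) powr - decay_exp / d\<^sup>2"
      using decay_const_nonneg by (intro divide_nonneg_nonneg mult_nonneg_nonneg) auto
    then show ?thesis using t by (rule add_increasing)
  qed
qed

end

section \<open>Sequences concentrating at one point\<close>

locale concentration = hartree +
  fixes D :: "(real^2) set" and V g :: "nat \<Rightarrow> real^2 \<Rightarrow> real" and p :: "real^2" and \<rho> A v0 \<alpha> :: real
  assumes sol: "\<And>k. solution D (V k) (g k)" and D: "open D" "cball p (2 * \<rho>) \<subseteq> D" and rho: "0 < \<rho>"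
    and A: "\<And>k. set_integrable lborel D (rhs (V k) (g k))" "\<And>k. (LINT y:D|lborel. rhs (V k) (g k) y) \<le> A"
    and Vlim: "\<And>e. 0 < e \<Longrightarrow> \<exists>d>0. eventually (\<lambda>k. \<forall>y\<in>ball p d. \<bar>V k y - v0\<bar> < e) sequentially"
    and mass: "\<And>r. 0 < r \<Longrightarrow> r \<le> \<rho> \<Longrightarrow> (\<lambda>k. LINT y:ball p r|lborel. rhs (V k) (g k) y) \<longlonglongrightarrow> \<alpha>"
    and away: "\<And>K M. compact K \<Longrightarrow> K \<subseteq> D - {p} \<Longrightarrow> eventually (\<lambda>k. \<forall>x\<in>K. ln (g k x) \<le> M) sequentially"
begin

lemma loc: "local_solution \<mu> lam Lam c0 D (V k) (g k) p \<rho> A"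
  by unfold_locales (use sol D rho A in auto)

lemma subseq:
  assumes "strict_mono (\<sigma> :: nat \<Rightarrow> nat)"
  shows "concentration \<mu> lam Lam c0 D (\<lambda>k. V (\<sigma> k)) (\<lambda>k. g (\<sigma> k)) p \<rho> A v0 \<alpha>"
proof unfold_locales
  note \<sigma> = filterlim_subseq[OF assms]
  show "\<exists>d>0. eventually (\<lambda>k. \<forall>y\<in>ball p d. \<bar>V (\<sigma> k) y - v0\<bar> < e) sequentially" if "0 < e" for e
    using Vlim[OF that] eventually_compose_filterlim[OF _ \<sigma>] by blast
  show "(\<lambda>k. LINT y:ball p r|lborel. rhs (V (\<sigma> k)) (g (\<sigma> k)) y) \<longlonglongrightarrow> \<alpha>" if "0 < r" "r \<le> \<rho>" for r
    using LIMSEQ_subseq_LIMSEQ[OF mass[OF that] assms] by (simp add: o_def)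
  show "eventually (\<lambda>k. \<forall>x\<in>K. ln (g (\<sigma> k) x) \<le> M) sequentially" if "compact K" "K \<subseteq> D - {p}" for K M
    using away[OF that] \<sigma> by (rule eventually_compose_filterlim)
qed (use sol D rho A in auto)

text \<open>A fixed ball inside \<open>D\<close> that avoids \<open>p\<close> is enough, since
  \<open>ln g\<close> tends to minus infinity uniformly on it; here its center is at distance
  \<open>\<rho>\<close> from \<open>p\<close> and its radius is \<open>\<rho> / 2\<close>.\<close>

lemma N_at_top: "filterlim (\<lambda>k. local_solution.N (g k) p \<rho>) at_top sequentially"
  unfolding filterlim_at_top
proof
  fix Z :: real
  define c where "c = p + \<rho> *\<^sub>R axis 1 1"
  have cp: "dist p c = \<rho>" using rho by (simp add: c_def dist_norm)
  define K where "K = cball c (\<rho> / 2)"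
  have K: "K \<subseteq> D - {p}"
  proof
    fix y assume y: "y \<in> K"
    then have cy: "dist c y \<le> \<rho> / 2" by (simp add: K_def)
    have "dist p y \<le> dist p c + dist c y" by (rule dist_triangle)
    then have "dist p y \<le> 2 * \<rho>" using cy cp rho by linarith
    moreover have "y \<noteq> p"
    proof
      assume "y = p"
      then have "dist p c \<le> \<rho> / 2" using cy by (simp only: dist_commute)
      then show False using cp rho by linarith
    qed
    ultimately show "y \<in> D - {p}" using D(2) by auto
  qed
  define a where "a = pi * (\<rho> / 2)\<^sup>2"
  have a: "0 < a" using rho by (simp add: a_def)
  define M where "M = \<bar>Z\<bar> / a"
  have M: "0 \<le> M" using a by (simp add: M_def)
  have "eventually (\<lambda>k. \<forall>x\<in>K. ln (g k x) \<le> - M) sequentially"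
    using K by (intro away) (auto simp: K_def)
  then show "eventually (\<lambda>k. Z \<le> local_solution.N (g k) p \<rho>) sequentially"
  proof eventually_elim
    case (elim k)
    interpret L: local_solution \<mu> lam Lam c0 D "V k" "g k" p \<rho> A by (rule loc)
    have i: "dist p c + \<rho> / 2 \<le> 2 * \<rho>" "0 < \<rho> / 2" using cp rho by auto
    have "Z \<le> M * a" using a by (simp add: M_def)
    also have "M * a = (LINT y|lborel. M * indicator (ball c (\<rho> / 2)) y)"
      using rho by (simp add: lebesgue_ball_real2 a_def)
    also have "\<dots> \<le> (LINT y:ball c (\<rho> / 2)|lborel. L.um y)"
      unfolding set_lebesgue_integral_def
    proof (rule integral_mono)
      fix y
      show "M * indicator (ball c (\<rho> / 2)) y \<le> indicator (ball c (\<rho> / 2)) y *\<^sub>R L.um y"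
      proof (cases "y \<in> ball c (\<rho> / 2)")
        case True
        then have "ln (g k y) \<le> - M" using elim by (auto simp: K_def)
        then show ?thesis using True by (simp add: L.um_def del: mem_ball)
      qed (simp del: mem_ball)
    qed (use L.ints(2)[OF i] integrable_indicator_ball in \<open>auto simp: set_integrable_def\<close>)
    also have "\<dots> \<le> L.N" by (rule L.ints(6)[OF i])
    finally show "Z \<le> L.N" .
  qed
qed

end

section \<open>Selection of bubbles\<close>

lemma frequently_subsequence:
  assumes "\<And>n. \<exists>\<^sub>F k in sequentially. P n (k::nat)"
  obtains \<sigma> where "strict_mono (\<sigma> :: nat \<Rightarrow> nat)" "\<And>n. P n (\<sigma> n)"
proof -
  have ex: "\<exists>k\<ge>K. P n k" for n K
    using assms[of n] by (simp add: frequently_sequentially)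
  have "\<exists>\<sigma>. \<forall>n. P n (\<sigma> n) \<and> \<sigma> n < \<sigma> (Suc n)"
  proof (rule dependent_nat_choice)
    show "\<exists>x. P 0 x" using ex by blast
    show "\<exists>y. P (Suc n) y \<and> x < y" for x n using ex[of "Suc x" "Suc n"] by (auto simp: Suc_le_eq)
  qed
  then obtain \<sigma> where "\<forall>n. P n (\<sigma> n) \<and> \<sigma> n < \<sigma> (Suc n)" by blast
  then show thesis by (intro that[of \<sigma>]) (simp_all add: strict_mono_Suc_iff)
qed

text \<open>Replaces the choice of a maximum point of the product of the density and the squared distance to \<open>Z\<close>.\<close>

lemma almost_maximal_ball:
  fixes f :: "real^2 \<Rightarrow> real"
  assumes f: "\<And>x. x \<in> ball p \<rho> \<Longrightarrow> f x \<le> M" "\<And>x. 0 \<le> f x" and C: "0 \<le> C"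
    and x: "0 < r" "ball x r \<subseteq> ball p \<rho> - Z" "C < r\<^sup>2 * f x"
  obtains y \<delta> where "0 < \<delta>" "ball y \<delta> \<subseteq> ball p \<rho> - Z" "C < \<delta>\<^sup>2 * f y" "\<And>z. z \<in> ball y (\<delta> / 4) \<Longrightarrow> f z \<le> 4 * f y"
proof -
  \<comment> \<open>All balls missing \<open>Z\<close> compete, with their radius in place of a
    distance; this also covers empty \<open>Z\<close> without a special case.\<close>
  define E where "E = {r\<^sup>2 * f x |x r. 0 < r \<and> ball x r \<subseteq> ball p \<rho> - Z}"
  have xE: "r\<^sup>2 * f x \<in> E" unfolding E_def using x by blast
  have bd: "bdd_above E"
  proof (rule bdd_aboveI)
    fix e assume "e \<in> E"
    then obtain x r where x: "0 < r" "ball x r \<subseteq> ball p \<rho> - Z" and e: "e = r\<^sup>2 * f x" unfolding E_def by blast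
    have "x \<in> ball p \<rho>" using x centre_in_ball by blast
    moreover have "r \<le> \<rho>"
    proof -
      have "ball x r \<subseteq> ball p \<rho>" using x by blast
      then have "dist x p + r \<le> \<rho>" using x(1) by (simp add: ball_subset_ball_iff)
      then show ?thesis using zero_le_dist[of x p] by linarith
    qed
    ultimately show "e \<le> \<rho>\<^sup>2 * M" unfolding e using x(1) f by (intro mult_mono power_mono) auto
  qed
  have S: "r\<^sup>2 * f x \<le> Sup E" using xE bd by (rule cSup_upper)
  \<comment> \<open>The choice is within a factor 2 of the supremum and still above the threshold
    \<open>C\<close>.\<close>
  have "max C (Sup E / 2) < Sup E" using S x(3) C by auto
  then obtain e where "e \<in> E" and e: "max C (Sup E / 2) < e" using less_cSupD[of E] xE by blast
  then obtain y \<delta> where y: "0 < \<delta>" "ball y \<delta> \<subseteq> ball p \<rho> - Z" and ey: "e = \<delta>\<^sup>2 * f y" unfolding E_def by blast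
  show thesis
  proof (rule that[OF y])
    show "C < \<delta>\<^sup>2 * f y" using e ey by simp
    fix z assume z: "z \<in> ball y (\<delta> / 4)"
    have "ball z (3 * \<delta> / 4) \<subseteq> ball y \<delta>"
    proof
      fix w assume "w \<in> ball z (3 * \<delta> / 4)"
      then show "w \<in> ball y \<delta>" using z dist_triangle[of y w z] by simp
    qed
    then have "(3 * \<delta> / 4)\<^sup>2 * f z \<in> E" unfolding E_def using y by fastforce
    then have "(3 * \<delta> / 4)\<^sup>2 * f z \<le> Sup E" using bd by (rule cSup_upper)
    also have "\<dots> \<le> 2 * (\<delta>\<^sup>2 * f y)" using e ey by simp
    \<comment> \<open>Around \<open>z\<close> the radius \<open>3 * \<delta> / 4\<close> is still
      admissible; the loss \<open>16 / 9\<close> times the factor 2 of near maximality is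
      \<open>32 / 9\<close>, below 4.\<close>
    finally have "\<delta>\<^sup>2 * (9 / 16 * f z) \<le> \<delta>\<^sup>2 * (2 * f y)" by (simp add: power2_eq_square)
    then have "9 / 16 * f z \<le> 2 * f y" using y(1) by (simp add: mult_le_cancel_left)
    then show "f z \<le> 4 * f y" using f(2)[of y] by simp
  qed
qed

context hartree
begin

text \<open>\<open>mm L\<close> is the limiting mass within \<open>L\<close> units of the bubble's
  own length \<open>1 / sqrt (g k (x k))\<close>. The last conjunct excludes much higher peaks at
  bounded rescaled distance; it is what separates a later center from this one.\<close>

definition bubble :: "real^2 \<Rightarrow> real \<Rightarrow> (nat \<Rightarrow> real^2 \<Rightarrow> real) \<Rightarrow> (nat \<Rightarrow> real^2 \<Rightarrow> real) \<Rightarrow> (nat \<Rightarrow> real^2) \<Rightarrow> (real \<Rightarrow> real) \<Rightarrow> bool"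
  where "bubble p \<rho> V g x mm \<longleftrightarrow> (\<forall>k. x k \<in> ball p \<rho>) \<and> x \<longlonglongrightarrow> p \<and> filterlim (\<lambda>k. g k (x k)) at_top sequentially
    \<and> (\<forall>L. (\<lambda>k. LINT y:ball (x k) (L / sqrt (g k (x k)))|lborel. rhs (V k) (g k) y) \<longlonglongrightarrow> mm L)
    \<and> (\<forall>L. mm L \<le> 8 * pi) \<and> (\<forall>e>0. \<exists>L\<ge>1. 8 * pi - e \<le> mm L) \<and> mono mm
    \<and> (\<forall>L. eventually (\<lambda>k. \<forall>y\<in>ball (x k) (L / sqrt (g k (x k))). g k y \<le> 4 * g k (x k)) sequentially)"

text \<open>The condition runs over ordered pairs, so the distance is large in the units of either
  of the two bubbles.\<close>

definition bubbles :: "real^2 \<Rightarrow> real \<Rightarrow> (nat \<Rightarrow> real^2 \<Rightarrow> real) \<Rightarrow> (nat \<Rightarrow> real^2 \<Rightarrow> real) \<Rightarrow> nat \<Rightarrow> (nat \<Rightarrow> nat \<Rightarrow> real^2) \<Rightarrow> (nat \<Rightarrow> real \<Rightarrow> real) \<Rightarrow> bool"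
  where "bubbles p \<rho> V g n X mm \<longleftrightarrow> (\<forall>i<n. bubble p \<rho> V g (X i) (mm i)) \<and>
    (\<forall>i<n. \<forall>j<n. i \<noteq> j \<longrightarrow> filterlim (\<lambda>k. dist (X i k) (X j k) * sqrt (g k (X i k))) at_top sequentially)"

lemma bubbleD:
  assumes "bubble p \<rho> V g x mm"
  shows "x k \<in> ball p \<rho>" "x \<longlonglongrightarrow> p" "filterlim (\<lambda>k. g k (x k)) at_top sequentially"
    "(\<lambda>k. LINT y:ball (x k) (L / sqrt (g k (x k)))|lborel. rhs (V k) (g k) y) \<longlonglongrightarrow> mm L"
    "mm L \<le> 8 * pi" "0 < e \<Longrightarrow> \<exists>L\<ge>1. 8 * pi - e \<le> mm L" "mono mm"
    "eventually (\<lambda>k. \<forall>y\<in>ball (x k) (L / sqrt (g k (x k))). g k y \<le> 4 * g k (x k)) sequentially"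
  using assms unfolding bubble_def by blast+

lemma bubblesD:
  assumes "bubbles p \<rho> V g n X mm"
  shows "i < n \<Longrightarrow> bubble p \<rho> V g (X i) (mm i)"
    "i < n \<Longrightarrow> j < n \<Longrightarrow> i \<noteq> j \<Longrightarrow> filterlim (\<lambda>k. dist (X i k) (X j k) * sqrt (g k (X i k))) at_top sequentially"
  using assms unfolding bubbles_def by blast+

lemma bubble_subseq:
  assumes b: "bubble p \<rho> V g x mm" and \<sigma>: "strict_mono \<sigma>"
  shows "bubble p \<rho> (\<lambda>k. V (\<sigma> k)) (\<lambda>k. g (\<sigma> k)) (\<lambda>k. x (\<sigma> k)) mm"
proof -
  note \<sigma>l = filterlim_subseq[OF \<sigma>]
  note b' = bubbleD[OF b]
  have "(\<lambda>k. x (\<sigma> k)) \<longlonglongrightarrow> p" using LIMSEQ_subseq_LIMSEQ[OF b'(2) \<sigma>] by (simp add: o_def)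
  moreover have "filterlim (\<lambda>k. g (\<sigma> k) (x (\<sigma> k))) at_top sequentially"
    by (rule filterlim_compose[OF b'(3) \<sigma>l])
  moreover have "(\<lambda>k. LINT y:ball (x (\<sigma> k)) (L / sqrt (g (\<sigma> k) (x (\<sigma> k))))|lborel. rhs (V (\<sigma> k)) (g (\<sigma> k)) y) \<longlonglongrightarrow> mm L" for L
    using LIMSEQ_subseq_LIMSEQ[OF b'(4)[of L] \<sigma>] by (simp add: o_def)
  moreover have "eventually (\<lambda>k. \<forall>y\<in>ball (x (\<sigma> k)) (L / sqrt (g (\<sigma> k) (x (\<sigma> k)))). g (\<sigma> k) y \<le> 4 * g (\<sigma> k) (x (\<sigma> k))) sequentially" for L
    using b'(8)[of L] \<sigma>l by (rule eventually_compose_filterlim)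
  ultimately show ?thesis unfolding bubble_def using b'(1,5,6,7) by (intro conjI allI impI)
qed

lemma bubbles_subseq:
  assumes b: "bubbles p \<rho> V g n X mm" and \<sigma>: "strict_mono \<sigma>"
  shows "bubbles p \<rho> (\<lambda>k. V (\<sigma> k)) (\<lambda>k. g (\<sigma> k)) n (\<lambda>i k. X i (\<sigma> k)) mm"
proof -
  have "filterlim (\<lambda>k. dist (X i (\<sigma> k)) (X j (\<sigma> k)) * sqrt (g (\<sigma> k) (X i (\<sigma> k)))) at_top sequentially"
    if "i < n" "j < n" "i \<noteq> j" for i j
    by (rule filterlim_compose[OF bubblesD(2)[OF b that] filterlim_subseq[OF \<sigma>]])
  then show ?thesis unfolding bubbles_def using bubble_subseq[OF bubblesD(1)[OF b] \<sigma>] by (intro conjI allI impI)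
qed

end

context concentration
begin

lemmas sols = solutionD[OF sol]

lemma ball_D: "ball p \<rho> \<subseteq> D"
proof
  fix x assume "x \<in> ball p \<rho>"
  then have "x \<in> cball p (2 * \<rho>)" using rho by simp
  then show "x \<in> D" using D(2) by blast
qed

text \<open>Boundedness of \<open>d\<^sup>2 * g\<close>, with \<open>d\<close> the distance to the
  centers and to the boundary of \<open>ball p \<rho>\<close>, expressed through balls as in
  \<open>almost_maximal_ball\<close>.\<close>

definition "scale_bounded n X Q \<longleftrightarrow> eventually (\<lambda>k. \<forall>x r. 0 < r \<longrightarrow>
   ball x r \<subseteq> ball p \<rho> - (\<lambda>i. X i k) ` {..<n} \<longrightarrow> r\<^sup>2 * g k x \<le> Q) sequentially"

text \<open>If no \<open>Q\<close> works, then along a subsequence there are balls free of centers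
  on which \<open>r\<^sup>2 * g\<close> at the center exceeds any given number. Passing to almost
  maximal ones supplies both the local bound by 4 and the growing rescaled radius that
  \<open>blow_up\<close> asks for.\<close>

lemma additional_bubble:
  assumes b: "bubbles p \<rho> V g n X mm" and not: "\<And>Q. \<not> scale_bounded n X Q"
  obtains \<sigma> X' mm' where "strict_mono \<sigma>" "bubbles p \<rho> (\<lambda>k. V (\<sigma> k)) (\<lambda>k. g (\<sigma> k)) (Suc n) X' mm'"
proof -
  define Z where "Z = (\<lambda>k. (\<lambda>i. X i k) ` {..<n})"
  have F: "\<exists>\<^sub>F k in sequentially. \<exists>x r. 0 < r \<and> ball x r \<subseteq> ball p \<rho> - Z k \<and> real m < r\<^sup>2 * g k x" for m
    using not[of "real m"] unfolding scale_bounded_def Z_def by (simp only: not_eventually not_all not_imp not_le)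
  obtain \<sigma> where \<sigma>: "strict_mono \<sigma>" and ex: "\<And>m. \<exists>x r. 0 < r \<and> ball x r \<subseteq> ball p \<rho> - Z (\<sigma> m) \<and> real m < r\<^sup>2 * g (\<sigma> m) x"
    by (rule frequently_subsequence[OF F], rule that)
  have "\<exists>y \<delta>. 0 < \<delta> \<and> ball y \<delta> \<subseteq> ball p \<rho> - Z (\<sigma> m) \<and> real m < \<delta>\<^sup>2 * g (\<sigma> m) y \<and>
     (\<forall>z\<in>ball y (\<delta> / 4). g (\<sigma> m) z \<le> 4 * g (\<sigma> m) y)" for m
  proof -
    obtain M where "0 \<le> M" and M: "\<And>x. x \<in> cball p (2 * \<rho>) \<Longrightarrow> g (\<sigma> m) x \<le> M"
      by (rule solution_bounded_on_compact[OF sol[of "\<sigma> m"] compact_cball D(2,1)]) (rule that)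
    have M': "g (\<sigma> m) x \<le> M" if "x \<in> ball p \<rho>" for x using that rho by (intro M) simp
    from ex[of m] obtain x r where x: "0 < r" "ball x r \<subseteq> ball p \<rho> - Z (\<sigma> m)" "real m < r\<^sup>2 * g (\<sigma> m) x" by blast
    show ?thesis
      by (rule almost_maximal_ball[where f = "g (\<sigma> m)", OF M' sols(8) _ x]) (simp, simp, blast)
  qed
  then have "\<forall>m. \<exists>y \<delta>. 0 < \<delta> \<and> ball y \<delta> \<subseteq> ball p \<rho> - Z (\<sigma> m) \<and> real m < \<delta>\<^sup>2 * g (\<sigma> m) y \<and>
     (\<forall>z\<in>ball y (\<delta> / 4). g (\<sigma> m) z \<le> 4 * g (\<sigma> m) y)" ..
  from this[unfolded choice_iff] obtain y \<delta> where y\<delta>: "\<forall>m. 0 < \<delta> m \<and> ball (y m) (\<delta> m) \<subseteq> ball p \<rho> - Z (\<sigma> m) \<and>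
     real m < (\<delta> m)\<^sup>2 * g (\<sigma> m) (y m) \<and> (\<forall>z\<in>ball (y m) (\<delta> m / 4). g (\<sigma> m) z \<le> 4 * g (\<sigma> m) (y m))"
    by (elim exE)
  have \<delta>: "0 < \<delta> m" and sub: "ball (y m) (\<delta> m) \<subseteq> ball p \<rho> - Z (\<sigma> m)"
    and big: "real m < (\<delta> m)\<^sup>2 * g (\<sigma> m) (y m)" for m using y\<delta> by simp_all
  have g4: "g (\<sigma> m) z \<le> 4 * g (\<sigma> m) (y m)" if "z \<in> ball (y m) (\<delta> m / 4)" for m z using y\<delta> that by blast
  have yB: "y m \<in> ball p \<rho>" for m using sub[of m] \<delta>[of m] centre_in_ball by blast
  have \<delta>\<rho>: "\<delta> m \<le> \<rho>" for m
  proof -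
    have "ball (y m) (\<delta> m) \<subseteq> ball p \<rho>" using sub[of m] by blast
    then have "dist (y m) p + \<delta> m \<le> \<rho>" using \<delta>[of m] by (simp add: ball_subset_ball_iff)
    then show ?thesis using zero_le_dist[of "y m" p] by linarith
  qed
  have gy: "real m / \<rho>\<^sup>2 \<le> g (\<sigma> m) (y m)" for m
  proof -
    have "real m \<le> (\<delta> m)\<^sup>2 * g (\<sigma> m) (y m)" using big[of m] by simp
    also have "\<dots> \<le> \<rho>\<^sup>2 * g (\<sigma> m) (y m)"
      using \<delta>[of m] \<delta>\<rho>[of m] sols(8) by (intro mult_right_mono power_mono) auto
    finally show ?thesis using rho by (simp add: divide_le_eq mult.commute)
  qed
  have "filterlim (\<lambda>m. real m / \<rho>\<^sup>2) at_top sequentially" using rho by real_asymp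
  then have gtop: "filterlim (\<lambda>m. g (\<sigma> m) (y m)) at_top sequentially"
    by (rule filterlim_at_top_mono) (simp add: gy)
  have "filterlim (\<lambda>m. sqrt (real m)) at_top sequentially" by real_asymp
  then have \<delta>top: "filterlim (\<lambda>m. \<delta> m * sqrt (g (\<sigma> m) (y m))) at_top sequentially"
  proof (rule filterlim_at_top_mono, intro always_eventually allI)
    fix m
    have "sqrt (real m) \<le> sqrt ((\<delta> m)\<^sup>2 * g (\<sigma> m) (y m))" using big[of m] by (intro real_sqrt_le_mono) simp
    then show "sqrt (real m) \<le> \<delta> m * sqrt (g (\<sigma> m) (y m))" using \<delta>[of m] by (simp add: real_sqrt_mult)
  qed
  \<comment> \<open>The values of the density at the chosen points tend to infinity, whereas at a
    fixed distance from \<open>p\<close> they are eventually at most 1.\<close>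
  have yp: "y \<longlonglongrightarrow> p"
    unfolding tendsto_iff
  proof (intro allI impI)
    fix e :: real assume e: "0 < e"
    have "cball p \<rho> - ball p e \<subseteq> D - {p}"
    proof
      fix z assume z: "z \<in> cball p \<rho> - ball p e"
      then have "z \<in> cball p (2 * \<rho>)" using rho by simp
      moreover have "z \<noteq> p" using z e by auto
      ultimately show "z \<in> D - {p}" using D(2) by blast
    qed
    then have "eventually (\<lambda>k. \<forall>x\<in>cball p \<rho> - ball p e. ln (g k x) \<le> 0) sequentially"
      by (intro away compact_diff) auto
    then have "eventually (\<lambda>m. \<forall>x\<in>cball p \<rho> - ball p e. ln (g (\<sigma> m) x) \<le> 0) sequentially"
      using filterlim_subseq[OF \<sigma>] by (rule eventually_compose_filterlim)
    moreover have "eventually (\<lambda>m. 1 < g (\<sigma> m) (y m)) sequentially"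
      using gtop by (simp add: filterlim_at_top_dense)
    ultimately show "eventually (\<lambda>m. dist (y m) p < e) sequentially"
    proof eventually_elim
      case (elim m)
      then have "0 < ln (g (\<sigma> m) (y m))" by simp
      then have "y m \<notin> cball p \<rho> - ball p e" using elim(1) by force
      then show ?case using yB[of m] by (simp add: dist_commute)
    qed
  qed
  interpret S: concentration \<mu> lam Lam c0 D "\<lambda>k. V (\<sigma> k)" "\<lambda>k. g (\<sigma> k)" p \<rho> A v0 \<alpha> by (rule subseq[OF \<sigma>])
  have bD: "ball (y m) (\<delta> m / 4) \<subseteq> D" for m
  proof -
    have "ball (y m) (\<delta> m / 4) \<subseteq> ball (y m) (\<delta> m)" using \<delta>[of m] by (intro subset_ball) simp
    then show ?thesis using sub[of m] ball_D by blast
  qed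
  have d4: "0 < \<delta> m / 4" for m using \<delta>[of m] by simp
  have "filterlim (\<lambda>m. 1 / 4 * (\<delta> m * sqrt (g (\<sigma> m) (y m)))) at_top sequentially"
    by (rule filterlim_tendsto_pos_mult_at_top[OF tendsto_const _ \<delta>top]) simp
  then have top4: "filterlim (\<lambda>m. \<delta> m / 4 * sqrt (g (\<sigma> m) (y m))) at_top sequentially" by simp
  obtain \<tau> mn where \<tau>: "strict_mono \<tau>"
    and mn: "\<And>L. (\<lambda>k. LINT z:ball (y (\<tau> k)) (L / sqrt (g (\<sigma> (\<tau> k)) (y (\<tau> k))))|lborel. rhs (V (\<sigma> (\<tau> k))) (g (\<sigma> (\<tau> k))) z) \<longlonglongrightarrow> mn L"
      "\<And>L. mn L \<le> 8 * pi" "\<And>e. 0 < e \<Longrightarrow> \<exists>L\<ge>1. 8 * pi - e \<le> mn L" "\<And>L L'. L \<le> L' \<Longrightarrow> mn L \<le> mn L'"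
    by (rule blow_up[OF D(1) S.sol bD d4 g4 top4 yp gtop S.Vlim S.A]) (assumption, assumption, rule that)
  note \<tau>l = filterlim_subseq[OF \<tau>]
  define s where "s = (\<lambda>k. \<sigma> (\<tau> k))"
  have s: "strict_mono s" using strict_mono_o[OF \<sigma> \<tau>] by (simp add: s_def o_def)
  note top = filterlim_compose[OF \<delta>top \<tau>l] and gt = filterlim_compose[OF gtop \<tau>l]
  have bs: "bubbles p \<rho> (\<lambda>k. V (s k)) (\<lambda>k. g (s k)) n (\<lambda>i k. X i (s k)) mm" by (rule bubbles_subseq[OF b s])
  have new: "bubble p \<rho> (\<lambda>k. V (s k)) (\<lambda>k. g (s k)) (\<lambda>k. y (\<tau> k)) mn"
  proof -
    have "eventually (\<lambda>k. \<forall>z\<in>ball (y (\<tau> k)) (L / sqrt (g (s k) (y (\<tau> k)))). g (s k) z \<le> 4 * g (s k) (y (\<tau> k))) sequentially" for L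
    proof -
      have "eventually (\<lambda>k. 4 * L \<le> \<delta> (\<tau> k) * sqrt (g (\<sigma> (\<tau> k)) (y (\<tau> k)))) sequentially"
        using top by (simp add: filterlim_at_top)
      moreover have "eventually (\<lambda>k. 1 \<le> g (\<sigma> (\<tau> k)) (y (\<tau> k))) sequentially"
        using gt by (simp add: filterlim_at_top)
      ultimately show ?thesis
      proof eventually_elim
        case (elim k)
        have "0 < sqrt (g (s k) (y (\<tau> k)))" using elim(2) by (simp add: s_def)
        then have "L / sqrt (g (s k) (y (\<tau> k))) \<le> \<delta> (\<tau> k) / 4"
          using elim(1) by (simp add: s_def divide_le_eq)
        then show ?case using g4[of _ "\<tau> k"] subset_ball unfolding s_def by blast
      qed
    qed
    moreover have "(\<lambda>k. y (\<tau> k)) \<longlonglongrightarrow> p" using LIMSEQ_subseq_LIMSEQ[OF yp \<tau>] by (simp add: o_def)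
    moreover have "mono mn" using mn(4) by (rule monoI)
    ultimately show ?thesis unfolding bubble_def using yB gt mn(1,2,3) by (simp add: s_def)
  qed
  have distZ: "\<delta> (\<tau> k) \<le> dist (y (\<tau> k)) (X i (s k))" if "i < n" for i k
  proof -
    have "X i (s k) \<in> Z (\<sigma> (\<tau> k))" unfolding Z_def s_def using that by blast
    then have "X i (s k) \<notin> ball (y (\<tau> k)) (\<delta> (\<tau> k))" using sub[of "\<tau> k"] by blast
    then show ?thesis by simp
  qed
  have sep1: "filterlim (\<lambda>k. dist (y (\<tau> k)) (X i (s k)) * sqrt (g (s k) (y (\<tau> k)))) at_top sequentially" if "i < n" for i
  proof (rule filterlim_at_top_mono[OF top], intro always_eventually allI)
    fix k
    show "\<delta> (\<tau> k) * sqrt (g (\<sigma> (\<tau> k)) (y (\<tau> k))) \<le> dist (y (\<tau> k)) (X i (s k)) * sqrt (g (s k) (y (\<tau> k)))"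
      using distZ[OF that, of k] sols(8) unfolding s_def by (intro mult_right_mono) auto
  qed
  \<comment> \<open>If the new center were within \<open>L\<close> units of the old one, the bound
    in \<open>bubble\<close> would give it at most 4 times the old density; then
    \<open>\<delta> * sqrt g\<close> at the new center would be less than \<open>2 * L\<close>,
    although it tends to infinity.\<close>
  have sep2: "filterlim (\<lambda>k. dist (X i (s k)) (y (\<tau> k)) * sqrt (g (s k) (X i (s k)))) at_top sequentially" if i: "i < n" for i
    unfolding filterlim_at_top
  proof
    fix L :: real
    note bi = bubbleD[OF bubblesD(1)[OF bs i]]
    have "eventually (\<lambda>k. 2 * L \<le> \<delta> (\<tau> k) * sqrt (g (\<sigma> (\<tau> k)) (y (\<tau> k)))) sequentially"
      using top by (simp add: filterlim_at_top)
    moreover have "eventually (\<lambda>k. 1 \<le> g (s k) (X i (s k))) sequentially"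
      using bi(3) by (simp add: filterlim_at_top)
    moreover note bi(8)[of L]
    ultimately show "eventually (\<lambda>k. L \<le> dist (X i (s k)) (y (\<tau> k)) * sqrt (g (s k) (X i (s k)))) sequentially"
    proof eventually_elim
      case (elim k)
      have q: "0 < sqrt (g (s k) (X i (s k)))" using elim(2) by simp
      show ?case
      proof (rule ccontr)
        assume n: "\<not> ?thesis"
        then have "dist (X i (s k)) (y (\<tau> k)) < L / sqrt (g (s k) (X i (s k)))" using q by (simp add: less_divide_eq)
        then have "g (s k) (y (\<tau> k)) \<le> 4 * g (s k) (X i (s k))" using elim(3) by simp
        then have "sqrt (g (s k) (y (\<tau> k))) \<le> sqrt (4 * g (s k) (X i (s k)))" by (rule real_sqrt_le_mono)
        also have "\<dots> = 2 * sqrt (g (s k) (X i (s k)))" by (simp add: real_sqrt_mult)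
        finally have "\<delta> (\<tau> k) * sqrt (g (s k) (y (\<tau> k))) \<le> dist (X i (s k)) (y (\<tau> k)) * (2 * sqrt (g (s k) (X i (s k))))"
          using distZ[OF i, of k] \<delta>[of "\<tau> k"] sols(8) by (intro mult_mono) (auto simp: dist_commute)
        then show False using n elim(1) by (simp add: s_def)
      qed
    qed
  qed
  define X' where "X' = (\<lambda>i k. if i < n then X i (s k) else y (\<tau> k))"
  define mm' where "mm' = (\<lambda>i. if i < n then mm i else mn)"
  have "bubbles p \<rho> (\<lambda>k. V (s k)) (\<lambda>k. g (s k)) (Suc n) X' mm'"
    unfolding bubbles_def
  proof (intro conjI allI impI)
    fix i assume "i < Suc n"
    show "bubble p \<rho> (\<lambda>k. V (s k)) (\<lambda>k. g (s k)) (X' i) (mm' i)"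
      using new bubblesD(1)[OF bs, of i] by (simp add: X'_def mm'_def)
    fix j assume "i < Suc n" "j < Suc n" "i \<noteq> j"
    then consider "i < n" "j < n" | "i < n" "j = n" | "i = n" "j < n" by linarith
    then show "filterlim (\<lambda>k. dist (X' i k) (X' j k) * sqrt (g (s k) (X' i k))) at_top sequentially"
      by cases (use bubblesD(2)[OF bs _ _ \<open>i \<noteq> j\<close>] sep1 sep2 in \<open>simp_all add: X'_def\<close>)
  qed
  with s show thesis by (rule that)
qed

lemma rhs0: "0 \<le> rhs (V k) (g k) y" by (rule rhs_nonneg[OF sols(2)])

lemma mass_on:
  assumes "B \<in> sets borel" "B \<subseteq> D"
  shows "integrable lborel (\<lambda>y. indicator B y * rhs (V k) (g k) y)"
proof -
  interpret L: local_solution \<mu> lam Lam c0 D "V k" "g k" p \<rho> A by (rule loc)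
  show ?thesis using L.mass_sub(1)[OF assms] by (simp add: set_integrable_def)
qed

lemma bubble_ball_eventually:
  assumes b: "bubble p \<rho> V g x mm" and r: "0 < r"
  shows "eventually (\<lambda>k. ball (x k) (L / sqrt (g k (x k))) \<subseteq> ball p r) sequentially"
proof -
  note b' = bubbleD[OF b]
  have "filterlim (\<lambda>k. sqrt (g k (x k))) at_top sequentially"
    by (rule filterlim_compose[OF sqrt_at_top b'(3)])
  then have "(\<lambda>k. L / sqrt (g k (x k))) \<longlonglongrightarrow> 0"
    by (intro tendsto_divide_0[OF tendsto_const]) (rule filterlim_at_top_imp_at_infinity)
  then have "(\<lambda>k. dist (x k) p + L / sqrt (g k (x k))) \<longlonglongrightarrow> dist p p + 0"
    using b'(2) by (intro tendsto_intros)
  then have "eventually (\<lambda>k. dist (x k) p + L / sqrt (g k (x k)) < r) sequentially"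
    using r by (intro order_tendstoD(2)[where a = r]) auto
  then show ?thesis
  proof eventually_elim
    case (elim k)
    show ?case
    proof
      fix y assume "y \<in> ball (x k) (L / sqrt (g k (x k)))"
      then show "y \<in> ball p r" using elim dist_triangle[of p y "x k"] by (simp add: dist_commute)
    qed
  qed
qed

text \<open>Each radius is eventually at most half the distance between the two centers, because
  that distance is large in the units of each bubble.\<close>

lemma bubbles_disjoint:
  assumes b: "bubbles p \<rho> V g n X mm"
  shows "eventually (\<lambda>k. disjoint_family_on (\<lambda>i. ball (X i k) (L i / sqrt (g k (X i k)))) {..<n}) sequentially"
proof -
  have ev: "eventually (\<lambda>k. 2 * L i / sqrt (g k (X i k)) \<le> dist (X i k) (X j k)) sequentially" if ij: "i < n" "j < n" "i \<noteq> j" for i j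
  proof -
    note b' = bubbleD[OF bubblesD(1)[OF b ij(1)]]
    have "eventually (\<lambda>k. 2 * L i \<le> dist (X i k) (X j k) * sqrt (g k (X i k))) sequentially"
      using bubblesD(2)[OF b ij] by (simp add: filterlim_at_top)
    moreover have "eventually (\<lambda>k. 1 \<le> g k (X i k)) sequentially" using b'(3) by (simp add: filterlim_at_top)
    ultimately show ?thesis
    proof eventually_elim
      case (elim k)
      then have "0 < sqrt (g k (X i k))" by simp
      then show ?case using elim(1) by (simp add: divide_le_eq)
    qed
  qed
  have "eventually (\<lambda>k. \<forall>ij\<in>{..<n} \<times> {..<n}. fst ij \<noteq> snd ij \<longrightarrow>
     2 * L (fst ij) / sqrt (g k (X (fst ij) k)) \<le> dist (X (fst ij) k) (X (snd ij) k)) sequentially"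
  proof (intro eventually_ball_finite ballI)
    fix ij assume "ij \<in> {..<n} \<times> {..<n}"
    then show "eventually (\<lambda>k. fst ij \<noteq> snd ij \<longrightarrow>
      2 * L (fst ij) / sqrt (g k (X (fst ij) k)) \<le> dist (X (fst ij) k) (X (snd ij) k)) sequentially"
      using ev[of "fst ij" "snd ij"] by (cases "fst ij = snd ij") auto
  qed simp
  then show ?thesis
  proof eventually_elim
    case (elim k)
    show ?case
      unfolding disjoint_family_on_def
    proof (intro ballI impI)
      fix i j assume ij: "i \<in> {..<n}" "j \<in> {..<n}" "i \<noteq> j"
      have 1: "2 * L i / sqrt (g k (X i k)) \<le> dist (X i k) (X j k)" using bspec[OF elim, of "(i, j)"] ij by simp
      have 2: "2 * L j / sqrt (g k (X j k)) \<le> dist (X i k) (X j k)" using bspec[OF elim, of "(j, i)"] ij by (simp add: dist_commute)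
      show "ball (X i k) (L i / sqrt (g k (X i k))) \<inter> ball (X j k) (L j / sqrt (g k (X j k))) = {}"
      proof (rule disjoint_ballI)
        show "L i / sqrt (g k (X i k)) + L j / sqrt (g k (X j k)) \<le> dist (X i k) (X j k)"
          using 1 2 by linarith
      qed
    qed
  qed
qed

text \<open>Cut every bubble at a radius where its mass is at least \<open>8 * pi - e\<close>. The
  resulting balls are eventually disjoint and contained in \<open>ball p \<rho>\<close>, so their
  masses add up below \<open>\<alpha>\<close>.\<close>

lemma mass_lower:
  assumes b: "bubbles p \<rho> V g n X mm"
  shows "8 * pi * real n \<le> \<alpha>"
proof (cases "n = 0")
  case True
  have "0 \<le> \<alpha>"
  proof (rule tendsto_lowerbound[OF mass[OF rho order_refl]])
    show "eventually (\<lambda>k. 0 \<le> (LINT y:ball p \<rho>|lborel. rhs (V k) (g k) y)) sequentially"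
      unfolding set_lebesgue_integral_def using rhs0
      by (intro always_eventually allI Bochner_Integration.integral_nonneg) simp
  qed simp
  then show ?thesis using True by simp
next
  case False
  have "real n * (8 * pi - e) \<le> \<alpha>" if e: "0 < e" for e
  proof -
    have "\<forall>i. \<exists>L. i < n \<longrightarrow> 8 * pi - e \<le> mm i L"
      using bubbleD(6)[OF bubblesD(1)[OF b] e] by blast
    then obtain L where L: "\<forall>i. i < n \<longrightarrow> 8 * pi - e \<le> mm i (L i)" unfolding choice_iff by (elim exE)
    define B where "B = (\<lambda>i k. ball (X i k) (L i / sqrt (g k (X i k))))"
    have "(\<lambda>k. \<Sum>i<n. LINT y:B i k|lborel. rhs (V k) (g k) y) \<longlonglongrightarrow> (\<Sum>i<n. mm i (L i))"
      unfolding B_def using bubbleD(4)[OF bubblesD(1)[OF b]] by (intro tendsto_sum) simp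
    moreover have "eventually (\<lambda>k. (\<Sum>i<n. LINT y:B i k|lborel. rhs (V k) (g k) y) \<le> (LINT y:ball p \<rho>|lborel. rhs (V k) (g k) y)) sequentially"
    proof -
      have "eventually (\<lambda>k. \<forall>i\<in>{..<n}. B i k \<subseteq> ball p \<rho>) sequentially"
        unfolding B_def using bubble_ball_eventually[OF bubblesD(1)[OF b] rho] by (intro eventually_ball_finite) auto
      with bubbles_disjoint[OF b, of L] show ?thesis
      proof eventually_elim
        case (elim k)
        have sub: "B i k \<subseteq> ball p \<rho>" if "i < n" for i using elim(2) that by simp
        then have i: "integrable lborel (\<lambda>y. indicator (B i k) y * rhs (V k) (g k) y)" if "i < n" for i
          using that ball_D by (intro mass_on) (auto simp: B_def simp del: mem_ball)
        have "(\<Sum>i<n. LINT y:B i k|lborel. rhs (V k) (g k) y) = (LINT y|lborel. (\<Sum>i<n. indicator (B i k) y * rhs (V k) (g k) y))"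
          unfolding set_lebesgue_integral_def real_scaleR_def using i by (subst Bochner_Integration.integral_sum) auto
        also have "\<dots> \<le> (LINT y|lborel. indicator (ball p \<rho>) y * rhs (V k) (g k) y)"
        proof (rule integral_mono)
          show "integrable lborel (\<lambda>y. indicator (ball p \<rho>) y * rhs (V k) (g k) y)"
            using ball_D by (intro mass_on) auto
          show "integrable lborel (\<lambda>y. \<Sum>i<n. indicator (B i k) y * rhs (V k) (g k) y)"
            using i by (intro Bochner_Integration.integrable_sum) simp
          fix y
          have "(\<Sum>i<n. indicator (B i k) y) = (indicator (\<Union>i<n. B i k) y :: real)"
            using elim(1) by (intro indicator_UN_disjoint[symmetric]) (simp_all add: B_def)
          also have "\<dots> \<le> indicator (ball p \<rho>) y" using sub by (intro indicator_leI) blast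
          finally have "(\<Sum>i<n. indicator (B i k) y) * rhs (V k) (g k) y \<le> indicator (ball p \<rho>) y * rhs (V k) (g k) y"
            using rhs0 by (rule mult_right_mono)
          then show "(\<Sum>i<n. indicator (B i k) y * rhs (V k) (g k) y) \<le> indicator (ball p \<rho>) y * rhs (V k) (g k) y"
            by (simp add: sum_distrib_right)
        qed
        finally show ?case by (simp add: set_lebesgue_integral_def)
      qed
    qed
    ultimately have "(\<Sum>i<n. mm i (L i)) \<le> \<alpha>"
      using mass[OF rho order_refl] by (intro tendsto_le[OF trivial_limit_sequentially]) auto
    moreover have "(\<Sum>i<n. 8 * pi - e) \<le> (\<Sum>i<n. mm i (L i))" using L by (intro sum_mono) simp
    ultimately show ?thesis by simp
  qed
  then have "8 * pi - \<alpha> / real n \<le> e" if "0 < e" for e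
    using that False by (simp add: field_simps)
  then have "8 * pi - \<alpha> / real n \<le> 0" by (rule field_le_epsilon[of _ 0, simplified])
  then show ?thesis using False by (simp add: field_simps)
qed

end

text \<open>The integral is invariant under rescaling by \<open>s\<close> about \<open>z\<close> and
  depends on \<open>R\<close> and \<open>q\<close> only. The tails of the bubbles are thus small
  uniformly along the sequence, however concentrated the bubbles are.\<close>

lemma scaled_tail_integral:
  fixes z :: "real^2"
  assumes "0 < q" "0 < s" "0 < R"
  shows "integrable lborel (\<lambda>x. indicator (- ball z (R / s)) x * ((dist x z * s) powr - q / (dist x z)\<^sup>2))"
    and "(LINT x|lborel. indicator (- ball z (R / s)) x * ((dist x z * s) powr - q / (dist x z)\<^sup>2)) = 2 * pi * R powr - q / q"
proof -
  define h where "h = (\<lambda>y::real^2. indicator (- ball 0 (R / s)) y * norm y powr - (2 + q))"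
  have h: "has_bochner_integral lborel h (2 * pi * (R / s) powr - q / q)"
    using has_bochner_integral_norm_powr_outside_ball[of "R / s" "2 + q"] assms by (simp add: h_def)
  have hm: "h \<in> borel_measurable borel" unfolding h_def by (auto intro!: borel_measurable_times borel_measurable_indicator)
  have eq: "indicator (- ball z (R / s)) x * ((dist x z * s) powr - q / (dist x z)\<^sup>2) = s powr - q * h (x - z)" for x
  proof -
  have m: "x - z \<in> ball 0 (R / s) \<longleftrightarrow> x \<in> ball z (R / s)"
    by (simp only: mem_ball dist_0_norm dist_norm[of x z, symmetric] dist_commute[of z x])
  show ?thesis
  proof (cases "x \<in> ball z (R / s)")
    case True
    then show ?thesis using m by (simp add: h_def del: mem_ball)
  next
    case False
    then have "R / s \<le> dist z x" by simp
    moreover have "0 < R / s" using assms by simp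
    ultimately have "0 < dist z x" by linarith
    then have d: "0 < norm (x - z)" by simp
    have "norm (x - z) powr - q / (norm (x - z))\<^sup>2 = norm (x - z) powr - (2 + q)"
    proof -
      have "norm (x - z) powr (- q - 2) = norm (x - z) powr - q / norm (x - z) powr 2" by (rule powr_diff)
      moreover have "- q - 2 = - (2 + q)" by simp
      ultimately show ?thesis using d by (simp only: powr_numeral)
    qed
    moreover have "(norm (x - z) * s) powr - q / (norm (x - z))\<^sup>2 = s powr - q * (norm (x - z) powr - q / (norm (x - z))\<^sup>2)"
      by (simp add: powr_mult)
    ultimately have "(norm (x - z) * s) powr - q / (norm (x - z))\<^sup>2 = s powr - q * norm (x - z) powr - (2 + q)" by (simp only:)
    then show ?thesis using False m by (simp add: h_def dist_norm del: mem_ball)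
  qed
  qed
  show "integrable lborel (\<lambda>x. indicator (- ball z (R / s)) x * ((dist x z * s) powr - q / (dist x z)\<^sup>2))"
    unfolding eq using h integral_lborel_shift(2)[OF hm, of z] by (intro integrable_mult_right) (simp add: has_bochner_integral_iff)
  have "s powr - q * (R / s) powr - q = (s * (R / s)) powr - q" by (rule powr_mult[symmetric])
  moreover have "s * (R / s) = R" using assms by simp
  ultimately have e: "s powr - q * (R / s) powr - q = R powr - q" by (simp only:)
  have "(LINT x|lborel. s powr - q * h (x - z)) = s powr - q * (2 * pi * (R / s) powr - q / q)"
    using h integral_lborel_shift(1)[OF hm, of z] by (simp add: has_bochner_integral_iff)
  also have "\<dots> = 2 * pi * (s powr - q * (R / s) powr - q) / q" by simp
  also have "\<dots> = 2 * pi * R powr - q / q" unfolding e ..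
  finally show "(LINT x|lborel. indicator (- ball z (R / s)) x * ((dist x z * s) powr - q / (dist x z)\<^sup>2)) = 2 * pi * R powr - q / q"
    unfolding eq .
qed

context local_solution
begin

text \<open>Outside the bubble balls, \<open>decay_estimate\<close> is applied with the nearest
  center, at distance \<open>d\<close>. Balls of radius \<open>d / 2\<close> about points of
  \<open>ball x (d / 2)\<close> then meet no center, which turns the hypothesis on \<open>Q\<close>
  into the pointwise bound needed. Summing over all centers removes the dependence on which one is
  nearest, so that the estimate can be integrated.\<close>

lemma covering_estimate:
  fixes X :: "nat \<Rightarrow> real^2"
  assumes n: "0 < n" and X: "\<And>i. i < n \<Longrightarrow> X i \<in> ball p (\<rho> / 4)"
    and Q: "\<And>x r. 0 < r \<Longrightarrow> ball x r \<subseteq> ball p \<rho> - X ` {..<n} \<Longrightarrow> r\<^sup>2 * g x \<le> Q"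
    and b: "1 \<le> b" "2 * b \<le> R"
    and m0: "\<And>i. i < n \<Longrightarrow> 7 * pi \<le> (LINT y:ball (X i) (b / sqrt (g (X i)))|lborel. rhs V g y)"
    and x: "x \<in> ball p (\<rho> / 4)"
  shows "rhs V g x \<le> (\<Sum>i<n. indicator (ball (X i) (R / sqrt (g (X i)))) x * rhs V g x)
    + (\<Sum>i<n. decay_const \<rho> A Q b * (indicator (- ball (X i) (R / sqrt (g (X i)))) x *
         ((dist x (X i) * sqrt (g (X i))) powr - decay_exp / (dist x (X i))\<^sup>2))) + tail_bound \<rho> A Q N"
proof -
  define F where "F = (\<lambda>i. indicator (ball (X i) (R / sqrt (g (X i)))) x * rhs V g x)"
  define G where "G = (\<lambda>i. decay_const \<rho> A Q b * (indicator (- ball (X i) (R / sqrt (g (X i)))) x *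
         ((dist x (X i) * sqrt (g (X i))) powr - decay_exp / (dist x (X i))\<^sup>2)))"
  have F0: "0 \<le> F i" for i unfolding F_def using rhs0 by simp
  have G0: "0 \<le> G i" for i unfolding G_def using decay_const_nonneg
    by (intro mult_nonneg_nonneg divide_nonneg_nonneg) auto
  have t0: "0 \<le> tail_bound \<rho> A Q N" by (rule tail_bound_nonneg)
  have FG: "F i \<le> sum F {..<n}" "G i \<le> sum G {..<n}" if "i < n" for i
    using that F0 G0 by (auto intro!: member_le_sum)
  have s0: "0 \<le> sum F {..<n}" "0 \<le> sum G {..<n}" using F0 G0 by (auto intro: sum_nonneg)
  have "rhs V g x \<le> sum F {..<n} + sum G {..<n} + tail_bound \<rho> A Q N"
  proof (cases "\<exists>i<n. x \<in> ball (X i) (R / sqrt (g (X i)))")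
    case True
    then obtain i where i: "i < n" "x \<in> ball (X i) (R / sqrt (g (X i)))" by blast
    then have "F i = rhs V g x" by (simp add: F_def del: mem_ball)
    then show ?thesis using FG(1)[OF i(1)] s0 t0 by linarith
  next
    case False
    define d where "d = Min ((\<lambda>i. dist x (X i)) ` {..<n})"
    have "d \<in> (\<lambda>i. dist x (X i)) ` {..<n}" unfolding d_def using n by (intro Min_in) auto
    then obtain i where i: "i < n" "d = dist x (X i)" by auto
    have dle: "d \<le> dist x (X j)" if "j < n" for j unfolding d_def using that by (intro Min_le) auto
    have inD: "X i \<in> D" using sub_ball[of "X i" 0] X[OF i(1)] rho by auto
    have gp: "0 < sqrt (g (X i))" using sols(4)[OF inD] by simp
    have out: "x \<notin> ball (X i) (R / sqrt (g (X i)))" using False i(1) by blast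
    then have "R / sqrt (g (X i)) \<le> d" unfolding i(2) by (simp add: dist_commute)
    moreover have "2 * (b / sqrt (g (X i))) \<le> R / sqrt (g (X i))" using b(2) gp by (simp add: divide_right_mono)
    ultimately have bd: "2 * (b / sqrt (g (X i))) \<le> d" by linarith
    have "0 < 2 * (b / sqrt (g (X i)))" using b gp by simp
    then have d0: "0 < d" using bd by linarith
    have d2: "d < \<rho> / 2"
    proof -
      have "d \<le> dist p x + dist p (X i)" unfolding i(2) by (rule dist_triangle3)
      then show ?thesis using x X[OF i(1)] by simp
    qed
    have gz: "g z \<le> 4 * Q / d\<^sup>2" if z: "z \<in> ball x (d / 2)" for z
    proof -
      have "ball z (d / 2) \<subseteq> ball p \<rho> - X ` {..<n}"
      proof
        fix w assume w: "w \<in> ball z (d / 2)"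
        have xw: "dist x w < d" using z w dist_triangle[of x w z] by simp
        have "dist p w < \<rho>" using xw d2 x dist_triangle[of p w x] rho by simp
        moreover have "w \<notin> X ` {..<n}"
        proof
          assume "w \<in> X ` {..<n}"
          then obtain j where "j < n" "w = X j" by blast
          then show False using dle[of j] xw by simp
        qed
        ultimately show "w \<in> ball p \<rho> - X ` {..<n}" by simp
      qed
      then have "(d / 2)\<^sup>2 * g z \<le> Q" using d0 by (intro Q) auto
      then show ?thesis using d0 by (simp add: field_simps power2_eq_square)
    qed
    have "rhs V g x \<le> decay_const \<rho> A Q b * (d * sqrt (g (X i))) powr - decay_exp / d\<^sup>2 + tail_bound \<rho> A Q N"
      by (rule decay_estimate[OF x X[OF i(1)] i(2) d0 gz b(1) bd m0[OF i(1)]])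
    also have "decay_const \<rho> A Q b * (d * sqrt (g (X i))) powr - decay_exp / d\<^sup>2 = G i"
      using out by (simp add: G_def i(2) del: mem_ball)
    finally show ?thesis using FG(2)[OF i(1)] s0 by linarith
  qed
  then show ?thesis by (simp only: F_def G_def)
qed

end

context concentration
begin

text \<open>Integrate the covering estimate over \<open>ball p (\<rho> / 4)\<close>. In the limit
  the bubble balls give at most \<open>8 * pi\<close> each, the tails a multiple of
  \<open>R powr - decay_exp\<close>, and the remainder vanishes because \<open>N\<close> tends to
  infinity.\<close>

lemma mass_upper_aux:
  assumes b: "bubbles p \<rho> V g n X mm" and n: "0 < n" and Q: "scale_bounded n X Q"
  obtains C where "\<And>R. C \<le> R \<Longrightarrow> 0 < R \<Longrightarrow> \<alpha> \<le> 8 * pi * real n + C * R powr - decay_exp"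
proof -
  have "\<forall>i. \<exists>L. i < n \<longrightarrow> 1 \<le> L \<and> 8 * pi - pi / 2 \<le> mm i L"
    using bubbleD(6)[OF bubblesD(1)[OF b], where e = "pi / 2"] by simp
  then obtain L where L: "\<forall>i. i < n \<longrightarrow> 1 \<le> L i \<and> 8 * pi - pi / 2 \<le> mm i (L i)" unfolding choice_iff by (elim exE)
  \<comment> \<open>A common radius for all bubbles: every \<open>L i\<close> is positive, so the
    sum dominates each of them, and monotonicity of \<open>mm i\<close> keeps the mass above
    \<open>7 * pi\<close>.\<close>
  define B where "B = sum L {..<n}"
  have LB: "L i \<le> B" if "i < n" for i unfolding B_def
  proof (rule member_le_sum)
    show "0 \<le> L j" if "j \<in> {..<n} - {i}" for j using L[rule_format, of j] that by simp
  qed (use that in auto)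
  have B1: "1 \<le> B" using LB[OF n] L[rule_format, OF n] by linarith
  have mB: "7 * pi < mm i B" if "i < n" for i
  proof -
    have "mm i (L i) \<le> mm i B" using bubbleD(7)[OF bubblesD(1)[OF b that]] LB[OF that] by (rule monoD)
    moreover have "8 * pi - pi / 2 \<le> mm i (L i)" using L that by simp
    ultimately show ?thesis using pi_gt_zero by linarith
  qed
  define K where "K = real n * (decay_const \<rho> A Q B * (2 * pi / decay_exp))"
  have q: "0 < decay_exp" using lam_bounds by (simp add: decay_exp_def)
  have K0: "0 \<le> K" unfolding K_def using decay_const_nonneg q by simp
  have main: "\<alpha> \<le> 8 * pi * real n + K * R powr - decay_exp" if R: "2 * B \<le> R" for R
  proof -
    have R0: "0 < R" using R B1 by linarith
    define U where "U = (\<lambda>i k. ball (X i k) (R / sqrt (g k (X i k))))"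
    define T where "T = (\<lambda>k. tail_bound \<rho> A Q (local_solution.N (g k) p \<rho>))"
    define E where "E = (\<lambda>k. (\<Sum>i<n. LINT y:U i k|lborel. rhs (V k) (g k) y) + K * R powr - decay_exp + T k * (pi * (\<rho> / 4)\<^sup>2))"
    have r4: "0 < \<rho> / 4" "\<rho> / 4 \<le> \<rho>" using rho by auto
    have ev: "eventually (\<lambda>k. (LINT y:ball p (\<rho> / 4)|lborel. rhs (V k) (g k) y) \<le> E k) sequentially"
    proof -
      have "eventually (\<lambda>k. \<forall>i\<in>{..<n}. 7 * pi \<le> (LINT y:ball (X i k) (B / sqrt (g k (X i k)))|lborel. rhs (V k) (g k) y)) sequentially"
      proof (intro eventually_ball_finite ballI)
        fix i assume i: "i \<in> {..<n}"
        have "eventually (\<lambda>k. 7 * pi < (LINT y:ball (X i k) (B / sqrt (g k (X i k)))|lborel. rhs (V k) (g k) y)) sequentially"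
          using bubbleD(4)[OF bubblesD(1)[OF b]] mB i by (intro order_tendstoD(1)) auto
        then show "eventually (\<lambda>k. 7 * pi \<le> (LINT y:ball (X i k) (B / sqrt (g k (X i k)))|lborel. rhs (V k) (g k) y)) sequentially"
          by eventually_elim simp
      qed simp
      moreover have "eventually (\<lambda>k. \<forall>i\<in>{..<n}. U i k \<subseteq> ball p (\<rho> / 4)) sequentially"
        unfolding U_def using bubble_ball_eventually[OF bubblesD(1)[OF b] r4(1)] by (intro eventually_ball_finite) auto
      moreover note Q[unfolded scale_bounded_def]
      ultimately show ?thesis
      proof eventually_elim
        case (elim k)
        interpret L: local_solution \<mu> lam Lam c0 D "V k" "g k" p \<rho> A by (rule loc)
        have inD: "X i k \<in> D" if "i < n" for i using bubbleD(1)[OF bubblesD(1)[OF b that]] ball_D by blast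
        have gp: "0 < sqrt (g k (X i k))" if "i < n" for i using sols(4)[OF inD[OF that]] by simp
        have XU: "X i k \<in> ball p (\<rho> / 4)" if "i < n" for i
        proof -
          have "X i k \<in> U i k" unfolding U_def using gp[OF that] R0 by (intro centre_in_ball[THEN iffD2] divide_pos_pos)
          then show ?thesis using elim(2) that by blast
        qed
        have UD: "U i k \<subseteq> D" if "i < n" for i
        proof -
          have "U i k \<subseteq> ball p (\<rho> / 4)" using elim(2) that by blast
          also have "\<dots> \<subseteq> ball p \<rho>" using r4(2) by (rule subset_ball)
          finally show ?thesis using ball_D by blast
        qed
        define h where "h = (\<lambda>i x. indicator (- U i k) x * ((dist x (X i k) * sqrt (g k (X i k))) powr - decay_exp / (dist x (X i k))\<^sup>2))"
        have h: "integrable lborel (h i)" "(LINT x|lborel. h i x) = 2 * pi * R powr - decay_exp / decay_exp" if "i < n" for i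
          unfolding h_def U_def using scaled_tail_integral[OF q gp[OF that] R0] by blast+
        have iU: "integrable lborel (\<lambda>y. indicator (U i k) y * rhs (V k) (g k) y)" if "i < n" for i
          using UD[OF that] by (intro mass_on) (auto simp: U_def simp del: mem_ball)
        have T0: "0 \<le> T k" unfolding T_def by (rule tail_bound_nonneg)
        have i0: "integrable lborel (\<lambda>y. indicator (ball p (\<rho> / 4)) y * T k)"
          by (intro integrable_mult_left integrable_indicator_ball)
        have hb: "has_bochner_integral lborel
           (\<lambda>y. (\<Sum>i<n. indicator (U i k) y * rhs (V k) (g k) y) + (\<Sum>i<n. decay_const \<rho> A Q B * h i y) + indicator (ball p (\<rho> / 4)) y * T k)
           ((\<Sum>i<n. LINT y|lborel. indicator (U i k) y * rhs (V k) (g k) y) + (\<Sum>i<n. decay_const \<rho> A Q B * (2 * pi * R powr - decay_exp / decay_exp)) + (LINT y|lborel. indicator (ball p (\<rho> / 4)) y * T k))"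
        proof (intro has_bochner_integral_add has_bochner_integral_sum has_bochner_integral_mult_right has_bochner_integral_integrable i0 iU)
          fix i assume "i \<in> {..<n}"
          then show "has_bochner_integral lborel (h i) (2 * pi * R powr - decay_exp / decay_exp)"
            using h[of i] by (simp add: has_bochner_integral_iff)
        qed simp
        have "(LINT y|lborel. indicator (ball p (\<rho> / 4)) y * rhs (V k) (g k) y) \<le>
          (LINT y|lborel. (\<Sum>i<n. indicator (U i k) y * rhs (V k) (g k) y) + (\<Sum>i<n. decay_const \<rho> A Q B * h i y) + indicator (ball p (\<rho> / 4)) y * T k)"
        proof (rule integral_mono)
          show "integrable lborel (\<lambda>y. indicator (ball p (\<rho> / 4)) y * rhs (V k) (g k) y)"
            using ball_D subset_ball[OF r4(2), of p] by (intro mass_on) auto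
          show "integrable lborel (\<lambda>y. (\<Sum>i<n. indicator (U i k) y * rhs (V k) (g k) y) + (\<Sum>i<n. decay_const \<rho> A Q B * h i y) + indicator (ball p (\<rho> / 4)) y * T k)"
            using hb by (rule integrable.intros)
          fix y
          have s0: "0 \<le> (\<Sum>i<n. indicator (U i k) y * rhs (V k) (g k) y)" "0 \<le> (\<Sum>i<n. decay_const \<rho> A Q B * h i y)"
            unfolding h_def using decay_const_nonneg rhs0
            by (auto intro!: sum_nonneg mult_nonneg_nonneg divide_nonneg_nonneg)
          show "indicator (ball p (\<rho> / 4)) y * rhs (V k) (g k) y \<le>
             (\<Sum>i<n. indicator (U i k) y * rhs (V k) (g k) y) + (\<Sum>i<n. decay_const \<rho> A Q B * h i y) + indicator (ball p (\<rho> / 4)) y * T k"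
          proof (cases "y \<in> ball p (\<rho> / 4)")
            case True
            have "rhs (V k) (g k) y \<le> (\<Sum>i<n. indicator (U i k) y * rhs (V k) (g k) y) + (\<Sum>i<n. decay_const \<rho> A Q B * h i y) + T k"
              unfolding h_def U_def T_def
              by (rule L.covering_estimate[OF n XU _ B1 R _ True]) (use elim(1,3) in auto)
            then show ?thesis using True by (simp del: mem_ball)
          next
            case False
            then show ?thesis using s0 by (simp del: mem_ball)
          qed
        qed
        also have "\<dots> = (\<Sum>i<n. LINT y|lborel. indicator (U i k) y * rhs (V k) (g k) y) + (\<Sum>i<n. decay_const \<rho> A Q B * (2 * pi * R powr - decay_exp / decay_exp)) + pi * (\<rho> / 4)\<^sup>2 * T k"
        proof -
          have "(LINT y|lborel. indicator (ball p (\<rho> / 4)) y * T k) = pi * (\<rho> / 4)\<^sup>2 * T k"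
            using r4 by (simp add: lebesgue_ball_real2)
          with has_bochner_integral_integral_eq[OF hb] show ?thesis by (simp only:)
        qed
        finally show ?case
          by (simp add: E_def K_def set_lebesgue_integral_def mult_ac)
      qed
    qed
    have "T \<longlonglongrightarrow> 0"
    proof -
      interpret L: local_solution \<mu> lam Lam c0 D "V 0" "g 0" p \<rho> A by (rule loc)
      show ?thesis unfolding T_def
        by (rule filterlim_compose[OF tail_bound_tendsto[OF rho L.A_nonneg] N_at_top])
    qed
    then have "E \<longlonglongrightarrow> (\<Sum>i<n. mm i R) + K * R powr - decay_exp + 0 * (pi * (\<rho> / 4)\<^sup>2)"
      unfolding E_def U_def using bubbleD(4)[OF bubblesD(1)[OF b]] by (intro tendsto_intros) simp
    then have "\<alpha> \<le> (\<Sum>i<n. mm i R) + K * R powr - decay_exp + 0 * (pi * (\<rho> / 4)\<^sup>2)"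
      using mass[OF r4] ev by (intro tendsto_le[OF trivial_limit_sequentially])
    moreover have "(\<Sum>i<n. mm i R) \<le> (\<Sum>i<n. 8 * pi)" using bubbleD(5)[OF bubblesD(1)[OF b]] by (intro sum_mono) simp
    ultimately show ?thesis by (simp add: mult.commute)
  qed
  show thesis
  \<comment> \<open>One number serves both as the constant and as the threshold for
    \<open>R\<close>.\<close>
  proof (rule that[of "max K (2 * B)"])
    fix R assume R: "max K (2 * B) \<le> R"
    have "\<alpha> \<le> 8 * pi * real n + K * R powr - decay_exp" using R by (intro main) simp
    also have "\<dots> \<le> 8 * pi * real n + max K (2 * B) * R powr - decay_exp" by (intro add_left_mono mult_right_mono) auto
    finally show "\<alpha> \<le> 8 * pi * real n + max K (2 * B) * R powr - decay_exp" .
  qed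
qed

text \<open>With centers present, let \<open>R\<close> tend to infinity. Without centers, the scale
  bound makes the right-hand side bounded near \<open>p\<close>, so \<open>\<alpha>\<close> is at
  most a multiple of \<open>r\<^sup>2\<close> for every small \<open>r\<close>.\<close>

lemma mass_upper:
  assumes b: "bubbles p \<rho> V g n X mm" and Q: "scale_bounded n X Q"
  shows "\<alpha> \<le> 8 * pi * real n"
proof (cases "n = 0")
  case False
  have q: "0 < decay_exp" using lam_bounds by (simp add: decay_exp_def)
  obtain C where C: "\<And>R. C \<le> R \<Longrightarrow> 0 < R \<Longrightarrow> \<alpha> \<le> 8 * pi * real n + C * R powr - decay_exp"
    by (rule mass_upper_aux[OF b _ Q]) (use False in simp, rule that)
  have "((\<lambda>R. R powr - decay_exp) \<longlongrightarrow> 0) at_top"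
    using q by (intro tendsto_neg_powr filterlim_ident) simp
  then have "((\<lambda>R. 8 * pi * real n + C * R powr - decay_exp) \<longlongrightarrow> 8 * pi * real n + C * 0) at_top"
    by (intro tendsto_intros)
  moreover have "eventually (\<lambda>R. \<alpha> \<le> 8 * pi * real n + C * R powr - decay_exp) at_top"
    using eventually_ge_at_top[of C] eventually_gt_at_top[of 0] by eventually_elim (rule C)
  ultimately have "\<alpha> \<le> 8 * pi * real n + C * 0" by (rule tendsto_lowerbound) simp
  then show ?thesis by simp
next
  case True
  have Q': "eventually (\<lambda>k. \<forall>x r. 0 < r \<longrightarrow> ball x r \<subseteq> ball p \<rho> \<longrightarrow> r\<^sup>2 * g k x \<le> Q) sequentially"
    using Q by (simp add: scale_bounded_def True)
  define C where "C = near_const Q / \<rho>\<^sup>2 * pi"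
  have C: "\<alpha> \<le> C * r\<^sup>2" if r: "0 < r" "r < \<rho> / 4" for r
  proof (rule tendsto_upperbound[OF mass])
    show "0 < r" "r \<le> \<rho>" using r by auto
    show "eventually (\<lambda>k. (LINT y:ball p r|lborel. rhs (V k) (g k) y) \<le> C * r\<^sup>2) sequentially"
      using Q'
    proof eventually_elim
      case (elim k)
      have gz: "g k z \<le> 4 * Q / \<rho>\<^sup>2" if z: "z \<in> ball p (\<rho> / 2)" for z
      proof -
        have "ball z (\<rho> / 2) \<subseteq> ball p \<rho>"
        proof
          fix w assume "w \<in> ball z (\<rho> / 2)"
          then show "w \<in> ball p \<rho>" using z dist_triangle[of p w z] by simp
        qed
        then have "(\<rho> / 2)\<^sup>2 * g k z \<le> Q" using elim rho by auto
        then show ?thesis using rho by (simp add: field_simps power2_eq_square)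
      qed
      have sub: "ball p r \<subseteq> ball p (\<rho> / 4)" "ball p r \<subseteq> ball p \<rho>" using r by (auto intro: subset_ball)
      have "(LINT y|lborel. indicator (ball p r) y * rhs (V k) (g k) y) \<le> (LINT y|lborel. indicator (ball p r) y * (near_const Q / \<rho>\<^sup>2))"
      proof (rule integral_mono)
        show "integrable lborel (\<lambda>y. indicator (ball p r) y * rhs (V k) (g k) y)"
          using sub ball_D by (intro mass_on) auto
        show "integrable lborel (\<lambda>y. indicator (ball p r) y * (near_const Q / \<rho>\<^sup>2))"
          by (intro integrable_mult_left integrable_indicator_ball)
        fix y
        show "indicator (ball p r) y * rhs (V k) (g k) y \<le> indicator (ball p r) y * (near_const Q / \<rho>\<^sup>2)"
        proof (cases "y \<in> ball p r")
          case True
          then have "y \<in> ball p (\<rho> / 4)" using sub by blast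

          from near_rhs(1)[OF sol[of k] rho gz this] have "rhs (V k) (g k) y \<le> near_const Q / \<rho>\<^sup>2" by blast
          then show ?thesis using True by (simp del: mem_ball)
        qed (simp del: mem_ball)
      qed
      also have "\<dots> = C * r\<^sup>2" using r by (simp add: lebesgue_ball_real2 C_def)
      finally show ?case by (simp add: set_lebesgue_integral_def)
    qed
  qed simp
  have "((\<lambda>r. C * r\<^sup>2) \<longlongrightarrow> C * 0\<^sup>2) (at_right 0)" by (intro tendsto_intros)
  moreover have "eventually (\<lambda>r. \<alpha> \<le> C * r\<^sup>2) (at_right 0)"
    by (rule eventually_at_rightI[of 0 "\<rho> / 4"]) (use rho C in auto)
  ultimately have "\<alpha> \<le> C * 0\<^sup>2" by (rule tendsto_lowerbound) simp
  then show ?thesis using True by simp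
qed

theorem quantization:
  assumes "0 < \<alpha>"
  shows "\<exists>n::nat. 1 \<le> n \<and> \<alpha> = 8 * pi * real n"
proof -
  \<comment> \<open>The subsequence belongs to the predicate, since each further bubble is found
    only along a further subsequence; \<open>P 0\<close> holds with the identity and no
    bubbles.\<close>
  define P where "P = (\<lambda>n. \<exists>\<sigma> X mm. strict_mono (\<sigma> :: nat \<Rightarrow> nat) \<and> bubbles p \<rho> (\<lambda>k. V (\<sigma> k)) (\<lambda>k. g (\<sigma> k)) n X mm)"
  have P0: "P 0" unfolding P_def bubbles_def using strict_mono_id by fastforce
  have bound: "real n \<le> \<alpha> / (8 * pi)" if "P n" for n
  proof -
    from that obtain \<sigma> X mm where \<sigma>: "strict_mono (\<sigma> :: nat \<Rightarrow> nat)" and b: "bubbles p \<rho> (\<lambda>k. V (\<sigma> k)) (\<lambda>k. g (\<sigma> k)) n X mm"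
      unfolding P_def by blast
    interpret S: concentration \<mu> lam Lam c0 D "\<lambda>k. V (\<sigma> k)" "\<lambda>k. g (\<sigma> k)" p \<rho> A v0 \<alpha> by (rule subseq[OF \<sigma>])
    show ?thesis using S.mass_lower[OF b] by (simp add: field_simps)
  qed
  then have "\<forall>n. P n \<longrightarrow> n \<le> nat \<lfloor>\<alpha> / (8 * pi)\<rfloor>" by (auto simp: le_nat_floor)
  then have n: "P (Greatest P)" "\<And>n. P n \<Longrightarrow> n \<le> Greatest P"
    using P0 by (auto intro: GreatestI_nat Greatest_le_nat)
  define n where "n = Greatest P"
  obtain \<sigma> X mm where \<sigma>: "strict_mono (\<sigma> :: nat \<Rightarrow> nat)" and b: "bubbles p \<rho> (\<lambda>k. V (\<sigma> k)) (\<lambda>k. g (\<sigma> k)) n X mm"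
    using n(1) unfolding P_def n_def by blast
  interpret S: concentration \<mu> lam Lam c0 D "\<lambda>k. V (\<sigma> k)" "\<lambda>k. g (\<sigma> k)" p \<rho> A v0 \<alpha> by (rule subseq[OF \<sigma>])
  have "\<exists>Q. S.scale_bounded n X Q"
  proof (rule ccontr)
    assume "\<not> ?thesis"
    then have not: "\<not> S.scale_bounded n X Q" for Q by blast
    obtain \<tau> X' mm' where \<tau>: "strict_mono \<tau>" and b': "bubbles p \<rho> (\<lambda>k. V (\<sigma> (\<tau> k))) (\<lambda>k. g (\<sigma> (\<tau> k))) (Suc n) X' mm'"
      by (rule S.additional_bubble[OF b not]) (rule that)
    have "strict_mono (\<lambda>k. \<sigma> (\<tau> k))" using strict_mono_o[OF \<sigma> \<tau>] by (simp add: o_def)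
    then have "P (Suc n)" using b' unfolding P_def by blast
    then show False using n(2) by (fastforce simp: n_def)
  qed
  then obtain Q where "S.scale_bounded n X Q" ..
  then have "\<alpha> = 8 * pi * real n" using S.mass_lower[OF b] S.mass_upper[OF b] by (intro antisym)
  moreover from this have "1 \<le> n" using assms by (cases n) auto
  ultimately show ?thesis by blast
qed

end

section \<open>Reduction of the distributional equation\<close>

text \<open>Piecewise linear in the distance: weak-* convergence is tested with continuous
  functions, so no smoothness is required.\<close>

definition cutoff :: "real^2 \<Rightarrow> real \<Rightarrow> real^2 \<Rightarrow> real" where
  "cutoff p r x = max 0 (min 1 (2 - dist p x / r))"

lemma cutoff:
  assumes "0 < r"
  shows "continuous_on UNIV (cutoff p r)" "0 \<le> cutoff p r x" "cutoff p r x \<le> 1"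
    "dist p x \<le> r \<Longrightarrow> cutoff p r x = 1" "2 * r \<le> dist p x \<Longrightarrow> cutoff p r x = 0"
    "cball p (2 * r) \<subseteq> \<omega> \<Longrightarrow> cutoff p r \<in> Cc \<omega>"
proof -
  show c: "continuous_on UNIV (cutoff p r)"
    unfolding cutoff_def[abs_def] using assms by (intro continuous_intros) auto
  show "0 \<le> cutoff p r x" "cutoff p r x \<le> 1" unfolding cutoff_def by auto
  show "cutoff p r x = 1" if "dist p x \<le> r"
  proof -
    have "dist p x / r \<le> 1" using that assms by simp
    then show ?thesis by (simp add: cutoff_def)
  qed
  have z: "cutoff p r x = 0" if "2 * r \<le> dist p x" for x
  proof -
    have "2 \<le> dist p x / r" using that assms by (simp add: le_divide_eq)
    then show ?thesis by (simp add: cutoff_def)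
  qed
  then show "2 * r \<le> dist p x \<Longrightarrow> cutoff p r x = 0" .
  assume \<omega>: "cball p (2 * r) \<subseteq> \<omega>"
  have "{x. cutoff p r x \<noteq> 0} \<subseteq> cball p (2 * r)"
  proof
    fix x assume "x \<in> {x. cutoff p r x \<noteq> 0}"
    then show "x \<in> cball p (2 * r)" using z[of x] by (cases "2 * r \<le> dist p x") auto
  qed
  then have sub: "closure {x. cutoff p r x \<noteq> 0} \<subseteq> cball p (2 * r)" by (rule closure_minimal) simp
  then have "compact (closure {x. cutoff p r x \<noteq> 0})"
    using bounded_subset[OF bounded_cball] by (auto simp: compact_eq_bounded_closed)
  then show "cutoff p r \<in> Cc \<omega>" unfolding Cc_def compact_support_in_def using c sub \<omega> by blast
qed

text \<open>The indicator of the ball is not continuous; it lies between the cutoffs of radii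
  \<open>r / 2\<close> and \<open>r\<close>. Both are 1 at \<open>a i\<close> and vanish at the
  other points, so their limits agree.\<close>

lemma weak_star_ball_mass:
  fixes f :: "nat \<Rightarrow> real^2 \<Rightarrow> real"
  assumes ws: "weak_star_converges \<omega> f (dirac_sum {1..m} \<alpha> a)" and \<alpha>: "\<And>j. j \<in> {1..m} \<Longrightarrow> 0 \<le> \<alpha> j"
    and i: "i \<in> {1..m}" and other: "\<And>j. j \<in> {1..m} \<Longrightarrow> j \<noteq> i \<Longrightarrow> a j \<notin> cball (a i) (2 * r)"
    and r: "0 < r" and sub: "cball (a i) (2 * r) \<subseteq> \<omega>" and \<omega>: "open \<omega>"
    and f [measurable]: "\<And>l. f l \<in> borel_measurable borel" and f0: "\<And>l x. 0 \<le> f l x"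
    and fi: "\<And>l. set_integrable lborel \<omega> (f l)"
  shows "(\<lambda>l. LINT y:ball (a i) r|lborel. f l y) \<longlonglongrightarrow> \<alpha> i"
proof -
  have [measurable]: "\<omega> \<in> sets borel" using \<omega> by (rule borel_open)
  have lim: "(\<lambda>l. LINT x|lborel. indicator \<omega> x * (f l x * cutoff (a i) s x)) \<longlonglongrightarrow> \<alpha> i" if s: "0 < s" "s \<le> r" for s
  proof -
    have [measurable]: "cutoff (a i) s \<in> borel_measurable borel"
      by (rule borel_measurable_continuous_onI[OF cutoff(1)[OF s(1)]])
    have s2: "cball (a i) (2 * s) \<subseteq> cball (a i) (2 * r)" using s by (intro subset_cball) simp
    have C: "cutoff (a i) s \<in> Cc \<omega>" using s2 sub by (intro cutoff(6)[OF s(1)]) blast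
    have "(LINT x:\<omega>|dirac_sum {1..m} \<alpha> a. cutoff (a i) s x) = (\<Sum>j\<in>{1..m}. \<alpha> j * (indicator \<omega> (a j) * cutoff (a i) s (a j)))"
      unfolding set_lebesgue_integral_def real_scaleR_def using \<alpha> by (intro integral_dirac_sum) auto
    also have "\<dots> = (\<Sum>j\<in>{1..m}. if j = i then \<alpha> i else 0)"
    proof (rule sum.cong[OF refl])
      fix j assume j: "j \<in> {1..m}"
      show "\<alpha> j * (indicator \<omega> (a j) * cutoff (a i) s (a j)) = (if j = i then \<alpha> i else 0)"
      proof (cases "j = i")
        case True
        moreover have "a i \<in> \<omega>" using sub r by auto
        moreover have "cutoff (a i) s (a i) = 1" using s by (intro cutoff(4)) auto
        ultimately show ?thesis by simp
      next
        case False
        then have "2 * s \<le> dist (a i) (a j)" using other[OF j] s by simp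
        then have "cutoff (a i) s (a j) = 0" by (rule cutoff(5)[OF s(1)])
        then show ?thesis using False by simp
      qed
    qed
    also have "\<dots> = \<alpha> i" using i by simp
    finally have eq: "(LINT x:\<omega>|dirac_sum {1..m} \<alpha> a. cutoff (a i) s x) = \<alpha> i" .
    have "(\<lambda>l. LINT x:\<omega>|lebesgue. f l x * cutoff (a i) s x) \<longlonglongrightarrow> \<alpha> i"
      using bspec[OF ws[unfolded weak_star_converges_def] C] unfolding eq .
    moreover have "(LINT x:\<omega>|lebesgue. f l x * cutoff (a i) s x) = (LINT x|lborel. indicator \<omega> x * (f l x * cutoff (a i) s x))" for l
      unfolding set_lebesgue_integral_def real_scaleR_def by (rule integral_completion) measurable
    ultimately show ?thesis by simp
  qed
  have int: "integrable lborel (\<lambda>x. indicator \<omega> x * (f l x * cutoff (a i) s x))" if s: "0 < s" for l s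
  proof (rule Bochner_Integration.integrable_bound)
    show "integrable lborel (\<lambda>x. indicator \<omega> x * f l x)" using fi[of l] by (simp add: set_integrable_def)
    have [measurable]: "cutoff (a i) s \<in> borel_measurable borel"
      by (rule borel_measurable_continuous_onI[OF cutoff(1)[OF s(1)]])
    show "(\<lambda>x. indicator \<omega> x * (f l x * cutoff (a i) s x)) \<in> borel_measurable lborel" by measurable
    show "AE x in lborel. norm (indicator \<omega> x * (f l x * cutoff (a i) s x)) \<le> norm (indicator \<omega> x * f l x)"
      using f0 cutoff(2,3)[OF s] by (intro AE_I2) (simp add: abs_mult mult_left_le mult_left_mono)
  qed
  have intB: "integrable lborel (\<lambda>x. indicator (ball (a i) r) x * f l x)" for l
  proof -
    have "ball (a i) r \<subseteq> cball (a i) (2 * r)"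
    proof
      fix x assume "x \<in> ball (a i) r"
      then show "x \<in> cball (a i) (2 * r)" using r by simp
    qed
    then have "ball (a i) r \<subseteq> \<omega>" using sub by blast
    then have "set_integrable lborel (ball (a i) r) (f l)" by (intro set_integrable_subset[OF fi]) auto
    then show ?thesis by (simp add: set_integrable_def)
  qed
  show ?thesis
  proof (rule tendsto_sandwich)
    show "(\<lambda>l. LINT x|lborel. indicator \<omega> x * (f l x * cutoff (a i) (r / 2) x)) \<longlonglongrightarrow> \<alpha> i"
      "(\<lambda>l. LINT x|lborel. indicator \<omega> x * (f l x * cutoff (a i) r x)) \<longlonglongrightarrow> \<alpha> i" using r by (auto intro: lim)
    have "(LINT x|lborel. indicator \<omega> x * (f l x * cutoff (a i) (r / 2) x)) \<le> (LINT x|lborel. indicator (ball (a i) r) x * f l x)" for l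
    proof (rule integral_mono[OF int intB])
      fix x
      show "indicator \<omega> x * (f l x * cutoff (a i) (r / 2) x) \<le> indicator (ball (a i) r) x * f l x"
      proof (cases "x \<in> ball (a i) r")
        case True
        have "indicator \<omega> x * (f l x * cutoff (a i) (r / 2) x) \<le> 1 * (f l x * 1)"
          using f0 cutoff(2,3)[of "r / 2"] r by (intro mult_mono) (auto simp: indicator_def)
        then show ?thesis using True by (simp del: mem_ball)
      next
        case False
        then have "cutoff (a i) (r / 2) x = 0" using r by (intro cutoff(5)) auto
        then show ?thesis using False by (simp del: mem_ball)
      qed
    qed (use r in simp)
    then show "eventually (\<lambda>l. (LINT x|lborel. indicator \<omega> x * (f l x * cutoff (a i) (r / 2) x)) \<le> (LINT y:ball (a i) r|lborel. f l y)) sequentially"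
      by (simp add: set_lebesgue_integral_def)
    have "(LINT x|lborel. indicator (ball (a i) r) x * f l x) \<le> (LINT x|lborel. indicator \<omega> x * (f l x * cutoff (a i) r x))" for l
    proof (rule integral_mono[OF intB int[OF r]])
      fix x
      show "indicator (ball (a i) r) x * f l x \<le> indicator \<omega> x * (f l x * cutoff (a i) r x)"
      proof (cases "x \<in> ball (a i) r")
        case True
        then have "x \<in> cball (a i) (2 * r)" using r by simp
        then have "x \<in> \<omega>" using sub by blast
        moreover have "cutoff (a i) r x = 1" using True by (intro cutoff(4)[OF r]) simp
        ultimately show ?thesis using True by (simp del: mem_ball)
      next
        case False
        then show ?thesis using f0 cutoff(2)[OF r] by (simp del: mem_ball)
      qed
    qed
    then show "eventually (\<lambda>l. (LINT y:ball (a i) r|lborel. f l y) \<le> (LINT x|lborel. indicator \<omega> x * (f l x * cutoff (a i) r x))) sequentially"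
      by (simp add: set_lebesgue_integral_def)
  qed
qed

text \<open>On \<open>\<Omega>\<close> the function \<open>exp (u x)\<close> is known to be Lebesgue
  measurable only. A Borel representative is taken outside \<open>\<omega>\<close>, while on
  \<open>\<omega>\<close>, where pointwise values matter, the continuous function itself is
  kept.\<close>

lemma borel_density:
  fixes u :: "real^2 \<Rightarrow> real"
  assumes \<omega>: "open \<omega>" "\<omega> \<subseteq> \<Omega>" and u: "continuous_on \<omega> u" "set_integrable lebesgue \<Omega> (\<lambda>x. exp (u x))"
  obtains g where "g \<in> borel_measurable borel" "\<And>x. 0 \<le> g x" "\<And>x. x \<in> \<omega> \<Longrightarrow> g x = exp (u x)"
    "AE x in lborel. g x = indicator \<Omega> x * exp (u x)"
    "integrable lborel g" "(LINT x|lborel. g x) = (LINT x:\<Omega>|lebesgue. exp (u x))"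
proof -
  define f where "f = (\<lambda>x. indicator \<Omega> x * exp (u x))"
  have f: "integrable lebesgue f" using u(2) by (simp add: set_integrable_def f_def)
  then obtain g' where g' [measurable]: "g' \<in> borel_measurable lborel" and ae: "AE x in lborel. f x = g' x"
    using completion_ex_borel_measurable_real[of f lborel] by auto
  define g where "g = (\<lambda>x. indicator \<omega> x * exp (u x) + indicator (- \<omega>) x * max 0 (g' x))"
  have "continuous_on \<omega> (\<lambda>x. exp (u x))" using u(1) by (intro continuous_intros)
  then have [measurable]: "(\<lambda>x. indicator \<omega> x * exp (u x)) \<in> borel_measurable borel"
    using borel_measurable_continuous_on_indicator[of \<omega> "\<lambda>x. exp (u x)"] borel_open[OF \<omega>(1)] by simp
  have [measurable]: "\<omega> \<in> sets borel" using \<omega>(1) by (rule borel_open)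
  have gm: "g \<in> borel_measurable borel" using g' unfolding g_def by simp
  have gae: "AE x in lborel. g x = f x"
    using ae
  proof eventually_elim
    case (elim x)
    then show ?case using \<omega>(2) by (cases "x \<in> \<omega>") (auto simp: g_def f_def elim[symmetric])
  qed
  have gl: "g \<in> borel_measurable lebesgue" by (rule measurable_completion) (simp add: gm)
  have gae': "AE x in lebesgue. f x = g x" using AE_completion[OF gae] by eventually_elim simp
  have gi: "integrable lebesgue g"
    using integrable_cong_AE_imp[OF f gl] gae' AE_completion[OF gae] by blast
  show thesis
  proof (rule that[of g])
    show "g \<in> borel_measurable borel" by (rule gm)
    show "0 \<le> g x" for x by (simp add: g_def)
    show "g x = exp (u x)" if "x \<in> \<omega>" for x using that by (simp add: g_def)
    show "AE x in lborel. g x = indicator \<Omega> x * exp (u x)" using gae by (simp add: f_def)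
    show "integrable lborel g" using gi gm by (subst (asm) integrable_completion) auto
    have "(LINT x|lborel. g x) = (LINT x|lebesgue. g x)" using gm by (subst integral_completion) auto
    also have "\<dots> = (LINT x|lebesgue. f x)"
      using gae' gl f by (intro integral_cong_AE) (auto simp: eq_commute)
    finally show "(LINT x|lborel. g x) = (LINT x:\<Omega>|lebesgue. exp (u x))" by (simp add: f_def set_lebesgue_integral_def)
  qed
qed

context hartree
begin

text \<open>The two integrands differ on a null set for each fixed \<open>x\<close>, so the
  potentials agree at every point and not merely almost everywhere.\<close>

lemma riesz_potential_eq_pot:
  assumes g: "g \<in> borel_measurable borel" and ae: "AE x in lborel. g x = indicator \<Omega> x * exp (u x)"
    and u: "set_integrable lebesgue \<Omega> (\<lambda>x. exp (u x))"
  shows "riesz_potential \<mu> (\<lambda>y. exp (lam * u y) * indicator \<Omega> y) x = pot g x"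
proof -
  define f where "f = (\<lambda>x. indicator \<Omega> x * exp (u x))"
  have fm [measurable]: "f \<in> borel_measurable lebesgue" using u by (simp add: set_integrable_def f_def borel_measurable_integrable)
  have hm: "(\<lambda>y. g y powr lam * norm (x - y) powr - \<mu>) \<in> borel_measurable borel" using g by measurable
  have nm [measurable]: "(\<lambda>y. norm (x - y) powr - \<mu>) \<in> borel_measurable lebesgue"
    by (rule measurable_completion) simp
  have "exp (lam * u y) * indicator \<Omega> y / norm (x - y) powr \<mu> = f y powr lam * norm (x - y) powr - \<mu>" for y
    by (cases "y \<in> \<Omega>") (simp_all add: f_def exp_powr_real mult.commute powr_minus_divide)
  then have "riesz_potential \<mu> (\<lambda>y. exp (lam * u y) * indicator \<Omega> y) x = (LINT y|lebesgue. f y powr lam * norm (x - y) powr - \<mu>)"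
    by (simp add: riesz_potential_def)
  also have "\<dots> = (LINT y|lebesgue. g y powr lam * norm (x - y) powr - \<mu>)"
  proof (rule integral_cong_AE)
    show "(\<lambda>y. f y powr lam * norm (x - y) powr - \<mu>) \<in> borel_measurable lebesgue" by measurable
    show "(\<lambda>y. g y powr lam * norm (x - y) powr - \<mu>) \<in> borel_measurable lebesgue"
      using hm by (intro measurable_completion) simp
    show "AE y in lebesgue. f y powr lam * norm (x - y) powr - \<mu> = g y powr lam * norm (x - y) powr - \<mu>"
      using AE_completion[OF ae] by eventually_elim (simp add: f_def)
  qed
  also have "\<dots> = pot g x" unfolding pot_def using hm by (intro integral_completion) simp
  finally show ?thesis .
qed

text \<open>The right-hand side is bounded on closed balls inside \<open>\<omega>\<close>, which is
  the hypothesis under which \<open>green_formula\<close> applies to \<open>u\<close>.\<close>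

lemma solution_of_distributional:
  assumes \<omega>: "open \<omega>" and g: "density g" and V: "weight V" and u: "continuous_on \<omega> u"
    and gu: "\<And>x. x \<in> \<omega> \<Longrightarrow> g x = exp (u x)" and eq: "neg_laplace_eq \<omega> u (rhs V g)" and D: "D \<subseteq> \<omega>"
  shows "solution D V g"
proof -
  have g0: "0 < g x" if "x \<in> \<omega>" for x using gu[OF that] by simp
  have gc: "continuous_on \<omega> g"
  proof -
    have "continuous_on \<omega> (\<lambda>x. exp (u x))" using u by (intro continuous_intros)
    then show ?thesis using gu by (simp cong: continuous_on_cong)
  qed
  have meas: "rhs V g \<in> borel_measurable borel" using g V by (intro rhs_measurable) (auto simp: density_def weight_def)
  have "ln (g x) = (LINT y:ball x R|lborel. ln (g y)) / (pi * R\<^sup>2) + (LINT y|lborel. green_kernel R (x - y) * rhs V g y)"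
    if R: "0 < R" and sub: "cball x R \<subseteq> D" for x R
  proof -
    have s\<omega>: "cball x R \<subseteq> \<omega>" using sub D by blast
    obtain M where M: "\<And>y. y \<in> cball x R \<Longrightarrow> rhs V g y \<le> M"
      by (rule density_bounded_on_compact[OF g V gc g0 compact_cball s\<omega> \<omega>]) (assumption, rule that)
    have M': "\<bar>rhs V g y\<bar> \<le> M" if "y \<in> cball x R" for y
      using M[OF that] rhs_nonneg[OF V, of g y] by simp
    have "u x = (LINT y:ball x R|lborel. u y) / (pi * R\<^sup>2) + (LINT y|lborel. green_kernel R (x - y) * rhs V g y)"
      by (rule green_formula[OF R s\<omega> eq u meas M'])
    moreover have "(LINT y:ball x R|lborel. u y) = (LINT y:ball x R|lborel. ln (g y))"
    proof (rule set_lebesgue_integral_cong)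
      show "\<forall>y. y \<in> ball x R \<longrightarrow> u y = ln (g y)"
      proof (intro allI impI)
        fix y assume "y \<in> ball x R"
        then have "y \<in> \<omega>" using s\<omega> ball_subset_cball by blast
        then show "u y = ln (g y)" using gu by simp
      qed
    qed simp
    moreover have "x \<in> \<omega>" using s\<omega> R by auto
    ultimately show ?thesis using gu[of x] by simp
  qed
  then show ?thesis
    unfolding solution_def using g V continuous_on_subset[OF gc D] g0 D by blast
qed

end

theorem theorem1p3:
  fixes \<Omega> \<omega> :: "(real^2) set"
    and \<mu> lam c\<^sub>0 :: real
    and V :: "real^2 \<Rightarrow> real"
    and Vk u :: "nat \<Rightarrow> real^2 \<Rightarrow> real"
    and k :: "nat \<Rightarrow> nat"
    and m :: nat
    and a :: "nat \<Rightarrow> real^2"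
    and \<alpha> :: "nat \<Rightarrow> real"
  assumes Omega: "open \<Omega>" "connected \<Omega>" "\<Omega> \<noteq> {}" "bounded \<Omega>"
    and omega: "open \<omega>" "connected \<omega>" "\<omega> \<noteq> {}" "\<omega> \<subseteq> \<Omega>"
    and mu: "0 < \<mu>" "\<mu> < 2"
    and lam: "lam = (4 - \<mu>) / 4"
    and V: "continuous_on (closure \<omega>) V"
    and Vk: "\<And>j. continuous_on (closure \<omega>) (Vk j)"
      "\<And>j x. x \<in> closure \<omega> \<Longrightarrow> 0 \<le> Vk j x"
    and Vk_lim: "uniform_limit (closure \<omega>) Vk V sequentially"
    and u_cont: "\<And>j. continuous_on \<omega> (u j)"
    and u_eq: "\<And>j. neg_laplace_eq \<omega> (u j)
        (\<lambda>x. Vk j x * riesz_potential \<mu> (\<lambda>y. exp (lam * u j y) * indicator \<Omega> y) x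
              * exp (lam * u j x))"
    and c0: "0 < c\<^sub>0"
    and u_L1: "\<And>j. set_integrable lebesgue \<Omega> (\<lambda>x. exp (u j x))"
      "\<And>j. (LINT x:\<Omega>|lebesgue. exp (u j x)) \<le> c\<^sub>0"
    and subseq: "strict_mono k"
    and S: "1 \<le> m" "inj_on a {1..m}" "a ` {1..m} \<subseteq> \<omega>"
    and alpha: "\<And>i. i \<in> {1..m} \<Longrightarrow> 4 * pi \<le> \<alpha> i"
    and blowup_i: "\<And>i. i \<in> {1..m} \<Longrightarrow>
        \<exists>x :: nat \<Rightarrow> real^2. (\<forall>l. x l \<in> \<omega>) \<and> x \<longlonglongrightarrow> a i \<and>
          filterlim (\<lambda>l. u (k l) (x l)) at_top sequentially"
    and blowup_ii: "locally_uniformly_to_minus_infinity (\<omega> - a ` {1..m}) (\<lambda>l. u (k l))"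
    and blowup_iii: "weak_star_converges \<omega>
        (\<lambda>l x. Vk (k l) x * riesz_potential \<mu> (\<lambda>y. exp (lam * u (k l) y) * indicator \<Omega> y) x
              * exp (lam * u (k l) x))
        (dirac_sum {1..m} \<alpha> a)"
  shows "\<forall>i\<in>{1..m}. \<exists>N::nat. 1 \<le> N \<and> \<alpha> i = 8 * pi * real N"
proof
  fix i assume i: "i \<in> {1..m}"
  have bounded: "bounded (closure \<omega>)" using omega(4) Omega(4) by (auto intro: bounded_subset bounded_closure)
  then have "compact (closure \<omega>)" by (simp add: compact_eq_bounded_closed)
  then have "compact (V ` closure \<omega>)" using V by (intro compact_continuous_image)
  then obtain B where B: "\<forall>z\<in>V ` closure \<omega>. norm z \<le> B" by (meson compact_imp_bounded bounded_iff)
  have VB: "\<bar>V x\<bar> \<le> B" if "x \<in> closure \<omega>" for x using B that by auto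
  have "eventually (\<lambda>j. \<forall>x\<in>closure \<omega>. dist (Vk j x) (V x) < 1) sequentially"
    using Vk_lim unfolding uniform_limit_iff by simp
  then obtain J where J: "\<And>j x. J \<le> j \<Longrightarrow> x \<in> closure \<omega> \<Longrightarrow> dist (Vk j x) (V x) < 1"
    unfolding eventually_sequentially by blast
  \<comment> \<open>Uniform convergence puts \<open>Vk j\<close> within 1 of \<open>V\<close> from
    index \<open>J\<close> on; the shift by \<open>J\<close> in \<open>\<kappa>\<close> makes
    \<open>Lam\<close> a bound for every weight used.\<close>
  define Lam where "Lam = \<bar>B\<bar> + 1"
  interpret hartree \<mu> lam Lam c\<^sub>0 by unfold_locales (use mu lam c0 in \<open>auto simp: Lam_def\<close>)
  define \<kappa> where "\<kappa> = (\<lambda>l. k (l + J))"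
  have \<kappa>J: "J \<le> \<kappa> l" for l using seq_suble[OF subseq, of "l + J"] by (simp add: \<kappa>_def)
  have \<kappa>mono: "strict_mono \<kappa>" using subseq by (auto simp: strict_mono_def \<kappa>_def)
  have cl: "x \<in> closure \<omega>" if "x \<in> \<omega>" for x using that closure_subset by blast
  have [measurable]: "\<omega> \<in> sets borel" using omega(1) by (rule borel_open)
  \<comment> \<open>Extension by zero gives a Borel weight on the whole plane and changes nothing
    inside \<open>\<omega>\<close>.\<close>
  define W where "W = (\<lambda>l x. indicator \<omega> x * Vk (\<kappa> l) x)"
  have W: "weight (W l)" for l
    unfolding weight_def
  proof (intro conjI allI)
    have "continuous_on \<omega> (Vk (\<kappa> l))" using Vk(1) closure_subset by (rule continuous_on_subset)
    then show "W l \<in> borel_measurable borel"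
      using borel_measurable_continuous_on_indicator[of \<omega> "Vk (\<kappa> l)"] unfolding W_def by simp
    fix x
    show "0 \<le> W l x" using Vk(2)[of x "\<kappa> l"] cl[of x] by (cases "x \<in> \<omega>") (auto simp: W_def)
    show "W l x \<le> Lam"
    proof (cases "x \<in> \<omega>")
      case True
      then have "\<bar>V x\<bar> \<le> B" "dist (Vk (\<kappa> l) x) (V x) < 1" using cl VB J[OF \<kappa>J] by auto
      then show ?thesis using True by (simp add: W_def Lam_def dist_real_def)
    qed (simp add: W_def Lam_def)
  qed
  have "\<exists>g. g \<in> borel_measurable borel \<and> (\<forall>x. 0 \<le> g x) \<and> (\<forall>x\<in>\<omega>. g x = exp (u (\<kappa> l) x)) \<and>
      (AE x in lborel. g x = indicator \<Omega> x * exp (u (\<kappa> l) x)) \<and>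
      integrable lborel g \<and> (LINT x|lborel. g x) = (LINT x:\<Omega>|lebesgue. exp (u (\<kappa> l) x))" for l
    by (rule borel_density[OF omega(1,4) u_cont u_L1(1), of "\<kappa> l"]) blast
  then have "\<forall>l. \<exists>g. g \<in> borel_measurable borel \<and> (\<forall>x. 0 \<le> g x) \<and> (\<forall>x\<in>\<omega>. g x = exp (u (\<kappa> l) x)) \<and>
      (AE x in lborel. g x = indicator \<Omega> x * exp (u (\<kappa> l) x)) \<and>
      integrable lborel g \<and> (LINT x|lborel. g x) = (LINT x:\<Omega>|lebesgue. exp (u (\<kappa> l) x))" ..
  from this[unfolded choice_iff] obtain G where G: "\<forall>l. G l \<in> borel_measurable borel \<and> (\<forall>x. 0 \<le> G l x) \<and> (\<forall>x\<in>\<omega>. G l x = exp (u (\<kappa> l) x)) \<and>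
      (AE x in lborel. G l x = indicator \<Omega> x * exp (u (\<kappa> l) x)) \<and>
      integrable lborel (G l) \<and> (LINT x|lborel. G l x) = (LINT x:\<Omega>|lebesgue. exp (u (\<kappa> l) x))"
    by (elim exE)
  have G1: "G l \<in> borel_measurable borel" "AE x in lborel. G l x = indicator \<Omega> x * exp (u (\<kappa> l) x)" for l
    using G by simp_all
  have Gu: "G l x = exp (u (\<kappa> l) x)" if "x \<in> \<omega>" for l x using G that by simp
  have dens: "density (G l)" for l
    unfolding density_def using G u_L1(2)[of "\<kappa> l"] by simp
  define F where "F = (\<lambda>j x. Vk j x * riesz_potential \<mu> (\<lambda>y. exp (lam * u j y) * indicator \<Omega> y) x * exp (lam * u j x))"
  have F: "F (\<kappa> l) x = rhs (W l) (G l) x" if "x \<in> \<omega>" for l x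
    using that riesz_potential_eq_pot[OF G1 u_L1(1), of l x]
    by (simp add: F_def rhs_def W_def Gu exp_powr_real mult_ac)
  have rm: "rhs (W l) (G l) \<in> borel_measurable borel" for l
    using W[of l] G1(1) by (intro rhs_measurable) (auto simp: weight_def)
  have r0: "0 \<le> rhs (W l) (G l) x" for l x by (rule rhs_nonneg[OF W])
  have \<omega>l: "\<omega> \<in> sets lebesgue" using sets_completionI_sets[of \<omega> lborel] by simp
  have eq: "neg_laplace_eq \<omega> (u (\<kappa> l)) (rhs (W l) (G l))" for l
  proof -
    have e: "neg_laplace_eq \<omega> (u (\<kappa> l)) (F (\<kappa> l))" using u_eq[of "\<kappa> l"] unfolding F_def .
    have "set_integrable lebesgue \<omega> (rhs (W l) (G l))"
      using e set_integrable_cong[of lebesgue lebesgue \<omega> \<omega> "F (\<kappa> l)", OF refl refl F] unfolding neg_laplace_eq_def by blast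
    moreover have "(LINT x:\<omega>|lebesgue. F (\<kappa> l) x * \<phi> x) = (LINT x:\<omega>|lebesgue. rhs (W l) (G l) x * \<phi> x)" for \<phi>
      by (rule set_lebesgue_integral_cong[OF \<omega>l]) (simp add: F)
    ultimately show ?thesis using e unfolding neg_laplace_eq_def by simp
  qed
  have fi: "set_integrable lborel \<omega> (rhs (W l) (G l))" for l
  proof -
    have "integrable lebesgue (\<lambda>x. indicator \<omega> x *\<^sub>R rhs (W l) (G l) x)"
      using eq[of l] unfolding neg_laplace_eq_def set_integrable_def by blast
    moreover have "(\<lambda>x. indicator \<omega> x *\<^sub>R rhs (W l) (G l) x) \<in> borel_measurable lborel" using rm[of l] by simp
    ultimately show ?thesis unfolding set_integrable_def by (subst (asm) integrable_completion)
  qed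
  have ws: "weak_star_converges \<omega> (\<lambda>l. rhs (W l) (G l)) (dirac_sum {1..m} \<alpha> a)"
    unfolding weak_star_converges_def
  proof
    fix \<psi> assume "\<psi> \<in> Cc \<omega>"
    then have "(\<lambda>l. LINT x:\<omega>|lebesgue. F (k l) x * \<psi> x) \<longlonglongrightarrow> (LINT x:\<omega>|dirac_sum {1..m} \<alpha> a. \<psi> x)"
      using blowup_iii unfolding weak_star_converges_def F_def by blast
    then have "(\<lambda>l. LINT x:\<omega>|lebesgue. F (\<kappa> l) x * \<psi> x) \<longlonglongrightarrow> (LINT x:\<omega>|dirac_sum {1..m} \<alpha> a. \<psi> x)"
      unfolding \<kappa>_def by (rule LIMSEQ_ignore_initial_segment)
    moreover have "(LINT x:\<omega>|lebesgue. F (\<kappa> l) x * \<psi> x) = (LINT x:\<omega>|lebesgue. rhs (W l) (G l) x * \<psi> x)" for l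
      by (rule set_lebesgue_integral_cong[OF \<omega>l]) (simp add: F)
    ultimately show "(\<lambda>l. LINT x:\<omega>|lebesgue. rhs (W l) (G l) x * \<psi> x) \<longlonglongrightarrow> (LINT x:\<omega>|dirac_sum {1..m} \<alpha> a. \<psi> x)"
      by simp
  qed
  have ai: "a i \<in> \<omega>" using S(3) i by blast
  \<comment> \<open>The other blow-up points are removed, so that \<open>a i\<close> is the only one
    near which mass concentrates.\<close>
  define U where "U = \<omega> - a ` ({1..m} - {i})"
  have "open U" unfolding U_def using omega(1) by (intro open_Diff finite_imp_closed) auto
  moreover have "a i \<in> U" unfolding U_def using ai S(2) i by (auto dest: inj_onD)
  ultimately obtain R where R: "0 < R" "cball (a i) R \<subseteq> U" unfolding open_contains_cball by blast
  \<comment> \<open>Masses are needed up to radius \<open>2 * \<rho>\<close>, that of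
    \<open>D\<close>, and the cutoff of radius \<open>r\<close> reaches out to \<open>2 * r\<close>;
    together this requires the radius \<open>4 * \<rho>\<close>.\<close>
  define \<rho> where "\<rho> = R / 4"
  have \<rho>: "0 < \<rho>" using R by (simp add: \<rho>_def)
  have sub: "cball (a i) (4 * \<rho>) \<subseteq> U" using R(2) by (simp add: \<rho>_def)
  have mass: "(\<lambda>l. LINT y:ball (a i) r|lborel. rhs (W l) (G l) y) \<longlonglongrightarrow> \<alpha> i" if r: "0 < r" "r \<le> 2 * \<rho>" for r
  proof (rule weak_star_ball_mass[OF ws _ i _ r(1) _ omega(1) rm r0 fi])
    have s: "cball (a i) (2 * r) \<subseteq> U" using sub subset_cball[of "2 * r" "4 * \<rho>" "a i"] r by auto
    then show "cball (a i) (2 * r) \<subseteq> \<omega>" unfolding U_def by blast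
    show "0 \<le> \<alpha> j" if "j \<in> {1..m}" for j using alpha[OF that] pi_gt_zero by linarith
    show "a j \<notin> cball (a i) (2 * r)" if "j \<in> {1..m}" "j \<noteq> i" for j using s that unfolding U_def by blast
  qed
  define D where "D = ball (a i) (2 * \<rho>)"
  have DU: "D \<subseteq> U"
  proof
    fix x assume "x \<in> D"
    then have "x \<in> cball (a i) (4 * \<rho>)" using \<rho> by (simp add: D_def)
    then show "x \<in> U" using sub by blast
  qed
  then have D\<omega>: "D \<subseteq> \<omega>" unfolding U_def by blast
  \<comment> \<open>The masses on \<open>D\<close> converge to \<open>\<alpha> i\<close>, hence are
    bounded; this provides the constant \<open>A\<close>.\<close>
  have "Bseq (\<lambda>l. LINT y:D|lborel. rhs (W l) (G l) y)"
    unfolding D_def using mass[of "2 * \<rho>"] \<rho> by (intro convergent_imp_Bseq convergentI) simp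
  then obtain A where A: "\<And>l. norm (LINT y:D|lborel. rhs (W l) (G l) y) \<le> A" unfolding Bseq_def by blast
  have A': "(LINT y:D|lborel. rhs (W l) (G l) y) \<le> A" for l using A[of l] by simp
  have Vlim: "\<exists>d>0. eventually (\<lambda>l. \<forall>y\<in>ball (a i) d. \<bar>W l y - V (a i)\<bar> < e) sequentially" if e: "0 < e" for e
  proof -
    have "continuous_on \<omega> V" using V closure_subset by (rule continuous_on_subset)
    then have "isCont V (a i)" using ai omega(1) by (simp add: continuous_on_eq_continuous_at)
    then obtain d where d: "0 < d" "\<And>y. dist y (a i) < d \<Longrightarrow> dist (V y) (V (a i)) < e / 2"
      unfolding continuous_at_eps_delta using e half_gt_zero by blast
    have "eventually (\<lambda>j. \<forall>x\<in>closure \<omega>. dist (Vk j x) (V x) < e / 2) sequentially"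
      using Vk_lim half_gt_zero[OF e] unfolding uniform_limit_iff by blast
    then have "eventually (\<lambda>l. \<forall>x\<in>closure \<omega>. dist (Vk (\<kappa> l) x) (V x) < e / 2) sequentially"
      using filterlim_subseq[OF \<kappa>mono] by (rule eventually_compose_filterlim)
    then have "eventually (\<lambda>l. \<forall>y\<in>ball (a i) (min d \<rho>). \<bar>W l y - V (a i)\<bar> < e) sequentially"
    proof eventually_elim
      case (elim l)
      show ?case
      proof
        fix y assume y: "y \<in> ball (a i) (min d \<rho>)"
        then have "y \<in> D" using \<rho> by (simp add: D_def)
        then have y\<omega>: "y \<in> \<omega>" using D\<omega> by blast
        then have "dist (Vk (\<kappa> l) y) (V y) < e / 2" using elim cl by blast
        moreover have "dist (V y) (V (a i)) < e / 2" using y by (intro d(2)) (simp add: dist_commute)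
        ultimately have "dist (Vk (\<kappa> l) y) (V (a i)) < e" using dist_triangle[of "Vk (\<kappa> l) y" "V (a i)" "V y"] by linarith
        then show "\<bar>W l y - V (a i)\<bar> < e" using y\<omega> by (simp add: W_def dist_real_def)
      qed
    qed
    then show ?thesis using d(1) \<rho> by (intro exI[of _ "min d \<rho>"]) simp
  qed
  \<comment> \<open>The radius is halved so that the closed ball of twice the radius is still inside
    the open ball \<open>D\<close>.\<close>
  have "concentration \<mu> lam Lam c\<^sub>0 D W G (a i) (\<rho> / 2) A (V (a i)) (\<alpha> i)"
  proof unfold_locales
    show "solution D (W l) (G l)" for l by (rule solution_of_distributional[OF omega(1) dens W u_cont Gu eq D\<omega>])
    show "open D" "cball (a i) (2 * (\<rho> / 2)) \<subseteq> D" "0 < \<rho> / 2" using \<rho> by (auto simp: D_def)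
    show "set_integrable lborel D (rhs (W l) (G l))" for l
      using D\<omega> by (intro set_integrable_subset[OF fi]) (simp_all add: D_def)
    show "(LINT y:D|lborel. rhs (W l) (G l) y) \<le> A" for l by (rule A')
    show "(\<lambda>l. LINT y:ball (a i) r|lborel. rhs (W l) (G l) y) \<longlonglongrightarrow> \<alpha> i" if "0 < r" "r \<le> \<rho> / 2" for r
      using that \<rho> by (intro mass) auto
    show "eventually (\<lambda>l. \<forall>x\<in>K. ln (G l x) \<le> M) sequentially" if K: "compact K" "K \<subseteq> D - {a i}" for K M
    proof -
      have "K \<subseteq> \<omega> - a ` {1..m}" using K(2) DU unfolding U_def by blast
      then have "eventually (\<lambda>l. \<forall>x\<in>K. u (k l) x \<le> M) sequentially"
        using blowup_ii K(1) unfolding locally_uniformly_to_minus_infinity_def by blast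
      then have "eventually (\<lambda>l. \<forall>x\<in>K. u (\<kappa> l) x \<le> M) sequentially"
        unfolding \<kappa>_def by (rule eventually_compose_filterlim[OF _ filterlim_add_const_nat_at_top])
      then show ?thesis
      proof eventually_elim
        case (elim l)
        show ?case
        proof
          fix x assume x: "x \<in> K"
          then have "x \<in> \<omega>" using K(2) D\<omega> by blast
          then show "ln (G l x) \<le> M" using elim x Gu[of x l] by simp
        qed
      qed
    qed
  qed (rule Vlim)
  then interpret concentration \<mu> lam Lam c\<^sub>0 D W G "a i" "\<rho> / 2" A "V (a i)" "\<alpha> i" .
  have "0 < \<alpha> i" using alpha[OF i] pi_gt_zero by linarith
  then show "\<exists>N::nat. 1 \<le> N \<and> \<alpha> i = 8 * pi * real N" by (rule quantization)
qed

end
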